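(* Suppose that $\psi>0$ and let $$\varphi:=\frac{\Psi(Y_{-}-a-1)\mathbf 1_{\{Y_{-}\ge a+1\}}-\Psi(Y_{-}-a)\mathbf 1_{\{Y_{-}\ge a\}}+\mathbf 1_{\{Y_{-}<a+1\}}-\mathbf 1_{\{Y_{-}<a\}}}{\psi S_{-}},$$ where, for $0<b<1$, $a:=-\frac1\alpha\ln b$. Consider the random time $$\tau:=\sup\{t: S_t\ge b\}=\sup\{t: Y_t\le a\}.$$ Then the following assertions hold. (a) The model "before $\tau$", $(S^\tau,\mathbb G)$, admits a classical arbitrage opportunity given by the $\mathbb G$-predictable process $\varphi^b:=\varphi\,\mathbf 1_{[\![0,\tau]\!]}$. (b) The model "after $\tau$", $(S-S^\tau,\mathbb G)$, admits a classical arbitrage opportunity given by the $\mathbb G$-predictable process $\varphi^a:=-\varphi\,\mathbf 1_{]\!]\tau,\nu]\!]}$, where $\nu:=\inf\{t>\tau:\ \widetilde Z_t\le\frac{1-\Delta A^o_\tau}{2}\}$.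
   Context: $N$ is a Poisson process with intensity $\lambda>0$ on $(\Omega,\mathcal A,\mathbb P)$, $\mathbb F=(\mathcal F_t)$ its natural filtration, $M_t=N_t-\lambda t$. The stock price is $dS_t=S_{t-}\psi\,dM_t$, $S_0=1$, with a constant $\psi>-1$, i.e. $S_t=\exp(-\lambda\psi t+\ln(1+\psi)N_t)$ (zero interest rate, infinite horizon). Notation: $\alpha:=\ln(1+\psi)$, $\mu:=\frac{\lambda\psi}{\ln(1+\psi)}$, $Y_t:=\mu t-N_t$ (so $S_t=\exp(-\alpha Y_t)$). The ruin probability is $\Psi(x):=\mathbb P(T^x<\infty)$ with $T^x=\inf\{t: x+Y_t<0\}$, $x\ge0$. $Y_-$, $S_-$ denote left-limit processes. $\mathbb G=(\mathcal G_t)$ is the progressive enlargement of $\mathbb F$ by $\tau$: $\mathcal G_t=\bigcap_{\epsilon>0}\big(\mathcal F_{t+\epsilon}\vee\sigma(\tau\wedge(t+\epsilon))\big)$. $S^\tau_t=S_{t\wedge\tau}$; $[\![\cdot,\cdot]\!]$, $]\!]\cdot,\cdot]\!]$ are stochastic intervals. $\widetilde Z_t=\mathbb P(\tau\ge t\mid\mathcal F_t)$; $A^o$ is the $\mathbb F$-dual optional projection of $A=\mathbf 1_{[\![\tau,\infty[\![}$, i.e. the unique integrable $\mathbb F$-optional increasing process with $\mathbb E\int_{[0,\infty)}U_s\,dA_s=\mathbb E\int_{[0,\infty)}U_s\,dA^o_s$ for every positive $\mathbb F$-optional $U$. Classical arbitrage: for a filtration $\mathbb K$ and a $\mathbb K$-semimartingale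 $X$, a $\mathbb K$-predictable $X$-integrable process $\theta$ is admissible if for some $c\ge0$, the stochastic integral satisfies $(\theta\cdot X)_t\ge-c$ a.s. for all $t\ge0$ and $(\theta\cdot X)_\infty:=\lim_{t\to\infty}(\theta\cdot X)_t$ exists. An admissible $\theta$ gives a classical arbitrage opportunity in the model $(X,\mathbb K)$ if $(\theta\cdot X)_\infty\ge0$ a.s. and $\mathbb P((\theta\cdot X)_\infty>0)>0$. *)

theory Defs
  imports "HOL-Probability.Probability"
begin

text \<open>
  Conventions. Processes are functions \<open>real \<Rightarrow> 'a \<Rightarrow> _\<close> of which only the times \<open>t \<ge> 0\<close> matter.
  Random times take values in \<open>[0,\<infinity>]\<close> and are \<open>ennreal\<close>-valued, with the usual
  \<open>Inf {} = \<infinity>\<close>. Filtrations are indexed by \<open>ennreal\<close>, so that \<open>F \<infinity>\<close> is the terminal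
  \<open>\<sigma>\<close>-algebra and the library's \<open>stopping_time\<close> and \<open>pre_sigma\<close> apply to stopping times that
  may be infinite.
\<close>

section \<open>Paths\<close>

definition cadlag :: "(real \<Rightarrow> real) \<Rightarrow> bool" where
  "cadlag f \<longleftrightarrow> (\<forall>t\<ge>0. continuous (at_right t) f) \<and> (\<forall>t>0. \<exists>l. (f \<longlongrightarrow> l) (at_left t))"

text \<open>The path \<open>t \<mapsto> f (t-)\<close>, with the convention \<open>f (0-) = f 0\<close>.\<close>

definition left_lim :: "(real \<Rightarrow> real) \<Rightarrow> real \<Rightarrow> real" where
  "left_lim f t = (if t \<le> 0 then f 0 else Lim (at_left t) f)"

text \<open>Increasing paths, in contrast, are null before time \<open>0\<close>: \<open>A (0-) = 0\<close>, so that
  \<open>A 0\<close> is the mass at \<open>0\<close> in integrals over \<open>[0,\<infinity>)\<close>.\<close>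

definition null_before :: "(real \<Rightarrow> real) \<Rightarrow> real \<Rightarrow> real" where
  "null_before A t = (if t < 0 then 0 else A t)"

definition increasing_jump :: "(real \<Rightarrow> real) \<Rightarrow> real \<Rightarrow> real" where
  "increasing_jump A t = A t - Lim (at_left t) (null_before A)"

definition increasing_path :: "(real \<Rightarrow> real) \<Rightarrow> bool" where
  "increasing_path A \<longleftrightarrow> 0 \<le> A 0 \<and> mono_on {0..} A \<and> (\<forall>t\<ge>0. continuous (at_right t) A)"

section \<open>Filtrations, optional and predictable processes\<close>

text \<open>The natural filtration, augmented by the null sets.\<close>

definition natural_filtration :: "'a measure \<Rightarrow> (real \<Rightarrow> 'a \<Rightarrow> nat) \<Rightarrow> ennreal \<Rightarrow> 'a measure" where
  "natural_filtration M N t = sigma (space M)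
     ({N s -` B \<inter> space M | s B. 0 \<le> s \<and> ennreal s \<le> t} \<union> null_sets M)"

definition progressive_enlargement ::
  "'a set \<Rightarrow> (ennreal \<Rightarrow> 'a measure) \<Rightarrow> ('a \<Rightarrow> ennreal) \<Rightarrow> ennreal \<Rightarrow> 'a measure" where
  "progressive_enlargement \<Omega> F \<tau> t = sigma \<Omega>
     (\<Inter>\<epsilon>\<in>{0::real<..}. sigma_sets \<Omega>
        (sets (F (t + ennreal \<epsilon>)) \<union>
         {(\<lambda>\<omega>. min (\<tau> \<omega>) (t + ennreal \<epsilon>)) -` B \<inter> \<Omega> | B. B \<in> sets borel}))"

definition adapted :: "(ennreal \<Rightarrow> 'a measure) \<Rightarrow> (real \<Rightarrow> 'a \<Rightarrow> real) \<Rightarrow> bool" where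
  "adapted F X \<longleftrightarrow> (\<forall>t\<ge>0. X t \<in> borel_measurable (F (ennreal t)))"

definition optional_sigma :: "'a set \<Rightarrow> (ennreal \<Rightarrow> 'a measure) \<Rightarrow> (real \<times> 'a) measure" where
  "optional_sigma \<Omega> F = sigma ({0..} \<times> \<Omega>)
     {{(t, \<omega>). 0 \<le> t \<and> \<omega> \<in> \<Omega> \<and> X t \<omega> \<in> B} | X B.
        adapted F X \<and> (\<forall>\<omega>\<in>\<Omega>. cadlag (\<lambda>t. X t \<omega>)) \<and> B \<in> sets borel}"

definition predictable_sigma :: "'a set \<Rightarrow> (ennreal \<Rightarrow> 'a measure) \<Rightarrow> (real \<times> 'a) measure" where
  "predictable_sigma \<Omega> F = sigma ({0..} \<times> \<Omega>)
     {{(t, \<omega>). 0 \<le> t \<and> \<omega> \<in> \<Omega> \<and> X t \<omega> \<in> B} | X B.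
        adapted F X \<and> (\<forall>\<omega>\<in>\<Omega>. \<forall>t>0. continuous (at_left t) (\<lambda>t. X t \<omega>)) \<and> B \<in> sets borel}"

definition optional_process ::
  "'a set \<Rightarrow> (ennreal \<Rightarrow> 'a measure) \<Rightarrow> (real \<Rightarrow> 'a \<Rightarrow> real) \<Rightarrow> bool" where
  "optional_process \<Omega> F X \<longleftrightarrow> (\<lambda>(t, \<omega>). X t \<omega>) \<in> borel_measurable (optional_sigma \<Omega> F)"

definition predictable_process ::
  "'a set \<Rightarrow> (ennreal \<Rightarrow> 'a measure) \<Rightarrow> (real \<Rightarrow> 'a \<Rightarrow> real) \<Rightarrow> bool" where
  "predictable_process \<Omega> F X \<longleftrightarrow> (\<lambda>(t, \<omega>). X t \<omega>) \<in> borel_measurable (predictable_sigma \<Omega> F)"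

definition stopped :: "('a \<Rightarrow> ennreal) \<Rightarrow> (real \<Rightarrow> 'a \<Rightarrow> real) \<Rightarrow> real \<Rightarrow> 'a \<Rightarrow> real" where
  "stopped \<tau> X t \<omega> = X (enn2real (min (ennreal t) (\<tau> \<omega>))) \<omega>"

text \<open>\<open>V\<close> is (a version of) the optional projection of the bounded measurable process \<open>X\<close>,
  \<open>V\<^sub>t = E[X\<^sub>t | F\<^sub>t]\<close> for all \<open>t\<close> simultaneously: the identity holds at every stopping time.\<close>

definition is_optional_projection ::
  "'a measure \<Rightarrow> (ennreal \<Rightarrow> 'a measure) \<Rightarrow> (real \<Rightarrow> 'a \<Rightarrow> real) \<Rightarrow> (real \<Rightarrow> 'a \<Rightarrow> real) \<Rightarrow> bool" where
  "is_optional_projection M F X V \<longleftrightarrow>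
     optional_process (space M) F V \<and>
     (\<forall>T. stopping_time F T \<longrightarrow>
        (AE \<omega> in M. V (enn2real (T \<omega>)) \<omega> * of_bool (T \<omega> < \<infinity>) =
           real_cond_exp M (filtration.pre_sigma (space M) F T)
             (\<lambda>\<omega>. X (enn2real (T \<omega>)) \<omega> * of_bool (T \<omega> < \<infinity>)) \<omega>))"

text \<open>\<open>A\<close> is an increasing process that need not be adapted.\<close>

definition is_dual_optional_projection ::
  "'a measure \<Rightarrow> (ennreal \<Rightarrow> 'a measure) \<Rightarrow> (real \<Rightarrow> 'a \<Rightarrow> real) \<Rightarrow> (real \<Rightarrow> 'a \<Rightarrow> real) \<Rightarrow> bool" where
  "is_dual_optional_projection M F A Ao \<longleftrightarrow>
     optional_process (space M) F Ao \<and>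
     (\<forall>\<omega>\<in>space M. increasing_path (\<lambda>t. Ao t \<omega>)) \<and>
     (\<integral>\<^sup>+\<omega>. (SUP t\<in>{0..}. ennreal (Ao t \<omega>)) \<partial>M) < \<infinity> \<and>
     (\<forall>U :: real \<times> 'a \<Rightarrow> ennreal. U \<in> borel_measurable (optional_sigma (space M) F) \<longrightarrow>
        (\<integral>\<^sup>+\<omega>. (\<integral>\<^sup>+s\<in>{0..}. U (s, \<omega>) \<partial>interval_measure (null_before (\<lambda>t. A t \<omega>))) \<partial>M) =
        (\<integral>\<^sup>+\<omega>. (\<integral>\<^sup>+s\<in>{0..}. U (s, \<omega>) \<partial>interval_measure (null_before (\<lambda>t. Ao t \<omega>))) \<partial>M))"

section \<open>Stochastic integrals and classical arbitrage\<close>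

text \<open>
  The semimartingales considered here have paths of finite variation. With respect to such a
  process the stochastic integral is the pathwise Lebesgue-Stieltjes integral over \<open>(0,t]\<close>.
  The integral below does not depend on the chosen decomposition \<open>x = x 0 + f - g\<close> as long as
  the integrand is integrable with respect to both \<open>f\<close> and \<open>g\<close>, and such a decomposition
  exists iff the integrand is integrable with respect to the total variation of \<open>x\<close>.
\<close>

definition monotone_decomposition ::
  "(real \<Rightarrow> real) \<Rightarrow> (real \<Rightarrow> real) \<Rightarrow> (real \<Rightarrow> real) \<Rightarrow> bool" where
  "monotone_decomposition x f g \<longleftrightarrow> mono f \<and> mono g \<and>
     (\<forall>t. continuous (at_right t) f \<and> continuous (at_right t) g) \<and>
     (\<forall>t\<ge>0. x t - x 0 = f t - g t)"

definition finite_variation_semimartingale ::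
  "'a measure \<Rightarrow> (ennreal \<Rightarrow> 'a measure) \<Rightarrow> (real \<Rightarrow> 'a \<Rightarrow> real) \<Rightarrow> bool" where
  "finite_variation_semimartingale M K X \<longleftrightarrow> adapted K X \<and>
     (\<forall>\<omega>\<in>space M. cadlag (\<lambda>t. X t \<omega>) \<and> (\<exists>f g. monotone_decomposition (\<lambda>t. X t \<omega>) f g))"

definition has_stieltjes_integral ::
  "(real \<Rightarrow> real) \<Rightarrow> (real \<Rightarrow> real) \<Rightarrow> real \<Rightarrow> real \<Rightarrow> bool" where
  "has_stieltjes_integral \<theta> x t I \<longleftrightarrow> (\<exists>f g. monotone_decomposition x f g \<and>
     set_integrable (interval_measure f) {0<..t} \<theta> \<and>
     set_integrable (interval_measure g) {0<..t} \<theta> \<and>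
     I = (LINT s:{0<..t}|interval_measure f. \<theta> s) - (LINT s:{0<..t}|interval_measure g. \<theta> s))"

definition stochastic_integral ::
  "(real \<Rightarrow> 'a \<Rightarrow> real) \<Rightarrow> (real \<Rightarrow> 'a \<Rightarrow> real) \<Rightarrow> real \<Rightarrow> 'a \<Rightarrow> real" where
  "stochastic_integral \<theta> X t \<omega> =
     (THE I. has_stieltjes_integral (\<lambda>s. \<theta> s \<omega>) (\<lambda>s. X s \<omega>) t I)"

definition integrable_wrt ::
  "'a measure \<Rightarrow> (real \<Rightarrow> 'a \<Rightarrow> real) \<Rightarrow> (real \<Rightarrow> 'a \<Rightarrow> real) \<Rightarrow> bool" where
  "integrable_wrt M X \<theta> \<longleftrightarrow>
     (AE \<omega> in M. \<forall>t\<ge>0. \<exists>I. has_stieltjes_integral (\<lambda>s. \<theta> s \<omega>) (\<lambda>s. X s \<omega>) t I)"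

definition admissible ::
  "'a measure \<Rightarrow> (ennreal \<Rightarrow> 'a measure) \<Rightarrow> (real \<Rightarrow> 'a \<Rightarrow> real) \<Rightarrow> (real \<Rightarrow> 'a \<Rightarrow> real) \<Rightarrow> bool" where
  "admissible M K X \<theta> \<longleftrightarrow>
     predictable_process (space M) K \<theta> \<and> integrable_wrt M X \<theta> \<and>
     (\<exists>c\<ge>0. AE \<omega> in M. \<forall>t\<ge>0. stochastic_integral \<theta> X t \<omega> \<ge> - c) \<and>
     (AE \<omega> in M. \<exists>l. ((\<lambda>t. stochastic_integral \<theta> X t \<omega>) \<longlongrightarrow> l) at_top)"

definition terminal_gain ::
  "(real \<Rightarrow> 'a \<Rightarrow> real) \<Rightarrow> (real \<Rightarrow> 'a \<Rightarrow> real) \<Rightarrow> 'a \<Rightarrow> real" where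
  "terminal_gain \<theta> X \<omega> = Lim at_top (\<lambda>t. stochastic_integral \<theta> X t \<omega>)"

definition classical_arbitrage ::
  "'a measure \<Rightarrow> (ennreal \<Rightarrow> 'a measure) \<Rightarrow> (real \<Rightarrow> 'a \<Rightarrow> real) \<Rightarrow> (real \<Rightarrow> 'a \<Rightarrow> real) \<Rightarrow> bool" where
  "classical_arbitrage M K X \<theta> \<longleftrightarrow>
     finite_variation_semimartingale M K X \<and> admissible M K X \<theta> \<and>
     (AE \<omega> in M. terminal_gain \<theta> X \<omega> \<ge> 0) \<and>
     measure M {\<omega> \<in> space M. terminal_gain \<theta> X \<omega> > 0} > 0"

section \<open>The Poisson market\<close>

definition poisson_process :: "'a measure \<Rightarrow> real \<Rightarrow> (real \<Rightarrow> 'a \<Rightarrow> nat) \<Rightarrow> bool" where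
  "poisson_process M lam N \<longleftrightarrow>
     (\<forall>t\<ge>0. N t \<in> M \<rightarrow>\<^sub>M count_space UNIV) \<and>
     (\<forall>\<omega>\<in>space M. N 0 \<omega> = 0 \<and> mono_on {0..} (\<lambda>t. N t \<omega>) \<and>
        (\<forall>t\<ge>0. continuous (at_right t) (\<lambda>s. real (N s \<omega>)))) \<and>
     (\<forall>s t. 0 \<le> s \<and> s < t \<longrightarrow>
        distr M (count_space UNIV) (\<lambda>\<omega>. N t \<omega> - N s \<omega>) = measure_pmf (poisson_pmf (lam * (t - s)))) \<and>
     (\<forall>n (u :: nat \<Rightarrow> real). 0 \<le> u 0 \<and> (\<forall>i<n. u i \<le> u (Suc i)) \<longrightarrow>
        prob_space.indep_vars M (\<lambda>_. count_space UNIV) (\<lambda>i \<omega>. N (u (Suc i)) \<omega> - N (u i) \<omega>) {..<n})"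

definition stock :: "real \<Rightarrow> real \<Rightarrow> (real \<Rightarrow> 'a \<Rightarrow> nat) \<Rightarrow> real \<Rightarrow> 'a \<Rightarrow> real" where
  "stock lam \<psi> N t \<omega> = exp (- lam * \<psi> * t + ln (1 + \<psi>) * real (N t \<omega>))"

text \<open>The process \<open>Y\<close>.\<close>

definition surplus :: "real \<Rightarrow> real \<Rightarrow> (real \<Rightarrow> 'a \<Rightarrow> nat) \<Rightarrow> real \<Rightarrow> 'a \<Rightarrow> real" where
  "surplus lam \<psi> N t \<omega> = lam * \<psi> / ln (1 + \<psi>) * t - real (N t \<omega>)"

definition ruin_time :: "(real \<Rightarrow> 'a \<Rightarrow> real) \<Rightarrow> real \<Rightarrow> 'a \<Rightarrow> ennreal" where
  "ruin_time Y x \<omega> = Inf (ennreal ` {t. 0 \<le> t \<and> x + Y t \<omega> < 0})"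

definition ruin_probability :: "'a measure \<Rightarrow> (real \<Rightarrow> 'a \<Rightarrow> real) \<Rightarrow> real \<Rightarrow> real" where
  "ruin_probability M Y x = measure M {\<omega> \<in> space M. ruin_time Y x \<omega> < \<infinity>}"

definition last_passage :: "(real \<Rightarrow> 'a \<Rightarrow> real) \<Rightarrow> real \<Rightarrow> 'a \<Rightarrow> ennreal" where
  "last_passage X b \<omega> = Sup (ennreal ` {t. 0 \<le> t \<and> X t \<omega> \<ge> b})"

definition level :: "real \<Rightarrow> real \<Rightarrow> real" where
  "level \<psi> b = - (1 / ln (1 + \<psi>)) * ln b"

lemma stock_eq_exp_surplus:
  assumes "\<psi> > 0"
  shows "stock lam \<psi> N t \<omega> = exp (- ln (1 + \<psi>) * surplus lam \<psi> N t \<omega>)"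
  using assms by (simp add: stock_def surplus_def algebra_simps)

lemma last_passage_stock:
  assumes "\<psi> > 0" "0 < b"
  shows "last_passage (stock lam \<psi> N) b \<omega> =
    Sup (ennreal ` {t. 0 \<le> t \<and> surplus lam \<psi> N t \<omega> \<le> level \<psi> b})"
proof -
  have pos: "ln (1 + \<psi>) > 0" using assms by simp
  have "stock lam \<psi> N t \<omega> \<ge> b \<longleftrightarrow> surplus lam \<psi> N t \<omega> \<le> level \<psi> b" for t
  proof -
    have "stock lam \<psi> N t \<omega> \<ge> b \<longleftrightarrow> ln b \<le> - ln (1 + \<psi>) * surplus lam \<psi> N t \<omega>"
      unfolding stock_eq_exp_surplus[OF assms(1)] using assms(2) by (metis exp_gt_zero ln_exp ln_le_cancel_iff)
    also have "\<dots> \<longleftrightarrow> surplus lam \<psi> N t \<omega> \<le> level \<psi> b"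
      unfolding level_def using pos by (simp add: field_simps) linarith
    finally show ?thesis .
  qed
  then show ?thesis by (simp add: last_passage_def)
qed

definition strategy ::
  "'a measure \<Rightarrow> real \<Rightarrow> real \<Rightarrow> (real \<Rightarrow> 'a \<Rightarrow> nat) \<Rightarrow> real \<Rightarrow> real \<Rightarrow> 'a \<Rightarrow> real" where
  "strategy M lam \<psi> N b t \<omega> =
    (let a = level \<psi> b;
         \<Psi> = ruin_probability M (surplus lam \<psi> N);
         y = left_lim (\<lambda>s. surplus lam \<psi> N s \<omega>) t
     in (\<Psi> (y - a - 1) * of_bool (y \<ge> a + 1) - \<Psi> (y - a) * of_bool (y \<ge> a)
         + of_bool (y < a + 1) - of_bool (y < a))
        / (\<psi> * left_lim (\<lambda>s. stock lam \<psi> N s \<omega>) t))"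

text \<open>The time \<open>\<nu>\<close>, for a version \<open>Z\<close> of \<open>P(\<tau> \<ge> t | F\<^sub>t)\<close> and the dual optional projection
  \<open>Ao\<close> of the process \<open>1[\<tau>,\<infinity>)\<close>.\<close>

definition exit_time ::
  "('a \<Rightarrow> ennreal) \<Rightarrow> (real \<Rightarrow> 'a \<Rightarrow> real) \<Rightarrow> (real \<Rightarrow> 'a \<Rightarrow> real) \<Rightarrow> 'a \<Rightarrow> ennreal" where
  "exit_time \<tau> Z Ao \<omega> = Inf (ennreal ` {t. 0 \<le> t \<and> \<tau> \<omega> < ennreal t \<and>
     Z t \<omega> \<le> (1 - increasing_jump (\<lambda>s. Ao s \<omega>) (enn2real (\<tau> \<omega>))) / 2})"

end

theory Submission
  imports Defs
begin

text \<open>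
  Let \<open>h(y) = \<Psi>(y - a)\<close>, which is 1 for \<open>y < a\<close>. The strategy is chosen such that \<open>\<phi> dS =
  (h(Y_- - 1) - h(Y_-)) dM\<close>. Considering what may happen in a short time gives the renewal
  equation \<open>\<mu> h'(y) = \<lambda> (h(y) - h(y - 1))\<close> for \<open>y\<close> different from \<open>a\<close> and \<open>a + 1\<close> (lemma
  \<open>Psi_has_derivative\<close>). It says that along a path of \<open>Y\<close> the function \<open>h(Y)\<close> changes exactly
  as the gains of \<open>\<phi>\<close> do, with one exception: \<open>h\<close> is discontinuous at \<open>a\<close>, where it falls from
  1 to \<open>\<Psi>(0)\<close>, and \<open>\<Psi>(0) = \<lambda> / \<mu> < 1\<close> by integrating the renewal equation. Almost surely \<open>Y\<close>
  passes through \<open>a\<close> only continuously and upwards, and so the gain up to time \<open>t\<close> is \<open>h(Y_t)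
  - 1 + (1 - \<Psi>(0)) n_t\<close>, where \<open>n_t\<close> is the number of times up to \<open>t\<close> at which \<open>Y\<close> is at \<open>a\<close>
  (lemma \<open>gain_eq\<close>). All stochastic integrals are pathwise, and their values do not depend on
  the decomposition of the integrator (lemma \<open>has_stieltjes_integral_unique\<close>).

  Both arbitrages can be read off. At \<open>\<tau>\<close> the surplus is at \<open>a\<close> for the last time. Hence the
  gain up to \<open>\<tau>\<close> is \<open>(1 - \<Psi>(0)) (n_\<tau> - 1)\<close>, which is nonnegative and, since \<open>Y\<close> may visit \<open>a\<close>
  twice, positive with positive probability; on the way the gain is at least \<open>- 1\<close>. After \<open>\<tau>\<close>
  the number of visits is constant, and the short position earns \<open>\<Psi>(0) - h(Y_t)\<close>. This is
  never negative, as \<open>Y\<close> is above \<open>a\<close>; it tends to \<open>\<Psi>(0)\<close>, as \<open>Y\<close> tends to infinity; and it is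
  positive at every time when \<open>h(Y) < \<Psi>(0)\<close> (lemma \<open>arbitrage_after\<close>).

  It remains to see that \<open>\<nu>\<close> is, almost surely, the first time after \<open>\<tau>\<close> with \<open>h(Y) \<le> \<Psi>(0) /
  2\<close>; then \<open>\<nu>\<close> is observable in the enlarged filtration and \<open>h(Y) < \<Psi>(0)\<close> at \<open>\<nu>\<close>. This needs
  the two projections in the definition of \<open>\<nu>\<close>. By the strong Markov property, any version of
  the projection \<open>Z\<close> agrees at each stopping time with \<open>h(Y)\<close>, or with 1 where \<open>Y\<close> is at \<open>a\<close>.
  To conclude that it agrees at all times simultaneously one needs that an optional set which
  no stopping time meets is evanescent (theorem \<open>optional_evanescent\<close>). For the Poisson
  filtration this is reduced to a section theorem for product-measurable sets (theorem
  \<open>measurable_section\<close>): while \<open>N = n\<close>, an optional set depends on time and on the first \<open>n\<close>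
  jumps only, and a time that is determined by the first \<open>n\<close> jumps becomes a stopping time if
  it is given up when the next jump comes too early. As to the dual projection, \<open>Y\<close> can be at
  \<open>a\<close> only at the deterministic times \<open>(a + k) / \<mu>\<close>, and \<open>\<tau>\<close> is one of them. At such a time
  the dual projection jumps by the conditional probability that it is \<open>\<tau>\<close>, which is \<open>1 - \<Psi>(0)\<close>
  if \<open>Y\<close> is at \<open>a\<close> (lemma \<open>dual_projection_jump\<close>).
\<close>

section \<open>Stieltjes integrals\<close>

text \<open>The part of the Stieltjes measure of \<open>F\<close> that integrals over \<open>(0,t]\<close> see. It is finite, so
  that it is determined by its distribution function.\<close>

definition window_measure :: "(real \<Rightarrow> real) \<Rightarrow> real \<Rightarrow> real measure" where
  "window_measure F t = density (interval_measure F) (\<lambda>x. ennreal (indicator {0<..t} x))"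

lemma sets_window_measure [simp, measurable_cong]: "sets (window_measure F t) = sets borel"
  by (simp add: window_measure_def)

lemma emeasure_window_measure:
  assumes "mono F" "\<And>u. continuous (at_right u) F" "0 \<le> t"
  shows "emeasure (window_measure F t) {..x} = ennreal (F (max 0 (min t x)) - F 0)"
proof -
  have "emeasure (window_measure F t) {..x}
      = (\<integral>\<^sup>+u. indicator ({0<..t} \<inter> {..x}) u \<partial>interval_measure F)"
    unfolding window_measure_def
    by (subst emeasure_density; (rule nn_integral_cong)?; auto split: split_indicator)
  also have "\<dots> = emeasure (interval_measure F) ({0<..t} \<inter> {..x})"
    by (subst nn_integral_indicator) auto
  also have "{0<..t} \<inter> {..x} = {0<..max 0 (min t x)}"
    using assms by auto
  also have "emeasure (interval_measure F) \<dots> = ennreal (F (max 0 (min t x)) - F 0)"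
    using assms by (intro emeasure_interval_measure_Ioc) (auto dest: monoD)
  finally show ?thesis .
qed

lemma finite_borel_measure_window:
  assumes "mono F" "\<And>u. continuous (at_right u) F" "0 \<le> t"
  shows "finite_borel_measure (window_measure F t)"
proof -
  have "emeasure (window_measure F t) UNIV
      = (\<integral>\<^sup>+u. indicator {0<..t} u \<partial>interval_measure F)"
    unfolding window_measure_def
    by (subst emeasure_density; (rule nn_integral_cong)?; auto split: split_indicator)
  also have "\<dots> = ennreal (F t - F 0)"
    using assms by (subst nn_integral_indicator) (auto intro!: emeasure_interval_measure_Ioc dest: monoD)
  finally have "emeasure (window_measure F t) (space (window_measure F t)) \<noteq> \<infinity>"
    by (simp add: window_measure_def)
  then show ?thesis
    by (intro finite_borel_measure.intro finite_measureI) (auto simp: finite_borel_measure_axioms_def)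
qed

lemma cdf_window_measure:
  assumes "mono F" "\<And>u. continuous (at_right u) F" "0 \<le> t"
  shows "measure (window_measure F t) {..x} = F (max 0 (min t x)) - F 0"
  using emeasure_window_measure[OF assms] assms(1)
  by (simp add: measure_def enn2real_ennreal monoD)

lemma window_measure_eqI:
  assumes "mono F" "\<And>u. continuous (at_right u) F" "0 \<le> t"
    and "finite_borel_measure \<nu>" "\<And>x. measure \<nu> {..x} = F (max 0 (min t x)) - F 0"
  shows "window_measure F t = \<nu>"
  using assms finite_borel_measure_window[OF assms(1-3)] cdf_window_measure[OF assms(1-3)]
  by (intro cdf_unique') (auto simp: cdf_def)

lemma set_integrable_window:
  fixes \<theta> :: "real \<Rightarrow> real"
  assumes "\<theta> \<in> borel_measurable borel"
  shows "set_integrable (interval_measure F) {0<..t} \<theta> \<longleftrightarrow> integrable (window_measure F t) \<theta>"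
  unfolding window_measure_def set_integrable_def
  using integrable_density[of \<theta> "interval_measure F" "indicator {0<..t}"] assms by simp

lemma set_integral_window:
  fixes \<theta> :: "real \<Rightarrow> real"
  assumes "\<theta> \<in> borel_measurable borel"
  shows "(LINT s:{0<..t}|interval_measure F. \<theta> s) = integral\<^sup>L (window_measure F t) \<theta>"
  unfolding window_measure_def set_lebesgue_integral_def
  using integral_density[of \<theta> "interval_measure F" "indicator {0<..t}"] assms by simp

text \<open>The half-lines generate the Borel sets and are stable under intersection, so additivity
  extends from them to all Borel sets, and from there to integrals.\<close>

lemma integral_sum_of_measures:
  assumes fm: "finite_borel_measure \<kappa>" "finite_borel_measure \<mu>" "finite_borel_measure \<nu>"
    and cdf: "\<And>x. measure \<kappa> {..x} = measure \<mu> {..x} + measure \<nu> {..x}"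
    and int: "integrable \<mu> \<theta>" "integrable \<nu> \<theta>"
  shows "integral\<^sup>L \<kappa> (\<theta> :: real \<Rightarrow> real) = integral\<^sup>L \<mu> \<theta> + integral\<^sup>L \<nu> \<theta>"
proof -
  interpret \<kappa>: finite_borel_measure \<kappa> by fact
  interpret \<mu>: finite_borel_measure \<mu> by fact
  interpret \<nu>: finite_borel_measure \<nu> by fact
  note [simp] = \<kappa>.M_is_borel \<mu>.M_is_borel \<nu>.M_is_borel
  note [simp] = \<kappa>.borel_UNIV \<mu>.borel_UNIV \<nu>.borel_UNIV
  note [measurable_cong] = \<kappa>.M_is_borel \<mu>.M_is_borel \<nu>.M_is_borel
  have lim: "((\<lambda>n. measure m {..real n}) \<longlonglongrightarrow> measure m UNIV)" if "finite_borel_measure m" for m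
  proof -
    interpret m: finite_borel_measure m by fact
    have "(\<lambda>n. measure m {..real n}) \<longlonglongrightarrow> measure m (\<Union>n. {..real n})"
      by (rule m.finite_Lim_measure_incseq) (auto simp: incseq_def)
    moreover have "(\<Union>n. {..real n}) = UNIV"
      by (auto simp: real_arch_simple)
    ultimately show ?thesis by simp
  qed
  have UNIV: "measure \<kappa> UNIV = measure \<mu> UNIV + measure \<nu> UNIV"
    using LIMSEQ_unique[OF lim[OF fm(1)]] tendsto_add[OF lim[OF fm(2)] lim[OF fm(3)]] cdf by auto
  have gen: "sets borel = sigma_sets UNIV (range (\<lambda>x::real. {..x}))"
    by (subst borel_eq_atMost) (rule sets_measure_of, auto)
  have m: "measure \<kappa> A = measure \<mu> A + measure \<nu> A" if "A \<in> sets borel" for A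
  proof -
    have "A \<in> sigma_sets UNIV (range (\<lambda>x::real. {..x}))" using that gen by simp
    have int: "Int_stable (range (\<lambda>x::real. {..x}))"
      by (auto simp: Int_stable_def)
    show ?thesis
    proof (rule sigma_sets_induct_disjoint[OF int _ \<open>A \<in> sigma_sets _ _\<close>, where P = "\<lambda>A. measure \<kappa> A = measure \<mu> A + measure \<nu> A"])
      show "range (\<lambda>x::real. {..x}) \<subseteq> Pow UNIV" by auto
      show "measure \<kappa> A = measure \<mu> A + measure \<nu> A" if "A \<in> range (\<lambda>x::real. {..x})" for A using that cdf by auto
      show "measure \<kappa> (UNIV - A) = measure \<mu> (UNIV - A) + measure \<nu> (UNIV - A)"
        if "A \<in> sigma_sets UNIV (range (\<lambda>x::real. {..x}))"
         "measure \<kappa> A = measure \<mu> A + measure \<nu> A" for A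
      proof -
        have "A \<in> sets borel" using that gen by simp
        then show ?thesis
          using \<kappa>.finite_measure_compl[of A] \<mu>.finite_measure_compl[of A] \<nu>.finite_measure_compl[of A] that UNIV by simp
      qed
      fix A :: "nat \<Rightarrow> real set"
      assume A: "disjoint_family A" "range A \<subseteq> sigma_sets UNIV (range (\<lambda>x. {..x}))"
        "\<And>i. measure \<kappa> (A i) = measure \<mu> (A i) + measure \<nu> (A i)"
      have A': "range A \<subseteq> sets borel" using A(2) gen by simp
      have "(\<lambda>i. measure \<kappa> (A i)) sums measure \<kappa> (\<Union>i. A i)"
        by (rule \<kappa>.finite_measure_UNION) (use A A' in auto)
      moreover have "(\<lambda>i. measure \<mu> (A i)) sums measure \<mu> (\<Union>i. A i)"
        by (rule \<mu>.finite_measure_UNION) (use A A' in auto)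
      moreover have "(\<lambda>i. measure \<nu> (A i)) sums measure \<nu> (\<Union>i. A i)"
        by (rule \<nu>.finite_measure_UNION) (use A A' in auto)
      ultimately show "measure \<kappa> (\<Union>(range A)) = measure \<mu> (\<Union>(range A)) + measure \<nu> (\<Union>(range A))"
        using A(3) sums_unique2[OF _ sums_add] by fastforce
    qed simp
  qed
  have e: "emeasure \<kappa> A = emeasure \<mu> A + emeasure \<nu> A" if "A \<in> sets borel" for A
    using m[OF that] by (simp add: \<kappa>.emeasure_eq_measure \<mu>.emeasure_eq_measure \<nu>.emeasure_eq_measure)
  have nn: "integral\<^sup>N \<kappa> f = integral\<^sup>N \<mu> f + integral\<^sup>N \<nu> f"
    if "f \<in> borel_measurable borel" for f :: "real \<Rightarrow> ennreal"
    using that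
  proof (induction rule: borel_measurable_induct)
    case (cong f g) then show ?case by (auto cong: nn_integral_cong)
  next
    case (set A) then show ?case using e[OF set] by simp
  next
    case (mult u c) then show ?case by (simp add: nn_integral_cmult distrib_left)
  next
    case (add u v) then show ?case by (simp add: nn_integral_add ac_simps)
  next
    case (seq U)
    have *: "integral\<^sup>N m (SUP i. U i) = (SUP i. integral\<^sup>N m (U i))" if "sets m = sets borel" for m
    proof -
      have "integral\<^sup>N m (SUP i. U i) = (\<integral>\<^sup>+x. (SUP i. U i x) \<partial>m)"
        by (intro nn_integral_cong) (simp add: image_comp)
      also have "\<dots> = (SUP i. integral\<^sup>N m (U i))"
        using seq that by (intro nn_integral_monotone_convergence_SUP) (auto cong: measurable_cong_sets)
      finally show ?thesis .
    qed
    have inc: "incseq (\<lambda>i. integral\<^sup>N m (U i))" if "sets m = sets borel" for m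
      using \<open>incseq U\<close> by (auto simp: incseq_def le_fun_def intro!: nn_integral_mono)
    have "integral\<^sup>N \<kappa> (SUP i. U i) = (SUP i. integral\<^sup>N \<mu> (U i) + integral\<^sup>N \<nu> (U i))"
      by (simp only: *[OF \<kappa>.M_is_borel] seq.IH)
    also have "\<dots> = (SUP i. integral\<^sup>N \<mu> (U i)) + (SUP i. integral\<^sup>N \<nu> (U i))"
      by (intro ennreal_SUP_add inc) auto
    finally show ?case
      by (simp only: *[OF \<mu>.M_is_borel] *[OF \<nu>.M_is_borel])
  qed
  have \<theta>[measurable]: "\<theta> \<in> borel_measurable borel"
    using int(1) borel_measurable_integrable measurable_cong_sets[OF \<mu>.M_is_borel refl] by blast
  have fin: "(\<integral>\<^sup>+x. ennreal (\<theta> x) \<partial>\<mu>) < top" "(\<integral>\<^sup>+x. ennreal (\<theta> x) \<partial>\<nu>) < top"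
    "(\<integral>\<^sup>+x. ennreal (- \<theta> x) \<partial>\<mu>) < top" "(\<integral>\<^sup>+x. ennreal (- \<theta> x) \<partial>\<nu>) < top"
    using int unfolding real_integrable_def by (auto simp: less_top)
  have "integrable \<kappa> \<theta>"
    unfolding real_integrable_def using fin by (simp add: nn less_top)
  then show ?thesis
    using int fin by (simp add: real_lebesgue_integral_def nn enn2real_plus)
qed

text \<open>Two decompositions \<open>f - g\<close> and \<open>f' - g'\<close> of the same path satisfy \<open>f + g' = f' + g\<close> up to a
  constant. The integral is additive in the integrator, and so it is the same for both.\<close>

lemma has_stieltjes_integral_unique:
  assumes "has_stieltjes_integral \<theta> x t I" "has_stieltjes_integral \<theta> x t I'" "0 \<le> t"
    and [measurable]: "\<theta> \<in> borel_measurable borel"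
  shows "I = I'"
proof -
  obtain f g where d: "monotone_decomposition x f g"
    and i: "integrable (window_measure f t) \<theta>" "integrable (window_measure g t) \<theta>"
    and I: "I = integral\<^sup>L (window_measure f t) \<theta> - integral\<^sup>L (window_measure g t) \<theta>"
    using assms(1) unfolding has_stieltjes_integral_def
    by (auto simp: set_integrable_window set_integral_window)
  obtain f' g' where d': "monotone_decomposition x f' g'"
    and i': "integrable (window_measure f' t) \<theta>" "integrable (window_measure g' t) \<theta>"
    and I': "I' = integral\<^sup>L (window_measure f' t) \<theta> - integral\<^sup>L (window_measure g' t) \<theta>"
    using assms(2) unfolding has_stieltjes_integral_def
    by (auto simp: set_integrable_window set_integral_window)
  note D = d[unfolded monotone_decomposition_def] d'[unfolded monotone_decomposition_def]
  have eq: "f s + g' s - (f 0 + g' 0) = f' s + g s - (f' 0 + g 0)" if "s \<ge> 0" for s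
  proof -
    have "f s - g s = f' s - g' s" "f 0 - g 0 = f' 0 - g' 0"
      using D that by (metis order_refl)+
    then show ?thesis by linarith
  qed
  let ?h = "\<lambda>s. f s + g' s" and ?h' = "\<lambda>s. f' s + g s"
  have m: "mono ?h" "mono ?h'"
    using D by (auto simp: mono_def intro!: add_mono)
  have c: "continuous (at_right u) ?h" "continuous (at_right u) ?h'" for u
    using D by (auto intro!: continuous_add)
  have W: "window_measure ?h t = window_measure ?h' t"
    using eq assms(3) m c by (intro window_measure_eqI) (auto simp: finite_borel_measure_window cdf_window_measure)
  have "integral\<^sup>L (window_measure ?h t) \<theta> = integral\<^sup>L (window_measure f t) \<theta> + integral\<^sup>L (window_measure g' t) \<theta>"
    using D m c i i' assms(3)
    by (intro integral_sum_of_measures) (auto simp: finite_borel_measure_window cdf_window_measure)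
  moreover have "integral\<^sup>L (window_measure ?h' t) \<theta> = integral\<^sup>L (window_measure f' t) \<theta> + integral\<^sup>L (window_measure g t) \<theta>"
    using D m c i i' assms(3)
    by (intro integral_sum_of_measures) (auto simp: finite_borel_measure_window cdf_window_measure)
  ultimately show ?thesis using W I I' by simp
qed

lemma stochastic_integral_eqI:
  assumes "has_stieltjes_integral (\<lambda>s. \<theta> s \<omega>) (\<lambda>s. X s \<omega>) t I" "0 \<le> t"
    "(\<lambda>s. \<theta> s \<omega>) \<in> borel_measurable borel"
  shows "stochastic_integral \<theta> X t \<omega> = I"
  unfolding stochastic_integral_def
  using has_stieltjes_integral_unique[OF _ assms(1) assms(2,3)] assms(1) by blast

text \<open>A path that jumps up by \<open>c s\<close> at the times \<open>s\<close> in \<open>J\<close> and otherwise decreases at rate \<open>\<gamma>\<close>.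
  The stock price is of this form, before and after \<open>\<tau>\<close>, and so its Stieltjes integrals are a
  finite sum minus a Lebesgue integral.\<close>

locale jump_drift_path =
  fixes x c \<gamma> :: "real \<Rightarrow> real" and J :: "real set"
  assumes finJ: "\<And>t. finite (J \<inter> {0<..t})"
    and c_nonneg: "\<And>s. 0 \<le> c s"
    and \<gamma>_nonneg: "\<And>u. 0 \<le> \<gamma> u" and \<gamma>_meas [measurable]: "\<gamma> \<in> borel_measurable borel"
    and \<gamma>_bdd: "\<And>t. \<exists>B. \<forall>u\<in>{0<..t}. \<gamma> u \<le> B"
    and rep: "\<And>t. 0 \<le> t \<Longrightarrow>
      x t - x 0 = (\<Sum>s\<in>J \<inter> {0<..t}. c s) - (LINT u:{0<..t}|lborel. \<gamma> u)"
begin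

definition "up t = (\<Sum>s\<in>J \<inter> {0<..t}. c s)"
definition "down t = (LINT u:{0<..t}|lborel. \<gamma> u)"

lemma mono_up: "mono up"
  unfolding up_def by (auto intro!: monoI sum_mono2 finJ c_nonneg)

lemma continuous_up: "continuous (at_right t) up"
proof -
  have "finite (J \<inter> {max 0 t<..t+1})"
    by (rule finite_subset[OF _ finJ[of "t+1"]]) auto
  then obtain e where e: "e > 0" "\<And>s. s \<in> J \<inter> {max 0 t<..t+1} \<Longrightarrow> t + e < s"
  proof (cases "J \<inter> {max 0 t<..t+1} = {}")
    case False
    let ?m = "Min (J \<inter> {max 0 t<..t+1})"
    have "?m \<in> J \<inter> {max 0 t<..t+1}" using Min_in[OF \<open>finite _\<close> False] .
    then have "t < ?m" by auto
    moreover have "?m \<le> s" if "s \<in> J \<inter> {max 0 t<..t+1}" for s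
      using Min_le[OF \<open>finite _\<close> that] .
    moreover have "t + (?m - t)/2 < ?m" using \<open>t < ?m\<close> by (simp add: field_simps)
    ultimately have "t + (?m - t)/2 < s" if "s \<in> J \<inter> {max 0 t<..t+1}" for s
      using that by (meson less_le_trans)
    then show ?thesis
      using \<open>t < ?m\<close> by (intro that[of "(?m - t)/2"]) auto
  qed (auto intro: that[of 1])
  have "up s = up t" if "s > t" "s < t + min e 1" for s
  proof -
    have "J \<inter> {0<..s} = J \<inter> {0<..t}"
      using that e by fastforce
    then show ?thesis by (simp add: up_def)
  qed
  then have "eventually (\<lambda>s. up s = up t) (at_right t)"
    using e by (auto simp: eventually_at_right_field intro!: exI[of _ "t + min e 1"])
  then show ?thesis
    unfolding continuous_within by (rule tendsto_eventually)
qed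

lemma integrable_drift: "set_integrable lborel {0<..t} (\<lambda>u. \<gamma> u * k u)"
  if "k \<in> borel_measurable borel" "\<And>u. u \<in> {0<..t} \<Longrightarrow> \<bar>k u\<bar> \<le> C"
proof -
  obtain B where B: "\<forall>u\<in>{0<..t}. \<gamma> u \<le> B" using \<gamma>_bdd by blast
  have "\<bar>\<gamma> u * k u\<bar> \<le> B * C" if "u \<in> {0<..t}" for u
    using B that \<open>\<And>u. u \<in> {0<..t} \<Longrightarrow> \<bar>k u\<bar> \<le> C\<close>[OF that] \<gamma>_nonneg[of u]
    by (auto simp: abs_mult intro!: mult_mono intro: order_trans)
  then show ?thesis
    unfolding set_integrable_def using that
    by (cases "0 \<le> t"; intro integrableI_bounded_set_indicator[where B = "B * C"]) auto
qed

lemma integrable_drift': "set_integrable lborel {0<..t} \<gamma>"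
  using integrable_drift[of "\<lambda>_. 1" t 1] by simp

lemma down_diff: "down t - down s = (LINT u:{s<..t}|lborel. \<gamma> u)" if "0 \<le> s" "s \<le> t"
proof -
  have "{0<..t} = {0<..s} \<union> {s<..t}" using that by auto
  moreover have "set_integrable lborel {0<..s} \<gamma>" "set_integrable lborel {s<..t} \<gamma>"
    by (rule set_integrable_subset[OF integrable_drift'[of t]]; use that in auto)+
  then have "(LINT u:{0<..s} \<union> {s<..t}|lborel. \<gamma> u) = (LINT u:{0<..s}|lborel. \<gamma> u) + (LINT u:{s<..t}|lborel. \<gamma> u)"
    by (intro set_integral_Un) auto
  ultimately show ?thesis by (simp add: down_def)
qed

lemma down_0: "t \<le> 0 \<Longrightarrow> down t = 0"
  by (simp add: down_def set_lebesgue_integral_def)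

lemma down_diff_bounds:
  assumes "0 \<le> s" "s \<le> t" "\<And>u. u \<in> {0<..t} \<Longrightarrow> \<gamma> u \<le> B"
  shows "0 \<le> down t - down s" "down t - down s \<le> B * (t - s)"
proof -
  show "0 \<le> down t - down s"
    unfolding down_diff[OF assms(1,2)] set_lebesgue_integral_def
    by (intro integral_nonneg_AE) (auto simp: \<gamma>_nonneg)
  have "(LINT u:{s<..t}|lborel. \<gamma> u) \<le> (LINT u:{s<..t}|lborel. B)"
    by (intro set_integral_mono set_integrable_subset[OF integrable_drift'[of t]])
       (use assms in \<open>auto simp: set_integrable_def\<close>)
  also have "\<dots> = B * (t - s)"
    using assms by (simp add: set_lebesgue_integral_def)
  finally show "down t - down s \<le> B * (t - s)" using down_diff[OF assms(1,2)] by simp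
qed

lemma mono_down: "mono down"
proof (rule monoI)
  fix s t :: real assume "s \<le> t"
  obtain B where B: "\<forall>u\<in>{0<..t}. \<gamma> u \<le> B" using \<gamma>_bdd by blast
  show "down s \<le> down t"
  proof (cases "0 \<le> s")
    case True then show ?thesis using down_diff_bounds(1)[of s t B] B \<open>s \<le> t\<close> by auto
  next
    case False
    then have "down s = down 0" "down t = down (max 0 t)" by (auto simp: down_0 max_def)
    then show ?thesis using down_diff_bounds(1)[of 0 t B] B by (cases "0 \<le> t") (auto simp: max_def)
  qed
qed

lemma continuous_down: "continuous (at_right t) down"
proof (cases "0 \<le> t")
  case True
  obtain B where B: "\<forall>u\<in>{0<..t+1}. \<gamma> u \<le> B" using \<gamma>_bdd by blast
  have 1: "eventually (\<lambda>s. t < s \<and> s < t + 1) (at_right t)"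
    by (auto simp: eventually_at_right_field intro!: exI[of _ "t+1"])
  have "((\<lambda>s. down s) \<longlongrightarrow> down t) (at_right t)"
  proof (rule tendsto_sandwich[of "\<lambda>_. down t" _ _ "\<lambda>s. down t + B * (s - t)"])
    show "eventually (\<lambda>s. down t \<le> down s) (at_right t)"
      using 1 by eventually_elim (auto intro: monoD[OF mono_down])
    show "eventually (\<lambda>s. down s \<le> down t + B * (s - t)) (at_right t)"
      using 1
    proof eventually_elim
      case (elim s)
      then have "down s - down t \<le> B * (s - t)"
        using B True by (intro down_diff_bounds) auto
      then show ?case by simp
    qed
    show "((\<lambda>s. down t + B * (s - t)) \<longlongrightarrow> down t) (at_right t)"
      by (rule tendsto_eq_intros refl | simp)+
  qed simp
  then show ?thesis by (simp add: continuous_within)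
next
  case False
  then have "eventually (\<lambda>s. down s = down t) (at_right t)"
    by (auto simp: eventually_at_right_field down_0 intro!: exI[of _ 0])
  then show ?thesis unfolding continuous_within by (rule tendsto_eventually)
qed

lemma monotone_decomposition_up_down: "monotone_decomposition x up down"
  unfolding monotone_decomposition_def
  using mono_up mono_down continuous_up continuous_down rep by (auto simp: up_def down_def)

lemma window_up:
  assumes "0 \<le> t"
  shows "window_measure up t = distr (point_measure (J \<inter> {0<..t}) (\<lambda>s. ennreal (c s))) borel (\<lambda>s. s)"
    (is "_ = ?\<nu>")
proof (rule window_measure_eqI[OF mono_up continuous_up assms])
  have e: "emeasure ?\<nu> A = ennreal (\<Sum>s\<in>J \<inter> {0<..t} \<inter> A. c s)" if "A \<in> sets borel" for A
    using that finJ[of t]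
    by (subst emeasure_distr)
       (auto simp: emeasure_point_measure_finite[OF _ Int_lower2] space_point_measure sum_ennreal c_nonneg Int_commute
         intro!: sum.cong arg_cong[where f=ennreal])
  show "finite_borel_measure ?\<nu>"
    by (intro finite_borel_measure.intro finite_measureI) (auto simp: finite_borel_measure_axioms_def e)
  fix y
  have "measure ?\<nu> {..y} = (\<Sum>s\<in>J \<inter> {0<..t} \<inter> {..y}. c s)"
    by (simp add: measure_def e sum_nonneg c_nonneg)
  also have "J \<inter> {0<..t} \<inter> {..y} = J \<inter> {0<..max 0 (min t y)}" by auto
  finally show "measure ?\<nu> {..y} = up (max 0 (min t y)) - up 0"
    by (simp add: up_def)
qed

lemma window_down:
  assumes "0 \<le> t"
  shows "window_measure down t = density lborel (\<lambda>u. ennreal (indicator {0<..t} u * \<gamma> u))"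
    (is "_ = ?\<nu>")
proof (rule window_measure_eqI[OF mono_down continuous_down assms])
  have e: "emeasure ?\<nu> {..y} = ennreal (down (max 0 (min t y)))" for y
  proof -
    have "emeasure ?\<nu> {..y} = (\<integral>\<^sup>+u. ennreal (indicator {0<..max 0 (min t y)} u * \<gamma> u) \<partial>lborel)"
      by (subst emeasure_density) (auto intro!: nn_integral_cong split: split_indicator)
    also have "\<dots> = ennreal (LINT u:{0<..max 0 (min t y)}|lborel. \<gamma> u)"
      using integrable_drift'[of "max 0 (min t y)"] unfolding set_lebesgue_integral_def set_integrable_def
      by (subst nn_integral_eq_integral) (auto simp: \<gamma>_nonneg)
    finally show ?thesis by (simp add: down_def)
  qed
  have "emeasure ?\<nu> UNIV = emeasure ?\<nu> {..t}"
    by (auto simp: emeasure_density intro!: nn_integral_cong split: split_indicator)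
  then show "finite_borel_measure ?\<nu>"
    by (intro finite_borel_measure.intro finite_measureI) (auto simp: finite_borel_measure_axioms_def e)
  fix y
  have "0 \<le> down (max 0 (min t y))" using monoD[OF mono_down, of 0 "max 0 (min t y)"] down_0 by simp
  then show "measure ?\<nu> {..y} = down (max 0 (min t y)) - down 0"
    by (simp add: measure_def e down_0)
qed

lemma has_stieltjes_integral_jump_drift:
  assumes [measurable]: "\<theta> \<in> borel_measurable borel" and bdd: "\<And>u. u \<in> {0<..t} \<Longrightarrow> \<bar>\<theta> u\<bar> \<le> C" and t: "0 \<le> t"
  shows "has_stieltjes_integral \<theta> x t
    ((\<Sum>s\<in>J \<inter> {0<..t}. c s * \<theta> s) - (LINT u:{0<..t}|lborel. \<gamma> u * \<theta> u))"
proof -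
  have 1: "integrable (window_measure up t) \<theta>"
    unfolding window_up[OF t] using finJ[of t]
    by (subst integrable_distr_eq) (auto simp: integrable_point_measure_finite)
  have 2: "integral\<^sup>L (window_measure up t) \<theta> = (\<Sum>s\<in>J \<inter> {0<..t}. c s * \<theta> s)"
    unfolding window_up[OF t] using finJ[of t]
    by (subst integral_distr) (auto simp: lebesgue_integral_point_measure_finite c_nonneg)
  have 3: "integrable (window_measure down t) \<theta>"
    unfolding window_down[OF t]
    using integrable_drift[OF assms(1) bdd]
    by (subst integrable_density) (auto simp: \<gamma>_nonneg set_integrable_def mult.assoc)
  have 4: "integral\<^sup>L (window_measure down t) \<theta> = (LINT u:{0<..t}|lborel. \<gamma> u * \<theta> u)"
    unfolding window_down[OF t] set_lebesgue_integral_def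
    by (subst integral_density) (auto simp: \<gamma>_nonneg mult.assoc)
  show ?thesis
    unfolding has_stieltjes_integral_def
    by (rule exI[of _ up], rule exI[of _ down])
       (auto simp: set_integrable_window set_integral_window 1 2 3 4 monotone_decomposition_up_down)
qed

end

section \<open>Counting paths\<close>

text \<open>Removing the jumps at the points of \<open>F\<close> makes \<open>k\<close> continuous, and then the fundamental
  theorem of calculus holds with a finite exceptional set \<open>E\<close>.\<close>

lemma jump_ftc:
  fixes k d l :: "real \<Rightarrow> real"
  assumes F: "finite F" "F \<subseteq> {0<..t}" and E: "finite E" and t: "0 \<le> t"
    and cont: "\<And>u. u \<in> {0..t} - F \<Longrightarrow> continuous (at u within {0..t}) k"
    and right: "\<And>u. u \<in> F \<Longrightarrow> continuous (at_right u) k"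
    and left: "\<And>u. u \<in> F \<Longrightarrow> (k \<longlongrightarrow> l u) (at_left u)"
    and deriv: "\<And>u. u \<in> {0<..<t} - E \<Longrightarrow> (k has_real_derivative d u) (at u)"
  shows "(d has_integral (k t - k 0 - (\<Sum>s\<in>F. k s - l s))) {0..t}"
proof -
  \<comment> \<open>the jumps up to time \<open>u\<close>\<close>
  define \<sigma> where "\<sigma> u = (\<Sum>s\<in>F \<inter> {..u}. k s - l s)" for u
  have sep: "\<exists>e>0. \<forall>v. v \<noteq> u \<and> \<bar>v - u\<bar> < e \<longrightarrow> v \<notin> F" for u
  proof -
    obtain e where "e > 0" "\<forall>v\<in>F. v \<noteq> u \<longrightarrow> e \<le> dist u v"
      using finite_set_avoid[OF F(1), of u] by blast
    then show ?thesis by (intro exI[of _ e]) (auto simp: dist_real_def abs_minus_commute not_less[symmetric])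
  qed
  have right_const: "eventually (\<lambda>v. \<sigma> v = \<sigma> u) (at_right u)" for u
  proof -
    obtain e where e: "e > 0" "\<And>v. v \<noteq> u \<Longrightarrow> \<bar>v - u\<bar> < e \<Longrightarrow> v \<notin> F" using sep[of u] by blast
    have "\<sigma> v = \<sigma> u" if "u < v" "v < u + e" for v
    proof -
      have "x \<le> u" if "x \<in> F" "x \<le> v" for x
        using e(2)[of x] that \<open>v < u + e\<close> by (cases "x \<le> u") (auto simp: abs_if)
      then have "F \<inter> {..v} = F \<inter> {..u}"
        using that by force
      then show ?thesis by (simp add: \<sigma>_def)
    qed
    then show ?thesis using e(1) by (auto simp: eventually_at_right_field intro!: exI[of _ "u + e"])
  qed
  have left_const: "eventually (\<lambda>v. \<sigma> v = (\<Sum>s\<in>F \<inter> {..<u}. k s - l s)) (at_left u)" for u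
  proof -
    obtain e where e: "e > 0" "\<And>v. v \<noteq> u \<Longrightarrow> \<bar>v - u\<bar> < e \<Longrightarrow> v \<notin> F" using sep[of u] by blast
    have "\<sigma> v = (\<Sum>s\<in>F \<inter> {..<u}. k s - l s)" if "v < u" "u - e < v" for v
    proof -
      have "x \<le> v" if "x \<in> F" "x < u" for x
        using e(2)[of x] that \<open>u - e < v\<close> by (cases "x \<le> v") (auto simp: abs_if)
      then have "F \<inter> {..v} = F \<inter> {..<u}"
        using that by force
      then show ?thesis by (simp add: \<sigma>_def)
    qed
    then show ?thesis using e(1) by (auto simp: eventually_at_left_field intro!: exI[of _ "u - e"])
  qed
  have off: "(\<Sum>s\<in>F \<inter> {..<u}. k s - l s) = \<sigma> u" if "u \<notin> F" for u
  proof -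
    have "F \<inter> {..<u} = F \<inter> {..u}" using that by (auto simp: less_le)
    then show ?thesis by (simp add: \<sigma>_def)
  qed
  have on: "(\<Sum>s\<in>F \<inter> {..<u}. k s - l s) = \<sigma> u - (k u - l u)" if "u \<in> F" for u
  proof -
    have "F \<inter> {..u} = insert u (F \<inter> {..<u})" using that by auto
    then show ?thesis using F(1) by (simp add: \<sigma>_def)
  qed
  have loc: "eventually (\<lambda>v. \<sigma> v = \<sigma> u) (at u)" if "u \<notin> F" for u
    using left_const[of u] right_const[of u] off[OF that] by (simp add: eventually_at_split)
  define \<kappa> where "\<kappa> u = k u - \<sigma> u" for u
  have "continuous_on {0..t} \<kappa>"
    unfolding continuous_on_eq_continuous_within
  proof
    fix u assume u: "u \<in> {0..t}"
    show "continuous (at u within {0..t}) \<kappa>"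
    proof (cases "u \<in> F")
      case False
      have "continuous (at u) \<sigma>" unfolding continuous_within by (rule tendsto_eventually[OF loc[OF False]])
      then have "continuous (at u within {0..t}) \<sigma>" by (rule continuous_at_imp_continuous_at_within)
      then show ?thesis unfolding \<kappa>_def using cont[of u] u False by (intro continuous_diff) auto
    next
      case True
      have "(\<kappa> \<longlongrightarrow> \<kappa> u) (at_right u)"
        unfolding \<kappa>_def using right[OF True] tendsto_eventually[OF right_const[of u]]
        by (intro tendsto_diff) (auto simp: continuous_within)
      moreover have "(\<kappa> \<longlongrightarrow> l u - (\<sigma> u - (k u - l u))) (at_left u)"
        unfolding \<kappa>_def using left[OF True] tendsto_eventually[OF left_const[of u]] on[OF True]
        by (intro tendsto_diff) auto
      moreover have "l u - (\<sigma> u - (k u - l u)) = \<kappa> u" by (simp add: \<kappa>_def)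
      ultimately have "continuous (at u) \<kappa>"
        unfolding isCont_def by (metis filterlim_split_at)
      then show ?thesis by (rule continuous_at_imp_continuous_at_within)
    qed
  qed
  moreover have "(\<kappa> has_vector_derivative d u) (at u)" if "u \<in> {0<..<t} - (E \<union> F)" for u
  proof -
    have "eventually (\<lambda>v. \<sigma> v = \<sigma> u) (nhds u)"
      using loc[of u] that by (simp add: eventually_nhds_conv_at)
    then have "((\<lambda>v. \<sigma> v) has_real_derivative 0) (at u)"
      by (subst DERIV_cong_ev[OF refl _ refl]) auto
    then have "(\<kappa> has_real_derivative d u - 0) (at u)"
      unfolding \<kappa>_def using deriv[of u] that by (intro DERIV_diff) auto
    then show ?thesis by (simp add: has_real_derivative_iff_has_vector_derivative)
  qed
  ultimately have "(d has_integral (\<kappa> t - \<kappa> 0)) {0..t}"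
    using E F(1) t by (intro fundamental_theorem_of_calculus_interior_strong[of "E \<union> F"]) auto
  moreover have "F \<inter> {..t} = F" "F \<inter> {..0} = {}" using F(2) by force+
  ultimately show ?thesis by (simp add: \<kappa>_def \<sigma>_def algebra_simps)
qed

lemma set_integral_eq_of_has_integral:
  fixes d :: "real \<Rightarrow> real"
  assumes "(d has_integral I) {0..t}" and [measurable]: "d \<in> borel_measurable borel"
    and B: "\<And>u. u \<in> {0..t} \<Longrightarrow> \<bar>d u\<bar> \<le> B"
  shows "(LINT u:{0<..t}|lborel. d u) = I"
proof -
  have "set_integrable lborel {0..t} d"
    unfolding set_integrable_def
    by (cases "0 \<le> t"; intro integrableI_bounded_set_indicator[where B = B]) (use B in auto)
  then have "(LINT u:{0..t}|lborel. d u) = I"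
    using set_borel_integral_eq_integral(2) assms(1) integral_unique by metis
  moreover have "(LINT u:{0<..t}|lborel. d u) = (LINT u:{0..t}|lborel. d u)"
    unfolding set_lebesgue_integral_def using AE_lborel_singleton[of "0::real"]
    by (intro integral_cong_AE) (auto split: split_indicator)
  ultimately show ?thesis by simp
qed

locale counting_path =
  fixes n :: "real \<Rightarrow> nat"
  assumes n_0: "n 0 = 0" and mono_n: "mono_on {0..} n"
    and right_cont_n: "\<And>t. 0 \<le> t \<Longrightarrow> continuous (at_right t) (\<lambda>s. real (n s))"
begin

lemma n_mono: "0 \<le> s \<Longrightarrow> s \<le> t \<Longrightarrow> n s \<le> n t"
  using mono_n by (auto simp: mono_on_def)

text \<open>The left limit of the path: an increasing integer-valued path attains it, as the maximum
  over all earlier times.\<close>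

definition before :: "real \<Rightarrow> nat" where
  "before t = (if t \<le> 0 then n 0 else Max (n ` {0..<t}))"

lemma right_constant:
  assumes "0 \<le> t"
  obtains e where "e > 0" "\<And>s. t \<le> s \<Longrightarrow> s < t + e \<Longrightarrow> n s = n t"
proof -
  have "((\<lambda>s. real (n s)) \<longlongrightarrow> real (n t)) (at_right t)"
    using right_cont_n[OF assms] by (simp add: continuous_within)
  then have "eventually (\<lambda>s. dist (real (n s)) (real (n t)) < 1) (at_right t)"
    by (rule tendstoD) simp
  then obtain b where b: "b > t" "\<And>s. t < s \<Longrightarrow> s < b \<Longrightarrow> dist (real (n s)) (real (n t)) < 1"
    by (auto simp: eventually_at_right_field)
  show ?thesis
  proof (rule that[of "b - t"])
    fix s assume s: "t \<le> s" "s < t + (b - t)"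
    show "n s = n t"
    proof (cases "s = t")
      case False
      then have "dist (real (n s)) (real (n t)) < 1" using b(2)[of s] s by auto
      then show ?thesis by (simp add: dist_real_def)
    qed simp
  qed (use b in auto)
qed

lemma finite_values_before: "finite (n ` {0..<t})"
  by (rule finite_subset[of _ "{..n t}"]) (auto intro: n_mono)

lemma n_le_before: "0 \<le> s \<Longrightarrow> s < t \<Longrightarrow> n s \<le> before t"
  using finite_values_before[of t] by (auto simp: before_def intro!: Max_ge)

lemma left_constant:
  assumes "0 < t"
  obtains s where "0 \<le> s" "s < t" "\<And>u. s \<le> u \<Longrightarrow> u < t \<Longrightarrow> n u = before t"
proof -
  have "before t \<in> n ` {0..<t}"
    using Max_in[OF finite_values_before, of t] assms by (auto simp: before_def)
  then obtain s where s: "0 \<le> s" "s < t" "n s = before t" by auto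
  show ?thesis
  proof (rule that[OF s(1,2)])
    fix u assume "s \<le> u" "u < t"
    then show "n u = before t"
      using n_mono[of s u] n_le_before[of u t] s by auto
  qed
qed

lemma before_le: "0 \<le> t \<Longrightarrow> before t \<le> n t"
proof (cases "0 < t")
  case True
  then obtain s where "0 \<le> s" "s < t" "n s = before t" using left_constant by (metis order_refl)
  then show ?thesis using n_mono[of s t] by simp
qed (auto simp: before_def)

lemma before_mono: "s \<le> t \<Longrightarrow> before s \<le> before t"
proof (cases "0 < s")
  case True
  assume "s \<le> t"
  from left_constant[OF True] obtain u where "0 \<le> u" "u < s" "n u = before s" by (metis order_refl)
  then show ?thesis using n_le_before[of u t] \<open>s \<le> t\<close> by simp
qed (auto simp: before_def n_0)

lemma tendsto_before:
  assumes "0 < t" shows "((\<lambda>s. real (n s)) \<longlongrightarrow> real (before t)) (at_left t)"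
proof -
  obtain s where "0 \<le> s" "s < t" "\<And>u. s \<le> u \<Longrightarrow> u < t \<Longrightarrow> n u = before t"
    using left_constant[OF assms] by blast
  then have "eventually (\<lambda>u. real (n u) = real (before t)) (at_left t)"
    by (auto simp: eventually_at_left_field intro!: exI[of _ s])
  then show ?thesis by (rule tendsto_eventually)
qed

lemma before_measurable: "(\<lambda>t. real (before t)) \<in> borel_measurable borel"
  by (intro borel_measurable_mono monoI) (simp add: before_mono)

definition jumps :: "real set" where
  "jumps = {t. 0 < t \<and> before t \<noteq> n t}"

lemma finite_jumps: "finite (jumps \<inter> {0<..t})"
proof (rule inj_on_finite)
  show "n ` (jumps \<inter> {0<..t}) \<subseteq> {..n t}" by (auto intro: n_mono)
  have "n s < n u" if "s \<in> jumps" "u \<in> jumps" "s < u" for s u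
    using that n_le_before[of s u] before_le[of u] by (simp add: jumps_def)
  then show "inj_on n (jumps \<inter> {0<..t})"
    by (intro inj_onI) (metis IntD1 less_irrefl linorder_neqE_linordered_idom)
qed simp

lemma locally_constant:
  assumes "0 < t" "t \<notin> jumps"
  shows "eventually (\<lambda>s. n s = n t) (nhds t)"
proof -
  obtain s where s: "s < t" "\<And>u. s \<le> u \<Longrightarrow> u < t \<Longrightarrow> n u = before t"
    using left_constant[OF assms(1)] by metis
  obtain e where e: "e > 0" "\<And>s. t \<le> s \<Longrightarrow> s < t + e \<Longrightarrow> n s = n t"
    using right_constant[of t] assms(1) by (metis less_eq_real_def)
  have "before t = n t" using assms by (simp add: jumps_def)
  then have const: "n u = n t" if "u \<in> {s<..<t+e}" for u
    using s(2)[of u] e(2)[of u] that by (cases "u < t") auto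
  have "eventually (\<lambda>u. u \<in> {s<..<t+e}) (nhds t)"
    using s e by (intro eventually_nhds_in_open) auto
  then show ?thesis by eventually_elim (rule const)
qed

end

locale drift_path = counting_path +
  fixes \<mu> :: real
  assumes \<mu>_pos: "\<mu> > 0"
begin

definition y :: "real \<Rightarrow> real" where "y t = \<mu> * t - real (n t)"
definition y_before :: "real \<Rightarrow> real" where "y_before t = \<mu> * t - real (before t)"

text \<open>Between jumps \<open>y\<close> increases strictly. Thus it leaves each value upwards and reaches each
  left limit from below, so that a function \<open>H\<close> with one-sided limits can be followed along
  \<open>y\<close>.\<close>

lemma filterlim_y_right: "0 \<le> t \<Longrightarrow> filterlim y (at_right (y t)) (at_right t)"
proof -
  assume "0 \<le> t"
  then obtain e where e: "e > 0" "\<And>s. t \<le> s \<Longrightarrow> s < t + e \<Longrightarrow> n s = n t"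
    using right_constant by blast
  have "(y \<longlongrightarrow> y t) (at_right t)"
    unfolding y_def using right_cont_n[OF \<open>0 \<le> t\<close>] by (auto intro!: tendsto_intros simp: continuous_within)
  moreover have *: "eventually (\<lambda>s. y t < y s) (at_right t)"
    unfolding eventually_at_right_field
  proof (intro exI[of _ "t + e"] conjI allI impI)
    fix s assume "t < s" "s < t + e"
    then show "y t < y s" using e(2)[of s] \<mu>_pos by (simp add: y_def)
  qed (use e in simp)
  moreover from * have "eventually (\<lambda>s. y s \<in> {y t<..} \<and> y s \<noteq> y t) (at_right t)"
    by (rule eventually_mono) simp
  ultimately show ?thesis
    unfolding filterlim_at by blast
qed

lemma filterlim_y_left: "0 < t \<Longrightarrow> filterlim y (at_left (y_before t)) (at_left t)"
proof -
  assume "0 < t"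
  then obtain s where s: "s < t" "\<And>u. s \<le> u \<Longrightarrow> u < t \<Longrightarrow> n u = before t"
    using left_constant by metis
  have "(y \<longlongrightarrow> y_before t) (at_left t)"
    unfolding y_def y_before_def using tendsto_before[OF \<open>0 < t\<close>] by (auto intro!: tendsto_intros)
  moreover have *: "eventually (\<lambda>s. y s < y_before t) (at_left t)"
    unfolding eventually_at_left_field
  proof (intro exI[of _ s] conjI allI impI)
    fix r assume "s < r" "r < t"
    then show "y r < y_before t" using s(2)[of r] \<mu>_pos by (simp add: y_def y_before_def)
  qed (use s in simp)
  moreover from * have "eventually (\<lambda>s. y s \<in> {..<y_before t} \<and> y s \<noteq> y_before t) (at_left t)"
    by (rule eventually_mono) simp
  ultimately show ?thesis
    unfolding filterlim_at by blast
qed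

lemma has_derivative_y: "0 < t \<Longrightarrow> t \<notin> jumps \<Longrightarrow> (y has_real_derivative \<mu>) (at t)"
proof -
  assume "0 < t" "t \<notin> jumps"
  then have ev: "eventually (\<lambda>s. n s = n t) (nhds t)" by (rule locally_constant)
  have "((\<lambda>s. \<mu> * s - real (n t)) has_real_derivative \<mu>) (at t)"
    by (auto intro!: derivative_eq_intros)
  moreover have "eventually (\<lambda>s. y s = \<mu> * s - real (n t)) (nhds t)"
    using ev by eventually_elim (simp add: y_def)
  ultimately show ?thesis by (subst DERIV_cong_ev[OF refl _ refl])
qed

lemma finite_level_times: "finite {u \<in> {0<..t}. y u = c}"
proof (rule finite_subset)
  show "{u \<in> {0<..t}. y u = c} \<subseteq> (\<lambda>k. (c + real k) / \<mu>) ` {..n t}"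
  proof
    fix u assume u: "u \<in> {u \<in> {0<..t}. y u = c}"
    then have "u = (c + real (n u)) / \<mu>" using \<mu>_pos by (auto simp: y_def field_simps)
    then show "u \<in> (\<lambda>k. (c + real k) / \<mu>) ` {..n t}" using u n_mono[of u t] by auto
  qed
qed simp

text \<open>\<open>H \<circ> y\<close> is differentiable except at the finitely many times when \<open>y\<close> jumps or meets a point
  of \<open>D\<close>. At such a time its left limit is \<open>Hl (y_before s)\<close>, because \<open>y\<close> arrives from below.\<close>

lemma path_change_of_variables:
  fixes H H' Hl :: "real \<Rightarrow> real"
  assumes D: "finite D" and t: "0 \<le> t"
    and right: "\<And>z. continuous (at_right z) H"
    and left: "\<And>z. (H \<longlongrightarrow> Hl z) (at_left z)"
    and deriv: "\<And>z. z \<notin> D \<Longrightarrow> (H has_real_derivative H' z) (at z)"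
  shows "((\<lambda>u. \<mu> * H' (y u)) has_integral
    (H (y t) - H (y 0) - (\<Sum>s\<in>{s \<in> {0<..t}. s \<in> jumps \<or> y s \<in> D}. H (y s) - Hl (y_before s)))) {0..t}"
proof -
  let ?F = "{s \<in> {0<..t}. s \<in> jumps \<or> y s \<in> D}"
  have fin: "finite ?F"
  proof (rule finite_subset)
    show "?F \<subseteq> (jumps \<inter> {0<..t}) \<union> (\<Union>c\<in>D. {u \<in> {0<..t}. y u = c})" by auto
  qed (intro finite_UnI finite_UN_I finite_jumps D finite_level_times)
  have r: "continuous (at_right u) (\<lambda>u. H (y u))" if "0 \<le> u" for u
  proof -
    have "(H \<longlongrightarrow> H (y u)) (at_right (y u))" using right by (simp add: continuous_within)
    from filterlim_compose[OF this filterlim_y_right[OF that]] show ?thesis by (simp add: continuous_within)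
  qed
  have d: "((\<lambda>u. H (y u)) has_real_derivative \<mu> * H' (y u)) (at u)" if "0 < u" "u \<notin> jumps" "y u \<notin> D" for u
    using DERIV_chain2[OF deriv[OF that(3)] has_derivative_y[OF that(1,2)]] by (simp add: mult.commute)
  show ?thesis
  proof (rule jump_ftc[where E = ?F])
    show "finite ?F" "finite ?F" "?F \<subseteq> {0<..t}" "0 \<le> t" using fin t by auto
    show "continuous (at u within {0..t}) (\<lambda>u. H (y u))" if "u \<in> {0..t} - ?F" for u
    proof (cases "u = 0")
      case True
      show ?thesis
      proof (cases "t = 0")
        case False
        then have "at u within {0..t} = at_right u" using True t by (simp add: at_within_Icc_at_right)
        then show ?thesis using r[of 0] True by simp
      qed (use True in \<open>simp add: continuous_within at_within_def\<close>)
    next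
      case False
      then show ?thesis using d[of u] that
        by (auto intro!: continuous_at_imp_continuous_at_within DERIV_isCont)
    qed
    show "continuous (at_right u) (\<lambda>u. H (y u))" if "u \<in> ?F" for u using r[of u] that by auto
    show "((\<lambda>u. H (y u)) \<longlongrightarrow> Hl (y_before u)) (at_left u)" if "u \<in> ?F" for u
      using filterlim_compose[OF left filterlim_y_left, of u] that by auto
    show "((\<lambda>u. H (y u)) has_real_derivative \<mu> * H' (y u)) (at u)" if "u \<in> {0<..<t} - ?F" for u
      using d[of u] that by auto
  qed
qed

end

section \<open>The Poisson process\<close>

text \<open>Increasingly enumerated times turn a finite-dimensional event into an event about
  independent increments.\<close>

lemma enumerate_times:
  assumes "finite D" "D \<subseteq> {0..}" "0 \<in> D"
  obtains u :: "nat \<Rightarrow> real" and m where "u 0 = 0" "\<forall>i<m. u i < u (Suc i)" "D = u ` {..m}"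
proof -
  let ?L = "sorted_list_of_set D"
  have ne: "?L \<noteq> []" using assms by auto
  have set: "set ?L = D" using assms by simp
  have len: "length ?L > 0" using ne by (simp only: length_greater_0_conv not_False_eq_True)
  obtain j where j: "j < length ?L" "?L ! j = 0" using assms(3) set by (metis in_set_conv_nth)
  have "?L ! 0 \<le> ?L ! j" using j by (intro sorted_nth_mono) auto
  moreover have "?L ! 0 \<ge> 0" using nth_mem[OF len] set assms(2) by auto
  ultimately have "?L ! 0 = 0" using j by simp
  moreover have "?L ! i < ?L ! Suc i" if "i < length ?L - 1" for i
    using that strict_sorted_list_of_set[of D]
    by (auto simp: sorted_wrt_iff_nth_less)
  moreover have "D = (\<lambda>i. ?L ! i) ` {..length ?L - 1}"
  proof -
    have "D = (\<lambda>i. ?L ! i) ` {..<length ?L}" using set by (auto simp: set_conv_nth)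
    also have "{..<length ?L} = {..length ?L - 1}" using len by auto
    finally show ?thesis .
  qed
  ultimately show ?thesis by (intro that) auto
qed

lemma times_mono:
  assumes "\<forall>i<m. u i < (u (Suc i) :: real)" "i \<le> j" "j \<le> m"
  shows "u i \<le> u j"
  using assms(2,3) 
proof (induction j rule: dec_induct)
  case (step k)
  then have "u k < u (Suc k)" using assms(1) by simp
  then show ?case using step by simp
qed simp

lemma PiM_nat_sets:
  assumes "finite I" "A \<subseteq> PiE I (\<lambda>_. UNIV)"
  shows "A \<in> sets (PiM I (\<lambda>_. count_space (UNIV :: nat set)))"
  using assms by (subst count_space_PiM_finite) auto

lemma one_minus_exp_le: "1 - exp (- (r::real)) \<le> r"
  using exp_ge_add_one_self[of "-r"] by simp

lemma exp_minus_taylor: "0 \<le> r \<Longrightarrow> \<bar>exp (- r) - 1 + r\<bar> \<le> (r::real)\<^sup>2"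
proof -
  assume r: "0 \<le> r"
  have "exp (- r) \<ge> 1 - r" using exp_ge_add_one_self[of "-r"] by simp
  moreover have "exp (- r) \<le> 1 - r + r\<^sup>2"
  proof -
    have "(1 + r) * exp (- r) \<le> exp r * exp (- r)" using exp_ge_add_one_self[of r] by (intro mult_right_mono) auto
    also have "\<dots> = 1" by (simp add: exp_add[symmetric])
    also have "\<dots> \<le> (1 + r) * (1 - r + r\<^sup>2)"
      using r by (simp add: algebra_simps power2_eq_square)
    finally show ?thesis using r by (simp add: mult_le_cancel_left)
  qed
  ultimately show ?thesis by simp
qed

locale poisson_proc = prob_space M for M :: "'a measure" +
  fixes N :: "real \<Rightarrow> 'a \<Rightarrow> nat" and lam :: real
  assumes poisson: "poisson_process M lam N" and lam_pos: "lam > 0"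
begin

abbreviation "\<Omega> \<equiv> space M"

lemma N_measurable [measurable]: "0 \<le> t \<Longrightarrow> N t \<in> measurable M (count_space UNIV)"
  using poisson by (auto simp: poisson_process_def)

lemma counting: "\<omega> \<in> \<Omega> \<Longrightarrow> counting_path (\<lambda>t. N t \<omega>)"
  using poisson by (auto simp: poisson_process_def counting_path_def)

lemma N_0: "\<omega> \<in> \<Omega> \<Longrightarrow> N 0 \<omega> = 0"
  using counting_path.n_0[OF counting] .

lemma N_mono: "\<omega> \<in> \<Omega> \<Longrightarrow> 0 \<le> s \<Longrightarrow> s \<le> t \<Longrightarrow> N s \<omega> \<le> N t \<omega>"
  using counting_path.n_mono[OF counting] .

lemma distr_increment:
  "0 \<le> s \<Longrightarrow> s < t \<Longrightarrow>
    distr M (count_space UNIV) (\<lambda>\<omega>. N t \<omega> - N s \<omega>) = measure_pmf (poisson_pmf (lam * (t - s)))"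
  using poisson by (auto simp: poisson_process_def)

lemma indep_increments:
  "0 \<le> u 0 \<Longrightarrow> (\<And>i. i < m \<Longrightarrow> u i \<le> u (Suc i)) \<Longrightarrow>
    indep_vars (\<lambda>_. count_space UNIV) (\<lambda>i \<omega>. N (u (Suc i)) \<omega> - N (u i) \<omega>) {..<m}"
  using poisson by (auto simp: poisson_process_def)

lemma prob_increment_in:
  assumes "0 \<le> s" "s < t"
  shows "prob {\<omega> \<in> \<Omega>. N t \<omega> - N s \<omega> \<in> B} = measure_pmf.prob (poisson_pmf (lam * (t - s))) B"
proof -
  have "measure_pmf.prob (poisson_pmf (lam * (t - s))) B
      = prob ((\<lambda>\<omega>. N t \<omega> - N s \<omega>) -` B \<inter> \<Omega>)"
    unfolding distr_increment[OF assms, symmetric]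
    using assms by (intro measure_distr) auto
  also have "(\<lambda>\<omega>. N t \<omega> - N s \<omega>) -` B \<inter> \<Omega> = {\<omega> \<in> \<Omega>. N t \<omega> - N s \<omega> \<in> B}" by auto
  finally show ?thesis ..
qed

lemma prob_increment:
  assumes "0 \<le> s" "s < t"
  shows "prob {\<omega> \<in> \<Omega>. N t \<omega> - N s \<omega> = k} = (lam * (t - s)) ^ k / fact k * exp (- (lam * (t - s)))"
  using prob_increment_in[OF assms, of "{k}"] assms lam_pos by (simp add: measure_pmf_single)

lemma prob_no_jump:
  assumes "0 \<le> s" "s \<le> t"
  shows "prob {\<omega> \<in> \<Omega>. N t \<omega> = N s \<omega>} = exp (- (lam * (t - s)))"
proof (cases "s = t")
  case False
  have "{\<omega> \<in> \<Omega>. N t \<omega> = N s \<omega>} = {\<omega> \<in> \<Omega>. N t \<omega> - N s \<omega> = 0}"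
    using N_mono[OF _ assms] by (auto simp: le_antisym)
  then show ?thesis using prob_increment[of s t 0] assms False by simp
qed (simp add: prob_space)

lemma events_N_eq:
  assumes "0 \<le> s" "0 \<le> t"
  shows "{\<omega> \<in> \<Omega>. N t \<omega> = N s \<omega>} \<in> events"
proof -
  have [measurable]: "N s \<in> measurable M (count_space UNIV)" "N t \<in> measurable M (count_space UNIV)"
    using assms by auto
  have "{\<omega> \<in> \<Omega>. real (N t \<omega>) = real (N s \<omega>)} \<in> events" by measurable
  then show ?thesis by simp
qed

lemma prob_jump_le:
  assumes "0 \<le> s" "s \<le> t"
  shows "prob {\<omega> \<in> \<Omega>. N t \<omega> \<noteq> N s \<omega>} \<le> lam * (t - s)"
proof -
  have [measurable]: "N s \<in> measurable M (count_space UNIV)" "N t \<in> measurable M (count_space UNIV)"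
    using assms by auto
  have "{\<omega> \<in> \<Omega>. N t \<omega> = N s \<omega>} \<in> events" using assms by (intro events_N_eq) auto
  then have "prob {\<omega> \<in> \<Omega>. N t \<omega> \<noteq> N s \<omega>} = 1 - prob {\<omega> \<in> \<Omega>. N t \<omega> = N s \<omega>}"
    by (subst prob_compl[symmetric]) (auto intro!: arg_cong[where f = prob])
  then show ?thesis using prob_no_jump[OF assms] one_minus_exp_le by simp
qed

lemma prob_two_jumps_le:
  assumes "0 \<le> s" "s < t"
  shows "prob {\<omega> \<in> \<Omega>. 2 \<le> N t \<omega> - N s \<omega>} \<le> (lam * (t - s))\<^sup>2"
proof -
  let ?r = "lam * (t - s)"
  have r: "?r > 0" using assms lam_pos by simp
  have [measurable]: "N s \<in> measurable M (count_space UNIV)" "N t \<in> measurable M (count_space UNIV)"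
    using assms by auto
  have "{\<omega> \<in> \<Omega>. 2 \<le> N t \<omega> - N s \<omega>}
      = \<Omega> - ({\<omega> \<in> \<Omega>. N t \<omega> - N s \<omega> = 0} \<union> {\<omega> \<in> \<Omega>. N t \<omega> - N s \<omega> = 1})" by auto
  then have "prob {\<omega> \<in> \<Omega>. 2 \<le> N t \<omega> - N s \<omega>}
      = 1 - prob ({\<omega> \<in> \<Omega>. N t \<omega> - N s \<omega> = 0} \<union> {\<omega> \<in> \<Omega>. N t \<omega> - N s \<omega> = 1})"
    by (simp only:) (rule prob_compl, measurable)
  also have "\<dots> = 1 - (exp (- ?r) + ?r * exp (- ?r))"
  proof (subst finite_measure_Union)
    show "{\<omega> \<in> \<Omega>. N t \<omega> - N s \<omega> = 0} \<in> events" "{\<omega> \<in> \<Omega>. N t \<omega> - N s \<omega> = 1} \<in> events" by measurable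
  qed (use prob_increment[OF assms, of 0] prob_increment[OF assms, of 1] in auto)
  also have "\<dots> \<le> 1 - (1 + ?r) * (1 - ?r)"
    using exp_ge_add_one_self[of "-?r"] r mult_left_mono[of "1 - ?r" "exp (- ?r)" "1 + ?r"] by (simp add: algebra_simps)
  also have "\<dots> = ?r\<^sup>2" by (simp add: algebra_simps power2_eq_square)
  finally show ?thesis .
qed

lemma sum_increments:
  assumes "\<forall>i<m. u i < (u (Suc i) :: real)" "0 \<le> u 0" "p \<le> i" "i \<le> m" "\<omega> \<in> \<Omega>"
  shows "N (u i) \<omega> - N (u p) \<omega> = (\<Sum>j\<in>{p..<i}. N (u (Suc j)) \<omega> - N (u j) \<omega>)"
  using assms(3,4)
proof (induction i rule: dec_induct)
  case (step i)
  have "0 \<le> u p" using times_mono[OF assms(1), of 0 p] step assms(2) by simp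
  moreover have "u p \<le> u i" "u i \<le> u (Suc i)" using times_mono[OF assms(1)] step by auto
  ultimately have "N (u p) \<omega> \<le> N (u i) \<omega>" "N (u i) \<omega> \<le> N (u (Suc i)) \<omega>"
    using N_mono[OF assms(5)] by auto
  then show ?case using step by simp
qed simp

definition "cylinder D B = {\<omega> \<in> \<Omega>. \<forall>s\<in>D. N s \<omega> \<in> B s}"
definition "future_cylinder t D C = {\<omega> \<in> \<Omega>. \<forall>s\<in>D. N (t + s) \<omega> - N t \<omega> \<in> C s}"

lemma cylinder_sets: "finite D \<Longrightarrow> D \<subseteq> {0..} \<Longrightarrow> cylinder D B \<in> events"
  unfolding cylinder_def by (intro sets.sets_Collect_finite_All) auto

lemma future_cylinder_sets:
  assumes "finite D" "D \<subseteq> {0..}" "0 \<le> t" shows "future_cylinder t D C \<in> events"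
proof -
  have "{\<omega> \<in> \<Omega>. N (t + s) \<omega> - N t \<omega> \<in> C s} \<in> events" if "s \<in> D" for s
  proof -
    have [measurable]: "N (t + s) \<in> measurable M (count_space UNIV)" "N t \<in> measurable M (count_space UNIV)"
      using assms that by (auto intro!: N_measurable)
    show ?thesis by measurable
  qed
  then show ?thesis unfolding future_cylinder_def using assms by (intro sets.sets_Collect_finite_All) auto
qed

text \<open>With \<open>t\<close> and all the times involved in one increasing enumeration, the first event depends
  on the increments before \<open>t\<close> and the second on those after \<open>t\<close>.\<close>

lemma indep_past_future:
  assumes D: "finite D" "D \<subseteq> {0..t}" and D': "finite D'" "D' \<subseteq> {0..}" and t: "0 \<le> t"
  shows "prob (cylinder D B \<inter> future_cylinder t D' C) = prob (cylinder D B) * prob (future_cylinder t D' C)"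
proof -
  obtain u m where u0: "u 0 = 0" and u: "\<forall>i<m. u i < (u (Suc i) :: real)"
    and all: "{0, t} \<union> D \<union> (\<lambda>s. t + s) ` D' = u ` {..m}"
  proof (rule enumerate_times[of "{0, t} \<union> D \<union> (\<lambda>s. t + s) ` D'"])
    show "{0, t} \<union> D \<union> (\<lambda>s. t + s) ` D' \<subseteq> {0..}" using D D' t by auto
  qed (use D D' in auto)
  note um = times_mono[OF u]
  have less: "u i < u j" if "i < j" "j \<le> m" for i j
    using um[of "Suc i" j] u[rule_format, of i] that by auto
  have "t \<in> u ` {..m}" unfolding all[symmetric] by simp
  then obtain p where p: "p \<le> m" "u p = t" by auto
  define X where "X i \<omega> = N (u (Suc i)) \<omega> - N (u i) \<omega>" for i \<omega>
  have ind: "indep_vars (\<lambda>_. count_space UNIV) X {..<m}"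
    unfolding X_def using u u0 by (intro indep_increments) (auto intro: less_imp_le)
  let ?P1 = "PiM {..<p} (\<lambda>_. count_space (UNIV :: nat set))" and ?P2 = "PiM {p..<m} (\<lambda>_. count_space (UNIV :: nat set))"
  let ?R1 = "\<lambda>\<omega>. restrict (\<lambda>i. X i \<omega>) {..<p}" and ?R2 = "\<lambda>\<omega>. restrict (\<lambda>i. X i \<omega>) {p..<m}"
  have ind2: "indep_var ?P1 ?R1 ?P2 ?R2"
    using p by (intro indep_var_restrict[OF ind]) auto
  \<comment> \<open>the two events, expressed by the increments\<close>
  define Q1 where "Q1 = {z \<in> PiE {..<p} (\<lambda>_. UNIV). \<forall>i\<le>p. u i \<in> D \<longrightarrow> (\<Sum>j\<in>{0..<i}. z j) \<in> B (u i)}"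
  define Q2 where "Q2 = {z \<in> PiE {p..<m} (\<lambda>_. UNIV). \<forall>i\<in>{p..m}. u i - t \<in> D' \<longrightarrow> (\<Sum>j\<in>{p..<i}. z j) \<in> C (u i - t)}"
  have Q: "Q1 \<in> sets ?P1" "Q2 \<in> sets ?P2"
    by (auto simp: Q1_def Q2_def intro!: PiM_nat_sets)
  have 1: "?R1 -` Q1 \<inter> \<Omega> = cylinder D B"
  proof -
    have "?R1 \<omega> \<in> Q1 \<longleftrightarrow> \<omega> \<in> cylinder D B" if \<omega>: "\<omega> \<in> \<Omega>" for \<omega>
    proof -
      have s: "(\<Sum>j\<in>{0..<i}. ?R1 \<omega> j) = N (u i) \<omega>" if "i \<le> p" for i
      proof -
        have "(\<Sum>j\<in>{0..<i}. ?R1 \<omega> j) = (\<Sum>j\<in>{0..<i}. X j \<omega>)" using that by (intro sum.cong) auto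
        also have "\<dots> = N (u i) \<omega>"
          using sum_increments[OF u, of 0 i \<omega>] that p u0 \<omega> N_0[OF \<omega>] by (simp add: X_def)
        finally show ?thesis .
      qed
      have d: "\<exists>i\<le>p. u i = d" if "d \<in> D" for d
      proof -
        have "d \<in> u ` {..m}" unfolding all[symmetric] using that by simp
        then obtain i where i: "i \<le> m" "u i = d" by auto
        have "d \<le> t" using that D(2) by auto
        then have "\<not> p < i" using less[of p i] i p by auto
        then show ?thesis using i by (intro exI[of _ i]) auto
      qed
      have "?R1 \<omega> \<in> Q1 \<longleftrightarrow> (\<forall>i\<le>p. u i \<in> D \<longrightarrow> N (u i) \<omega> \<in> B (u i))"
        unfolding Q1_def using s by simp
      also have "\<dots> \<longleftrightarrow> (\<forall>x\<in>D. N x \<omega> \<in> B x)"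
        using d by blast
      also have "\<dots> \<longleftrightarrow> \<omega> \<in> cylinder D B" using \<omega> by (simp add: cylinder_def)
      finally show ?thesis .
    qed
    then show ?thesis by (auto simp: cylinder_def)
  qed
  have 2: "?R2 -` Q2 \<inter> \<Omega> = future_cylinder t D' C"
  proof -
    have "?R2 \<omega> \<in> Q2 \<longleftrightarrow> \<omega> \<in> future_cylinder t D' C" if \<omega>: "\<omega> \<in> \<Omega>" for \<omega>
    proof -
      have s: "(\<Sum>j\<in>{p..<i}. ?R2 \<omega> j) = N (u i) \<omega> - N t \<omega>" if "i \<in> {p..m}" for i
      proof -
        have "(\<Sum>j\<in>{p..<i}. ?R2 \<omega> j) = (\<Sum>j\<in>{p..<i}. X j \<omega>)" using that by (intro sum.cong) auto
        also have "\<dots> = N (u i) \<omega> - N t \<omega>"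
          using sum_increments[OF u, of p i \<omega>] that p u0 \<omega> by (simp add: X_def)
        finally show ?thesis .
      qed
      have d: "\<exists>i\<in>{p..m}. u i = t + d" if "d \<in> D'" for d
      proof -
        have "t + d \<in> u ` {..m}" unfolding all[symmetric] using that by simp
        then obtain i where i: "i \<le> m" "u i = t + d" by auto
        have "0 \<le> d" using that D'(2) by auto
        then have "\<not> i < p" using less[of i p] i p by auto
        then show ?thesis using i by auto
      qed
      have "?R2 \<omega> \<in> Q2 \<longleftrightarrow> (\<forall>i\<in>{p..m}. u i - t \<in> D' \<longrightarrow> N (u i) \<omega> - N t \<omega> \<in> C (u i - t))"
        unfolding Q2_def using s by simp
      also have "\<dots> \<longleftrightarrow> (\<forall>x\<in>D'. N (t + x) \<omega> - N t \<omega> \<in> C x)"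
      proof (intro iffI ballI impI)
        fix x assume "\<forall>i\<in>{p..m}. u i - t \<in> D' \<longrightarrow> N (u i) \<omega> - N t \<omega> \<in> C (u i - t)" "x \<in> D'"
        then show "N (t + x) \<omega> - N t \<omega> \<in> C x" using d[of x] by auto
      next
        fix i assume "\<forall>x\<in>D'. N (t + x) \<omega> - N t \<omega> \<in> C x" "u i - t \<in> D'"
        then show "N (u i) \<omega> - N t \<omega> \<in> C (u i - t)" by force
      qed
      also have "\<dots> \<longleftrightarrow> \<omega> \<in> future_cylinder t D' C"
        using \<omega> by (simp add: future_cylinder_def)
      finally show ?thesis .
    qed
    then show ?thesis by (auto simp: future_cylinder_def)
  qed
  have "(\<lambda>x. (?R1 x, ?R2 x)) -` (Q1 \<times> Q2) \<inter> \<Omega> = (?R1 -` Q1 \<inter> \<Omega>) \<inter> (?R2 -` Q2 \<inter> \<Omega>)" by auto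
  then show ?thesis
    using indep_varD[OF ind2 Q] unfolding 1 2 by simp
qed

end

text \<open>The law of the increments on any grid of times is a product of Poisson laws, in which only
  the intensity enters.\<close>

lemma poisson_cylinder_unique:
  assumes "poisson_proc M N lam" "poisson_proc M' N' lam"
    and D: "finite D" "D \<subseteq> {0..}"
  shows "measure M (poisson_proc.cylinder M N D B) = measure M' (poisson_proc.cylinder M' N' D B)"
proof -
  obtain u m where u0: "u 0 = 0" and u: "\<forall>i<m. u i < (u (Suc i) :: real)"
    and all: "{0, 1} \<union> D = u ` {..m}"
  proof (rule enumerate_times[of "{0, 1} \<union> D"])
    show "{0, 1} \<union> D \<subseteq> {0..}" using D by auto
  qed (use D in auto)
  have "m \<noteq> 0"
  proof
    assume "m = 0"
    then have "{0, 1} \<union> D = {0}" using all u0 by simp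
    then have "(1::real) \<in> {0}" by blast
    then show False by simp
  qed
  then have ne: "{..<m} \<noteq> {}" by (simp add: lessThan_empty_iff)
  define Q where "Q = {z \<in> PiE {..<m} (\<lambda>_. UNIV). \<forall>i\<le>m. u i \<in> D \<longrightarrow> (\<Sum>j\<in>{0..<i}. z j) \<in> B (u i)}"
  let ?P = "PiM {..<m} (\<lambda>_. count_space (UNIV :: nat set))"
  have "measure M (poisson_proc.cylinder M N D B)
      = measure (PiM {..<m} (\<lambda>i. measure_pmf (poisson_pmf (lam * (u (Suc i) - u i))))) Q"
    if "poisson_proc M N lam" for M :: "'c measure" and N
  proof -
    interpret R: poisson_proc M N lam by fact
    note um = times_mono[OF u]
    have pos: "0 \<le> u i" if "i \<le> m" for i using um[of 0 i] u0 that by simp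
    define X where "X i \<omega> = N (u (Suc i)) \<omega> - N (u i) \<omega>" for i \<omega>
    have ind: "R.indep_vars (\<lambda>_. count_space UNIV) X {..<m}"
      unfolding X_def using u u0 by (intro R.indep_increments) (auto intro: less_imp_le)
    have X[measurable]: "X i \<in> measurable M (count_space UNIV)" if "i \<in> {..<m}" for i
      using ind that by (auto simp: R.indep_vars_def)
    let ?R = "\<lambda>\<omega>. restrict (\<lambda>i. X i \<omega>) {..<m}"
    have Rm: "?R \<in> measurable M ?P" by (intro measurable_restrict X)
    have "distr M ?P ?R = PiM {..<m} (\<lambda>i. distr M (count_space UNIV) (X i))"
      using R.indep_vars_iff_distr_eq_PiM'[OF ne, where M' = "\<lambda>_. count_space UNIV" and X = X] X ind by blast
    also have "\<dots> = PiM {..<m} (\<lambda>i. measure_pmf (poisson_pmf (lam * (u (Suc i) - u i))))"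
      unfolding X_def using u pos by (intro PiM_cong R.distr_increment) auto
    finally have d: "distr M ?P ?R = \<dots>" .
    have "Q \<in> sets ?P" unfolding Q_def by (rule PiM_nat_sets) auto
    then have "measure (distr M ?P ?R) Q = measure M (?R -` Q \<inter> space M)"
      by (intro measure_distr Rm)
    also have "?R -` Q \<inter> space M = poisson_proc.cylinder M N D B"
    proof -
      have "?R \<omega> \<in> Q \<longleftrightarrow> \<omega> \<in> R.cylinder D B" if \<omega>: "\<omega> \<in> space M" for \<omega>
      proof -
        have s: "(\<Sum>j\<in>{0..<i}. ?R \<omega> j) = N (u i) \<omega>" if "i \<le> m" for i
        proof -
          have "(\<Sum>j\<in>{0..<i}. ?R \<omega> j) = (\<Sum>j\<in>{0..<i}. X j \<omega>)" using that by (intro sum.cong) auto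
          also have "\<dots> = N (u i) \<omega>"
            using R.sum_increments[OF u, of 0 i \<omega>] that u0 \<omega> R.N_0[OF \<omega>] by (simp add: X_def)
          finally show ?thesis .
        qed
        have d: "\<exists>i\<le>m. u i = d" if "d \<in> D" for d
        proof -
          have "d \<in> u ` {..m}" unfolding all[symmetric] using that by simp
          then show ?thesis by auto
        qed
        have "?R \<omega> \<in> Q \<longleftrightarrow> (\<forall>i\<le>m. u i \<in> D \<longrightarrow> N (u i) \<omega> \<in> B (u i))"
          unfolding Q_def using s by simp
        also have "\<dots> \<longleftrightarrow> (\<forall>x\<in>D. N x \<omega> \<in> B x)"
          using d by blast
        also have "\<dots> \<longleftrightarrow> \<omega> \<in> R.cylinder D B" using \<omega> by (simp add: R.cylinder_def)
        finally show ?thesis .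
      qed
      then show ?thesis by (auto simp: R.cylinder_def)
    qed
    finally show ?thesis unfolding d ..
  qed
  from this[OF assms(1)] this[OF assms(2)] show ?thesis by simp
qed

context poisson_proc
begin

lemma shifted_process:
  assumes t: "0 \<le> t"
  shows "poisson_proc M (\<lambda>s \<omega>. N (t + s) \<omega> - N t \<omega>) lam"
proof (unfold_locales)
  have m: "N t \<omega> \<le> N (t + s) \<omega>" if "\<omega> \<in> \<Omega>" "0 \<le> s" for s \<omega>
    using N_mono[OF that(1), of t "t + s"] t that by simp
  show "poisson_process M lam (\<lambda>s \<omega>. N (t + s) \<omega> - N t \<omega>)"
    unfolding poisson_process_def
  proof (intro conjI allI impI ballI)
    fix s :: real assume "0 \<le> s"
    then have [measurable]: "N (t + s) \<in> measurable M (count_space UNIV)" "N t \<in> measurable M (count_space UNIV)"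
      using t by auto
    show "(\<lambda>\<omega>. N (t + s) \<omega> - N t \<omega>) \<in> measurable M (count_space UNIV)" by measurable
  next
    fix \<omega> assume \<omega>: "\<omega> \<in> \<Omega>"
    interpret c: counting_path "\<lambda>t. N t \<omega>" using counting[OF \<omega>] .
    show "N (t + 0) \<omega> - N t \<omega> = 0" by simp
    show "mono_on {0..} (\<lambda>s. N (t + s) \<omega> - N t \<omega>)"
      using t by (auto simp: mono_on_def intro!: diff_le_mono N_mono[OF \<omega>])
    fix s :: real assume s: "0 \<le> s"
    then obtain e where e: "e > 0" "\<And>r. t + s \<le> r \<Longrightarrow> r < t + s + e \<Longrightarrow> N r \<omega> = N (t + s) \<omega>"
      using c.right_constant[of "t + s"] t by (metis add_nonneg_nonneg)
    have "eventually (\<lambda>r. real (N (t + r) \<omega> - N t \<omega>) = real (N (t + s) \<omega> - N t \<omega>)) (at_right s)"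
      unfolding eventually_at_right_field
    proof (intro exI[of _ "s + e"] conjI allI impI)
      fix r assume "s < r" "r < s + e"
      then show "real (N (t + r) \<omega> - N t \<omega>) = real (N (t + s) \<omega> - N t \<omega>)"
        using e(2)[of "t + r"] by simp
    qed (use e in simp)
    then show "continuous (at_right s) (\<lambda>s. real (N (t + s) \<omega> - N t \<omega>))"
      unfolding continuous_within by (rule tendsto_eventually)
  next
    fix s r :: real assume sr: "0 \<le> s \<and> s < r"
    have "distr M (count_space UNIV) (\<lambda>\<omega>. N (t + r) \<omega> - N t \<omega> - (N (t + s) \<omega> - N t \<omega>))
      = distr M (count_space UNIV) (\<lambda>\<omega>. N (t + r) \<omega> - N (t + s) \<omega>)"
      using m sr by (intro distr_cong) auto
    also have "\<dots> = measure_pmf (poisson_pmf (lam * (t + r - (t + s))))"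
      using sr t by (intro distr_increment) auto
    finally show "distr M (count_space UNIV) (\<lambda>\<omega>. N (t + r) \<omega> - N t \<omega> - (N (t + s) \<omega> - N t \<omega>))
      = measure_pmf (poisson_pmf (lam * (r - s)))" by simp
  next
    fix k and u :: "nat \<Rightarrow> real" assume u: "0 \<le> u 0 \<and> (\<forall>i<k. u i \<le> u (Suc i))"
    have pos: "0 \<le> u i" if "i \<le> k" for i using that
    proof (induction i)
      case (Suc i) then show ?case using u by (metis Suc_le_lessD less_imp_le order_trans)
    qed (use u in simp)
    have ind: "indep_vars (\<lambda>_. count_space UNIV) (\<lambda>i \<omega>. N (t + u (Suc i)) \<omega> - N (t + u i) \<omega>) {..<k}"
      using u t by (intro indep_increments[of "\<lambda>i. t + u i"]) auto
    have eq: "N (t + u (Suc i)) \<omega> - N t \<omega> - (N (t + u i) \<omega> - N t \<omega>) = N (t + u (Suc i)) \<omega> - N (t + u i) \<omega>"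
      if "i < k" "\<omega> \<in> \<Omega>" for i \<omega>
      using m[OF that(2) pos[of i]] that by simp
    have "indep_vars (\<lambda>_. count_space UNIV) (\<lambda>i \<omega>. N (t + u (Suc i)) \<omega> - N t \<omega> - (N (t + u i) \<omega> - N t \<omega>)) {..<k}
      \<longleftrightarrow> indep_vars (\<lambda>_. count_space UNIV) (\<lambda>i \<omega>. N (t + u (Suc i)) \<omega> - N (t + u i) \<omega>) {..<k}"
      unfolding indep_vars_def2
    proof (intro conj_cong ball_cong refl indep_sets_cong)
      fix i assume "i \<in> {..<k}"
      then show "random_variable (count_space UNIV) (\<lambda>\<omega>. N (t + u (Suc i)) \<omega> - N t \<omega> - (N (t + u i) \<omega> - N t \<omega>))
         = random_variable (count_space UNIV) (\<lambda>\<omega>. N (t + u (Suc i)) \<omega> - N (t + u i) \<omega>)"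
        using eq by (intro measurable_cong) auto
      have "(\<lambda>\<omega>. N (t + u (Suc i)) \<omega> - N t \<omega> - (N (t + u i) \<omega> - N t \<omega>)) -` A \<inter> \<Omega>
          = (\<lambda>\<omega>. N (t + u (Suc i)) \<omega> - N (t + u i) \<omega>) -` A \<inter> \<Omega>" for A
        using eq \<open>i \<in> {..<k}\<close> by auto
      then show "{(\<lambda>\<omega>. N (t + u (Suc i)) \<omega> - N t \<omega> - (N (t + u i) \<omega> - N t \<omega>)) -` A \<inter> \<Omega> |A. A \<in> sets (count_space UNIV)}
          = {(\<lambda>\<omega>. N (t + u (Suc i)) \<omega> - N (t + u i) \<omega>) -` A \<inter> \<Omega> |A. A \<in> sets (count_space UNIV)}"
        by simp
    qed
    with ind show "indep_vars (\<lambda>_. count_space UNIV) (\<lambda>i \<omega>. N (t + u (Suc i)) \<omega> - N t \<omega> - (N (t + u i) \<omega> - N t \<omega>)) {..<k}"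
      by simp
  qed
qed (rule lam_pos)

lemma future_cylinder_eq: "future_cylinder t D C = poisson_proc.cylinder M (\<lambda>s \<omega>. N (t + s) \<omega> - N t \<omega>) D C" if "0 \<le> t"
  unfolding future_cylinder_def poisson_proc.cylinder_def[OF shifted_process[OF that]] ..

lemma prob_future_cylinder:
  assumes "finite D" "D \<subseteq> {0..}" "0 \<le> t"
  shows "prob (future_cylinder t D C) = prob (cylinder D C)"
  unfolding future_cylinder_eq[OF assms(3)]
  by (rule poisson_cylinder_unique[OF shifted_process[OF assms(3)] _ assms(1,2)]) unfold_locales

subsection \<open>The natural filtration\<close>

definition "F = natural_filtration M N"

lemma space_F [simp]: "space (F t) = \<Omega>"
  by (simp add: F_def natural_filtration_def space_measure_of_conv)

lemma gen_F_sub: "{N s -` B \<inter> \<Omega> | s B. 0 \<le> s \<and> ennreal s \<le> t} \<union> null_sets M \<subseteq> events"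
proof -
  have "N s -` B \<inter> \<Omega> \<in> events" if "0 \<le> s" for s B
    using measurable_sets[OF N_measurable[OF that], of B] by simp
  then show ?thesis by (auto simp: null_sets_def)
qed

lemma sets_F: "sets (F t) = sigma_sets \<Omega> ({N s -` B \<inter> \<Omega> | s B. 0 \<le> s \<and> ennreal s \<le> t} \<union> null_sets M)"
  unfolding F_def natural_filtration_def
  using gen_F_sub[of t] sets.space_closed[of M] by (intro sets_measure_of) blast

lemma sets_F_subset: "sets (F t) \<subseteq> events"
  unfolding sets_F by (rule sets.sigma_sets_subset[OF gen_F_sub])

lemma sets_F_mono: "s \<le> t \<Longrightarrow> sets (F s) \<subseteq> sets (F t)"
  unfolding sets_F by (rule sigma_sets_mono') (auto intro: order_trans)

lemma null_in_F: "A \<in> null_sets M \<Longrightarrow> A \<in> sets (F t)"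
  unfolding sets_F by auto

lemma N_measurable_F: "0 \<le> s \<Longrightarrow> ennreal s \<le> t \<Longrightarrow> N s \<in> measurable (F t) (count_space UNIV)"
  by (rule measurableI) (auto simp: sets_F intro!: sigma_sets.Basic)

lemma filtration_F: "filtration \<Omega> F"
  by unfold_locales (auto dest: sets_F_mono)

text \<open>The cylinders up to time \<open>t\<close>, together with the null sets, are an intersection-stable
  generator of \<open>F t\<close>, and on them independence is known.\<close>

lemma indep_F_future_cylinder:
  assumes A: "A \<in> sets (F (ennreal t))" and D: "finite D" "D \<subseteq> {0..}" and t: "0 \<le> t"
  shows "prob (A \<inter> future_cylinder t D C) = prob A * prob (future_cylinder t D C)"
proof -
  let ?R = "future_cylinder t D C"
  have R: "?R \<in> events" using D t by (rule future_cylinder_sets)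
  define G where "G = {cylinder D B | D B. finite D \<and> D \<subseteq> {0..t}} \<union> null_sets M"
  have Gsub: "G \<subseteq> events" using cylinder_sets by (auto simp: G_def null_sets_def) (meson atLeast_iff atLeastAtMost_iff cylinder_sets subset_iff)
  have sets: "sets (F (ennreal t)) = sigma_sets \<Omega> G"
    unfolding sets_F
  proof (rule sigma_sets_eqI)
    fix A assume "A \<in> {N s -` B \<inter> \<Omega> | s B. 0 \<le> s \<and> ennreal s \<le> ennreal t} \<union> null_sets M"
    then show "A \<in> sigma_sets \<Omega> G"
    proof
      assume "A \<in> {N s -` B \<inter> \<Omega> | s B. 0 \<le> s \<and> ennreal s \<le> ennreal t}"
      then obtain s B where "A = N s -` B \<inter> \<Omega>" "0 \<le> s" "s \<le> t" using t by auto
      then have "A = cylinder {s} (\<lambda>_. B)" "finite {s}" "{s} \<subseteq> {0..t}" by (auto simp: cylinder_def)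
      then show ?thesis unfolding G_def by blast
    qed (auto simp: G_def)
  next
    fix A assume "A \<in> G"
    then show "A \<in> sigma_sets \<Omega> ({N s -` B \<inter> \<Omega> | s B. 0 \<le> s \<and> ennreal s \<le> ennreal t} \<union> null_sets M)"
      unfolding sets_F[symmetric]
    proof (unfold G_def, elim UnE CollectE exE conjE)
      fix D B assume *: "A = cylinder D B" "finite D" "D \<subseteq> {0..t}"
      have "{\<omega> \<in> space (F (ennreal t)). N s \<omega> \<in> B s} \<in> sets (F (ennreal t))" if "s \<in> D" for s
        using measurable_sets[OF N_measurable_F[of s "ennreal t"], of "B s"] that * t
        by (auto simp: vimage_def Int_def conj_commute intro!: ennreal_leI)
      then show "A \<in> sets (F (ennreal t))"
        unfolding * cylinder_def using sets.sets_Collect_finite_All[of D "F (ennreal t)"] * by simp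
    qed (rule null_in_F)
  qed
  have int: "Int_stable G"
  proof (rule Int_stableI)
    fix A A' assume AA: "A \<in> G" "A' \<in> G"
    show "A \<inter> A' \<in> G"
    proof (cases "A \<in> null_sets M \<or> A' \<in> null_sets M")
      case True
      then have "A \<inter> A' \<in> null_sets M"
        using AA Gsub null_set_Int1[of A' M A] null_set_Int2[of A M A'] by blast
      then show ?thesis by (simp add: G_def)
    next
      case False
      then obtain D B D' B' where *: "A = cylinder D B" "finite D" "D \<subseteq> {0..t}" "A' = cylinder D' B'" "finite D'" "D' \<subseteq> {0..t}"
        using AA by (auto simp: G_def)
      have "A \<inter> A' = cylinder (D \<union> D') (\<lambda>s. (if s \<in> D then B s else UNIV) \<inter> (if s \<in> D' then B' s else UNIV))"
        using * by (auto simp: cylinder_def)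
      moreover have "finite (D \<union> D')" "D \<union> D' \<subseteq> {0..t}" using * by auto
      ultimately show ?thesis unfolding G_def by blast
    qed
  qed
  have "A \<in> sigma_sets \<Omega> G" using A sets by simp
  then show ?thesis
  proof (rule sigma_sets_induct_disjoint[OF int _ _, where P = "\<lambda>A. prob (A \<inter> ?R) = prob A * prob ?R", rotated])
    show "G \<subseteq> Pow \<Omega>" using Gsub sets.space_closed by blast
    show "prob (A \<inter> ?R) = prob A * prob ?R" if "A \<in> G" for A
      using that unfolding G_def
    proof (elim UnE CollectE exE conjE)
      fix D' B assume "A = cylinder D' B" "finite D'" "D' \<subseteq> {0..t}"
      then show ?thesis using indep_past_future[of D' t D B C] D t by simp
    next
      assume "A \<in> null_sets M"
      then have "A \<inter> ?R \<in> null_sets M" using R by (rule null_set_Int2)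
      then show ?thesis using \<open>A \<in> null_sets M\<close> by (simp add: measure_eq_0_null_sets)
    qed
    show "prob ({} \<inter> ?R) = prob {} * prob ?R" by simp
    have ev: "A \<in> events" if "A \<in> sigma_sets \<Omega> G" for A
      using that sets sets_F_subset by auto
    show "prob ((\<Omega> - A) \<inter> ?R) = prob (\<Omega> - A) * prob ?R"
      if "A \<in> sigma_sets \<Omega> G" "prob (A \<inter> ?R) = prob A * prob ?R" for A
    proof -
      have "(\<Omega> - A) \<inter> ?R = ?R - A \<inter> ?R" using sets.sets_into_space[OF R] by auto
      then have "prob ((\<Omega> - A) \<inter> ?R) = prob ?R - prob (A \<inter> ?R)"
        using ev[OF that(1)] R by (simp add: finite_measure_Diff)
      then show ?thesis using that ev[OF that(1)] by (simp add: prob_compl algebra_simps)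
    qed
    fix A :: "nat \<Rightarrow> 'a set"
    assume A: "disjoint_family A" "range A \<subseteq> sigma_sets \<Omega> G" "\<And>i. prob (A i \<inter> ?R) = prob (A i) * prob ?R"
    have "(\<lambda>i. prob (A i \<inter> ?R)) sums prob (\<Union>i. A i \<inter> ?R)"
      using A ev R by (intro finite_measure_UNION) (auto simp: disjoint_family_on_def)
    moreover have "(\<lambda>i. prob (A i) * prob ?R) sums (prob (\<Union>i. A i) * prob ?R)"
      using A ev by (intro sums_mult2 finite_measure_UNION) auto
    moreover have "(\<Union>i. A i \<inter> ?R) = (\<Union>(range A)) \<inter> ?R" by auto
    ultimately show "prob (\<Union>(range A) \<inter> ?R) = prob (\<Union>(range A)) * prob ?R"
      using A(3) sums_unique2 by simp
  qed
qed

lemma indep_F_no_jump: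
  assumes "A \<in> sets (F (ennreal t))" "0 \<le> t" "0 \<le> s"
  shows "prob (A \<inter> {\<omega> \<in> \<Omega>. N (t + s) \<omega> = N t \<omega>}) = prob A * exp (- (lam * s))"
proof -
  have "future_cylinder t {s} (\<lambda>_. {0}) = {\<omega> \<in> \<Omega>. N (t + s) \<omega> = N t \<omega>}"
    using N_mono[of _ t "t + s"] assms by (auto simp: future_cylinder_def le_antisym)
  then show ?thesis
    using indep_F_future_cylinder[OF assms(1), of "{s}" "\<lambda>_. {0}"] assms prob_no_jump[of t "t + s"] by simp
qed

subsection \<open>Almost sure properties\<close>

text \<open>There are \<open>m\<close> cells of length \<open>K / m\<close>, and each contains two jumps with a probability of
  order \<open>1 / m\<^sup>2\<close>. The total vanishes as the grid is refined.\<close>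

lemma prob_double_jump_on_grid_le:
  assumes "0 < K" "0 < m"
  shows "prob (\<Union>k<m. {\<omega> \<in> \<Omega>. 2 \<le> N (real (Suc k) * K / real m) \<omega> - N (real k * K / real m) \<omega>}) \<le> (lam * K)\<^sup>2 / real m"
proof -
  have ev: "{\<omega> \<in> \<Omega>. 2 \<le> N (real (Suc k) * K / real m) \<omega> - N (real k * K / real m) \<omega>} \<in> events" for k
  proof -
    have [measurable]: "N (real (Suc k) * K / real m) \<in> measurable M (count_space UNIV)"
      "N (real k * K / real m) \<in> measurable M (count_space UNIV)"
      using assms by (auto intro!: N_measurable)
    show ?thesis by measurable
  qed
  have "prob (\<Union>k<m. {\<omega> \<in> \<Omega>. 2 \<le> N (real (Suc k) * K / real m) \<omega> - N (real k * K / real m) \<omega>})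
    \<le> (\<Sum>k<m. prob {\<omega> \<in> \<Omega>. 2 \<le> N (real (Suc k) * K / real m) \<omega> - N (real k * K / real m) \<omega>})"
    using ev by (intro finite_measure_subadditive_finite) auto
  also have "\<dots> \<le> (\<Sum>k<m. (lam * (K / real m))\<^sup>2)"
  proof (rule sum_mono)
    fix k assume "k \<in> {..<m}"
    have "real (Suc k) * K / real m - real k * K / real m = K / real m"
      using assms by (simp add: field_simps)
    then show "prob {\<omega> \<in> \<Omega>. 2 \<le> N (real (Suc k) * K / real m) \<omega> - N (real k * K / real m) \<omega>} \<le> (lam * (K / real m))\<^sup>2"
      using prob_two_jumps_le[of "real k * K / real m" "real (Suc k) * K / real m"] assms
      by (simp add: divide_strict_right_mono)
  qed
  also have "\<dots> = (lam * K)\<^sup>2 / real m"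
    using assms by (simp add: power2_eq_square)
  finally show ?thesis .
qed

text \<open>A jump of size at least two would show up as a large increment on every grid.\<close>

lemma AE_unit_jumps: "AE \<omega> in M. \<forall>t>0. N t \<omega> \<le> Suc (counting_path.before (\<lambda>t. N t \<omega>) t)"
proof -
  define E where "E K m = (\<Union>k<m. {\<omega> \<in> \<Omega>. 2 \<le> N (real (Suc k) * K / real m) \<omega> - N (real k * K / real m) \<omega>})" for K m
  have ev: "E K m \<in> events" if "0 < K" "0 < m" for K m
    unfolding E_def
  proof (intro sets.finite_UN ballI)
    fix k
    have [measurable]: "N (real (Suc k) * K / real m) \<in> measurable M (count_space UNIV)"
      "N (real k * K / real m) \<in> measurable M (count_space UNIV)"
      using that by (auto intro!: N_measurable)
    show "{\<omega> \<in> \<Omega>. 2 \<le> N (real (Suc k) * K / real m) \<omega> - N (real k * K / real m) \<omega>} \<in> events" by measurable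
  qed simp
  have null: "(\<Inter>m. E K (Suc m)) \<in> null_sets M" if K: "0 < K" for K
  proof -
    have "prob (\<Inter>m. E K (Suc m)) \<le> (lam * K)\<^sup>2 / real (Suc m)" for m
    proof -
      have "prob (\<Inter>m. E K (Suc m)) \<le> prob (E K (Suc m))"
        using ev[OF K] by (intro finite_measure_mono) auto
      also have "\<dots> \<le> (lam * K)\<^sup>2 / real (Suc m)"
        unfolding E_def by (rule prob_double_jump_on_grid_le[OF K zero_less_Suc])
      finally show ?thesis .
    qed
    moreover have "(\<lambda>m. (lam * K)\<^sup>2 / real (Suc m)) \<longlonglongrightarrow> 0"
      using LIMSEQ_Suc[OF lim_const_over_n] by blast
    ultimately have "prob (\<Inter>m. E K (Suc m)) \<le> 0"
      by (intro LIMSEQ_le_const[of _ 0]) auto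
    then have "prob (\<Inter>m. E K (Suc m)) = 0" using measure_nonneg[of M] by (metis order_antisym)
    then show ?thesis using ev[OF K] by (auto simp: null_sets_def emeasure_eq_measure)
  qed
  have "AE \<omega> in M. \<forall>K::nat. \<omega> \<notin> (\<Inter>m. E (real (Suc K)) (Suc m))"
    unfolding AE_all_countable by (intro allI AE_not_in null) simp
  then show ?thesis
  proof (rule AE_mp[OF _ AE_I2], intro impI allI)
    fix \<omega> and t :: real assume \<omega>: "\<omega> \<in> \<Omega>" and nE: "\<forall>K::nat. \<omega> \<notin> (\<Inter>m. E (real (Suc K)) (Suc m))" and t: "0 < t"
    interpret c: counting_path "\<lambda>t. N t \<omega>" using counting[OF \<omega>] .
    obtain K :: nat where K: "t \<le> real K" using real_arch_simple by blast
    obtain m where m: "\<omega> \<notin> E (real (Suc K)) (Suc m)" using nE by blast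
    let ?K = "real (Suc K)" and ?m = "real (Suc m)"
    \<comment> \<open>the grid cell that contains \<open>t\<close> is \<open>(k K / m, (k + 1) K / m]\<close>\<close>
    define k where "k = nat (\<lceil>t * ?m / ?K\<rceil> - 1)"
    have pos: "0 < t * ?m / ?K" using t by simp
    have c1: "1 \<le> \<lceil>t * ?m / ?K\<rceil>" using pos by linarith
    have k: "real k < t * ?m / ?K" "t * ?m / ?K \<le> real (Suc k)"
      using c1 unfolding k_def by linarith+
    have "real k < ?m"
    proof -
      have "t * ?m / ?K \<le> ?m" using K mult_right_mono[OF K, of "real m"] by (simp add: field_simps)
      then show ?thesis using k by linarith
    qed
    then have "k < Suc m" by simp
    then have "\<not> 2 \<le> N (real (Suc k) * ?K / ?m) \<omega> - N (real k * ?K / ?m) \<omega>"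
      using m \<omega> unfolding E_def by blast
    moreover have "t \<le> real (Suc k) * ?K / ?m" "real k * ?K / ?m < t"
      using k by (simp_all add: field_simps)
    then have "N t \<omega> \<le> N (real (Suc k) * ?K / ?m) \<omega>" "N (real k * ?K / ?m) \<omega> \<le> c.before t"
      using t by (auto intro!: c.n_mono c.n_le_before)
    ultimately show "N t \<omega> \<le> Suc (c.before t)" by linarith
  qed
qed

lemma AE_no_jump_at:
  assumes t: "0 < t"
  shows "AE \<omega> in M. counting_path.before (\<lambda>t. N t \<omega>) t = N t \<omega>"
proof -
  define E where "E m = {\<omega> \<in> \<Omega>. N t \<omega> \<noteq> N (t - t / real (Suc m)) \<omega>}" for m
  have nn: "0 \<le> t - t / real (Suc m)" for m using t by (simp add: field_simps)
  have ev: "E m \<in> events" for m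
  proof -
    have "E m = \<Omega> - {\<omega> \<in> \<Omega>. N t \<omega> = N (t - t / real (Suc m)) \<omega>}" by (auto simp: E_def)
    then show ?thesis using events_N_eq[OF nn, of t] t by simp
  qed
  have "prob (\<Inter>m. E m) \<le> lam * t / real (Suc m)" for m
  proof -
    have "prob (\<Inter>m. E m) \<le> prob (E m)" using ev by (intro finite_measure_mono) auto
    also have "\<dots> \<le> lam * (t - (t - t / real (Suc m)))"
      unfolding E_def using nn t by (intro prob_jump_le) auto
    finally show ?thesis by simp
  qed
  moreover have "(\<lambda>m. lam * t / real (Suc m)) \<longlonglongrightarrow> 0"
    using LIMSEQ_Suc[OF lim_const_over_n] by blast
  ultimately have "prob (\<Inter>m. E m) \<le> 0"
    by (intro LIMSEQ_le_const[of _ 0]) auto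
  then have "prob (\<Inter>m. E m) = 0" using measure_nonneg[of M] by (metis order_antisym)
  then have "(\<Inter>m. E m) \<in> null_sets M" using ev by (auto simp: null_sets_def emeasure_eq_measure)
  then have "AE \<omega> in M. \<omega> \<notin> (\<Inter>m. E m)" by (rule AE_not_in)
  then show ?thesis
  proof (rule AE_mp[OF _ AE_I2], intro impI)
    fix \<omega> assume \<omega>: "\<omega> \<in> \<Omega>" and "\<omega> \<notin> (\<Inter>m. E m)"
    then obtain m where m: "N t \<omega> = N (t - t / real (Suc m)) \<omega>" by (auto simp: E_def)
    interpret c: counting_path "\<lambda>t. N t \<omega>" using counting[OF \<omega>] .
    have "N t \<omega> \<le> c.before t"
      unfolding m using nn t by (intro c.n_le_before) auto
    then show "c.before t = N t \<omega>" using c.before_le[of t] t by simp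
  qed
qed

lemma nn_integral_exp_N:
  assumes "0 < t"
  shows "(\<integral>\<^sup>+\<omega>. ennreal (exp (\<theta> * real (N t \<omega>))) \<partial>M) = ennreal (exp (lam * t * (exp \<theta> - 1)))"
proof -
  let ?r = "lam * t"
  have r: "?r > 0" using assms lam_pos by simp
  have "distr M (count_space UNIV) (N t) = distr M (count_space UNIV) (\<lambda>\<omega>. N t \<omega> - N 0 \<omega>)"
    by (intro distr_cong) (auto simp: N_0)
  then have d: "distr M (count_space UNIV) (N t) = measure_pmf (poisson_pmf ?r)"
    using distr_increment[of 0 t] assms by simp
  have "(\<integral>\<^sup>+\<omega>. ennreal (exp (\<theta> * real (N t \<omega>))) \<partial>M) = (\<integral>\<^sup>+k. ennreal (exp (\<theta> * real k)) \<partial>measure_pmf (poisson_pmf ?r))"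
    unfolding d[symmetric] using assms by (subst nn_integral_distr[of "N t" M "count_space UNIV"]) auto
  also have "\<dots> = (\<Sum>k. ennreal (pmf (poisson_pmf ?r) k) * ennreal (exp (\<theta> * real k)))"
    by (simp add: nn_integral_measure_pmf nn_integral_count_space_nat)
  also have "\<dots> = (\<Sum>k. ennreal (exp (- ?r) * ((?r * exp \<theta>) ^ k /\<^sub>R fact k)))"
  proof (intro suminf_cong)
    fix k
    have "exp (\<theta> * real k) = exp \<theta> ^ k" by (metis exp_of_nat_mult mult.commute)
    then have "pmf (poisson_pmf ?r) k * exp (\<theta> * real k) = exp (- ?r) * ((?r * exp \<theta>) ^ k /\<^sub>R fact k)"
      using r by (simp only: pmf_poisson power_mult_distrib divide_inverse real_scaleR_def ac_simps)
    then show "ennreal (pmf (poisson_pmf ?r) k) * ennreal (exp (\<theta> * real k))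
        = ennreal (exp (- ?r) * ((?r * exp \<theta>) ^ k /\<^sub>R fact k))"
      by (simp only: ennreal_mult[symmetric] pmf_nonneg exp_ge_zero)
  qed
  also have "\<dots> = ennreal (\<Sum>k. exp (- ?r) * ((?r * exp \<theta>) ^ k /\<^sub>R fact k))"
    using r by (intro suminf_ennreal2 summable_mult summable_exp_generic) auto
  also have "(\<Sum>k. exp (- ?r) * ((?r * exp \<theta>) ^ k /\<^sub>R fact k)) = exp (- ?r) * exp (?r * exp \<theta>)"
    by (rule sums_unique[symmetric], rule sums_mult, rule exp_converges)
  also have "\<dots> = exp (?r * (exp \<theta> - 1))" by (simp add: exp_add[symmetric] algebra_simps)
  finally show ?thesis .
qed

text \<open>The exponential Chebyshev inequality makes \<open>P(\<mu> k - N k \<le> c)\<close> summable over the integers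
  \<open>k\<close>, so that Borel-Cantelli applies. Since \<open>N\<close> is increasing, \<open>\<mu> t - N t\<close> is at least its
  value at the next integer minus \<open>\<mu>\<close>.\<close>

lemma AE_surplus_at_top:
  assumes \<theta>: "\<theta> > 0" "lam * (exp \<theta> - 1) < \<theta> * \<mu>"
  shows "AE \<omega> in M. filterlim (\<lambda>t. \<mu> * t - real (N t \<omega>)) at_top at_top"
proof -
  have \<mu>: "\<mu> > 0"
  proof -
    have "0 < lam * (exp \<theta> - 1)" using \<theta> lam_pos by simp
    then have "0 < \<theta> * \<mu>" using \<theta> by linarith
    then show ?thesis using \<theta> by (simp add: zero_less_mult_iff)
  qed
  define \<rho> where "\<rho> = exp (lam * (exp \<theta> - 1) - \<theta> * \<mu>)"
  have \<rho>: "0 < \<rho>" "\<rho> < 1" using \<theta> by (auto simp: \<rho>_def)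
  define E where "E c k = {\<omega> \<in> \<Omega>. \<mu> * real k - real (N (real k) \<omega>) \<le> c}" for c :: real and k :: nat
  have ev: "E c k \<in> events" for c k
  proof -
    have [measurable]: "N (real k) \<in> measurable M (count_space UNIV)" by (auto intro!: N_measurable)
    show ?thesis unfolding E_def by measurable
  qed
  have bound: "prob (E c k) \<le> exp (\<theta> * c) * \<rho> ^ k" if "0 < k" for c k
  proof -
    have [measurable]: "N (real k) \<in> measurable M (count_space UNIV)" by (auto intro!: N_measurable)
    have "emeasure M (E c k) = (\<integral>\<^sup>+\<omega>. indicator (E c k) \<omega> \<partial>M)" using ev by simp
    also have "\<dots> \<le> (\<integral>\<^sup>+\<omega>. ennreal (exp (\<theta> * (c - \<mu> * real k))) * ennreal (exp (\<theta> * real (N (real k) \<omega>))) \<partial>M)"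
    proof (rule nn_integral_mono)
      fix \<omega> assume "\<omega> \<in> \<Omega>"
      show "indicator (E c k) \<omega> \<le> ennreal (exp (\<theta> * (c - \<mu> * real k))) * ennreal (exp (\<theta> * real (N (real k) \<omega>)))"
      proof (cases "\<omega> \<in> E c k")
        case True
        then have "0 \<le> \<theta> * (c - \<mu> * real k + real (N (real k) \<omega>))"
          using \<theta> by (intro mult_nonneg_nonneg) (auto simp: E_def)
        then have "1 \<le> exp (\<theta> * (c - \<mu> * real k)) * exp (\<theta> * real (N (real k) \<omega>))"
          by (simp add: exp_add[symmetric] distrib_left)
        then show ?thesis using True by (simp add: ennreal_mult[symmetric])
      qed simp
    qed
    also have "\<dots> = ennreal (exp (\<theta> * (c - \<mu> * real k))) * ennreal (exp (lam * real k * (exp \<theta> - 1)))"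
      using that by (subst nn_integral_cmult) (auto simp: nn_integral_exp_N)
    also have "\<dots> = ennreal (exp (\<theta> * c) * \<rho> ^ k)"
      by (simp add: ennreal_mult[symmetric] \<rho>_def exp_of_nat_mult[symmetric] exp_add[symmetric] algebra_simps)
    finally show ?thesis
      using \<rho> by (simp add: emeasure_eq_measure)
  qed
  have "AE \<omega> in M. eventually (\<lambda>k. \<omega> \<in> \<Omega> - E c k) sequentially" for c
  proof (rule borel_cantelli_AE1[OF ev])
    show "emeasure M (E c k) < \<infinity>" for k by (simp add: emeasure_eq_measure)
    show "summable (\<lambda>k. prob (E c k))"
    proof (rule summable_comparison_test_ev)
      show "eventually (\<lambda>k. norm (prob (E c k)) \<le> exp (\<theta> * c) * \<rho> ^ k) sequentially"
        using eventually_gt_at_top[of 0] by eventually_elim (use bound in simp)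
      show "summable (\<lambda>k. exp (\<theta> * c) * \<rho> ^ k)"
        using \<rho> by (intro summable_mult summable_geometric) auto
    qed
  qed
  then have "AE \<omega> in M. \<forall>c::nat. eventually (\<lambda>k. \<omega> \<in> \<Omega> - E (real c) k) sequentially"
    by (subst AE_all_countable) blast
  then show ?thesis
  proof (rule AE_mp[OF _ AE_I2], intro impI)
    fix \<omega> assume \<omega>: "\<omega> \<in> \<Omega>" and c: "\<forall>c::nat. eventually (\<lambda>k. \<omega> \<in> \<Omega> - E (real c) k) sequentially"
    show "filterlim (\<lambda>t. \<mu> * t - real (N t \<omega>)) at_top at_top"
      unfolding filterlim_at_top
    proof
      fix Z :: real
      obtain c :: nat where Z: "Z + \<mu> \<le> real c" using real_arch_simple by blast
      obtain k0 where k0: "\<And>k. k \<ge> k0 \<Longrightarrow> \<omega> \<in> \<Omega> - E (real c) k"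
        using c by (auto simp: eventually_sequentially)
      have "Z \<le> \<mu> * t - real (N t \<omega>)" if t: "real k0 \<le> t" for t
      proof -
        define k where "k = nat \<lceil>t\<rceil>"
        have k: "t \<le> real k" "real k \<le> t + 1" using t unfolding k_def by linarith+
        then have "k0 \<le> k" using t by linarith
        then have "real c < \<mu> * real k - real (N (real k) \<omega>)" using k0[of k] \<omega> by (auto simp: E_def)
        moreover have "N t \<omega> \<le> N (real k) \<omega>" using k t \<omega> by (intro N_mono) auto
        moreover have "\<mu> * real k \<le> \<mu> * t + \<mu>" using k \<mu> mult_left_mono[of "real k" "t + 1" \<mu>] by (simp add: distrib_left)
        ultimately show ?thesis using Z by linarith
      qed
      then show "eventually (\<lambda>t. Z \<le> \<mu> * t - real (N t \<omega>)) at_top"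
        by (auto simp: eventually_at_top_linorder)
    qed
  qed
qed

end

section \<open>The ruin probability\<close>

locale poisson_market = poisson_proc M N lam for M :: "'a measure" and N lam +
  fixes \<psi> :: real
  assumes psi_pos: "\<psi> > 0"
begin

definition "\<alpha> = ln (1 + \<psi>)"
definition "\<mu> = lam * \<psi> / \<alpha>"

abbreviation "Y \<equiv> surplus lam \<psi> N"
abbreviation "\<Psi> \<equiv> ruin_probability M Y"

lemma alpha_pos: "\<alpha> > 0" using psi_pos by (simp add: \<alpha>_def)

lemma alpha_less: "\<alpha> < \<psi>"
proof -
  have "ln (1 + \<psi>) \<noteq> \<psi>"
    using ln_add_one_self_less_self[OF psi_pos] by simp
  moreover have "ln (1 + \<psi>) \<le> \<psi>" using psi_pos by (simp add: ln_add_one_self_le_self)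
  ultimately show ?thesis by (simp add: \<alpha>_def)
qed

lemma mu_pos: "\<mu> > 0" using psi_pos alpha_pos lam_pos by (simp add: \<mu>_def)

lemma Y_eq: "Y t \<omega> = \<mu> * t - real (N t \<omega>)"
  by (simp add: surplus_def \<mu>_def \<alpha>_def)

lemma path: "\<omega> \<in> \<Omega> \<Longrightarrow> drift_path (\<lambda>t. N t \<omega>) \<mu>"
  using counting mu_pos by (auto simp: drift_path_def drift_path_axioms_def)

text \<open>For the exponent \<open>\<alpha>\<close> the two sides of the condition of the preceding estimate agree, as \<open>S\<close>
  is a martingale. By strict convexity the condition holds for \<open>\<alpha> / 2\<close>.\<close>

lemma AE_Y_at_top: "AE \<omega> in M. filterlim (\<lambda>t. Y t \<omega>) at_top at_top"
  unfolding Y_eq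
proof (rule AE_surplus_at_top)
  show "0 < \<alpha> / 2" using alpha_pos by simp
  define e where "e = exp (\<alpha> / 2)"
  have "e > 1" using alpha_pos by (simp add: e_def)
  have "e * e = 1 + \<psi>" using psi_pos by (simp add: e_def exp_add[symmetric] \<alpha>_def)
  moreover have "0 < (e - 1) * (e - 1)" using \<open>e > 1\<close> by simp
  ultimately have "e - 1 < \<psi> / 2" by (simp add: algebra_simps)
  then show "lam * (exp (\<alpha> / 2) - 1) < \<alpha> / 2 * \<mu>"
    using lam_pos alpha_pos by (simp add: \<mu>_def e_def)
qed

text \<open>Ruin of the surplus process that is restarted at time \<open>t\<close> from the capital \<open>x\<close>.\<close>

definition ruin where "ruin t x = {\<omega> \<in> \<Omega>. \<exists>s\<ge>t. x + (Y s \<omega> - Y t \<omega>) < 0}"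

lemma Psi_eq: "\<Psi> x = prob (ruin 0 x)"
proof -
  have "ruin_time Y x \<omega> < \<infinity> \<longleftrightarrow> (\<exists>t\<ge>0. x + Y t \<omega> < 0)" for \<omega>
  proof -
    have "ruin_time Y x \<omega> < \<infinity> \<longleftrightarrow> (\<exists>i\<in>ennreal ` {t. 0 \<le> t \<and> x + Y t \<omega> < 0}. i < \<infinity>)"
      unfolding ruin_time_def by (rule Inf_less_iff)
    then show ?thesis by (auto simp: ennreal_less_top)
  qed
  moreover have "Y 0 \<omega> = 0" if "\<omega> \<in> \<Omega>" for \<omega> using that by (simp add: Y_eq N_0)
  ultimately show ?thesis
    unfolding ruin_probability_def ruin_def by (intro arg_cong[where f = prob]) auto
qed

text \<open>An enumeration of the nonnegative rational times. As paths are right-continuous, they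
  suffice to observe ruin.\<close>

definition q :: "nat \<Rightarrow> real" where "q = from_nat_into (\<rat> \<inter> {0..})"

lemma q_range: "range q = \<rat> \<inter> {0..}"
proof -
  have "(0::real) \<in> \<rat> \<inter> {0..}" by simp
  then show ?thesis unfolding q_def by (intro range_from_nat_into countable_Int1 countable_rat) auto
qed

lemma q_nonneg: "0 \<le> q i" using q_range by (metis IntD2 atLeast_iff rangeI)

lemma q_dense: "0 \<le> s \<Longrightarrow> s < t \<Longrightarrow> \<exists>i. s < q i \<and> q i < t"
proof -
  assume "0 \<le> s" "s < t"
  then obtain r where r: "r \<in> \<rat>" "s < r" "r < t" using Rats_dense_in_real by blast
  then have "r \<in> range q" using \<open>0 \<le> s\<close> unfolding q_range by simp
  then show ?thesis using r by auto
qed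

text \<open>The numbers of jumps within time \<open>s\<close> that keep the capital nonnegative when it starts from
  \<open>x\<close>.\<close>

definition "safe x s = {k::nat. 0 \<le> x + \<mu> * s - real k}"

text \<open>If the surplus is negative at some time then, by right-continuity, it is so at a rational
  time shortly afterwards. Hence survival is a decreasing limit of finite-dimensional events.\<close>

lemma ruin_eq:
  assumes t: "0 \<le> t"
  shows "ruin t x = \<Omega> - (\<Inter>m. future_cylinder t (q ` {..<m}) (safe x))"
proof -
  have "(\<exists>s\<ge>t. x + (Y s \<omega> - Y t \<omega>) < 0) \<longleftrightarrow> (\<exists>i. N (t + q i) \<omega> - N t \<omega> \<notin> safe x (q i))" if \<omega>: "\<omega> \<in> \<Omega>" for \<omega>
  proof -
    interpret c: counting_path "\<lambda>t. N t \<omega>" by (rule counting[OF \<omega>])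
    have eq: "N (t + r) \<omega> - N t \<omega> \<notin> safe x r \<longleftrightarrow> x + (Y (t + r) \<omega> - Y t \<omega>) < 0" if "0 \<le> r" for r
      using c.n_mono[of t "t + r"] that t by (auto simp: safe_def Y_eq algebra_simps of_nat_diff)
    show ?thesis
    proof
      assume "\<exists>s\<ge>t. x + (Y s \<omega> - Y t \<omega>) < 0"
      then obtain s where s: "t \<le> s" "x + (Y s \<omega> - Y t \<omega>) < 0" by blast
      obtain e where e: "e > 0" "\<And>r. s \<le> r \<Longrightarrow> r < s + e \<Longrightarrow> N r \<omega> = N s \<omega>"
        using c.right_constant[of s] s(1) t by (metis order_trans)
      let ?d = "- (x + (Y s \<omega> - Y t \<omega>)) / \<mu>"
      have d: "?d > 0" using s mu_pos by (simp add: field_simps)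
      obtain i where i: "s - t < q i" "q i < s - t + min e ?d"
        using q_dense[of "s - t" "s - t + min e ?d"] s e(1) d by auto
      have "\<mu> * (t + q i - s) < - (x + (Y s \<omega> - Y t \<omega>))"
      proof -
        have "t + q i - s < ?d" using i(2) by simp
        then have "\<mu> * (t + q i - s) < \<mu> * ?d" using mu_pos by (rule mult_strict_left_mono)
        then show ?thesis using mu_pos by simp
      qed
      moreover have "N (t + q i) \<omega> = N s \<omega>" using i e(2)[of "t + q i"] by auto
      ultimately have "x + (Y (t + q i) \<omega> - Y t \<omega>) < 0" by (simp add: Y_eq algebra_simps)
      then show "\<exists>i. N (t + q i) \<omega> - N t \<omega> \<notin> safe x (q i)" using eq[of "q i"] q_nonneg by auto
    next
      assume "\<exists>i. N (t + q i) \<omega> - N t \<omega> \<notin> safe x (q i)"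
      then obtain i where "x + (Y (t + q i) \<omega> - Y t \<omega>) < 0" using eq q_nonneg by auto
      then show "\<exists>s\<ge>t. x + (Y s \<omega> - Y t \<omega>) < 0" using q_nonneg[of i] by (intro exI[of _ "t + q i"]) simp
    qed
  qed
  then show ?thesis by (auto simp: ruin_def future_cylinder_def)
qed

lemma future_q_sets: "0 \<le> t \<Longrightarrow> future_cylinder t (q ` {..<m}) C \<in> events"
  by (rule future_cylinder_sets) (auto simp: q_nonneg)

lemma ruin_sets: "0 \<le> t \<Longrightarrow> ruin t x \<in> events"
  unfolding ruin_eq by (intro sets.Diff sets.countable_INT' sets.top) (auto simp: future_q_sets)

lemma ruin_prob_limit:
  assumes "A \<in> events" "0 \<le> t"
  shows "(\<lambda>m. prob (A \<inter> future_cylinder t (q ` {..<m}) (safe x))) \<longlonglongrightarrow> prob A - prob (A \<inter> ruin t x)"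
proof -
  have "(\<lambda>m. prob (A \<inter> future_cylinder t (q ` {..<m}) (safe x))) \<longlonglongrightarrow> prob (\<Inter>m. A \<inter> future_cylinder t (q ` {..<m}) (safe x))"
  proof (rule finite_Lim_measure_decseq)
    show "range (\<lambda>m. A \<inter> future_cylinder t (q ` {..<m}) (safe x)) \<subseteq> events"
      using assms future_q_sets by auto
    show "decseq (\<lambda>m. A \<inter> future_cylinder t (q ` {..<m}) (safe x))"
      unfolding decseq_def future_cylinder_def by fastforce
  qed
  also have "(\<Inter>m. A \<inter> future_cylinder t (q ` {..<m}) (safe x)) = A - A \<inter> ruin t x"
    using sets.sets_into_space[OF assms(1)] by (auto simp: ruin_eq[OF assms(2)])
  also have "prob (A - A \<inter> ruin t x) = prob A - prob (A \<inter> ruin t x)"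
    using assms by (intro finite_measure_Diff) (auto simp: ruin_sets)
  finally show ?thesis .
qed

text \<open>For the finite-dimensional events that approximate survival this is independence and
  stationarity of the increments, and it passes to the limit.\<close>

lemma Markov:
  assumes A: "A \<in> sets (F (ennreal t))" and t: "0 \<le> t"
  shows "prob (A \<inter> ruin t x) = prob A * \<Psi> x"
proof -
  have qs: "finite (q ` {..<m})" "q ` {..<m} \<subseteq> {0..}" for m using q_nonneg by auto
  have ev: "A \<in> events" using A sets_F_subset by auto
  have "(\<lambda>m. prob (A \<inter> future_cylinder t (q ` {..<m}) (safe x))) \<longlonglongrightarrow> prob A - prob (A \<inter> ruin t x)"
    by (rule ruin_prob_limit[OF ev t])
  moreover have "(\<lambda>m. prob (\<Omega> \<inter> future_cylinder 0 (q ` {..<m}) (safe x))) \<longlonglongrightarrow> prob \<Omega> - prob (\<Omega> \<inter> ruin 0 x)"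
    by (rule ruin_prob_limit) auto
  then have "(\<lambda>m. prob A * prob (\<Omega> \<inter> future_cylinder 0 (q ` {..<m}) (safe x))) \<longlonglongrightarrow> prob A * (prob \<Omega> - prob (\<Omega> \<inter> ruin 0 x))"
    by (intro tendsto_mult tendsto_const)
  moreover have "prob A * prob (\<Omega> \<inter> future_cylinder 0 (q ` {..<m}) (safe x)) = prob (A \<inter> future_cylinder t (q ` {..<m}) (safe x))" for m
  proof -
    have "\<Omega> \<inter> future_cylinder 0 (q ` {..<m}) (safe x) = future_cylinder 0 (q ` {..<m}) (safe x)"
      by (auto simp: future_cylinder_def)
    then show ?thesis
      using indep_F_future_cylinder[OF A qs t, of m "safe x"] prob_future_cylinder[OF qs t, of m "safe x"]
        prob_future_cylinder[OF qs, of 0 m "safe x"] by simp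
  qed
  moreover have "\<Omega> \<inter> ruin 0 x = ruin 0 x" by (auto simp: ruin_def)
  ultimately have "prob A - prob (A \<inter> ruin t x) = prob A * (1 - \<Psi> x)"
    unfolding Psi_eq using LIMSEQ_unique by (simp add: prob_space)
  then show ?thesis by (simp add: algebra_simps)
qed

lemma Psi_bounds: "0 \<le> \<Psi> x" "\<Psi> x \<le> 1"
  by (simp_all add: Psi_eq)

lemma ruin_antimono: "x \<le> x' \<Longrightarrow> ruin t x' \<subseteq> ruin t x"
  by (force simp: ruin_def)

lemma Psi_antimono: "x \<le> x' \<Longrightarrow> \<Psi> x' \<le> \<Psi> x"
  unfolding Psi_eq by (intro finite_measure_mono ruin_antimono ruin_sets) auto

lemma Psi_neg: "x < 0 \<Longrightarrow> \<Psi> x = 1"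
proof -
  assume "x < 0"
  then have "ruin 0 x = \<Omega>" by (auto simp: ruin_def intro!: exI[of _ 0])
  then show ?thesis by (simp add: Psi_eq prob_space)
qed

lemma Psi_measurable [measurable]: "\<Psi> \<in> borel_measurable borel"
proof -
  have "(\<lambda>x. - \<Psi> x) \<in> borel_measurable borel"
    by (intro borel_measurable_mono monoI) (simp add: Psi_antimono)
  then show ?thesis by (simp add: borel_measurable_uminus_eq)
qed

text \<open>Ruin means that a strict inequality holds at some time, and hence the ruin events for
  capitals that decrease to \<open>x\<close> exhaust the one for \<open>x\<close>.\<close>

lemma Psi_right_continuous: "continuous (at_right x) \<Psi>"
  unfolding continuous_within
proof (rule tendsto_at_right_sequentially[of x "x + 1"])
  fix S assume S: "\<And>n. x < S n" "decseq S" "S \<longlonglongrightarrow> x"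
  have "(\<lambda>n. prob (ruin 0 (S n))) \<longlonglongrightarrow> prob (\<Union>n. ruin 0 (S n))"
    using S(2) ruin_antimono by (intro finite_Lim_measure_incseq) (auto simp: incseq_def decseq_def ruin_sets)
  also have "(\<Union>n. ruin 0 (S n)) = ruin 0 x"
  proof
    show "(\<Union>n. ruin 0 (S n)) \<subseteq> ruin 0 x" using ruin_antimono S(1) by (auto dest!: less_imp_le)
    show "ruin 0 x \<subseteq> (\<Union>n. ruin 0 (S n))"
    proof
      fix \<omega> assume "\<omega> \<in> ruin 0 x"
      then obtain s where s: "\<omega> \<in> \<Omega>" "0 \<le> s" "x + (Y s \<omega> - Y 0 \<omega>) < 0" by (auto simp: ruin_def)
      then have "x < - (Y s \<omega> - Y 0 \<omega>)" by linarith
      then have "eventually (\<lambda>n. S n < - (Y s \<omega> - Y 0 \<omega>)) sequentially"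
        by (rule order_tendstoD[OF S(3)])
      then obtain n where "S n < - (Y s \<omega> - Y 0 \<omega>)" by (auto simp: eventually_sequentially)
      then have "S n + (Y s \<omega> - Y 0 \<omega>) < 0" by linarith
      then have "\<omega> \<in> ruin 0 (S n)" unfolding ruin_def using s by blast
      then show "\<omega> \<in> (\<Union>n. ruin 0 (S n))" by blast
    qed
  qed
  finally show "(\<lambda>n. \<Psi> (S n)) \<longlonglongrightarrow> \<Psi> x" by (simp add: Psi_eq)
qed simp

text \<open>Almost every path tends to infinity. It is then bounded below and survives from some initial
  capital.\<close>

lemma Psi_tendsto_0: "(\<Psi> \<longlongrightarrow> 0) at_top"
proof -
  have "(\<lambda>n. prob (ruin 0 (real n))) \<longlonglongrightarrow> prob (\<Inter>n. ruin 0 (real n))"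
    by (intro finite_Lim_measure_decseq decseq_SucI ruin_antimono) (auto simp: ruin_sets)
  moreover have "prob (\<Inter>n. ruin 0 (real n)) = 0"
  proof (rule measure_eq_0_null_sets, rule AE_iff_null_sets[THEN iffD2])
    show "(\<Inter>n. ruin 0 (real n)) \<in> events" by (auto simp: ruin_sets)
    show "AE \<omega> in M. \<omega> \<notin> (\<Inter>n. ruin 0 (real n))"
      using AE_Y_at_top
    proof (rule AE_mp[OF _ AE_I2], intro impI)
      fix \<omega> assume \<omega>: "\<omega> \<in> \<Omega>" and "filterlim (\<lambda>t. Y t \<omega>) at_top at_top"
      then obtain T where T: "\<And>t. T \<le> t \<Longrightarrow> 0 \<le> Y t \<omega>"
        by (auto simp: filterlim_at_top eventually_at_top_linorder)
      have nn: "0 \<le> real (N (max 0 T) \<omega>) + Y t \<omega>" if "0 \<le> t" for t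
      proof (cases "T \<le> t")
        case False
        then have "N t \<omega> \<le> N (max 0 T) \<omega>" using that by (intro N_mono[OF \<omega>]) auto
        moreover have "0 \<le> \<mu> * t" using that mu_pos by simp
        ultimately show ?thesis by (simp add: Y_eq)
      qed (use T[of t] in simp)
      have "Y 0 \<omega> = 0" using \<omega> by (simp add: Y_eq N_0)
      then have "\<omega> \<notin> ruin 0 (real (N (max 0 T) \<omega>))" using nn by (simp add: ruin_def not_less)
      then show "\<omega> \<notin> (\<Inter>n. ruin 0 (real n))" by blast
    qed
  qed
  ultimately have lim: "(\<lambda>n. \<Psi> (real n)) \<longlonglongrightarrow> 0" by (simp add: Psi_eq)
  show ?thesis
  proof (rule tendstoI)
    fix e :: real assume "e > 0"
    then have "eventually (\<lambda>n. \<Psi> (real n) < e) sequentially" by (rule order_tendstoD(2)[OF lim])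
    then obtain n where n: "\<Psi> (real n) < e" by (auto simp: eventually_sequentially)
    show "eventually (\<lambda>x. dist (\<Psi> x) 0 < e) at_top"
      using eventually_ge_at_top[of "real n"]
    proof eventually_elim
      case (elim x)
      then show ?case using Psi_antimono[of "real n" x] n Psi_bounds(1)[of x] by (simp add: dist_real_def)
    qed
  qed
qed

subsection \<open>The renewal equation\<close>

lemma count_event_F: "0 \<le> t \<Longrightarrow> {\<omega> \<in> \<Omega>. N t \<omega> = k} \<in> sets (F (ennreal t))"
  using measurable_sets[OF N_measurable_F[of t "ennreal t"], of "{k}"] by (simp add: vimage_def Int_def conj_commute)

lemma prob_N_eq: "0 < t \<Longrightarrow> prob {\<omega> \<in> \<Omega>. N t \<omega> = k} = (lam * t) ^ k / fact k * exp (- (lam * t))"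
proof -
  assume t: "0 < t"
  have "{\<omega> \<in> \<Omega>. N t \<omega> = k} = {\<omega> \<in> \<Omega>. N t \<omega> - N 0 \<omega> = k}" using N_0 by auto
  then show ?thesis using prob_increment[of 0 t k] t by simp
qed

lemma ruin_no_jump:
  assumes "0 \<le> x" "0 < d"
  shows "prob (ruin 0 x \<inter> {\<omega> \<in> \<Omega>. N d \<omega> = 0}) = exp (- (lam * d)) * \<Psi> (x + \<mu> * d)"
proof -
  have "ruin 0 x \<inter> {\<omega> \<in> \<Omega>. N d \<omega> = 0} = {\<omega> \<in> \<Omega>. N d \<omega> = 0} \<inter> ruin d (x + \<mu> * d)"
  proof -
    have "(\<exists>s\<ge>0. x + (Y s \<omega> - Y 0 \<omega>) < 0) \<longleftrightarrow> (\<exists>s\<ge>d. x + \<mu> * d + (Y s \<omega> - Y d \<omega>) < 0)"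
      if \<omega>: "\<omega> \<in> \<Omega>" "N d \<omega> = 0" for \<omega>
    proof -
      have "\<not> (x + Y s \<omega> < 0)" if "0 \<le> s" "s < d" for s
      proof -
        have "N s \<omega> = 0" using N_mono[OF \<omega>(1), of s d] that \<omega> by simp
        then show ?thesis using that mu_pos assms by (simp add: Y_eq not_less)
      qed
      moreover have "Y 0 \<omega> = 0" "Y d \<omega> = \<mu> * d" using \<omega> by (simp_all add: Y_eq N_0)
      ultimately show ?thesis using assms by simp (smt (verit))
    qed
    then show ?thesis by (auto simp: ruin_def)
  qed
  then show ?thesis
    using Markov[OF count_event_F[of d 0], of "x + \<mu> * d"] prob_N_eq[of d 0] assms by simp
qed

text \<open>After a single jump the position at time \<open>d\<close> is \<open>x + \<mu> d - 1\<close>. If \<open>1 \<le> x\<close>, there was no ruin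
  before \<open>d\<close>; if the position is negative, then ruin is present at \<open>d\<close>. In both cases ruin is
  decided by what happens from \<open>d\<close> on.\<close>

lemma ruin_one_jump:
  assumes "0 \<le> x" "0 < d" "1 \<le> x \<or> x + \<mu> * d < 1"
  shows "prob (ruin 0 x \<inter> {\<omega> \<in> \<Omega>. N d \<omega> = 1}) = lam * d * exp (- (lam * d)) * \<Psi> (x + \<mu> * d - 1)"
proof -
  have "ruin 0 x \<inter> {\<omega> \<in> \<Omega>. N d \<omega> = 1} = {\<omega> \<in> \<Omega>. N d \<omega> = 1} \<inter> ruin d (x + \<mu> * d - 1)"
  proof -
    have "(\<exists>s\<ge>0. x + (Y s \<omega> - Y 0 \<omega>) < 0) \<longleftrightarrow> (\<exists>s\<ge>d. x + \<mu> * d - 1 + (Y s \<omega> - Y d \<omega>) < 0)"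
      if \<omega>: "\<omega> \<in> \<Omega>" "N d \<omega> = 1" for \<omega>
    proof -
      have Y: "Y 0 \<omega> = 0" "Y d \<omega> = \<mu> * d - 1" using \<omega> by (simp_all add: Y_eq N_0)
      show ?thesis
      proof (cases "1 \<le> x")
        case True
        have "\<not> (x + Y s \<omega> < 0)" if "0 \<le> s" "s < d" for s
        proof -
          have "N s \<omega> \<le> 1" using N_mono[OF \<omega>(1), of s d] that \<omega> by simp
          moreover have "0 \<le> \<mu> * s" using that mu_pos by simp
          ultimately show ?thesis using True by (simp add: Y_eq not_less)
        qed
        then show ?thesis using assms Y by simp (smt (verit))
      next
        case False
        then have "x + \<mu> * d - 1 < 0" using assms(3) by simp
        then show ?thesis using Y assms by (intro iffI; intro exI[of _ d]) auto
      qed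
    qed
    then show ?thesis by (auto simp: ruin_def)
  qed
  then show ?thesis
    using Markov[OF count_event_F[of d 1], of "x + \<mu> * d - 1"] prob_N_eq[of d 1] assms by simp
qed

text \<open>The cases of no jump and of one jump before \<open>d\<close> are exact, and two or more jumps have
  probability of order \<open>d\<^sup>2\<close>.\<close>

lemma Psi_step:
  assumes "0 \<le> x" "0 < d" "1 \<le> x \<or> x + \<mu> * d < 1"
  shows "\<bar>\<Psi> x - exp (- (lam * d)) * \<Psi> (x + \<mu> * d) - lam * d * exp (- (lam * d)) * \<Psi> (x + \<mu> * d - 1)\<bar> \<le> (lam * d)\<^sup>2"
proof -
  have [measurable]: "N d \<in> measurable M (count_space UNIV)" using assms by auto
  have R: "ruin 0 x \<in> events" by (simp add: ruin_sets)
  have e: "{\<omega> \<in> \<Omega>. N d \<omega> = k} \<in> events" "{\<omega> \<in> \<Omega>. 2 \<le> N d \<omega>} \<in> events" for k by measurable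
  let ?A = "ruin 0 x \<inter> {\<omega> \<in> \<Omega>. N d \<omega> = 0}" and ?B = "ruin 0 x \<inter> {\<omega> \<in> \<Omega>. N d \<omega> = 1}" and ?C = "ruin 0 x \<inter> {\<omega> \<in> \<Omega>. 2 \<le> N d \<omega>}"
  have "ruin 0 x = (?A \<union> ?B) \<union> ?C" by (auto simp: ruin_def)
  then have "prob (ruin 0 x) = prob ((?A \<union> ?B) \<union> ?C)" by simp
  also have "\<dots> = prob ?A + prob ?B + prob ?C"
    using R e by (subst finite_measure_Union, simp, simp, force, subst finite_measure_Union) auto
  finally have "\<Psi> x - exp (- (lam * d)) * \<Psi> (x + \<mu> * d) - lam * d * exp (- (lam * d)) * \<Psi> (x + \<mu> * d - 1) = prob ?C"
    using ruin_no_jump[OF assms(1,2)] ruin_one_jump[OF assms] by (simp add: Psi_eq)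
  moreover have "prob ?C \<le> prob {\<omega> \<in> \<Omega>. 2 \<le> N d \<omega>}"
    using e by (intro finite_measure_mono) auto
  moreover have "{\<omega> \<in> \<Omega>. 2 \<le> N d \<omega>} = {\<omega> \<in> \<Omega>. 2 \<le> N d \<omega> - N 0 \<omega>}" using N_0 by auto
  ultimately show ?thesis using prob_two_jumps_le[of 0 d] assms by simp
qed

lemma Psi_Lipschitz:
  assumes "0 \<le> x" "x \<le> z"
  shows "\<bar>\<Psi> x - \<Psi> z\<bar> \<le> lam / \<mu> * (z - x)"
proof (cases "x = z")
  case False
  define d where "d = (z - x) / \<mu>"
  have d: "0 < d" "z = x + \<mu> * d" using assms False mu_pos by (auto simp: d_def)
  have R: "ruin 0 x \<in> events" by (simp add: ruin_sets)
  have [measurable]: "N d \<in> measurable M (count_space UNIV)" using d by auto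
  have e: "{\<omega> \<in> \<Omega>. N d \<omega> = k} \<in> events" for k by measurable
  have "prob (ruin 0 x) \<le> prob ((ruin 0 x \<inter> {\<omega> \<in> \<Omega>. N d \<omega> = 0}) \<union> (\<Omega> - {\<omega> \<in> \<Omega>. N d \<omega> = 0}))"
    using R e by (intro finite_measure_mono) (auto simp: ruin_def)
  also have "\<dots> \<le> prob (ruin 0 x \<inter> {\<omega> \<in> \<Omega>. N d \<omega> = 0}) + prob (\<Omega> - {\<omega> \<in> \<Omega>. N d \<omega> = 0})"
    using R e by (intro measure_Un_le) auto
  also have "\<dots> = exp (- (lam * d)) * \<Psi> z + (1 - exp (- (lam * d)))"
    using e prob_N_eq[OF d(1), of 0] ruin_no_jump[OF assms(1) d(1)] by (simp add: prob_compl d(2))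
  also have "\<dots> \<le> \<Psi> z + lam * d"
  proof -
    have "exp (- (lam * d)) * \<Psi> z \<le> 1 * \<Psi> z"
      using d lam_pos Psi_bounds by (intro mult_right_mono) auto
    then show ?thesis using one_minus_exp_le[of "lam * d"] by simp
  qed
  finally have "\<Psi> x - \<Psi> z \<le> lam * d" by (simp add: Psi_eq)
  moreover have "\<Psi> z \<le> \<Psi> x" by (rule Psi_antimono[OF assms(2)])
  moreover have "lam * d = lam / \<mu> * (z - x)" by (simp add: d_def)
  ultimately show ?thesis by simp
qed simp

lemma Psi_continuous_on: "continuous_on {0..} \<Psi>"
proof -
  have "(lam / \<mu>)-lipschitz_on {0..} \<Psi>"
  proof (rule lipschitz_onI)
    fix x z :: real assume "x \<in> {0..}" "z \<in> {0..}"
    then show "dist (\<Psi> x) (\<Psi> z) \<le> lam / \<mu> * dist x z"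
      using Psi_Lipschitz[of x z] Psi_Lipschitz[of z x]
      by (cases "x \<le> z") (auto simp: dist_real_def abs_minus_commute)
  qed (use lam_pos mu_pos in simp)
  then show ?thesis by (rule lipschitz_on_continuous_on)
qed

lemma isCont_Psi: "x \<noteq> 0 \<Longrightarrow> isCont \<Psi> x"
proof (cases "x > 0")
  case True
  have "continuous_on {0<..} \<Psi>" by (rule continuous_on_subset[OF Psi_continuous_on]) auto
  then show ?thesis using True by (simp add: continuous_on_eq_continuous_at)
next
  case False
  assume "x \<noteq> 0"
  then have "eventually (\<lambda>z. z \<in> {..<0}) (nhds x)" using False by (intro eventually_nhds_in_open) auto
  then have "eventually (\<lambda>z. \<Psi> z = 1) (nhds x)" by eventually_elim (simp add: Psi_neg)
  then show ?thesis by (subst isCont_cong[of _ "\<lambda>_. 1"]) auto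
qed

text \<open>The step estimate with \<open>d = (z - x) / \<mu>\<close>, in which \<open>exp (- lam d)\<close> is replaced by its linear
  part.\<close>

lemma Psi_difference:
  assumes "0 \<le> x" "x < z" "1 \<le> x \<or> z < 1"
  shows "\<bar>\<Psi> z - \<Psi> x - lam / \<mu> * (z - x) * (\<Psi> z - \<Psi> (z - 1))\<bar> \<le> 3 * (lam / \<mu>)\<^sup>2 * (z - x)\<^sup>2"
proof -
  define d where "d = (z - x) / \<mu>"
  have d: "0 < d" "z = x + \<mu> * d" using assms mu_pos by (auto simp: d_def)
  let ?r = "lam * d"
  have r: "0 \<le> ?r" using d lam_pos by simp
  let ?e = "exp (- ?r)"
  have 1: "\<bar>\<Psi> x - ?e * \<Psi> z - ?r * ?e * \<Psi> (z - 1)\<bar> \<le> ?r\<^sup>2"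
    using Psi_step[OF assms(1) d(1)] assms(3) d(2) by simp
  have 2: "\<bar>(?e - 1 + ?r) * \<Psi> z\<bar> \<le> ?r\<^sup>2"
    using mult_mono[OF exp_minus_taylor[OF r], of "\<bar>\<Psi> z\<bar>" 1] Psi_bounds[of z] by (simp add: abs_mult)
  have 3: "\<bar>?r * (?e - 1) * \<Psi> (z - 1)\<bar> \<le> ?r\<^sup>2"
  proof -
    have "\<bar>?e - 1\<bar> \<le> ?r" using one_minus_exp_le[of ?r] r by simp
    then have "?r * \<bar>?e - 1\<bar> * \<bar>\<Psi> (z - 1)\<bar> \<le> ?r * ?r * 1"
      using Psi_bounds[of "z - 1"] d lam_pos by (intro mult_mono mult_nonneg_nonneg) auto
    then show ?thesis using d lam_pos by (simp add: abs_mult power2_eq_square)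
  qed
  have "\<Psi> z - \<Psi> x - ?r * (\<Psi> z - \<Psi> (z - 1))
      = - (\<Psi> x - ?e * \<Psi> z - ?r * ?e * \<Psi> (z - 1)) - (?e - 1 + ?r) * \<Psi> z - ?r * (?e - 1) * \<Psi> (z - 1)"
    by (simp add: algebra_simps)
  then have "\<bar>\<Psi> z - \<Psi> x - ?r * (\<Psi> z - \<Psi> (z - 1))\<bar> \<le> 3 * ?r\<^sup>2"
    using 1 2 3 by linarith
  moreover have "?r = lam / \<mu> * (z - x)" by (simp add: d_def)
  ultimately show ?thesis by (simp add: power_mult_distrib power_divide)
qed

text \<open>The difference estimate covers both sides of \<open>x\<close>, with the right end of the interval in the
  argument of \<open>\<Psi>\<close>. The point 1 is excluded because \<open>\<Psi>\<close> jumps at 0.\<close>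

lemma Psi_has_derivative:
  assumes "0 < x" "x \<noteq> 1"
  shows "(\<Psi> has_real_derivative lam / \<mu> * (\<Psi> x - \<Psi> (x - 1))) (at x)"
proof -
  let ?c = "\<lambda>z. lam / \<mu> * (\<Psi> z - \<Psi> (z - 1))"
  let ?s = "\<lambda>z. (\<Psi> z - \<Psi> x) / (z - x)"
  let ?K = "3 * (lam / \<mu>)\<^sup>2"
  have c: "isCont ?c x"
  proof -
    have "isCont (\<lambda>z. \<Psi> (z - 1)) x"
      using assms by (intro isCont_o2[where f = "\<lambda>z. z - 1" and g = \<Psi>] isCont_Psi) (auto intro!: continuous_intros)
    then show ?thesis using isCont_Psi[of x] assms mu_pos by (auto intro!: continuous_intros)
  qed
  have m: "((\<lambda>z. max x z) \<longlongrightarrow> x) (at x)" by (rule tendsto_eq_intros refl | simp)+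
  have "((\<lambda>z. ?c (max x z)) \<longlongrightarrow> ?c x) (at x)"
    by (rule isCont_tendsto_compose[OF c m])
  moreover have "((\<lambda>z. ?s z - ?c (max x z)) \<longlongrightarrow> 0) (at x)"
  proof (rule Lim_null_comparison)
    have "eventually (\<lambda>z. z \<in> (if x < 1 then {0<..<1} else {1<..})) (at x)"
      using assms by (intro eventually_at_in_open') auto
    moreover have "eventually (\<lambda>z. z \<noteq> x) (at x)" by (simp add: eventually_at_filter)
    ultimately show "eventually (\<lambda>z. norm (?s z - ?c (max x z)) \<le> ?K * \<bar>z - x\<bar>) (at x)"
    proof eventually_elim
      case (elim z)
      define u v where "u = min x z" and "v = max x z"
      have uv: "0 \<le> u" "u < v" "1 \<le> u \<or> v < 1" using elim assms by (auto simp: u_def v_def split: if_splits)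
      have s: "?s z = (\<Psi> v - \<Psi> u) / (v - u)"
        using elim by (auto simp: u_def v_def min_def max_def divide_simps) (auto simp: algebra_simps)
      have "?s z - ?c v = (\<Psi> v - \<Psi> u - lam / \<mu> * (v - u) * (\<Psi> v - \<Psi> (v - 1))) / (v - u)"
        unfolding s using uv by (simp add: diff_divide_distrib)
      then have "\<bar>?s z - ?c v\<bar> \<le> ?K * (v - u)\<^sup>2 / (v - u)"
        using Psi_difference[OF uv] uv by (simp add: divide_right_mono)
      also have "\<dots> = ?K * \<bar>z - x\<bar>" using uv by (simp add: power2_eq_square u_def v_def min_def max_def)
      finally show ?case by (simp add: v_def)
    qed
    show "((\<lambda>z. ?K * \<bar>z - x\<bar>) \<longlongrightarrow> 0) (at x)"
      by (rule tendsto_eq_intros refl | simp)+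
  qed
  ultimately have "((\<lambda>z. ?c (max x z) + (?s z - ?c (max x z))) \<longlongrightarrow> ?c x + 0) (at x)"
    by (rule tendsto_add)
  then show ?thesis by (simp add: has_field_derivative_iff)
qed

text \<open>Integrated over \<open>[0, X]\<close>, the two terms of the derivative cancel except for the integrals of
  \<open>\<Psi>\<close> over \<open>[X - 1, X]\<close> and over \<open>[- 1, 0]\<close>. The latter equals 1, since \<open>\<Psi> = 1\<close> on negative
  capitals, and everything at \<open>X\<close> vanishes as \<open>X\<close> tends to infinity.\<close>

lemma Psi_0: "\<Psi> 0 = lam / \<mu>"
proof -
  have *: "\<bar>\<Psi> 0 - lam / \<mu>\<bar> \<le> (1 + lam / \<mu>) * \<Psi> (real n)" for n
  proof -
    define X where "X = real n + 1"
    have cont: "continuous_on {u..v} \<Psi>" if "0 \<le> u" for u v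
      by (rule continuous_on_subset[OF Psi_continuous_on]) (use that in auto)
    have int: "\<Psi> integrable_on {u..v}" if "0 \<le> u" for u v
      by (rule integrable_continuous_interval[OF cont[OF that]])
    obtain a1 where a1: "(\<Psi> has_integral a1) {0..X - 1}" using int[of 0 "X - 1"] by auto
    obtain a2 where a2: "(\<Psi> has_integral a2) {X - 1..X}" using int[of "X - 1" X] by (auto simp: X_def)
    have "((\<lambda>_. 1::real) has_integral 1) {-1..0::real}"
      using has_integral_const_real[of "1::real" "-1" 0] by simp
    then have "(\<Psi> has_integral 1) {-1..0}"
      by (rule has_integral_spike_finite[of "{0}", rotated 2]) (auto simp: Psi_neg)
    from has_integral_combine[OF _ _ this a1] have "(\<Psi> has_integral 1 + a1) {-1..X - 1}" by (simp add: X_def)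
    then have sh: "((\<lambda>v. \<Psi> (v - 1)) has_integral 1 + a1) {0..X}"
      using has_integral_affinity'[of \<Psi> "1 + a1" "-1" "X - 1" 1 "-1"] by simp
    have "(\<Psi> has_integral a1 + a2) {0..X}"
      using has_integral_combine[OF _ _ a1 a2] by (simp add: X_def)
    from has_integral_mult_right[OF has_integral_diff[OF this sh], of "lam / \<mu>"]
    have 1: "((\<lambda>v. lam / \<mu> * (\<Psi> v - \<Psi> (v - 1))) has_integral lam / \<mu> * (a2 - 1)) {0..X}" by simp
    have "((\<lambda>v. lam / \<mu> * (\<Psi> v - \<Psi> (v - 1))) has_integral (\<Psi> X - \<Psi> 0)) {0..X}"
    proof (rule fundamental_theorem_of_calculus_interior_strong[of "{1}"])
      show "(\<Psi> has_vector_derivative lam / \<mu> * (\<Psi> v - \<Psi> (v - 1))) (at v)" if "v \<in> {0<..<X} - {1}" for v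
        using Psi_has_derivative[of v] that by (simp add: has_real_derivative_iff_has_vector_derivative)
      show "continuous_on {0..X} \<Psi>" by (rule cont) simp
    qed (auto simp: X_def)
    with 1 have eq: "\<Psi> X - \<Psi> 0 = lam / \<mu> * (a2 - 1)" by (rule has_integral_unique[symmetric])
    have "0 \<le> a2" by (rule has_integral_nonneg[OF a2]) (simp add: Psi_bounds)
    moreover have "a2 \<le> \<Psi> (X - 1)"
      using has_integral_le[OF a2, of "\<lambda>_. \<Psi> (X - 1)" "\<Psi> (X - 1)"] has_integral_const_real[of "\<Psi> (X - 1)" "X - 1" X]
      by (auto simp: Psi_antimono)
    ultimately have "lam / \<mu> * a2 \<le> lam / \<mu> * \<Psi> (X - 1)" "0 \<le> lam / \<mu> * a2"
      using lam_pos mu_pos mult_left_mono[of a2 "\<Psi> (X - 1)" "lam / \<mu>"] by auto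
    moreover have "\<Psi> 0 - lam / \<mu> = \<Psi> X - lam / \<mu> * a2" using eq by (simp add: algebra_simps diff_divide_distrib)
    moreover have "0 \<le> \<Psi> X" "\<Psi> X \<le> \<Psi> (X - 1)" by (simp_all add: Psi_bounds Psi_antimono)
    ultimately have "\<bar>\<Psi> 0 - lam / \<mu>\<bar> \<le> \<Psi> (X - 1) + lam / \<mu> * \<Psi> (X - 1)" by linarith
    then show ?thesis by (simp add: X_def distrib_right)
  qed
  have "(\<lambda>n. (1 + lam / \<mu>) * \<Psi> (real n)) \<longlonglongrightarrow> (1 + lam / \<mu>) * 0"
    by (intro tendsto_mult tendsto_const filterlim_compose[OF Psi_tendsto_0 filterlim_real_sequentially])
  then have "\<bar>\<Psi> 0 - lam / \<mu>\<bar> \<le> (1 + lam / \<mu>) * 0"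
    by (rule LIMSEQ_le_const) (use * in auto)
  then show ?thesis by simp
qed

lemma Psi_0_bounds: "0 < \<Psi> 0" "\<Psi> 0 < 1"
  using lam_pos mu_pos psi_pos alpha_pos alpha_less by (auto simp: Psi_0 \<mu>_def field_simps)

end

section \<open>Gains along a path\<close>

locale barrier_market = poisson_market M N lam \<psi> for M :: "'a measure" and N lam \<psi> +
  fixes b :: real
  assumes b_pos: "0 < b" and b_less: "b < 1" and complete: "complete_measure M"
begin

definition "a = level \<psi> b"
abbreviation "S \<equiv> stock lam \<psi> N"
abbreviation "\<tau> \<equiv> last_passage S b"
abbreviation "\<phi> \<equiv> strategy M lam \<psi> N b"

text \<open>The conditional probability, given that the surplus is at \<open>z\<close>, that it will be below \<open>a\<close>
  later on.\<close>

definition "h z = \<Psi> (z - a)"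

lemma a_pos: "a > 0"
  using b_pos b_less alpha_pos by (simp add: a_def level_def \<alpha>_def mult_neg_pos divide_neg_pos)

lemma stock_eq: "S t \<omega> = exp (- \<alpha> * Y t \<omega>)"
  using stock_eq_exp_surplus[OF psi_pos] by (simp add: \<alpha>_def)

lemma tau_eq: "\<tau> \<omega> = Sup (ennreal ` {t. 0 \<le> t \<and> Y t \<omega> \<le> a})"
  using last_passage_stock[OF psi_pos b_pos] by (simp add: a_def)

lemma alpha_mu: "\<alpha> * \<mu> = lam * \<psi>"
  using alpha_pos by (simp add: \<mu>_def)

lemma h_bounds: "0 \<le> h z" "h z \<le> 1" by (simp_all add: h_def Psi_bounds)
lemma h_antimono: "z \<le> z' \<Longrightarrow> h z' \<le> h z" by (simp add: h_def Psi_antimono)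
lemma h_below: "z < a \<Longrightarrow> h z = 1" by (simp add: h_def Psi_neg)
lemma h_a: "h a = \<Psi> 0" by (simp add: h_def)
lemma h_measurable [measurable]: "h \<in> borel_measurable borel" unfolding h_def by measurable

lemma h_right_continuous: "continuous (at_right z) h"
proof -
  have "filterlim (\<lambda>x. x - a) (at_right (z - a)) (at_right z)"
    using filterlim_at_right_to_0[of "\<lambda>x. x - a" "at_right (z - a)" z]
      filterlim_at_right_to_0[of "\<lambda>x. x" "at_right (z - a)" "z - a"]
    by (simp add: algebra_simps filterlim_ident)
  from filterlim_compose[OF Psi_right_continuous[of "z - a", unfolded continuous_within] this]
  show ?thesis by (simp add: continuous_within h_def[abs_def])
qed

lemma h_left_limit: "(h \<longlongrightarrow> (if z = a then 1 else h z)) (at_left z)"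
proof (cases "z = a")
  case True
  have "eventually (\<lambda>x. h x = 1) (at_left z)"
    using True by (auto simp: eventually_at_left_field h_below intro!: exI[of _ "z - 1"])
  then show ?thesis using True by (simp add: tendsto_eventually)
next
  case False
  then have "isCont (\<lambda>x. \<Psi> (x - a)) z"
    by (intro isCont_o2[where f = "\<lambda>x. x - a" and g = \<Psi>] isCont_Psi) (auto intro!: continuous_intros)
  then have "(h \<longlongrightarrow> h z) (at z)" by (simp add: isCont_def h_def[abs_def])
  then show ?thesis using False filterlim_at_split by auto
qed

lemma h_has_derivative:
  assumes "z \<notin> {a, a + 1}"
  shows "(h has_real_derivative lam / \<mu> * (h z - h (z - 1))) (at z)"
proof (cases "z < a")
  case True
  have "eventually (\<lambda>x. x \<in> {..<a}) (nhds z)" using True by (intro eventually_nhds_in_open) auto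
  then have ev: "eventually (\<lambda>x. h x = 1) (nhds z)" by eventually_elim (simp add: h_below)
  have "(h has_real_derivative 0) (at z)"
    by (subst DERIV_cong_ev[OF refl ev refl]) auto
  then show ?thesis using True by (simp add: h_below)
next
  case False
  then have "(\<Psi> has_real_derivative lam / \<mu> * (\<Psi> (z - a) - \<Psi> (z - a - 1))) (at (z - a))"
    using assms by (intro Psi_has_derivative) auto
  moreover have "((\<lambda>x. x - a) has_real_derivative 1) (at z)" by (auto intro!: derivative_eq_intros)
  ultimately have "((\<lambda>x. \<Psi> (x - a)) has_real_derivative lam / \<mu> * (\<Psi> (z - a) - \<Psi> (z - a - 1)) * 1) (at z)"
    by (rule DERIV_chain2)
  then show ?thesis by (simp add: h_def[abs_def] algebra_simps)
qed

text \<open>\<open>Y t = a\<close> means \<open>\<mu> t = a + N t\<close>, so that \<open>Y\<close> can be at \<open>a\<close> only at one of these countably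
  many deterministic times.\<close>

definition "crossing k = (a + real k) / \<mu>"

lemma crossing_pos: "0 < crossing k" using a_pos mu_pos by (simp add: crossing_def)

lemma Y_eq_a_iff: "Y t \<omega> = a \<longleftrightarrow> t = crossing (N t \<omega>)"
  using mu_pos by (auto simp: crossing_def Y_eq field_simps)

definition "hits (t::real) \<omega> = card {s \<in> {0<..t}. Y s \<omega> = a}"

text \<open>What the pathwise arguments need of a path. By the last clause \<open>Y\<close> is continuous at the
  times when it is at \<open>a\<close>: it reaches this level from below and never by a jump.\<close>

definition good :: "'a \<Rightarrow> bool" where
  "good \<omega> \<longleftrightarrow> filterlim (\<lambda>t. Y t \<omega>) at_top at_top \<and>
    (\<forall>t>0. N t \<omega> \<le> Suc (counting_path.before (\<lambda>t. N t \<omega>) t)) \<and>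
    (\<forall>k. counting_path.before (\<lambda>t. N t \<omega>) (crossing k) = N (crossing k) \<omega>)"

lemma AE_good: "AE \<omega> in M. good \<omega>"
proof -
  have "AE \<omega> in M. \<forall>k. counting_path.before (\<lambda>t. N t \<omega>) (crossing k) = N (crossing k) \<omega>"
    unfolding AE_all_countable using AE_no_jump_at crossing_pos by blast
  with AE_Y_at_top AE_unit_jumps show ?thesis
    unfolding good_def by eventually_elim blast
qed

text \<open>After its last jump before \<open>s\<close> the path increases; if it were above \<open>a\<close> at the end, it would
  have been so for a while, against the choice of \<open>s\<close> as a supremum. After \<open>s\<close> it stays above
  \<open>a\<close>, and so right-continuity gives the other inequality.\<close>

lemma tau_eq_a:
  assumes \<omega>: "\<omega> \<in> \<Omega>" and s: "\<tau> \<omega> = ennreal s" "0 \<le> s"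
  shows "Y s \<omega> = a" "\<And>u. s < u \<Longrightarrow> a < Y u \<omega>"
proof -
  interpret p: drift_path "\<lambda>t. N t \<omega>" \<mu> by (rule path[OF \<omega>])
  have up: "t \<le> s" if "0 \<le> t" "Y t \<omega> \<le> a" for t
  proof -
    have "ennreal t \<le> \<tau> \<omega>" unfolding tau_eq using that by (intro Sup_upper) auto
    then show ?thesis using s that by simp
  qed
  then show after: "a < Y u \<omega>" if "s < u" for u using that s(2) by (meson not_le order_trans less_imp_le)
  have Y0: "Y 0 \<omega> \<le> a" using a_pos \<omega> by (simp add: Y_eq N_0)
  have "Y s \<omega> \<le> a"
  proof (cases "s = 0")
    case False
    then have s0: "0 < s" using s by simp
    obtain r where r: "0 \<le> r" "r < s" "\<And>u. r \<le> u \<Longrightarrow> u < s \<Longrightarrow> N u \<omega> = p.before s"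
      using p.left_constant[OF s0] by blast
    show ?thesis
    proof (rule ccontr)
      assume "\<not> Y s \<omega> \<le> a"
      then have gt: "a < \<mu> * s - real (p.before s)"
        using p.before_le[of s] s0 by (simp add: Y_eq not_le)
      \<comment> \<open>without a jump in between, the path would have been at \<open>a\<close> at time \<open>s - e\<close>\<close>
      define e where "e = (\<mu> * s - real (p.before s) - a) / \<mu>"
      have e: "e > 0" using gt mu_pos by (simp add: e_def)
      have "ennreal (max r (s - e)) < \<tau> \<omega>"
        unfolding s(1) using r e s0 by (intro ennreal_lessI) auto
      then obtain t where t: "0 \<le> t" "Y t \<omega> \<le> a" "max r (s - e) < t"
        unfolding tau_eq less_Sup_iff using r by (auto simp: ennreal_less_iff)
      have "t \<noteq> s" using t \<open>\<not> Y s \<omega> \<le> a\<close> by auto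
      then have "t < s" using up[OF t(1,2)] by simp
      then have "N t \<omega> = p.before s" using r(3)[of t] t by simp
      moreover have "\<mu> * (s - e) < \<mu> * t" using t mu_pos by simp
      moreover have "\<mu> * (s - e) = a + real (p.before s)" using mu_pos by (simp add: e_def field_simps)
      ultimately show False using t(2) by (simp add: Y_eq)
    qed
  qed (use Y0 in simp)
  moreover have "a \<le> Y s \<omega>"
  proof -
    have "((\<lambda>u. Y u \<omega>) \<longlongrightarrow> Y s \<omega>) (at_right s)"
      unfolding Y_eq using p.right_cont_n[OF s(2)] by (auto intro!: tendsto_intros simp: continuous_within)
    moreover have "eventually (\<lambda>u. a \<le> Y u \<omega>) (at_right s)"
      using after by (auto simp: eventually_at_right_field intro!: exI[of _ "s + 1"] less_imp_le)
    ultimately show ?thesis by (rule tendsto_lowerbound) simp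
  qed
  ultimately show "Y s \<omega> = a" by simp
qed

lemma good_tau_finite:
  assumes "good \<omega>" "\<omega> \<in> \<Omega>"
  obtains s where "\<tau> \<omega> = ennreal s" "0 < s"
proof -
  have "\<exists>T. \<forall>t\<ge>T. a + 1 \<le> Y t \<omega>"
    using assms(1) unfolding good_def filterlim_at_top eventually_at_top_linorder by blast
  then obtain T where T: "\<And>t. T \<le> t \<Longrightarrow> a + 1 \<le> Y t \<omega>" by blast
  have "\<tau> \<omega> \<le> ennreal (max 0 T)"
    unfolding tau_eq
  proof (rule Sup_least, clarify)
    fix t assume "0 \<le> t" "Y t \<omega> \<le> a"
    then have "t \<le> T" using T[of t] by (cases "t \<le> T") auto
    then show "ennreal t \<le> ennreal (max 0 T)" by (intro ennreal_leI) simp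
  qed
  then obtain s where s: "\<tau> \<omega> = ennreal s" "0 \<le> s"
    by (cases "\<tau> \<omega>") (auto simp: top_unique)
  have "s = crossing (N s \<omega>)" using tau_eq_a(1)[OF assms(2) s] by (simp add: Y_eq_a_iff)
  then show ?thesis using that[OF s(1)] crossing_pos by metis
qed

lemma finite_crossings: "\<omega> \<in> \<Omega> \<Longrightarrow> finite {s \<in> {0<..t}. Y s \<omega> = a}"
proof -
  assume \<omega>: "\<omega> \<in> \<Omega>"
  interpret p: drift_path "\<lambda>t. N t \<omega>" \<mu> by (rule path[OF \<omega>])
  show ?thesis using p.finite_level_times[of t a] by (simp add: p.y_def Y_eq)
qed

definition "jumps \<omega> = counting_path.jumps (\<lambda>t. N t \<omega>)"
text \<open>The left limits of \<open>Y\<close> and of \<open>S\<close>.\<close>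

definition "Yb u \<omega> = drift_path.y_before (\<lambda>t. N t \<omega>) \<mu> u"
definition "Sb u \<omega> = exp (- \<alpha> * Yb u \<omega>)"

text \<open>The strategy is \<open>\<phi> = g / (\<psi> Sb)\<close>, so that \<open>\<phi> dS = g dM\<close> for the compensated process \<open>M\<close>.\<close>

definition "g u \<omega> = h (Yb u \<omega> - 1) - h (Yb u \<omega>)"

lemma g_bounds: "0 \<le> g u \<omega>" "g u \<omega> \<le> 1"
  using h_antimono[of "Yb u \<omega> - 1" "Yb u \<omega>"] h_bounds[of "Yb u \<omega> - 1"] h_bounds[of "Yb u \<omega>"] by (simp_all add: g_def)

lemma Yb_measurable: "\<omega> \<in> \<Omega> \<Longrightarrow> (\<lambda>u. Yb u \<omega>) \<in> borel_measurable borel"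
proof -
  assume \<omega>: "\<omega> \<in> \<Omega>"
  interpret p: drift_path "\<lambda>t. N t \<omega>" \<mu> by (rule path[OF \<omega>])
  note [measurable] = p.before_measurable
  show ?thesis unfolding Yb_def p.y_before_def by measurable
qed

lemma g_measurable: "\<omega> \<in> \<Omega> \<Longrightarrow> (\<lambda>u. g u \<omega>) \<in> borel_measurable borel"
  using Yb_measurable unfolding g_def by measurable

lemma finite_jumps: "\<omega> \<in> \<Omega> \<Longrightarrow> finite (jumps \<omega> \<inter> {0<..t})"
proof -
  assume \<omega>: "\<omega> \<in> \<Omega>"
  interpret p: drift_path "\<lambda>t. N t \<omega>" \<mu> by (rule path[OF \<omega>])
  show ?thesis unfolding jumps_def by (rule p.finite_jumps)
qed

lemma left_lim_Y: "\<omega> \<in> \<Omega> \<Longrightarrow> left_lim (\<lambda>s. Y s \<omega>) t = (if t \<le> 0 then 0 else Yb t \<omega>)"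
proof -
  assume \<omega>: "\<omega> \<in> \<Omega>"
  interpret p: drift_path "\<lambda>t. N t \<omega>" \<mu> by (rule path[OF \<omega>])
  show ?thesis
  proof (cases "t \<le> 0")
    case True then show ?thesis using \<omega> by (simp add: left_lim_def Y_eq N_0)
  next
    case False
    then have "((\<lambda>s. Y s \<omega>) \<longlongrightarrow> Yb t \<omega>) (at_left t)"
      unfolding Y_eq Yb_def p.y_before_def using p.tendsto_before[of t] by (auto intro!: tendsto_intros)
    then have "Lim (at_left t) (\<lambda>s. Y s \<omega>) = Yb t \<omega>" by (intro tendsto_Lim) auto
    then show ?thesis using False by (simp add: left_lim_def)
  qed
qed

lemma left_lim_S: "\<omega> \<in> \<Omega> \<Longrightarrow> left_lim (\<lambda>s. S s \<omega>) t = exp (- \<alpha> * left_lim (\<lambda>s. Y s \<omega>) t)"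
proof -
  assume \<omega>: "\<omega> \<in> \<Omega>"
  interpret p: drift_path "\<lambda>t. N t \<omega>" \<mu> by (rule path[OF \<omega>])
  show ?thesis
  proof (cases "t \<le> 0")
    case True then show ?thesis by (simp add: left_lim_def stock_eq)
  next
    case False
    then have "((\<lambda>s. Y s \<omega>) \<longlongrightarrow> Yb t \<omega>) (at_left t)"
      unfolding Y_eq Yb_def p.y_before_def using p.tendsto_before[of t] by (auto intro!: tendsto_intros)
    then have "((\<lambda>s. S s \<omega>) \<longlongrightarrow> exp (- \<alpha> * Yb t \<omega>)) (at_left t)"
      unfolding stock_eq by (intro tendsto_intros)
    then have "Lim (at_left t) (\<lambda>s. S s \<omega>) = exp (- \<alpha> * Yb t \<omega>)" by (intro tendsto_Lim) auto
    then show ?thesis using False left_lim_Y[OF \<omega>, of t] by (simp add: left_lim_def[of "\<lambda>s. S s \<omega>"])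
  qed
qed

lemma strategy_eq:
  "\<omega> \<in> \<Omega> \<Longrightarrow> \<phi> t \<omega> = (\<lambda>z. (h (z - 1) - h z) / (\<psi> * exp (- \<alpha> * z))) (left_lim (\<lambda>s. Y s \<omega>) t)"
proof -
  assume \<omega>: "\<omega> \<in> \<Omega>"
  have "\<Psi> (z - a - 1) * of_bool (z \<ge> a + 1) - \<Psi> (z - a) * of_bool (z \<ge> a)
         + of_bool (z < a + 1) - of_bool (z < a) = h (z - 1) - h z" for z
    using Psi_neg[of "z - a"] Psi_neg[of "z - a - 1"]
    by (cases "z < a"; cases "z < a + 1") (auto simp: h_def algebra_simps)
  then show ?thesis by (simp add: strategy_def Let_def a_def[symmetric] left_lim_S[OF \<omega>])
qed

lemma strategy_eq': "\<omega> \<in> \<Omega> \<Longrightarrow> 0 < t \<Longrightarrow> \<phi> t \<omega> = g t \<omega> / (\<psi> * Sb t \<omega>)"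
  by (simp add: strategy_eq left_lim_Y g_def Sb_def)

lemma strategy_measurable_path: "\<omega> \<in> \<Omega> \<Longrightarrow> (\<lambda>t. \<phi> t \<omega>) \<in> borel_measurable borel"
proof -
  assume \<omega>: "\<omega> \<in> \<Omega>"
  note [measurable] = Yb_measurable[OF \<omega>]
  show ?thesis unfolding strategy_eq[OF \<omega>] left_lim_Y[OF \<omega>] by measurable
qed

text \<open>The integral of \<open>g\<close> against \<open>M\<close>.\<close>

definition "gain t \<omega> = (\<Sum>s\<in>jumps \<omega> \<inter> {0<..t}. g s \<omega>) - (LINT u:{0<..t}|lborel. lam * g u \<omega>)"

lemma jump_size:
  assumes "\<omega> \<in> \<Omega>" "good \<omega>" "s \<in> jumps \<omega>"
  shows "Y s \<omega> = Yb s \<omega> - 1" "Yb s \<omega> \<noteq> a" "Y s \<omega> \<noteq> a" "0 < s"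
proof -
  interpret p: drift_path "\<lambda>t. N t \<omega>" \<mu> by (rule path[OF assms(1)])
  have s: "0 < s" "p.before s \<noteq> N s \<omega>" using assms(3) by (auto simp: jumps_def p.jumps_def)
  then show "0 < s" by simp
  have "N s \<omega> = Suc (p.before s)"
    using s p.before_le[of s] assms(2) by (auto simp: good_def)
  then show Y: "Y s \<omega> = Yb s \<omega> - 1" by (simp add: Y_eq Yb_def p.y_before_def)
  have nc: "s \<noteq> crossing k" for k using assms(2) s(2) by (auto simp: good_def)
  show "Y s \<omega> \<noteq> a" using nc Y_eq_a_iff by auto
  show "Yb s \<omega> \<noteq> a"
  proof
    assume "Yb s \<omega> = a"
    then have "s = crossing (p.before s)" using mu_pos by (simp add: Yb_def p.y_before_def crossing_def field_simps)
    then show False using nc by simp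
  qed
qed

lemma Yb_off_jumps: "\<omega> \<in> \<Omega> \<Longrightarrow> 0 < s \<Longrightarrow> s \<notin> jumps \<omega> \<Longrightarrow> Yb s \<omega> = Y s \<omega>"
proof -
  assume \<omega>: "\<omega> \<in> \<Omega>" "0 < s" "s \<notin> jumps \<omega>"
  interpret p: drift_path "\<lambda>t. N t \<omega>" \<mu> by (rule path[OF \<omega>(1)])
  show ?thesis using \<omega> by (simp add: jumps_def p.jumps_def Yb_def p.y_before_def Y_eq)
qed

text \<open>Change of variables for \<open>h\<close> along the path. By the renewal equation the drift of \<open>h(Y)\<close> is
  the compensator \<open>- lam g\<close>, and the jumps of \<open>Y\<close> change it by \<open>g\<close>. What remains is the loss
  of \<open>1 - \<Psi> 0\<close> at each time when \<open>Y\<close> passes continuously through \<open>a\<close>, where \<open>h\<close> falls from 1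
  to \<open>\<Psi> 0\<close>. The gains do not suffer this loss.\<close>

lemma gain_eq:
  assumes \<omega>: "\<omega> \<in> \<Omega>" and good: "good \<omega>" and t: "0 \<le> t"
  shows "gain t \<omega> = h (Y t \<omega>) - 1 + (1 - \<Psi> 0) * real (hits t \<omega>)"
proof -
  interpret p: drift_path "\<lambda>t. N t \<omega>" \<mu> by (rule path[OF \<omega>])
  have py: "p.y u = Y u \<omega>" for u by (simp add: p.y_def Y_eq)
  have pb: "p.y_before u = Yb u \<omega>" for u by (simp add: Yb_def)
  have pj: "p.jumps = jumps \<omega>" by (simp add: jumps_def)
  let ?hl = "\<lambda>z. if z = a then 1 else h z"
  let ?F = "{s \<in> {0<..t}. s \<in> jumps \<omega> \<or> Y s \<omega> \<in> {a, a + 1}}"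
  let ?J = "jumps \<omega> \<inter> {0<..t}" and ?C = "{s \<in> {0<..t}. Y s \<omega> = a}"
  have int: "((\<lambda>u. \<mu> * (lam / \<mu> * (h (Y u \<omega>) - h (Y u \<omega> - 1)))) has_integral
    (h (Y t \<omega>) - h (Y 0 \<omega>) - (\<Sum>s\<in>?F. h (Y s \<omega>) - ?hl (Yb s \<omega>)))) {0..t}"
    using p.path_change_of_variables[of "{a, a + 1}" t h ?hl "\<lambda>z. lam / \<mu> * (h z - h (z - 1))",
        OF _ t h_right_continuous h_left_limit h_has_derivative]
    unfolding py pb pj by simp
  have fin: "finite ?F"
  proof -
    have "finite {s \<in> {0<..t}. Y s \<omega> = a + 1}"
      using p.finite_level_times[of t "a + 1"] by (simp add: py)
    moreover have "?F \<subseteq> ?J \<union> ?C \<union> {s \<in> {0<..t}. Y s \<omega> = a + 1}" by auto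
    ultimately show ?thesis
      using finite_jumps[OF \<omega>, of t] finite_crossings[OF \<omega>, of t] finite_subset by (meson finite_UnI)
  qed
  have "(\<Sum>s\<in>?F. h (Y s \<omega>) - ?hl (Yb s \<omega>)) = (\<Sum>s\<in>?F. (if s \<in> jumps \<omega> then g s \<omega> else 0) + (if Y s \<omega> = a then \<Psi> 0 - 1 else 0))"
  proof (intro sum.cong refl)
    fix s assume s: "s \<in> ?F"
    \<comment> \<open>At a jump neither \<open>Y\<close> nor its left limit is at \<open>a\<close>; at other times only
      the discontinuity of \<open>h\<close> at \<open>a\<close> contributes.\<close>
    show "h (Y s \<omega>) - ?hl (Yb s \<omega>) = (if s \<in> jumps \<omega> then g s \<omega> else 0) + (if Y s \<omega> = a then \<Psi> 0 - 1 else 0)"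
    proof (cases "s \<in> jumps \<omega>")
      case True
      then show ?thesis using jump_size[OF \<omega> good True] by (simp add: g_def)
    next
      case False
      then show ?thesis using Yb_off_jumps[OF \<omega> _ False] s by (auto simp: h_a)
    qed
  qed
  also have "\<dots> = (\<Sum>s\<in>?F. if s \<in> jumps \<omega> then g s \<omega> else 0) + (\<Sum>s\<in>?F. if Y s \<omega> = a then \<Psi> 0 - 1 else 0)"
    by (rule sum.distrib)
  also have "(\<Sum>s\<in>?F. if s \<in> jumps \<omega> then g s \<omega> else 0) = (\<Sum>s\<in>?J. g s \<omega>)"
    using fin by (intro sum.mono_neutral_cong_right) auto
  also have "(\<Sum>s\<in>?F. if Y s \<omega> = a then \<Psi> 0 - 1 else 0) = (\<Sum>s\<in>?C. \<Psi> 0 - 1)"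
    using fin by (intro sum.mono_neutral_cong_right) auto
  finally have sum: "(\<Sum>s\<in>?F. h (Y s \<omega>) - ?hl (Yb s \<omega>)) = (\<Sum>s\<in>?J. g s \<omega>) + real (hits t \<omega>) * (\<Psi> 0 - 1)"
    by (simp add: hits_def)
  let ?I = "h (Y t \<omega>) - 1 - ((\<Sum>s\<in>?J. g s \<omega>) + real (hits t \<omega>) * (\<Psi> 0 - 1))"
  have "h (Y 0 \<omega>) = 1" using a_pos \<omega> by (intro h_below) (simp add: Y_eq N_0)
  with int sum have "((\<lambda>u. \<mu> * (lam / \<mu> * (h (Y u \<omega>) - h (Y u \<omega> - 1)))) has_integral ?I) {0..t}" by simp
  then have "((\<lambda>u. - (lam * g u \<omega>)) has_integral ?I) {0..t}"
  proof (rule has_integral_spike_finite[rotated 2])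
    show "finite (insert 0 ?J)" using finite_jumps[OF \<omega>] by simp
    show "- (lam * g u \<omega>) = \<mu> * (lam / \<mu> * (h (Y u \<omega>) - h (Y u \<omega> - 1)))" if "u \<in> {0..t} - insert 0 ?J" for u
      using Yb_off_jumps[OF \<omega>, of u] that mu_pos by (auto simp: g_def algebra_simps)
  qed
  then have "(LINT u:{0<..t}|lborel. - (lam * g u \<omega>)) = ?I"
  proof (rule set_integral_eq_of_has_integral)
    show "(\<lambda>u. - (lam * g u \<omega>)) \<in> borel_measurable borel"
      using g_measurable[OF \<omega>] by measurable
    show "\<bar>- (lam * g u \<omega>)\<bar> \<le> lam" for u
      using g_bounds[of u \<omega>] lam_pos mult_left_mono[of "g u \<omega>" 1 lam] by (simp add: abs_mult)
  qed
  moreover have "(LINT u:{0<..t}|lborel. - (lam * g u \<omega>)) = - (LINT u:{0<..t}|lborel. lam * g u \<omega>)"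
    by (simp only: set_lebesgue_integral_def scaleR_minus_right Bochner_Integration.integral_minus)
  ultimately show ?thesis by (simp add: gain_def algebra_simps)
qed

text \<open>The jumps and the downward drift of \<open>S\<close> at the times in \<open>W\<close>. Random time windows \<open>W\<close>
  describe the price stopped at \<open>\<tau>\<close> and the price after \<open>\<tau>\<close> alike.\<close>

definition "jump_part W s \<omega> = (if 0 < s \<and> s \<in> W then S s \<omega> - Sb s \<omega> else 0)"
definition "drift_part W u \<omega> = indicator W u * (lam * \<psi> * Sb u \<omega>)"

lemma Sb_le_S: "\<omega> \<in> \<Omega> \<Longrightarrow> 0 \<le> s \<Longrightarrow> Sb s \<omega> \<le> S s \<omega>"
proof -
  assume \<omega>: "\<omega> \<in> \<Omega>" "0 \<le> s"
  interpret p: drift_path "\<lambda>t. N t \<omega>" \<mu> by (rule path[OF \<omega>(1)])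
  have "Y s \<omega> \<le> Yb s \<omega>" using p.before_le[OF \<omega>(2)] by (simp add: Y_eq Yb_def p.y_before_def)
  then show ?thesis using alpha_pos by (simp add: stock_eq Sb_def)
qed

lemma Sb_bounds:
  assumes "\<omega> \<in> \<Omega>" "u \<in> {0<..t}"
  shows "Sb u \<omega> \<le> exp (\<alpha> * real (N t \<omega>))" "exp (- \<alpha> * \<mu> * t) \<le> Sb u \<omega>"
proof -
  interpret p: drift_path "\<lambda>t. N t \<omega>" \<mu> by (rule path[OF assms(1)])
  have b: "p.before u \<le> N t \<omega>" using p.before_le[of u] p.n_mono[of u t] assms by auto
  have "0 \<le> \<mu> * u" "\<mu> * u \<le> \<mu> * t" using assms mu_pos by auto
  then have "- real (N t \<omega>) \<le> Yb u \<omega>" "Yb u \<omega> \<le> \<mu> * t"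
    using b by (auto simp: Yb_def p.y_before_def)
  then have "\<alpha> * - real (N t \<omega>) \<le> \<alpha> * Yb u \<omega>" "\<alpha> * Yb u \<omega> \<le> \<alpha> * (\<mu> * t)"
    using alpha_pos by (auto simp only: mult_left_mono less_imp_le)
  then show "Sb u \<omega> \<le> exp (\<alpha> * real (N t \<omega>))" "exp (- \<alpha> * \<mu> * t) \<le> Sb u \<omega>" by (auto simp: Sb_def)
qed

lemma Sb_measurable: "\<omega> \<in> \<Omega> \<Longrightarrow> (\<lambda>u. Sb u \<omega>) \<in> borel_measurable borel"
  using Yb_measurable unfolding Sb_def by measurable

lemma stock_representation:
  assumes \<omega>: "\<omega> \<in> \<Omega>" and t: "0 \<le> t"
  shows "S t \<omega> - S 0 \<omega> = (\<Sum>s\<in>jumps \<omega> \<inter> {0<..t}. jump_part UNIV s \<omega>) - (LINT u:{0<..t}|lborel. drift_part UNIV u \<omega>)"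
proof -
  interpret p: drift_path "\<lambda>t. N t \<omega>" \<mu> by (rule path[OF \<omega>])
  have py: "p.y u = Y u \<omega>" for u by (simp add: p.y_def Y_eq)
  have pb: "p.y_before u = Yb u \<omega>" for u by (simp add: Yb_def)
  have pj: "p.jumps = jumps \<omega>" by (simp add: jumps_def)
  let ?E = "\<lambda>z. exp (- \<alpha> * z)"
  have cont: "isCont ?E z" for z by (intro continuous_intros)
  have "((\<lambda>u. \<mu> * (- \<alpha> * ?E (Y u \<omega>))) has_integral
    (?E (Y t \<omega>) - ?E (Y 0 \<omega>) - (\<Sum>s\<in>{s \<in> {0<..t}. s \<in> jumps \<omega> \<or> Y s \<omega> \<in> {}}. ?E (Y s \<omega>) - ?E (Yb s \<omega>)))) {0..t}"
    unfolding py[symmetric] pb[symmetric] pj[symmetric]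
  proof (rule p.path_change_of_variables[where H' = "\<lambda>z. - \<alpha> * ?E z"])
    show "continuous (at_right z) ?E" for z using cont by (rule continuous_at_imp_continuous_at_within)
    show "(?E \<longlongrightarrow> ?E z) (at_left z)" for z using cont[of z] filterlim_at_split by (auto simp: isCont_def)
    show "(?E has_real_derivative - \<alpha> * ?E z) (at z)" for z by (auto intro!: derivative_eq_intros)
  qed (use t in auto)
  moreover have "{s \<in> {0<..t}. s \<in> jumps \<omega> \<or> Y s \<omega> \<in> {}} = jumps \<omega> \<inter> {0<..t}" by auto
  moreover have "(\<Sum>s\<in>jumps \<omega> \<inter> {0<..t}. ?E (Y s \<omega>) - ?E (Yb s \<omega>)) = (\<Sum>s\<in>jumps \<omega> \<inter> {0<..t}. jump_part UNIV s \<omega>)"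
    by (intro sum.cong) (auto simp: jump_part_def stock_eq Sb_def)
  ultimately have "((\<lambda>u. \<mu> * (- \<alpha> * ?E (Y u \<omega>))) has_integral
    (S t \<omega> - S 0 \<omega> - (\<Sum>s\<in>jumps \<omega> \<inter> {0<..t}. jump_part UNIV s \<omega>))) {0..t}" (is "(_ has_integral ?I) _")
    by (simp add: stock_eq)
  then have "((\<lambda>u. - (if u = 0 then 0 else drift_part UNIV u \<omega>)) has_integral ?I) {0..t}"
  proof (rule has_integral_spike_finite[rotated 2])
    show "finite (insert 0 (jumps \<omega> \<inter> {0<..t}))" using finite_jumps[OF \<omega>] by simp
    show "- (if u = 0 then 0 else drift_part UNIV u \<omega>) = \<mu> * (- \<alpha> * ?E (Y u \<omega>))"
      if "u \<in> {0..t} - insert 0 (jumps \<omega> \<inter> {0<..t})" for u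
      using Yb_off_jumps[OF \<omega>, of u] that alpha_mu by (auto simp: drift_part_def Sb_def mult.commute)
  qed
  then have "(LINT u:{0<..t}|lborel. - (if u = 0 then 0 else drift_part UNIV u \<omega>)) = ?I"
  proof (rule set_integral_eq_of_has_integral)
    note [measurable] = Sb_measurable[OF \<omega>]
    show "(\<lambda>u. - (if u = 0 then 0 else drift_part UNIV u \<omega>)) \<in> borel_measurable borel"
      unfolding drift_part_def by measurable
    show "\<bar>- (if u = 0 then 0 else drift_part UNIV u \<omega>)\<bar> \<le> lam * \<psi> * exp (\<alpha> * real (N t \<omega>))" if "u \<in> {0..t}" for u
      using Sb_bounds(1)[OF \<omega>, of u t] that lam_pos psi_pos
      by (auto simp: drift_part_def abs_mult Sb_def intro!: mult_left_mono mult_nonneg_nonneg)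
  qed
  moreover have "(LINT u:{0<..t}|lborel. - (if u = 0 then 0 else drift_part UNIV u \<omega>)) = - (LINT u:{0<..t}|lborel. drift_part UNIV u \<omega>)"
    by (auto simp: set_lebesgue_integral_def indicator_def intro!: Bochner_Integration.integral_cong simp flip: integral_minus)
  ultimately show ?thesis by simp
qed

lemma windowed_path:
  assumes \<omega>: "\<omega> \<in> \<Omega>" and W [measurable]: "W \<in> sets borel"
    and rep: "\<And>t. 0 \<le> t \<Longrightarrow> x t - x 0 = (\<Sum>s\<in>jumps \<omega> \<inter> {0<..t}. jump_part W s \<omega>) - (LINT u:{0<..t}|lborel. drift_part W u \<omega>)"
  shows "jump_drift_path x (\<lambda>s. jump_part W s \<omega>) (\<lambda>u. drift_part W u \<omega>) (jumps \<omega>)"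
proof
  note [measurable] = Sb_measurable[OF \<omega>]
  show "finite (jumps \<omega> \<inter> {0<..t})" for t using finite_jumps[OF \<omega>] .
  show "0 \<le> jump_part W s \<omega>" for s using Sb_le_S[OF \<omega>, of s] by (simp add: jump_part_def)
  show "0 \<le> drift_part W u \<omega>" for u using lam_pos psi_pos by (simp add: drift_part_def Sb_def)
  show "(\<lambda>u. drift_part W u \<omega>) \<in> borel_measurable borel" unfolding drift_part_def by measurable
  show "\<exists>B. \<forall>u\<in>{0<..t}. drift_part W u \<omega> \<le> B" for t
    using Sb_bounds(1)[OF \<omega>, of _ t] lam_pos psi_pos
    by (intro exI[of _ "lam * \<psi> * exp (\<alpha> * real (N t \<omega>))"] ballI)
       (auto simp: drift_part_def indicator_def intro!: mult_left_mono)
qed (rule rep)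

text \<open>At a jump the price moves by \<open>\<psi> Sb\<close>, and between jumps it drifts at rate \<open>- lam \<psi> Sb\<close>.
  Division by \<open>\<psi> Sb\<close> leaves \<open>g\<close> against the compensated process, restricted to the trading
  times in \<open>V\<close>.\<close>

lemma windowed_gain:
  assumes \<omega>: "\<omega> \<in> \<Omega>" and good: "good \<omega>" and W [measurable]: "W \<in> sets borel"
    and V [measurable]: "V \<in> sets borel" and VW: "V \<subseteq> W" and t: "0 \<le> t"
    and rep: "\<And>t. 0 \<le> t \<Longrightarrow> x t - x 0 = (\<Sum>s\<in>jumps \<omega> \<inter> {0<..t}. jump_part W s \<omega>) - (LINT u:{0<..t}|lborel. drift_part W u \<omega>)"
  shows "has_stieltjes_integral (\<lambda>u. \<phi> u \<omega> * indicator V u) x t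
    ((\<Sum>s\<in>jumps \<omega> \<inter> {0<..t} \<inter> V. g s \<omega>) - (LINT u:{0<..t} \<inter> V|lborel. lam * g u \<omega>))"
proof -
  note [measurable] = Sb_measurable[OF \<omega>] strategy_measurable_path[OF \<omega>] g_measurable[OF \<omega>]
  interpret j: jump_drift_path x "\<lambda>s. jump_part W s \<omega>" "\<lambda>u. drift_part W u \<omega>" "jumps \<omega>"
    by (rule windowed_path[OF \<omega> W rep])
  have "has_stieltjes_integral (\<lambda>u. \<phi> u \<omega> * indicator V u) x t
     ((\<Sum>s\<in>jumps \<omega> \<inter> {0<..t}. jump_part W s \<omega> * (\<phi> s \<omega> * indicator V s))
      - (LINT u:{0<..t}|lborel. drift_part W u \<omega> * (\<phi> u \<omega> * indicator V u)))"
  proof (rule j.has_stieltjes_integral_jump_drift)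
    show "(\<lambda>u. \<phi> u \<omega> * indicator V u) \<in> borel_measurable borel" by measurable
    show "\<bar>\<phi> u \<omega> * indicator V u\<bar> \<le> 1 / (\<psi> * exp (- \<alpha> * \<mu> * t))" if "u \<in> {0<..t}" for u
    proof -
      have "\<bar>\<phi> u \<omega> * indicator V u\<bar> \<le> g u \<omega> / (\<psi> * Sb u \<omega>)"
        using that strategy_eq'[OF \<omega>, of u] g_bounds psi_pos by (auto simp: indicator_def Sb_def)
      also have "\<dots> \<le> 1 / (\<psi> * exp (- \<alpha> * \<mu> * t))"
        using g_bounds Sb_bounds(2)[OF \<omega> that] psi_pos by (intro frac_le mult_left_mono) auto
      finally show ?thesis .
    qed
  qed (rule t)
  moreover have "(\<Sum>s\<in>jumps \<omega> \<inter> {0<..t}. jump_part W s \<omega> * (\<phi> s \<omega> * indicator V s)) = (\<Sum>s\<in>jumps \<omega> \<inter> {0<..t} \<inter> V. g s \<omega>)"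
  proof (rule sum.mono_neutral_cong_right)
    show "finite (jumps \<omega> \<inter> {0<..t})" using finite_jumps[OF \<omega>] .
    fix s assume s: "s \<in> jumps \<omega> \<inter> {0<..t} \<inter> V"
    then have j: "s \<in> jumps \<omega>" by simp
    have "Yb s \<omega> = Y s \<omega> + 1" using jump_size(1)[OF \<omega> good j] by simp
    then have "S s \<omega> = Sb s \<omega> * exp \<alpha>"
      by (simp add: stock_eq Sb_def exp_add[symmetric] algebra_simps)
    moreover have "exp \<alpha> = 1 + \<psi>" using psi_pos by (simp add: \<alpha>_def)
    ultimately have "S s \<omega> - Sb s \<omega> = \<psi> * Sb s \<omega>" by (simp add: algebra_simps)
    moreover have "\<psi> * Sb s \<omega> \<noteq> 0" using psi_pos by (simp add: Sb_def)
    ultimately show "jump_part W s \<omega> * (\<phi> s \<omega> * indicator V s) = g s \<omega>"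
      using s VW strategy_eq'[OF \<omega>, of s] by (auto simp: jump_part_def)
  qed auto
  moreover have "(LINT u:{0<..t}|lborel. drift_part W u \<omega> * (\<phi> u \<omega> * indicator V u)) = (LINT u:{0<..t} \<inter> V|lborel. lam * g u \<omega>)"
    unfolding set_lebesgue_integral_def
  proof (rule Bochner_Integration.integral_cong)
    fix u
    have "\<psi> * Sb u \<omega> \<noteq> 0" using psi_pos by (simp add: Sb_def)
    then show "indicat_real {0<..t} u *\<^sub>R (drift_part W u \<omega> * (\<phi> u \<omega> * indicator V u)) = indicat_real ({0<..t} \<inter> V) u *\<^sub>R (lam * g u \<omega>)"
      using VW strategy_eq'[OF \<omega>, of u] by (auto simp: drift_part_def indicator_def)
  qed simp
  ultimately show ?thesis by simp
qed

end

section \<open>The stochastic integrals\<close>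

lemma has_stieltjes_integral_uminus:
  "has_stieltjes_integral \<theta> x t I \<Longrightarrow> has_stieltjes_integral (\<lambda>s. - \<theta> s) x t (- I)"
proof -
  assume "has_stieltjes_integral \<theta> x t I"
  then obtain f g where "monotone_decomposition x f g"
    "set_integrable (interval_measure f) {0<..t} \<theta>" "set_integrable (interval_measure g) {0<..t} \<theta>"
    "I = (LINT s:{0<..t}|interval_measure f. \<theta> s) - (LINT s:{0<..t}|interval_measure g. \<theta> s)"
    unfolding has_stieltjes_integral_def by blast
  then show ?thesis
    unfolding has_stieltjes_integral_def
    by (intro exI[of _ f] exI[of _ g])
       (simp add: set_integrable_def set_lebesgue_integral_def)
qed

text \<open>The time \<open>t \<and> c\<close>.\<close>

definition cut :: "ennreal \<Rightarrow> real \<Rightarrow> real" where "cut c t = enn2real (min (ennreal t) c)"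

lemma ennreal_cut: "ennreal (cut c t) = min (ennreal t) c"
  unfolding cut_def by (rule ennreal_enn2real) (simp add: min_less_iff_disj)

lemma cut_nonneg: "0 \<le> cut c t" by (simp add: cut_def)

lemma le_cut_iff: "0 \<le> s \<Longrightarrow> 0 \<le> t \<Longrightarrow> s \<le> cut c t \<longleftrightarrow> s \<le> t \<and> ennreal s \<le> c"
  by (metis cut_nonneg ennreal_cut ennreal_le_iff min.bounded_iff)

lemma cut_ennreal: "0 \<le> s \<Longrightarrow> 0 \<le> t \<Longrightarrow> cut (ennreal s) t = min t s"
  by (auto simp: cut_def min_def)

lemma cut_top: "0 \<le> t \<Longrightarrow> cut \<infinity> t = t"
  by (simp add: cut_def)

lemma stopped_cut: "stopped c X t \<omega> = X (cut (c \<omega>) t) \<omega>"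
  by (simp add: stopped_def cut_def)

lemma cadlag_cut:
  assumes f: "cadlag f" shows "cadlag (\<lambda>t. f (cut c t))"
proof (cases c)
  case (real s)
  have r: "continuous (at_right t) (\<lambda>t. f (cut c t))" if t: "0 \<le> t" for t
  proof (cases "t < s")
    case True
    have "((\<lambda>t. f t) \<longlongrightarrow> f t) (at_right t)" using f t by (auto simp: cadlag_def continuous_within)
    moreover have "eventually (\<lambda>u. f u = f (cut c u)) (at_right t)"
      using True t real by (auto simp: eventually_at_right_field cut_ennreal intro!: exI[of _ s])
    ultimately have "((\<lambda>u. f (cut c u)) \<longlongrightarrow> f t) (at_right t)" by (rule Lim_transform_eventually)
    then show ?thesis using True t real by (simp add: continuous_within cut_ennreal min_def)
  next
    case False
    have "eventually (\<lambda>u. f (cut c u) = f (cut c t)) (at_right t)"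
      using False t real by (auto simp: eventually_at_right_field cut_ennreal intro!: exI[of _ "t + 1"])
    then show ?thesis unfolding continuous_within by (rule tendsto_eventually)
  qed
  have l: "\<exists>l. ((\<lambda>t. f (cut c t)) \<longlongrightarrow> l) (at_left t)" if t: "0 < t" for t
  proof (cases "t \<le> s")
    case True
    obtain l where l: "(f \<longlongrightarrow> l) (at_left t)" using f t by (auto simp: cadlag_def)
    have "eventually (\<lambda>u. f u = f (cut c u)) (at_left t)"
      using True t real by (auto simp: eventually_at_left_field cut_ennreal intro!: exI[of _ 0])
    from Lim_transform_eventually[OF l this] show ?thesis by (rule exI)
  next
    case False
    have "eventually (\<lambda>u. f (cut c u) = f s) (at_left t)"
      using False t real by (auto simp: eventually_at_left_field cut_ennreal intro!: exI[of _ s])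
    then show ?thesis by (intro exI tendsto_eventually)
  qed
  show ?thesis unfolding cadlag_def using r l by blast
next
  case top
  have r: "continuous (at_right t) (\<lambda>t. f (cut c t))" if t: "0 \<le> t" for t
  proof -
    have "((\<lambda>t. f t) \<longlongrightarrow> f t) (at_right t)" using f t by (auto simp: cadlag_def continuous_within)
    moreover have "eventually (\<lambda>u. f u = f (cut c u)) (at_right t)"
      using t top cut_top by (auto simp: eventually_at_right_field intro!: exI[of _ "t + 1"])
    ultimately have "((\<lambda>u. f (cut c u)) \<longlongrightarrow> f t) (at_right t)" by (rule Lim_transform_eventually)
    then show ?thesis using t top cut_top by (simp add: continuous_within)
  qed
  have l: "\<exists>l. ((\<lambda>t. f (cut c t)) \<longlongrightarrow> l) (at_left t)" if t: "0 < t" for t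
  proof -
    obtain l where l: "(f \<longlongrightarrow> l) (at_left t)" using f t by (auto simp: cadlag_def)
    have "eventually (\<lambda>u. f u = f (cut c u)) (at_left t)"
      using t top cut_top by (auto simp: eventually_at_left_field intro!: exI[of _ 0])
    from Lim_transform_eventually[OF l this] show ?thesis by (rule exI)
  qed
  show ?thesis unfolding cadlag_def using r l by blast
qed

lemma continuous_left_of_bool_le:
  assumes "0 < t"
  shows "continuous (at_left t) (\<lambda>t. of_bool (ennreal t \<le> c) :: real)"
proof (cases "ennreal t \<le> c")
  case True
  have "eventually (\<lambda>s. of_bool (ennreal s \<le> c) = (of_bool (ennreal t \<le> c) :: real)) (at_left t)"
    unfolding eventually_at_left_field
    using True by (intro exI[of _ "t - 1"]) (auto intro: order_trans[OF ennreal_leI[OF less_imp_le]])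
  then show ?thesis unfolding continuous_within by (rule tendsto_eventually)
next
  case False
  then have "c < ennreal t" by simp
  also have "\<dots> \<le> \<infinity>" by simp
  finally have "c < \<infinity>" .
  then obtain s where s: "c = ennreal s" "0 \<le> s" by (cases c) auto
  then have "s < t" using False assms by (auto simp: not_le ennreal_less_iff)
  then have "eventually (\<lambda>u. of_bool (ennreal u \<le> c) = (of_bool (ennreal t \<le> c) :: real)) (at_left t)"
    unfolding eventually_at_left_field
    using s False by (intro exI[of _ s]) auto
  then show ?thesis unfolding continuous_within by (rule tendsto_eventually)
qed

lemma predictable_process_left_continuous:
  assumes "adapted K X" "\<And>\<omega> t. \<omega> \<in> \<Omega> \<Longrightarrow> 0 < t \<Longrightarrow> continuous (at_left t) (\<lambda>t. X t \<omega>)"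
  shows "predictable_process \<Omega> K X"
  unfolding predictable_process_def
proof (rule measurableI)
  fix B :: "real set" assume B: "B \<in> sets borel"
  let ?G = "{{(t, \<omega>). 0 \<le> t \<and> \<omega> \<in> \<Omega> \<and> X t \<omega> \<in> B} | X B.
        adapted K X \<and> (\<forall>\<omega>\<in>\<Omega>. \<forall>t>0. continuous (at_left t) (\<lambda>t. X t \<omega>)) \<and> B \<in> sets borel}"
  have "(\<lambda>(t, \<omega>). X t \<omega>) -` B \<inter> space (predictable_sigma \<Omega> K) = {(t, \<omega>). 0 \<le> t \<and> \<omega> \<in> \<Omega> \<and> X t \<omega> \<in> B}"
    by (auto simp: predictable_sigma_def space_measure_of_conv)
  also have "\<dots> \<in> ?G" using assms B by blast
  also have "?G \<subseteq> sets (predictable_sigma \<Omega> K)"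
    unfolding predictable_sigma_def by (subst sets_measure_of) auto
  finally show "(\<lambda>(t, \<omega>). X t \<omega>) -` B \<inter> space (predictable_sigma \<Omega> K) \<in> sets (predictable_sigma \<Omega> K)" .
qed simp

lemma predictable_process_mult:
  "predictable_process \<Omega> K X \<Longrightarrow> predictable_process \<Omega> K Z \<Longrightarrow> predictable_process \<Omega> K (\<lambda>t \<omega>. X t \<omega> * Z t \<omega>)"
  unfolding predictable_process_def using borel_measurable_times[of "\<lambda>(t, \<omega>). X t \<omega>" _ "\<lambda>(t, \<omega>). Z t \<omega>"]
  by (simp add: case_prod_beta')

context barrier_market
begin

abbreviation "G \<equiv> progressive_enlargement \<Omega> F \<tau>"

text \<open>By completeness of \<open>M\<close> the exceptional outcomes form a null set all of whose subsets are
  events.\<close>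

lemma AE_set:
  assumes "AE \<omega> in M. P \<omega> \<longleftrightarrow> \<omega> \<in> E" "E \<in> events"
  shows "{\<omega> \<in> \<Omega>. P \<omega>} \<in> events" "prob {\<omega> \<in> \<Omega>. P \<omega>} = prob E"
proof -
  interpret C: complete_measure M by (rule complete)
  obtain Z where Z: "{\<omega> \<in> \<Omega>. \<not> (P \<omega> \<longleftrightarrow> \<omega> \<in> E)} \<subseteq> Z" "Z \<in> null_sets M"
    using assms(1) by (elim AE_E) auto
  have "{\<omega> \<in> \<Omega>. P \<omega>} \<inter> Z \<in> events" using Z(2) by (intro C.complete[of _ Z]) auto
  moreover have "{\<omega> \<in> \<Omega>. P \<omega>} = (E - Z) \<union> ({\<omega> \<in> \<Omega>. P \<omega>} \<inter> Z)"
    using Z(1) sets.sets_into_space[OF assms(2)] by blast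
  ultimately show m: "{\<omega> \<in> \<Omega>. P \<omega>} \<in> events" using Z(2) assms(2) by (metis null_setsD2 sets.Diff sets.Un)
  show "prob {\<omega> \<in> \<Omega>. P \<omega>} = prob E"
    using assms m by (intro finite_measure_eq_AE) auto
qed

subsection \<open>The gains before and after \<open>\<tau>\<close>\<close>

lemma cut_window: "0 \<le> t \<Longrightarrow> {0<..t} \<inter> {s. ennreal s \<le> c} = {0<..cut c t}"
  by (auto simp: le_cut_iff dest: less_imp_le)

lemma stopped_stock_representation:
  assumes \<omega>: "\<omega> \<in> \<Omega>" and t: "0 \<le> t"
  shows "stopped \<tau> S t \<omega> - stopped \<tau> S 0 \<omega>
    = (\<Sum>s\<in>jumps \<omega> \<inter> {0<..t}. jump_part {s. ennreal s \<le> \<tau> \<omega>} s \<omega>)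
      - (LINT u:{0<..t}|lborel. drift_part {s. ennreal s \<le> \<tau> \<omega>} u \<omega>)"
proof -
  let ?W = "{s. ennreal s \<le> \<tau> \<omega>}" and ?t = "cut (\<tau> \<omega>) t"
  have c: "{0<..t} \<inter> ?W = {0<..?t}" by (rule cut_window[OF t])
  have "(\<Sum>s\<in>jumps \<omega> \<inter> {0<..t}. jump_part ?W s \<omega>) = (\<Sum>s\<in>jumps \<omega> \<inter> {0<..?t}. jump_part UNIV s \<omega>)"
    unfolding c[symmetric]
    by (rule sum.mono_neutral_cong_right) (auto simp: finite_jumps[OF \<omega>] jump_part_def)
  moreover have "(LINT u:{0<..t}|lborel. drift_part ?W u \<omega>) = (LINT u:{0<..?t}|lborel. drift_part UNIV u \<omega>)"
    unfolding c[symmetric] set_lebesgue_integral_def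
    by (intro Bochner_Integration.integral_cong) (auto simp: drift_part_def indicator_def)
  moreover have "stopped \<tau> S 0 \<omega> = S 0 \<omega>" by (simp add: stopped_def)
  ultimately show ?thesis
    using stock_representation[OF \<omega> cut_nonneg, of "\<tau> \<omega>" t] by (simp add: stopped_cut)
qed

lemma after_stock_representation:
  assumes \<omega>: "\<omega> \<in> \<Omega>" and t: "0 \<le> t"
  shows "(S t \<omega> - stopped \<tau> S t \<omega>) - (S 0 \<omega> - stopped \<tau> S 0 \<omega>)
    = (\<Sum>s\<in>jumps \<omega> \<inter> {0<..t}. jump_part (- {s. ennreal s \<le> \<tau> \<omega>}) s \<omega>)
      - (LINT u:{0<..t}|lborel. drift_part (- {s. ennreal s \<le> \<tau> \<omega>}) u \<omega>)"
proof -
  let ?W = "{s. ennreal s \<le> \<tau> \<omega>}"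
  interpret A: jump_drift_path "\<lambda>t. S t \<omega>" "\<lambda>s. jump_part UNIV s \<omega>" "\<lambda>u. drift_part UNIV u \<omega>" "jumps \<omega>"
    by (rule windowed_path[OF \<omega>]) (auto simp: stock_representation[OF \<omega>])
  interpret B: jump_drift_path "\<lambda>t. stopped \<tau> S t \<omega>" "\<lambda>s. jump_part ?W s \<omega>" "\<lambda>u. drift_part ?W u \<omega>" "jumps \<omega>"
    by (rule windowed_path[OF \<omega>]) (use stopped_stock_representation[OF \<omega>] in auto)
  have j: "jump_part (- ?W) s \<omega> = jump_part UNIV s \<omega> - jump_part ?W s \<omega>" for s
    by (simp add: jump_part_def)
  have d: "drift_part (- ?W) u \<omega> = drift_part UNIV u \<omega> - drift_part ?W u \<omega>" for u
    by (simp add: drift_part_def indicator_def)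
  have "(LINT u:{0<..t}|lborel. drift_part (- ?W) u \<omega>)
      = (LINT u:{0<..t}|lborel. drift_part UNIV u \<omega>) - (LINT u:{0<..t}|lborel. drift_part ?W u \<omega>)"
    unfolding d by (intro set_integral_diff A.integrable_drift' B.integrable_drift')
  then show ?thesis
    using stock_representation[OF \<omega> t] stopped_stock_representation[OF \<omega> t]
    by (simp add: j sum_subtractf)
qed

lemma before_integral:
  assumes \<omega>: "\<omega> \<in> \<Omega>" and good: "good \<omega>" and t: "0 \<le> t"
  shows "has_stieltjes_integral (\<lambda>u. \<phi> u \<omega> * of_bool (ennreal u \<le> \<tau> \<omega>)) (\<lambda>u. stopped \<tau> S u \<omega>) t (gain (cut (\<tau> \<omega>) t) \<omega>)"
    and "stochastic_integral (\<lambda>u \<omega>. \<phi> u \<omega> * of_bool (ennreal u \<le> \<tau> \<omega>)) (stopped \<tau> S) t \<omega> = gain (cut (\<tau> \<omega>) t) \<omega>"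
proof -
  let ?V = "{s. ennreal s \<le> \<tau> \<omega>}"
  note [measurable] = strategy_measurable_path[OF \<omega>]
  have eq: "(\<lambda>u. \<phi> u \<omega> * of_bool (ennreal u \<le> \<tau> \<omega>)) = (\<lambda>u. \<phi> u \<omega> * indicator ?V u)"
    by (simp add: indicator_def)
  have "has_stieltjes_integral (\<lambda>u. \<phi> u \<omega> * indicator ?V u) (\<lambda>u. stopped \<tau> S u \<omega>) t
    ((\<Sum>s\<in>jumps \<omega> \<inter> {0<..t} \<inter> ?V. g s \<omega>) - (LINT u:{0<..t} \<inter> ?V|lborel. lam * g u \<omega>))"
    using \<omega> good t by (intro windowed_gain[where W = ?V]) (auto simp: stopped_stock_representation[OF \<omega>])
  then show *: "has_stieltjes_integral (\<lambda>u. \<phi> u \<omega> * of_bool (ennreal u \<le> \<tau> \<omega>)) (\<lambda>u. stopped \<tau> S u \<omega>) t (gain (cut (\<tau> \<omega>) t) \<omega>)"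
    unfolding eq by (simp only: gain_def Int_assoc cut_window[OF t])
  show "stochastic_integral (\<lambda>u \<omega>. \<phi> u \<omega> * of_bool (ennreal u \<le> \<tau> \<omega>)) (stopped \<tau> S) t \<omega> = gain (cut (\<tau> \<omega>) t) \<omega>"
    by (rule stochastic_integral_eqI, rule *, rule t, measurable)
qed

lemma gain_split:
  assumes \<omega>: "\<omega> \<in> \<Omega>" and st: "0 \<le> s" "s \<le> t"
  shows "(\<Sum>r\<in>jumps \<omega> \<inter> {s<..t}. g r \<omega>) - (LINT u:{s<..t}|lborel. lam * g u \<omega>) = gain t \<omega> - gain s \<omega>"
proof -
  have un: "{0<..t} = {0<..s} \<union> {s<..t}" using st by auto
  have fin: "finite (jumps \<omega> \<inter> {0<..s})" "finite (jumps \<omega> \<inter> {s<..t})"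
    by (rule finite_subset[OF _ finite_jumps[OF \<omega>, of t]]; use st in auto)+
  have "(\<Sum>r\<in>jumps \<omega> \<inter> {0<..t}. g r \<omega>) = (\<Sum>r\<in>jumps \<omega> \<inter> {0<..s}. g r \<omega>) + (\<Sum>r\<in>jumps \<omega> \<inter> {s<..t}. g r \<omega>)"
    unfolding un Int_Un_distrib using fin by (intro sum.union_disjoint) auto
  moreover have i: "set_integrable lborel {r<..v} (\<lambda>u. lam * g u \<omega>)" for r v
  proof -
    note [measurable] = g_measurable[OF \<omega>]
    have "\<bar>lam * g u \<omega>\<bar> \<le> lam" for u
      using g_bounds[of u \<omega>] lam_pos mult_left_mono[of "g u \<omega>" 1 lam] by (simp add: abs_mult)
    then show ?thesis
      unfolding set_integrable_def
      by (cases "r \<le> v"; intro integrableI_bounded_set_indicator[where B = lam]) auto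
  qed
  have "(LINT u:{0<..t}|lborel. lam * g u \<omega>) = (LINT u:{0<..s}|lborel. lam * g u \<omega>) + (LINT u:{s<..t}|lborel. lam * g u \<omega>)"
    unfolding un by (intro set_integral_Un i) auto
  ultimately show ?thesis by (simp add: gain_def)
qed

lemma after_integral:
  assumes \<omega>: "\<omega> \<in> \<Omega>" and good: "good \<omega>" and t: "0 \<le> t" and \<nu>: "\<tau> \<omega> \<le> \<nu> \<omega>"
  shows "has_stieltjes_integral (\<lambda>u. - \<phi> u \<omega> * of_bool (\<tau> \<omega> < ennreal u \<and> ennreal u \<le> \<nu> \<omega>))
      (\<lambda>u. S u \<omega> - stopped \<tau> S u \<omega>) t (gain (cut (\<tau> \<omega>) t) \<omega> - gain (cut (\<nu> \<omega>) t) \<omega>)"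
    and "stochastic_integral (\<lambda>u \<omega>. - \<phi> u \<omega> * of_bool (\<tau> \<omega> < ennreal u \<and> ennreal u \<le> \<nu> \<omega>))
      (\<lambda>u \<omega>. S u \<omega> - stopped \<tau> S u \<omega>) t \<omega> = gain (cut (\<tau> \<omega>) t) \<omega> - gain (cut (\<nu> \<omega>) t) \<omega>"
proof -
  let ?W = "- {s. ennreal s \<le> \<tau> \<omega>}" and ?V = "{s. ennreal s \<le> \<nu> \<omega>} - {s. ennreal s \<le> \<tau> \<omega>}"
  note [measurable] = strategy_measurable_path[OF \<omega>]
  have eq: "(\<lambda>u. - \<phi> u \<omega> * of_bool (\<tau> \<omega> < ennreal u \<and> ennreal u \<le> \<nu> \<omega>)) = (\<lambda>u. - (\<phi> u \<omega> * indicator ?V u))"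
    by (auto simp: indicator_def not_le)
  have cut: "{0<..t} \<inter> ?V = {cut (\<tau> \<omega>) t<..cut (\<nu> \<omega>) t}"
  proof -
    have "{0<..t} \<inter> ?V = ({0<..t} \<inter> {s. ennreal s \<le> \<nu> \<omega>}) - ({0<..t} \<inter> {s. ennreal s \<le> \<tau> \<omega>})" by auto
    also have "\<dots> = {0<..cut (\<nu> \<omega>) t} - {0<..cut (\<tau> \<omega>) t}" by (simp only: cut_window[OF t])
    also have "\<dots> = {cut (\<tau> \<omega>) t<..cut (\<nu> \<omega>) t}" using cut_nonneg[of "\<tau> \<omega>" t] by auto
    finally show ?thesis .
  qed
  have le: "cut (\<tau> \<omega>) t \<le> cut (\<nu> \<omega>) t"
    using le_cut_iff[of "cut (\<tau> \<omega>) t" t "\<nu> \<omega>"] le_cut_iff[of "cut (\<tau> \<omega>) t" t "\<tau> \<omega>"] cut_nonneg t \<nu> by auto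
  have "has_stieltjes_integral (\<lambda>u. \<phi> u \<omega> * indicator ?V u) (\<lambda>u. S u \<omega> - stopped \<tau> S u \<omega>) t
    ((\<Sum>s\<in>jumps \<omega> \<inter> {0<..t} \<inter> ?V. g s \<omega>) - (LINT u:{0<..t} \<inter> ?V|lborel. lam * g u \<omega>))"
  proof (rule windowed_gain[where W = ?W])
    show "S t \<omega> - stopped \<tau> S t \<omega> - (S 0 \<omega> - stopped \<tau> S 0 \<omega>)
      = (\<Sum>s\<in>jumps \<omega> \<inter> {0<..t}. jump_part ?W s \<omega>) - (LINT u:{0<..t}|lborel. drift_part ?W u \<omega>)" if "0 \<le> t" for t
      by (rule after_stock_representation[OF \<omega> that])
  qed (use \<omega> good t in auto)
  then have "has_stieltjes_integral (\<lambda>u. \<phi> u \<omega> * indicator ?V u) (\<lambda>u. S u \<omega> - stopped \<tau> S u \<omega>) t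
      (gain (cut (\<nu> \<omega>) t) \<omega> - gain (cut (\<tau> \<omega>) t) \<omega>)"
    by (simp only: Int_assoc cut gain_split[OF \<omega> cut_nonneg le])
  from has_stieltjes_integral_uminus[OF this]
  show *: "has_stieltjes_integral (\<lambda>u. - \<phi> u \<omega> * of_bool (\<tau> \<omega> < ennreal u \<and> ennreal u \<le> \<nu> \<omega>))
      (\<lambda>u. S u \<omega> - stopped \<tau> S u \<omega>) t (gain (cut (\<tau> \<omega>) t) \<omega> - gain (cut (\<nu> \<omega>) t) \<omega>)"
    unfolding eq by simp
  show "stochastic_integral (\<lambda>u \<omega>. - \<phi> u \<omega> * of_bool (\<tau> \<omega> < ennreal u \<and> ennreal u \<le> \<nu> \<omega>))
      (\<lambda>u \<omega>. S u \<omega> - stopped \<tau> S u \<omega>) t \<omega> = gain (cut (\<tau> \<omega>) t) \<omega> - gain (cut (\<nu> \<omega>) t) \<omega>"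
    by (rule stochastic_integral_eqI, rule *, rule t, measurable)
qed

lemma gain_lower_bound: "\<omega> \<in> \<Omega> \<Longrightarrow> good \<omega> \<Longrightarrow> 0 \<le> t \<Longrightarrow> - 1 \<le> gain t \<omega>"
  using gain_eq[of \<omega> t] h_bounds(1)[of "Y t \<omega>"] Psi_0_bounds(2) mult_nonneg_nonneg[of "1 - \<Psi> 0" "real (hits t \<omega>)"] by simp

text \<open>At \<open>\<tau>\<close> the surplus is at \<open>a\<close>, where \<open>h\<close> is \<open>\<Psi> 0\<close>, and this time is itself one of the hits.\<close>

lemma before_terminal:
  assumes \<omega>: "\<omega> \<in> \<Omega>" and good: "good \<omega>"
  shows "((\<lambda>t. stochastic_integral (\<lambda>u \<omega>. \<phi> u \<omega> * of_bool (ennreal u \<le> \<tau> \<omega>)) (stopped \<tau> S) t \<omega>)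
    \<longlongrightarrow> (1 - \<Psi> 0) * (real (hits (enn2real (\<tau> \<omega>)) \<omega>) - 1)) at_top"
    and "1 \<le> hits (enn2real (\<tau> \<omega>)) \<omega>"
proof -
  obtain s where s: "\<tau> \<omega> = ennreal s" "0 < s" using good_tau_finite[OF good \<omega>] by blast
  have Ys: "Y s \<omega> = a" using tau_eq_a(1)[OF \<omega> s(1)] s(2) by simp
  have "eventually (\<lambda>t. stochastic_integral (\<lambda>u \<omega>. \<phi> u \<omega> * of_bool (ennreal u \<le> \<tau> \<omega>)) (stopped \<tau> S) t \<omega> = gain s \<omega>) at_top"
    using eventually_ge_at_top[of s]
  proof eventually_elim
    case (elim t)
    then have "cut (\<tau> \<omega>) t = s" using s by (simp add: cut_ennreal)
    then show ?case using before_integral(2)[OF \<omega> good, of t] elim s by simp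
  qed
  moreover have "gain s \<omega> = (1 - \<Psi> 0) * (real (hits (enn2real (\<tau> \<omega>)) \<omega>) - 1)"
    using gain_eq[OF \<omega> good, of s] s Ys by (simp add: h_a algebra_simps)
  ultimately show "((\<lambda>t. stochastic_integral (\<lambda>u \<omega>. \<phi> u \<omega> * of_bool (ennreal u \<le> \<tau> \<omega>)) (stopped \<tau> S) t \<omega>)
    \<longlongrightarrow> (1 - \<Psi> 0) * (real (hits (enn2real (\<tau> \<omega>)) \<omega>) - 1)) at_top"
    by (simp add: tendsto_eventually)
  have "s \<in> {u \<in> {0<..s}. Y u \<omega> = a}" using s Ys by simp
  then have "hits s \<omega> \<noteq> 0" unfolding hits_def using finite_crossings[OF \<omega>] by (metis card_0_eq empty_iff)
  then show "1 \<le> hits (enn2real (\<tau> \<omega>)) \<omega>" using s by simp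
qed

text \<open>No hits are added after \<open>\<tau>\<close>.\<close>

lemma after_gain:
  assumes \<omega>: "\<omega> \<in> \<Omega>" and good: "good \<omega>" and s: "\<tau> \<omega> = ennreal s" "0 < s" and st: "s \<le> t"
  shows "gain s \<omega> - gain t \<omega> = \<Psi> 0 - h (Y t \<omega>)" "h (Y t \<omega>) \<le> \<Psi> 0"
proof -
  have Ys: "Y s \<omega> = a" and after: "\<And>u. s < u \<Longrightarrow> a < Y u \<omega>" using tau_eq_a[OF \<omega> s(1)] s(2) by auto
  have "{u \<in> {0<..t}. Y u \<omega> = a} = {u \<in> {0<..s}. Y u \<omega> = a}"
    using st after by (force simp: not_le[symmetric])
  then have "hits t \<omega> = hits s \<omega>" by (simp add: hits_def)
  then show "gain s \<omega> - gain t \<omega> = \<Psi> 0 - h (Y t \<omega>)"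
    using gain_eq[OF \<omega> good, of s] gain_eq[OF \<omega> good, of t] s st Ys by (simp add: h_a)
  have "a \<le> Y t \<omega>" using after[of t] Ys st by (cases "s = t") auto
  then show "h (Y t \<omega>) \<le> \<Psi> 0" using h_antimono[of a "Y t \<omega>"] by (simp add: h_a)
qed

lemma after_terminal:
  assumes \<omega>: "\<omega> \<in> \<Omega>" and good: "good \<omega>" and \<nu>: "\<tau> \<omega> \<le> \<nu> \<omega>"
  shows "0 \<le> t \<Longrightarrow> 0 \<le> stochastic_integral (\<lambda>u \<omega>. - \<phi> u \<omega> * of_bool (\<tau> \<omega> < ennreal u \<and> ennreal u \<le> \<nu> \<omega>))
      (\<lambda>u \<omega>. S u \<omega> - stopped \<tau> S u \<omega>) t \<omega>"
    and "((\<lambda>t. stochastic_integral (\<lambda>u \<omega>. - \<phi> u \<omega> * of_bool (\<tau> \<omega> < ennreal u \<and> ennreal u \<le> \<nu> \<omega>))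
      (\<lambda>u \<omega>. S u \<omega> - stopped \<tau> S u \<omega>) t \<omega>) \<longlongrightarrow> (\<Psi> 0 - (if \<nu> \<omega> < \<infinity> then h (Y (enn2real (\<nu> \<omega>)) \<omega>) else 0))) at_top"
proof -
  obtain s where s: "\<tau> \<omega> = ennreal s" "0 < s" using good_tau_finite[OF good \<omega>] by blast
  let ?I = "\<lambda>t. stochastic_integral (\<lambda>u \<omega>. - \<phi> u \<omega> * of_bool (\<tau> \<omega> < ennreal u \<and> ennreal u \<le> \<nu> \<omega>))
      (\<lambda>u \<omega>. S u \<omega> - stopped \<tau> S u \<omega>) t \<omega>"
  have I: "?I t = \<Psi> 0 - h (Y (cut (\<nu> \<omega>) t) \<omega>)" "h (Y (cut (\<nu> \<omega>) t) \<omega>) \<le> \<Psi> 0" if "s \<le> t" for t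
  proof -
    have "cut (\<tau> \<omega>) t = s" using s that by (simp add: cut_ennreal)
    moreover have "s \<le> cut (\<nu> \<omega>) t" using le_cut_iff[of s t "\<nu> \<omega>"] s that \<nu> by simp
    ultimately show "?I t = \<Psi> 0 - h (Y (cut (\<nu> \<omega>) t) \<omega>)" "h (Y (cut (\<nu> \<omega>) t) \<omega>) \<le> \<Psi> 0"
      using after_integral(2)[where \<nu> = \<nu> and \<omega> = \<omega> and t = t, OF \<omega> good _ \<nu>] after_gain[OF \<omega> good s, of "cut (\<nu> \<omega>) t"] that s by auto
  qed
  show "0 \<le> ?I t" if t: "0 \<le> t"
  proof (cases "s \<le> t")
    case True then show ?thesis using I by simp
  next
    case False
    have "cut (\<tau> \<omega>) t = t" using False s t by (simp add: cut_ennreal)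
    moreover have "cut (\<nu> \<omega>) t = t"
    proof -
      have "ennreal t \<le> \<nu> \<omega>" using False s \<nu> by (metis ennreal_leI less_eq_real_def linorder_le_cases order_trans)
      then show ?thesis using t by (simp add: cut_def min_def)
    qed
    ultimately show ?thesis using after_integral(2)[where \<nu> = \<nu> and \<omega> = \<omega> and t = t, OF \<omega> good t \<nu>] by simp
  qed
  show "(?I \<longlongrightarrow> (\<Psi> 0 - (if \<nu> \<omega> < \<infinity> then h (Y (enn2real (\<nu> \<omega>)) \<omega>) else 0))) at_top"
  proof (cases "\<nu> \<omega>")
    case (real r)
    have "eventually (\<lambda>t. ?I t = \<Psi> 0 - h (Y r \<omega>)) at_top"
      using eventually_ge_at_top[of "max r s"]
    proof eventually_elim
      case (elim t)
      then show ?case using I(1)[of t] real s by (simp add: cut_ennreal min_absorb2)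
    qed
    then show ?thesis using real by (simp add: tendsto_eventually)
  next
    case top
    have "filterlim (\<lambda>t. Y t \<omega> - a) at_top at_top"
      using good filterlim_tendsto_add_at_top[OF tendsto_const[of "-a"], of "\<lambda>t. Y t \<omega>"] by (simp add: good_def)
    from filterlim_compose[OF Psi_tendsto_0 this]
    have "((\<lambda>t. \<Psi> 0 - h (Y t \<omega>)) \<longlongrightarrow> \<Psi> 0 - 0) at_top"
      unfolding h_def by (intro tendsto_intros)
    moreover have "eventually (\<lambda>t. ?I t = \<Psi> 0 - h (Y t \<omega>)) at_top"
      using eventually_ge_at_top[of s]
    proof eventually_elim
      case (elim t)
      then show ?case using I(1)[of t] top s cut_top[of t] by simp
    qed
    ultimately show ?thesis using top by (simp add: tendsto_cong)
  qed
qed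

subsection \<open>Measurability in the enlarged filtration\<close>

lemma sets_G: "sets (G t) = (\<Inter>\<epsilon>\<in>{0::real<..}. sigma_sets \<Omega>
        (sets (F (t + ennreal \<epsilon>)) \<union>
         {(\<lambda>\<omega>. min (\<tau> \<omega>) (t + ennreal \<epsilon>)) -` B \<inter> \<Omega> | B. B \<in> sets borel}))" (is "_ = ?I")
proof -
  let ?A = "\<lambda>\<epsilon>. sets (F (t + ennreal \<epsilon>)) \<union> {(\<lambda>\<omega>. min (\<tau> \<omega>) (t + ennreal \<epsilon>)) -` B \<inter> \<Omega> | B. B \<in> sets borel}"
  have sub: "?A \<epsilon> \<subseteq> Pow \<Omega>" for \<epsilon> using sets.space_closed[of "F (t + ennreal \<epsilon>)"] by auto
  have c: "?I \<subseteq> Pow \<Omega>"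
  proof
    fix A assume "A \<in> ?I"
    then have "A \<in> sigma_sets \<Omega> (?A 1)" by (rule INT_D) simp
    then show "A \<in> Pow \<Omega>" using sigma_sets_into_sp[OF sub] by blast
  qed
  have "sigma_algebra \<Omega> ?I"
    unfolding sigma_algebra_iff2
  proof (intro conjI c ballI allI impI)
    show "{} \<in> ?I" by (auto intro: sigma_sets.Empty)
    show "\<Omega> - X \<in> ?I" if "X \<in> ?I" for X using that by (auto intro: sigma_sets.Compl)
    show "(\<Union>i. X i) \<in> ?I" if "range X \<subseteq> ?I" for X :: "nat \<Rightarrow> _"
      using that by (auto intro!: sigma_sets.Union)
  qed
  then have "sigma_sets \<Omega> ?I = ?I" by (rule sigma_algebra.sigma_sets_eq)
  then show ?thesis unfolding progressive_enlargement_def by (simp add: sets_measure_of c)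
qed

lemma space_G [simp]: "space (G t) = \<Omega>"
  by (simp add: progressive_enlargement_def space_measure_of_conv)

lemma F_subset_G: "sets (F t) \<subseteq> sets (G t)"
proof
  fix A assume A: "A \<in> sets (F t)"
  have "A \<in> sets (F (t + ennreal \<epsilon>))" for \<epsilon>
    using A sets_F_mono[of t "t + ennreal \<epsilon>"] by (auto simp: le_add1)
  then show "A \<in> sets (G t)" unfolding sets_G by (auto intro: sigma_sets.Basic)
qed

lemma tau_le_G: "c \<le> t \<Longrightarrow> t < \<infinity> \<Longrightarrow> {\<omega> \<in> \<Omega>. \<tau> \<omega> \<le> c} \<in> sets (G t)"
  unfolding sets_G
proof (intro INT_I sigma_sets.Basic UnI2 CollectI exI conjI)
  fix \<epsilon> :: real assume "c \<le> t" "t < \<infinity>" "\<epsilon> \<in> {0<..}"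
  then have "c < t + ennreal \<epsilon>" by (cases t) (auto simp: ennreal_plus[symmetric] ennreal_less_iff intro!: le_less_trans[of c t] simp del: ennreal_plus)
  then show "{\<omega> \<in> \<Omega>. \<tau> \<omega> \<le> c} = (\<lambda>\<omega>. min (\<tau> \<omega>) (t + ennreal \<epsilon>)) -` {..c} \<inter> \<Omega>"
    by (auto simp: min_le_iff_disj)
qed simp

lemma tau_less_G: "c \<le> t \<Longrightarrow> {\<omega> \<in> \<Omega>. \<tau> \<omega> < c} \<in> sets (G t)"
  unfolding sets_G
proof (intro INT_I sigma_sets.Basic UnI2 CollectI exI conjI)
  fix \<epsilon> :: real assume "c \<le> t" "\<epsilon> \<in> {0<..}"
  then have "c \<le> t + ennreal \<epsilon>" by (metis add_increasing2 zero_le)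
  then show "{\<omega> \<in> \<Omega>. \<tau> \<omega> < c} = (\<lambda>\<omega>. min (\<tau> \<omega>) (t + ennreal \<epsilon>)) -` {..<c} \<inter> \<Omega>"
    by (auto simp: min_less_iff_disj)
qed simp

lemma S_measurable_F: "0 \<le> s \<Longrightarrow> ennreal s \<le> t \<Longrightarrow> S s \<in> borel_measurable (F t)"
proof -
  assume "0 \<le> s" "ennreal s \<le> t"
  then have [measurable]: "N s \<in> measurable (F t) (count_space UNIV)" by (rule N_measurable_F)
  show ?thesis unfolding stock_def[abs_def] by measurable
qed

lemma Y_measurable_F: "0 \<le> s \<Longrightarrow> ennreal s \<le> t \<Longrightarrow> Y s \<in> borel_measurable (F t)"
proof -
  assume "0 \<le> s" "ennreal s \<le> t"
  then have [measurable]: "N s \<in> measurable (F t) (count_space UNIV)" by (rule N_measurable_F)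
  show ?thesis unfolding surplus_def[abs_def] by measurable
qed

lemma measurable_F_G: "X \<in> borel_measurable (F t) \<Longrightarrow> X \<in> borel_measurable (G t)"
  using F_subset_G[of t] measurable_mono[of borel borel "F t" "G t"] by auto

lemma adapted_stock: "adapted G S"
  unfolding adapted_def by (auto intro: measurable_F_G S_measurable_F)

lemma adapted_stopped: "adapted G (stopped \<tau> S)"
  unfolding adapted_def
proof (intro allI impI)
  fix t :: real assume t: "0 \<le> t"
  show "stopped \<tau> S t \<in> borel_measurable (G (ennreal t))"
  proof (rule measurableI)
    fix B :: "real set" assume B: "B \<in> sets borel"
    have SB: "{\<omega> \<in> \<Omega>. S s \<omega> \<in> B} \<in> sets (G (ennreal t))" if "0 \<le> s" "s \<le> t" for s
      using measurable_sets[OF measurable_F_G[OF S_measurable_F[of s "ennreal t"]] B] that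
      by (simp add: vimage_def Int_def conj_commute ennreal_leI)
    let ?A = "{\<omega> \<in> \<Omega>. S t \<omega> \<in> B} - {\<omega> \<in> \<Omega>. \<tau> \<omega> < ennreal t}"
    let ?C = "\<lambda>k. if crossing k < t then ({\<omega> \<in> \<Omega>. \<tau> \<omega> \<le> ennreal (crossing k)} - {\<omega> \<in> \<Omega>. \<tau> \<omega> < ennreal (crossing k)})
        \<inter> {\<omega> \<in> \<Omega>. S (crossing k) \<omega> \<in> B} else {}"
    have "stopped \<tau> S t -` B \<inter> space (G (ennreal t)) = ?A \<union> (\<Union>k. ?C k)"
    proof -
      have "stopped \<tau> S t \<omega> \<in> B \<longleftrightarrow> \<omega> \<in> ?A \<union> (\<Union>k. ?C k)" if \<omega>: "\<omega> \<in> \<Omega>" for \<omega>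
      proof (cases "\<tau> \<omega> < ennreal t")
        case False
        then have "cut (\<tau> \<omega>) t = t" using t by (simp add: cut_def min_def not_less)
        moreover have "\<omega> \<notin> ?C k" for k
        proof (cases "crossing k < t")
          case True
          have "\<not> \<tau> \<omega> \<le> ennreal (crossing k)"
            using False True t crossing_pos[of k] by (metis ennreal_less_iff le_less_trans less_imp_le)
          then show ?thesis by simp
        qed simp
        then have "\<omega> \<notin> (\<Union>k. ?C k)" by blast
        moreover have "\<omega> \<in> ?A \<longleftrightarrow> S t \<omega> \<in> B" using False \<omega> by simp
        ultimately show ?thesis by (simp only: stopped_cut Un_iff simp_thms)
      next
        case True
        then obtain s where s: "\<tau> \<omega> = ennreal s" "0 \<le> s" by (cases "\<tau> \<omega>") auto
        have st: "s < t" using True s by (simp add: ennreal_less_iff)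
        obtain k where k: "s = crossing k" using tau_eq_a(1)[OF \<omega> s] by (auto simp: Y_eq_a_iff)
        have "stopped \<tau> S t \<omega> = S s \<omega>" using s st t by (simp add: stopped_cut cut_ennreal)
        moreover have mem: "\<omega> \<in> ?C j \<longleftrightarrow> j = k \<and> S s \<omega> \<in> B" for j
        proof -
          have "crossing j = crossing k \<longleftrightarrow> j = k" using mu_pos by (simp add: crossing_def)
          then show ?thesis using s k st \<omega> crossing_pos[of j] crossing_pos[of k] by (auto simp: not_less ennreal_less_iff dest: le_antisym)
        qed
        have "\<omega> \<in> (\<Union>k. ?C k) \<longleftrightarrow> S s \<omega> \<in> B" using mem by blast
        moreover have "\<omega> \<notin> ?A" using True \<omega> by simp
        ultimately show ?thesis by (simp only: Un_iff simp_thms)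
      qed
      then show ?thesis by auto
    qed
    also have "?A \<union> (\<Union>k. ?C k) \<in> sets (G (ennreal t))"
    proof (intro sets.Un sets.countable_UN' sets.Diff tau_less_G SB image_subsetI)
      fix k
      show "?C k \<in> sets (G (ennreal t))"
      proof (cases "crossing k < t")
        case True
        then have "({\<omega> \<in> \<Omega>. \<tau> \<omega> \<le> ennreal (crossing k)} - {\<omega> \<in> \<Omega>. \<tau> \<omega> < ennreal (crossing k)})
            \<inter> {\<omega> \<in> \<Omega>. S (crossing k) \<omega> \<in> B} \<in> sets (G (ennreal t))"
          using crossing_pos[of k] by (intro sets.Int sets.Diff tau_le_G tau_less_G SB) (auto intro: ennreal_leI less_imp_le)
        then show ?thesis using True by (simp only: if_True)
      qed simp
    qed (use t in auto)
    finally show "stopped \<tau> S t -` B \<inter> space (G (ennreal t)) \<in> sets (G (ennreal t))" .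
  qed simp
qed

lemma cadlag_stock: "\<omega> \<in> \<Omega> \<Longrightarrow> cadlag (\<lambda>t. S t \<omega>)"
  unfolding cadlag_def
proof (intro conjI allI impI)
  fix t :: real assume \<omega>: "\<omega> \<in> \<Omega>"
  interpret p: drift_path "\<lambda>t. N t \<omega>" \<mu> by (rule path[OF \<omega>])
  show "continuous (at_right t) (\<lambda>t. S t \<omega>)" if "0 \<le> t"
    unfolding stock_eq Y_eq using p.right_cont_n[OF that] by (intro continuous_intros)
  show "\<exists>l. ((\<lambda>t. S t \<omega>) \<longlongrightarrow> l) (at_left t)" if "0 < t"
    unfolding stock_eq Y_eq using p.tendsto_before[OF that]
    by (intro exI[of _ "exp (- \<alpha> * (\<mu> * t - real (p.before t)))"] tendsto_intros)
qed

lemma semimartingale_stopped: "finite_variation_semimartingale M G (stopped \<tau> S)"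
  unfolding finite_variation_semimartingale_def
proof (intro conjI ballI adapted_stopped)
  fix \<omega> assume \<omega>: "\<omega> \<in> \<Omega>"
  show "cadlag (\<lambda>t. stopped \<tau> S t \<omega>)"
    unfolding stopped_cut by (rule cadlag_cut[OF cadlag_stock[OF \<omega>]])
  interpret B: jump_drift_path "\<lambda>t. stopped \<tau> S t \<omega>" "\<lambda>s. jump_part {s. ennreal s \<le> \<tau> \<omega>} s \<omega>"
      "\<lambda>u. drift_part {s. ennreal s \<le> \<tau> \<omega>} u \<omega>" "jumps \<omega>"
    by (rule windowed_path[OF \<omega>]) (use stopped_stock_representation[OF \<omega>] in auto)
  show "\<exists>f g. monotone_decomposition (\<lambda>t. stopped \<tau> S t \<omega>) f g"
    using B.monotone_decomposition_up_down by blast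
qed

lemma semimartingale_after: "finite_variation_semimartingale M G (\<lambda>t \<omega>. S t \<omega> - stopped \<tau> S t \<omega>)"
  unfolding finite_variation_semimartingale_def
proof (intro conjI ballI)
  show "adapted G (\<lambda>t \<omega>. S t \<omega> - stopped \<tau> S t \<omega>)"
    using adapted_stock adapted_stopped unfolding adapted_def by (auto intro: borel_measurable_diff)
  fix \<omega> assume \<omega>: "\<omega> \<in> \<Omega>"
  have 1: "cadlag (\<lambda>t. S t \<omega>)" and 2: "cadlag (\<lambda>t. stopped \<tau> S t \<omega>)"
    unfolding stopped_cut using cadlag_stock[OF \<omega>] cadlag_cut[OF cadlag_stock[OF \<omega>]] by auto
  show "cadlag (\<lambda>t. S t \<omega> - stopped \<tau> S t \<omega>)"
    unfolding cadlag_def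
  proof (intro conjI allI impI)
    fix t :: real
    show "continuous (at_right t) (\<lambda>t. S t \<omega> - stopped \<tau> S t \<omega>)" if "0 \<le> t"
      using 1 2 that by (auto simp: cadlag_def intro: continuous_diff)
    show "\<exists>l. ((\<lambda>t. S t \<omega> - stopped \<tau> S t \<omega>) \<longlongrightarrow> l) (at_left t)" if t: "0 < t"
    proof -
      obtain l where "((\<lambda>t. S t \<omega>) \<longlongrightarrow> l) (at_left t)" using 1 t unfolding cadlag_def by blast
      moreover obtain l' where "((\<lambda>t. stopped \<tau> S t \<omega>) \<longlongrightarrow> l') (at_left t)"
        using 2 t unfolding cadlag_def by blast
      ultimately have "((\<lambda>t. S t \<omega> - stopped \<tau> S t \<omega>) \<longlongrightarrow> l - l') (at_left t)"
        by (rule tendsto_diff)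
      then show ?thesis by (rule exI)
    qed
  qed
  interpret B: jump_drift_path "\<lambda>t. S t \<omega> - stopped \<tau> S t \<omega>" "\<lambda>s. jump_part (- {s. ennreal s \<le> \<tau> \<omega>}) s \<omega>"
      "\<lambda>u. drift_part (- {s. ennreal s \<le> \<tau> \<omega>}) u \<omega>" "jumps \<omega>"
    by (rule windowed_path[OF \<omega>]) (use after_stock_representation[OF \<omega>] in auto)
  show "\<exists>f g. monotone_decomposition (\<lambda>t. S t \<omega> - stopped \<tau> S t \<omega>) f g"
    using B.monotone_decomposition_up_down by blast
qed

lemma left_limit_Y_sequence:
  assumes "\<omega> \<in> \<Omega>" "0 < t"
  shows "(\<lambda>n. Y (t - t / real (Suc (Suc n))) \<omega>) \<longlonglongrightarrow> Yb t \<omega>"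
proof -
  interpret p: drift_path "\<lambda>t. N t \<omega>" \<mu> by (rule path[OF assms(1)])
  have "((\<lambda>s. Y s \<omega>) \<longlongrightarrow> Yb t \<omega>) (at_left t)"
    unfolding Y_eq Yb_def p.y_before_def using p.tendsto_before[OF assms(2)] by (auto intro!: tendsto_intros)
  moreover have "filterlim (\<lambda>n. t - t / real (Suc (Suc n))) (at_left t) sequentially"
  proof -
    have "(\<lambda>n. t / real n) \<longlonglongrightarrow> 0" by (rule lim_const_over_n)
    then have "(\<lambda>n. t / real (Suc (Suc n))) \<longlonglongrightarrow> 0" by (intro LIMSEQ_Suc[of "\<lambda>n. t / real (Suc n)"] LIMSEQ_Suc)
    then have "(\<lambda>n. t - t / real (Suc (Suc n))) \<longlonglongrightarrow> t - 0" by (intro tendsto_intros)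
    then show ?thesis using assms by (auto simp: filterlim_at)
  qed
  ultimately show ?thesis by (rule filterlim_compose)
qed

lemma predictable_left_limit_Y: "predictable_process \<Omega> G (\<lambda>t \<omega>. left_lim (\<lambda>s. Y s \<omega>) t)"
proof (rule predictable_process_left_continuous)
  show "adapted G (\<lambda>t \<omega>. left_lim (\<lambda>s. Y s \<omega>) t)"
    unfolding adapted_def
  proof (intro allI impI)
    fix t :: real assume t: "0 \<le> t"
    have "Yb t \<in> borel_measurable (G (ennreal t))" if t: "0 < t"
    proof (rule borel_measurable_LIMSEQ_real)
      show "(\<lambda>n. Y (t - t / real (Suc (Suc n))) \<omega>) \<longlonglongrightarrow> Yb t \<omega>" if "\<omega> \<in> space (G (ennreal t))" for \<omega>
        using left_limit_Y_sequence t that by simp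
      show "Y (t - t / real (Suc (Suc n))) \<in> borel_measurable (G (ennreal t))" for n
        using t by (intro measurable_F_G Y_measurable_F) (auto simp: field_simps intro!: ennreal_leI)
    qed
    then have "(\<lambda>\<omega>. if t \<le> 0 then 0 else Yb t \<omega>) \<in> borel_measurable (G (ennreal t))"
      by (cases "0 < t") simp_all
    then show "(\<lambda>\<omega>. left_lim (\<lambda>s. Y s \<omega>) t) \<in> borel_measurable (G (ennreal t))"
      by (subst measurable_cong[where g = "\<lambda>\<omega>. if t \<le> 0 then 0 else Yb t \<omega>"]) (auto simp: left_lim_Y)
  qed
  fix \<omega> and t :: real assume \<omega>: "\<omega> \<in> \<Omega>" and t: "0 < t"
  interpret p: drift_path "\<lambda>t. N t \<omega>" \<mu> by (rule path[OF \<omega>])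
  obtain r where r: "0 \<le> r" "r < t" "\<And>u. r \<le> u \<Longrightarrow> u < t \<Longrightarrow> N u \<omega> = p.before t"
    using p.left_constant[OF t] by blast
  have b: "p.before u = p.before t" if "r < u" "u \<le> t" for u
  proof -
    have "p.before u \<le> p.before t" using that by (intro p.before_mono)
    moreover have "p.before t \<le> p.before u" using r(3)[of r] r(1,2) p.n_le_before[of r u] that by simp
    ultimately show ?thesis by simp
  qed
  have "((\<lambda>u. \<mu> * u - real (p.before t)) \<longlongrightarrow> \<mu> * t - real (p.before t)) (at_left t)"
    by (intro tendsto_intros)
  moreover have "eventually (\<lambda>u. \<mu> * u - real (p.before t) = left_lim (\<lambda>s. Y s \<omega>) u) (at_left t)"
    unfolding eventually_at_left_field
  proof (intro exI[of _ r] conjI allI impI)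
    fix u assume "r < u" "u < t"
    then show "\<mu> * u - real (p.before t) = left_lim (\<lambda>s. Y s \<omega>) u"
      using b[of u] r(1) by (simp add: left_lim_Y[OF \<omega>] Yb_def p.y_before_def)
  qed (rule r(2))
  ultimately have "((\<lambda>u. left_lim (\<lambda>s. Y s \<omega>) u) \<longlongrightarrow> \<mu> * t - real (p.before t)) (at_left t)"
    by (rule Lim_transform_eventually)
  then show "continuous (at_left t) (\<lambda>t. left_lim (\<lambda>s. Y s \<omega>) t)"
    using t by (simp add: continuous_within left_lim_Y[OF \<omega>] Yb_def p.y_before_def)
qed

lemma predictable_strategy: "predictable_process \<Omega> G \<phi>"
proof -
  let ?f = "\<lambda>z. (h (z - 1) - h z) / (\<psi> * exp (- \<alpha> * z))"
  have [measurable]: "?f \<in> borel_measurable borel" by measurable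
  have "(\<lambda>(t, \<omega>). left_lim (\<lambda>s. Y s \<omega>) t) \<in> borel_measurable (predictable_sigma \<Omega> G)"
    using predictable_left_limit_Y by (simp add: predictable_process_def)
  from measurable_compose[OF this, of ?f borel]
  have "(\<lambda>x. ?f ((\<lambda>(t, \<omega>). left_lim (\<lambda>s. Y s \<omega>) t) x)) \<in> borel_measurable (predictable_sigma \<Omega> G)" by simp
  then show ?thesis
    unfolding predictable_process_def
    by (rule measurable_cong[THEN iffD1, rotated])
       (auto simp: predictable_sigma_def space_measure_of_conv strategy_eq)
qed

lemma adapted_of_bool:
  assumes "\<And>t. 0 \<le> t \<Longrightarrow> {\<omega> \<in> \<Omega>. P t \<omega>} \<in> sets (G (ennreal t))"
  shows "adapted G (\<lambda>t \<omega>. of_bool (P t \<omega>))"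
  unfolding adapted_def
proof (intro allI impI)
  fix t :: real assume "0 \<le> t"
  then have "(\<lambda>\<omega>. indicator {\<omega> \<in> \<Omega>. P t \<omega>} \<omega> :: real) \<in> borel_measurable (G (ennreal t))"
    using assms[of t] by simp
  then show "(\<lambda>\<omega>. of_bool (P t \<omega>) :: real) \<in> borel_measurable (G (ennreal t))"
    by (rule measurable_cong[THEN iffD1, rotated]) (simp add: indicator_def)
qed

text \<open>The final gain is \<open>1 - \<Psi> 0\<close> for every visit to \<open>a\<close> except one. It is nonnegative, and
  positive if there are two visits, which happens with positive probability.\<close>

theorem arbitrage_before:
  "classical_arbitrage M G (stopped \<tau> S) (\<lambda>t \<omega>. \<phi> t \<omega> * of_bool (ennreal t \<le> \<tau> \<omega>))"
proof -
  let ?\<theta> = "\<lambda>t \<omega>. \<phi> t \<omega> * of_bool (ennreal t \<le> \<tau> \<omega>)"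
  have pred: "predictable_process \<Omega> G ?\<theta>"
  proof (intro predictable_process_mult predictable_strategy predictable_process_left_continuous adapted_of_bool)
    show "{\<omega> \<in> \<Omega>. ennreal t \<le> \<tau> \<omega>} \<in> sets (G (ennreal t))" if "0 \<le> t" for t
    proof -
      have "{\<omega> \<in> \<Omega>. ennreal t \<le> \<tau> \<omega>} = space (G (ennreal t)) - {\<omega> \<in> \<Omega>. \<tau> \<omega> < ennreal t}" by auto
      then show ?thesis by (simp only:) (rule sets.compl_sets[OF tau_less_G[OF order_refl]])
    qed
  qed (rule continuous_left_of_bool_le)
  have final: "terminal_gain ?\<theta> (stopped \<tau> S) \<omega> = (1 - \<Psi> 0) * (real (hits (enn2real (\<tau> \<omega>)) \<omega>) - 1)"
    if "\<omega> \<in> \<Omega>" "good \<omega>" for \<omega>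
    unfolding terminal_gain_def by (rule tendsto_Lim[OF _ before_terminal(1)[OF that]]) simp
  \<comment> \<open>the paths with at least two visits to \<open>a\<close>\<close>
  define E where "E = (\<Union>j. \<Union>k\<in>- {j}. {\<omega> \<in> \<Omega>. N (crossing j) \<omega> = j} \<inter> {\<omega> \<in> \<Omega>. N (crossing k) \<omega> = k})"
  have Ne: "{\<omega> \<in> \<Omega>. N (crossing j) \<omega> = j} \<in> events" for j
    using count_event_F[of "crossing j" j] crossing_pos[of j] sets_F_subset by auto
  have E: "E \<in> events" unfolding E_def by (intro sets.countable_UN' sets.Int Ne image_subsetI) auto
  have pos_iff: "terminal_gain ?\<theta> (stopped \<tau> S) \<omega> > 0 \<longleftrightarrow> \<omega> \<in> E" if \<omega>: "\<omega> \<in> \<Omega>" and good: "good \<omega>" for \<omega>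
  proof -
    obtain s where s: "\<tau> \<omega> = ennreal s" "0 < s" using good_tau_finite[OF good \<omega>] by blast
    let ?C = "{u \<in> {0<..s}. Y u \<omega> = a}"
    have fin: "finite ?C" by (rule finite_crossings[OF \<omega>])
    have C: "crossing j \<in> ?C" if "N (crossing j) \<omega> = j" for j
    proof -
      have "Y (crossing j) \<omega> = a" using that by (simp add: Y_eq_a_iff)
      moreover have "crossing j \<le> s"
      proof (rule ccontr)
        assume "\<not> crossing j \<le> s"
        then show False using tau_eq_a(2)[OF \<omega> s(1), of "crossing j"] s(2) \<open>Y (crossing j) \<omega> = a\<close> by simp
      qed
      ultimately show ?thesis using crossing_pos by simp
    qed
    have "terminal_gain ?\<theta> (stopped \<tau> S) \<omega> > 0 \<longleftrightarrow> 2 \<le> card ?C"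
      using final[OF \<omega> good] Psi_0_bounds(2) s by (simp add: hits_def zero_less_mult_iff numeral_2_eq_2 Suc_le_eq)
    also have "\<dots> \<longleftrightarrow> \<omega> \<in> E"
    proof
      assume "2 \<le> card ?C"
      then have "\<not> card ?C \<le> Suc 0" by simp
      then obtain u v where uv: "u \<in> ?C" "v \<in> ?C" "u \<noteq> v"
        unfolding card_le_Suc0_iff_eq[OF fin] by blast
      then have Yuv: "Y u \<omega> = a" "Y v \<omega> = a" by auto
      have eq: "u = crossing (N u \<omega>)" "v = crossing (N v \<omega>)"
        using Y_eq_a_iff[THEN iffD1, OF Yuv(1)] Y_eq_a_iff[THEN iffD1, OF Yuv(2)] .
      then have "N u \<omega> \<noteq> N v \<omega>" using uv by metis
      then have "\<omega> \<in> {\<omega>' \<in> \<Omega>. N (crossing (N u \<omega>)) \<omega>' = N u \<omega>}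
          \<inter> {\<omega>' \<in> \<Omega>. N (crossing (N v \<omega>)) \<omega>' = N v \<omega>}" "N v \<omega> \<in> - {N u \<omega>}"
        using \<omega> eq(1)[symmetric] eq(2)[symmetric] by simp_all
      then show "\<omega> \<in> E" unfolding E_def by blast
    next
      assume "\<omega> \<in> E"
      then obtain j k where jk: "j \<noteq> k" "N (crossing j) \<omega> = j" "N (crossing k) \<omega> = k" by (auto simp: E_def)
      have "crossing j \<noteq> crossing k" using jk(1) mu_pos by (simp add: crossing_def)
      then have "card {crossing j, crossing k} = 2" by simp
      moreover have "card {crossing j, crossing k} \<le> card ?C" using C jk fin by (intro card_mono) auto
      ultimately show "2 \<le> card ?C" by simp
    qed
    finally show ?thesis .
  qed
  have "0 < prob E"
  proof -
    \<comment> \<open>Without a jump before \<open>crossing 0\<close> and with exactly one before \<open>crossing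
      1\<close>, both times are visits.\<close>
    let ?A = "{\<omega> \<in> \<Omega>. N (crossing 0) \<omega> = 0}" and ?d = "crossing 1 - crossing 0"
    let ?R = "future_cylinder (crossing 0) {?d} (\<lambda>_. {1})"
    have c: "0 < crossing 0" "0 < ?d" using a_pos mu_pos by (auto simp: crossing_def field_simps)
    have "prob (?A \<inter> ?R) = prob ?A * prob ?R"
      using c by (intro indep_F_future_cylinder count_event_F) auto
    also have "?R = {\<omega> \<in> \<Omega>. N (crossing 1) \<omega> - N (crossing 0) \<omega> = 1}" by (simp add: future_cylinder_def)
    also have "prob ?A * prob \<dots> > 0"
      using c prob_N_eq[of "crossing 0" 0] prob_increment[of "crossing 0" "crossing 1" 1] lam_pos by simp
    finally have "0 < prob (?A \<inter> ?R)" by (simp add: future_cylinder_def)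
    moreover have "?A \<inter> ?R \<subseteq> E"
    proof
      fix \<omega> assume \<omega>: "\<omega> \<in> ?A \<inter> ?R"
      then have "\<omega> \<in> \<Omega>" "N (crossing 0) \<omega> = 0" "N (crossing 1) \<omega> = 1" by (auto simp: future_cylinder_def)
      then show "\<omega> \<in> E" unfolding E_def by (intro UN_I[of 0] UN_I[of 1]) auto
    qed
    then have "prob (?A \<inter> ?R) \<le> prob E" using E by (intro finite_measure_mono)
    ultimately show ?thesis by simp
  qed
  moreover have "AE \<omega> in M. terminal_gain ?\<theta> (stopped \<tau> S) \<omega> > 0 \<longleftrightarrow> \<omega> \<in> E"
    using AE_good AE_space by eventually_elim (rule pos_iff)
  note AE_set(2)[OF this E]
  ultimately have pos: "measure M {\<omega> \<in> \<Omega>. terminal_gain ?\<theta> (stopped \<tau> S) \<omega> > 0} > 0" by simp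
  show ?thesis
    unfolding classical_arbitrage_def admissible_def integrable_wrt_def
  proof (intro conjI semimartingale_stopped pred pos exI[of _ 1])
    show "AE \<omega> in M. \<forall>t\<ge>0. \<exists>I. has_stieltjes_integral (\<lambda>s. ?\<theta> s \<omega>) (\<lambda>s. stopped \<tau> S s \<omega>) t I"
      using AE_good AE_space by eventually_elim (use before_integral(1) in blast)
    show "AE \<omega> in M. \<forall>t\<ge>0. stochastic_integral ?\<theta> (stopped \<tau> S) t \<omega> \<ge> - 1"
      using AE_good AE_space by eventually_elim (use before_integral(2) gain_lower_bound cut_nonneg in auto)
    show "AE \<omega> in M. \<exists>l. ((\<lambda>t. stochastic_integral ?\<theta> (stopped \<tau> S) t \<omega>) \<longlongrightarrow> l) at_top"
      using AE_good AE_space by eventually_elim (use before_terminal(1) in blast)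
    show "AE \<omega> in M. terminal_gain ?\<theta> (stopped \<tau> S) \<omega> \<ge> 0"
      using AE_good AE_space
      by eventually_elim (use final before_terminal(2) Psi_0_bounds(2) in \<open>auto intro!: mult_nonneg_nonneg\<close>)
  qed simp
qed

text \<open>After \<open>\<tau>\<close> the short position has earned \<open>\<Psi> 0 - h (Y t)\<close>, which is nonnegative since \<open>Y\<close>
  stays above \<open>a\<close>. It may be closed at any time that is observable in \<open>G\<close> and at which \<open>h (Y)\<close>
  has dropped below \<open>\<Psi> 0\<close>; if it is never closed, it ends with \<open>\<Psi> 0\<close>.\<close>

lemma arbitrage_after:
  fixes \<nu> :: "'a \<Rightarrow> ennreal"
  assumes \<nu>: "AE \<omega> in M. \<tau> \<omega> \<le> \<nu> \<omega>"
    and meas: "\<And>t. 0 \<le> t \<Longrightarrow> {\<omega> \<in> \<Omega>. \<tau> \<omega> < ennreal t \<and> ennreal t \<le> \<nu> \<omega>} \<in> sets (G (ennreal t))"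
    and small: "AE \<omega> in M. \<nu> \<omega> < \<infinity> \<longrightarrow> h (Y (enn2real (\<nu> \<omega>)) \<omega>) < \<Psi> 0"
  shows "classical_arbitrage M G (\<lambda>t \<omega>. S t \<omega> - stopped \<tau> S t \<omega>)
    (\<lambda>t \<omega>. - \<phi> t \<omega> * of_bool (\<tau> \<omega> < ennreal t \<and> ennreal t \<le> \<nu> \<omega>))"
proof -
  let ?\<theta> = "\<lambda>t \<omega>. - \<phi> t \<omega> * of_bool (\<tau> \<omega> < ennreal t \<and> ennreal t \<le> \<nu> \<omega>)"
  let ?X = "\<lambda>t \<omega>. S t \<omega> - stopped \<tau> S t \<omega>"
  have "predictable_process \<Omega> G (\<lambda>t \<omega>. \<phi> t \<omega> * of_bool (\<tau> \<omega> < ennreal t \<and> ennreal t \<le> \<nu> \<omega>))"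
  proof (intro predictable_process_mult predictable_strategy predictable_process_left_continuous adapted_of_bool meas)
    fix \<omega> and t :: real assume "0 < t"
    then have "continuous (at_left t) (\<lambda>t. (1 - of_bool (ennreal t \<le> \<tau> \<omega>)) * of_bool (ennreal t \<le> \<nu> \<omega>) :: real)"
      by (intro continuous_intros continuous_left_of_bool_le)
    moreover have "(\<lambda>t. (1 - of_bool (ennreal t \<le> \<tau> \<omega>)) * of_bool (ennreal t \<le> \<nu> \<omega>) :: real)
        = (\<lambda>t. of_bool (\<tau> \<omega> < ennreal t \<and> ennreal t \<le> \<nu> \<omega>))"
      by (auto simp: fun_eq_iff not_le)
    ultimately show "continuous (at_left t) (\<lambda>t. of_bool (\<tau> \<omega> < ennreal t \<and> ennreal t \<le> \<nu> \<omega>) :: real)"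
      by (simp only:)
  qed
  then have pred: "predictable_process \<Omega> G ?\<theta>"
    unfolding predictable_process_def using borel_measurable_uminus[of "\<lambda>(t, \<omega>). \<phi> t \<omega> * of_bool (\<tau> \<omega> < ennreal t \<and> ennreal t \<le> \<nu> \<omega>)"]
    by (simp add: case_prod_beta')
  have "AE \<omega> in M. terminal_gain ?\<theta> ?X \<omega> > 0"
    using AE_good AE_space \<nu> small
  proof eventually_elim
    case (elim \<omega>)
    have "terminal_gain ?\<theta> ?X \<omega> = \<Psi> 0 - (if \<nu> \<omega> < \<infinity> then h (Y (enn2real (\<nu> \<omega>)) \<omega>) else 0)"
      unfolding terminal_gain_def by (rule tendsto_Lim[OF _ after_terminal(2)]) (use elim in auto)
    then show ?case using elim Psi_0_bounds(1) by auto
  qed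
  note pos = this
  have "AE \<omega> in M. terminal_gain ?\<theta> ?X \<omega> > 0 \<longleftrightarrow> \<omega> \<in> \<Omega>"
    using pos AE_space by eventually_elim simp
  from AE_set(2)[OF this] have one: "measure M {\<omega> \<in> \<Omega>. terminal_gain ?\<theta> ?X \<omega> > 0} > 0"
    by (simp add: prob_space)
  show ?thesis
    unfolding classical_arbitrage_def admissible_def integrable_wrt_def
  proof (intro conjI semimartingale_after pred one exI[of _ 0])
    show "AE \<omega> in M. \<forall>t\<ge>0. \<exists>I. has_stieltjes_integral (\<lambda>s. ?\<theta> s \<omega>) (\<lambda>s. ?X s \<omega>) t I"
      using AE_good AE_space \<nu> by eventually_elim (use after_integral(1) in blast)
    show "AE \<omega> in M. \<forall>t\<ge>0. stochastic_integral ?\<theta> ?X t \<omega> \<ge> - 0"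
      using AE_good AE_space \<nu> by eventually_elim (use after_terminal(1) in auto)
    show "AE \<omega> in M. \<exists>l. ((\<lambda>t. stochastic_integral ?\<theta> ?X t \<omega>) \<longlongrightarrow> l) at_top"
      using AE_good AE_space \<nu> by eventually_elim (use after_terminal(2) in blast)
    show "AE \<omega> in M. terminal_gain ?\<theta> ?X \<omega> \<ge> 0" using pos by eventually_elim simp
  qed simp
qed

end

section \<open>Measurable sections\<close>

text \<open>A random compact set with finitely many values. Its hitting events are measurable.\<close>

definition simple_compact :: "'a measure \<Rightarrow> ('a \<Rightarrow> real set) \<Rightarrow> bool" where
  "simple_compact P C \<longleftrightarrow> simple_function P C \<and> (\<forall>\<omega>\<in>space P. compact (C \<omega>))"

lemma simple_compact_const: "compact c \<Longrightarrow> simple_compact P (\<lambda>_. c)"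
  by (simp add: simple_compact_def)

lemma simple_compact_Un:
  "simple_compact P C \<Longrightarrow> simple_compact P D \<Longrightarrow> simple_compact P (\<lambda>\<omega>. C \<omega> \<union> D \<omega>)"
  by (auto simp: simple_compact_def intro: simple_function_compose2[where h = "(\<union>)"])

lemma simple_compact_Int:
  "simple_compact P C \<Longrightarrow> simple_compact P D \<Longrightarrow> simple_compact P (\<lambda>\<omega>. C \<omega> \<inter> D \<omega>)"
  by (auto simp: simple_compact_def intro: simple_function_compose2[where h = "(\<inter>)"] compact_Int)

lemma simple_compact_UN:
  "finite I \<Longrightarrow> (\<And>i. i \<in> I \<Longrightarrow> simple_compact P (C i)) \<Longrightarrow> simple_compact P (\<lambda>\<omega>. \<Union>i\<in>I. C i \<omega>)"
  by (induction I rule: finite_induct) (auto intro: simple_compact_const simple_compact_Un)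

lemma simple_compact_INT_atMost:
  "(\<And>i. simple_compact P (C i)) \<Longrightarrow> simple_compact P (\<lambda>\<omega>. \<Inter>i\<le>(k::nat). C i \<omega>)"
  by (induction k) (auto simp: atMost_Suc intro: simple_compact_Int)

lemma simple_compact_hits: "simple_compact P C \<Longrightarrow> {\<omega> \<in> space P. C \<omega> \<inter> S \<noteq> {}} \<in> sets P"
proof -
  assume "simple_compact P C"
  then have "C -` {c. c \<inter> S \<noteq> {}} \<inter> space P \<in> sets P"
    unfolding simple_compact_def by (blast intro: simple_functionD(2))
  also have "C -` {c. c \<inter> S \<noteq> {}} \<inter> space P = {\<omega> \<in> space P. C \<omega> \<inter> S \<noteq> {}}" by auto
  finally show ?thesis .
qed

lemma simple_compact_rectangle: "compact c \<Longrightarrow> compact d \<Longrightarrow> A \<in> sets P \<Longrightarrow> simple_compact P (\<lambda>\<omega>. if \<omega> \<in> A then c else d)"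
  unfolding simple_compact_def
  by (auto intro!: simple_function_If_set)

text \<open>A Souslin scheme of random compact sets: the set at level \<open>n\<close> depends on the first \<open>n\<close>
  entries of the branch.\<close>

definition analytic_scheme where
  "analytic_scheme P (K :: nat \<Rightarrow> (nat \<Rightarrow> nat) \<Rightarrow> 'a \<Rightarrow> real set) \<longleftrightarrow>
    (\<forall>n f. simple_compact P (K n f)) \<and> (\<forall>n f g. (\<forall>i<n. f i = g i) \<longrightarrow> K n f = K n g)"

text \<open>The result of the Souslin operation, for random subsets of \<open>[0,T]\<close>.\<close>

definition analytic :: "'a measure \<Rightarrow> real \<Rightarrow> ('a \<Rightarrow> real set) \<Rightarrow> bool" where
  "analytic P T H \<longleftrightarrow> (\<forall>\<omega>\<in>space P. H \<omega> \<subseteq> {0..T}) \<and>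
    (\<exists>K. analytic_scheme P K \<and> (\<forall>\<omega>\<in>space P. H \<omega> = (\<Union>f. \<Inter>n. K n f \<omega>)))"

lemma analytic_simple_compact:
  "simple_compact P C \<Longrightarrow> (\<And>\<omega>. \<omega> \<in> space P \<Longrightarrow> C \<omega> \<subseteq> {0..T}) \<Longrightarrow> analytic P T C"
  unfolding analytic_def analytic_scheme_def by (intro conjI ballI exI[of _ "\<lambda>_ _. C"]) auto

lemma analytic_cong:
  "analytic P T H \<Longrightarrow> (\<And>\<omega>. \<omega> \<in> space P \<Longrightarrow> H \<omega> = H' \<omega>) \<Longrightarrow> analytic P T H'"
  by (simp add: analytic_def)

text \<open>The first entry of the new branch selects the index of the union.\<close>

lemma analytic_UN:
  assumes "\<And>i::nat. analytic P T (H i)"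
  shows "analytic P T (\<lambda>\<omega>. \<Union>i. H i \<omega>)"
proof -
  from assms have "\<forall>i. \<exists>K. analytic_scheme P K \<and> (\<forall>\<omega>\<in>space P. H i \<omega> = (\<Union>f. \<Inter>n. K n f \<omega>))"
    by (auto simp: analytic_def)
  then obtain K where K: "\<And>i. analytic_scheme P (K i)" "\<And>i \<omega>. \<omega> \<in> space P \<Longrightarrow> H i \<omega> = (\<Union>f. \<Inter>n. K i n f \<omega>)"
    by metis
  define K' where "K' n f = (case n of 0 \<Rightarrow> (\<lambda>_. {0..T}) | Suc m \<Rightarrow> K (f 0) m (\<lambda>i. f (Suc i)))" for n and f :: "nat \<Rightarrow> nat"
  have s: "analytic_scheme P K'"
    unfolding analytic_scheme_def
  proof (intro conjI allI impI)
    show "simple_compact P (K' n f)" for n f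
      using K(1) by (auto simp: K'_def analytic_scheme_def intro: simple_compact_const split: nat.split)
    fix n and f g :: "nat \<Rightarrow> nat" assume fg: "\<forall>i<n. f i = g i"
    show "K' n f = K' n g"
    proof (cases n)
      case (Suc m)
      then have "f 0 = g 0" "\<forall>i<m. f (Suc i) = g (Suc i)" using fg by auto
      then show ?thesis using K(1)[of "g 0"] Suc unfolding K'_def analytic_scheme_def by simp
    qed (simp add: K'_def)
  qed
  have "(\<Union>i. H i \<omega>) = (\<Union>f. \<Inter>n. K' n f \<omega>)" if \<omega>: "\<omega> \<in> space P" for \<omega>
  proof (intro equalityI subsetI)
    fix t assume "t \<in> (\<Union>i. H i \<omega>)"
    then obtain i where i: "t \<in> H i \<omega>" by blast
    then have "t \<in> (\<Union>f. \<Inter>n. K i n f \<omega>)" by (simp only: K(2)[OF \<omega>])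
    then obtain f where f: "\<And>n. t \<in> K i n f \<omega>" by blast
    have "t \<in> {0..T}" using i assms \<omega> unfolding analytic_def by blast
    then have "t \<in> K' n (case_nat i f) \<omega>" for n using f by (auto simp: K'_def split: nat.split)
    then show "t \<in> (\<Union>f. \<Inter>n. K' n f \<omega>)" by blast
  next
    fix t assume "t \<in> (\<Union>f. \<Inter>n. K' n f \<omega>)"
    then obtain f where f: "\<And>n. t \<in> K' n f \<omega>" by blast
    then have "t \<in> K (f 0) n (\<lambda>i. f (Suc i)) \<omega>" for n using f[of "Suc n"] by (simp add: K'_def)
    then have "t \<in> H (f 0) \<omega>" unfolding K(2)[OF \<omega>] by blast
    then show "t \<in> (\<Union>i. H i \<omega>)" by blast
  qed
  moreover have "(\<Union>i. H i \<omega>) \<subseteq> {0..T}" if "\<omega> \<in> space P" for \<omega>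
  proof -
    have "H i \<omega> \<subseteq> {0..T}" for i using assms[of i] that unfolding analytic_def by simp
    then show ?thesis by blast
  qed
  ultimately show ?thesis
    using s unfolding analytic_def by (intro conjI ballI exI[of _ K'])
qed

text \<open>One branch encodes a branch for every index of the intersection, by the pairing of natural
  numbers.\<close>

lemma analytic_INT:
  assumes "\<And>i::nat. analytic P T (H i)"
  shows "analytic P T (\<lambda>\<omega>. \<Inter>i. H i \<omega>)"
proof -
  from assms have "\<forall>i. \<exists>K. analytic_scheme P K \<and> (\<forall>\<omega>\<in>space P. H i \<omega> = (\<Union>f. \<Inter>n. K n f \<omega>))"
    by (auto simp: analytic_def)
  then obtain K where K: "\<And>i. analytic_scheme P (K i)" "\<And>i \<omega>. \<omega> \<in> space P \<Longrightarrow> H i \<omega> = (\<Union>f. \<Inter>n. K i n f \<omega>)"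
    by metis
  define K' where "K' n f = (case prod_decode n of (i, j) \<Rightarrow> K i j (\<lambda>k. f (prod_encode (i, k))))" for n and f :: "nat \<Rightarrow> nat"
  \<comment> \<open>so that level \<open>n\<close> of the new scheme uses only the first \<open>n\<close> entries\<close>
  have less: "prod_encode (i, k) < prod_encode (i, j)" if "k < j" for i j k
  proof -
    have "triangle (i + k) < triangle (i + j)"
      using that
    proof (induction j)
      case (Suc j)
      then show ?case by (cases "k = j") auto
    qed simp
    then show ?thesis by (simp add: prod_encode_def)
  qed
  have s: "analytic_scheme P K'"
    unfolding analytic_scheme_def
  proof (intro conjI allI impI)
    show "simple_compact P (K' n f)" for n f
      using K(1) by (auto simp: K'_def analytic_scheme_def split: prod.split)
    fix n and f g :: "nat \<Rightarrow> nat" assume fg: "\<forall>i<n. f i = g i"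
    obtain i j where ij: "prod_decode n = (i, j)" by (cases "prod_decode n")
    then have "n = prod_encode (i, j)" by (metis prod_decode_inverse)
    then have "\<forall>k<j. f (prod_encode (i, k)) = g (prod_encode (i, k))" using less fg by blast
    then show "K' n f = K' n g"
      using K(1)[of i] unfolding K'_def analytic_scheme_def ij by simp
  qed
  have "(\<Inter>i. H i \<omega>) = (\<Union>f. \<Inter>n. K' n f \<omega>)" if \<omega>: "\<omega> \<in> space P" for \<omega>
  proof (intro equalityI subsetI)
    fix t assume t: "t \<in> (\<Inter>i. H i \<omega>)"
    have "\<exists>f. \<forall>n. t \<in> K i n f \<omega>" for i
    proof -
      have "t \<in> H i \<omega>" using t by blast
      then have "t \<in> (\<Union>f. \<Inter>n. K i n f \<omega>)" by (simp only: K(2)[OF \<omega>])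
      then show ?thesis by blast
    qed
    then obtain f where f: "\<And>i n. t \<in> K i n (f i) \<omega>" by metis
    define g where "g m = (case prod_decode m of (i, k) \<Rightarrow> f i k)" for m
    have "t \<in> K' n g \<omega>" for n
      using f by (auto simp: K'_def g_def split: prod.split)
    then show "t \<in> (\<Union>f. \<Inter>n. K' n f \<omega>)" by blast
  next
    fix t assume "t \<in> (\<Union>f. \<Inter>n. K' n f \<omega>)"
    then obtain f where f: "\<And>n. t \<in> K' n f \<omega>" by blast
    have "t \<in> K i j (\<lambda>k. f (prod_encode (i, k))) \<omega>" for i j using f[of "prod_encode (i, j)"] by (simp add: K'_def)
    then have "t \<in> H i \<omega>" for i unfolding K(2)[OF \<omega>] by blast
    then show "t \<in> (\<Inter>i. H i \<omega>)" by blast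
  qed
  moreover have "(\<Inter>i. H i \<omega>) \<subseteq> {0..T}" if "\<omega> \<in> space P" for \<omega>
  proof -
    have "H i \<omega> \<subseteq> {0..T}" for i using assms[of i] that unfolding analytic_def by simp
    then show ?thesis by blast
  qed
  ultimately show ?thesis
    using s unfolding analytic_def by (intro conjI ballI exI[of _ K'])
qed

text \<open>Analytic sets are not stable under complements; sets that are analytic together with their
  complement form a sigma-algebra.\<close>

definition bianalytic :: "'a measure \<Rightarrow> real \<Rightarrow> ('a \<Rightarrow> real set) \<Rightarrow> bool" where
  "bianalytic P T H \<longleftrightarrow> analytic P T (\<lambda>\<omega>. H \<omega> \<inter> {0..T}) \<and> analytic P T (\<lambda>\<omega>. {0..T} - H \<omega>)"

lemma bianalyticI:
  assumes "analytic P T U" "analytic P T V"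
    and "\<And>\<omega>. \<omega> \<in> space P \<Longrightarrow> U \<omega> = H \<omega> \<inter> {0..T}" "\<And>\<omega>. \<omega> \<in> space P \<Longrightarrow> V \<omega> = {0..T} - H \<omega>"
  shows "bianalytic P T H"
  unfolding bianalytic_def
  using analytic_cong[OF assms(1), of "\<lambda>\<omega>. H \<omega> \<inter> {0..T}"] analytic_cong[OF assms(2), of "\<lambda>\<omega>. {0..T} - H \<omega>"] assms(3,4)
  by simp

lemma bianalytic_cong:
  assumes "bianalytic P T H" "\<And>\<omega>. \<omega> \<in> space P \<Longrightarrow> H \<omega> = H' \<omega>"
  shows "bianalytic P T H'"
  using assms by (intro bianalyticI[of P T "\<lambda>\<omega>. H \<omega> \<inter> {0..T}" "\<lambda>\<omega>. {0..T} - H \<omega>"]) (auto simp: bianalytic_def)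

lemma bianalytic_compl: "bianalytic P T H \<Longrightarrow> bianalytic P T (\<lambda>\<omega>. UNIV - H \<omega>)"
  by (rule bianalyticI[of P T "\<lambda>\<omega>. {0..T} - H \<omega>" "\<lambda>\<omega>. H \<omega> \<inter> {0..T}"]) (auto simp: bianalytic_def)

lemma bianalytic_UN:
  assumes "\<And>i::nat. bianalytic P T (H i)" shows "bianalytic P T (\<lambda>\<omega>. \<Union>i. H i \<omega>)"
proof -
  have "analytic P T (\<lambda>\<omega>. \<Union>i. H i \<omega> \<inter> {0..T})"
    by (rule analytic_UN) (use assms in \<open>simp add: bianalytic_def\<close>)
  moreover have "analytic P T (\<lambda>\<omega>. \<Inter>i. {0..T} - H i \<omega>)"
    by (rule analytic_INT) (use assms in \<open>simp add: bianalytic_def\<close>)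
  ultimately show ?thesis by (rule bianalyticI) auto
qed

lemma bianalytic_Int:
  assumes "bianalytic P T H" "bianalytic P T H'" shows "bianalytic P T (\<lambda>\<omega>. H \<omega> \<inter> H' \<omega>)"
proof -
  define D where "D i \<omega> = UNIV - (if i = 0 then H \<omega> else H' \<omega>)" for i :: nat and \<omega>
  have "bianalytic P T (D i)" for i
    using assms[THEN bianalytic_compl] by (cases "i = 0") (simp_all add: D_def[abs_def])
  then have "bianalytic P T (\<lambda>\<omega>. UNIV - (\<Union>i. D i \<omega>))" by (intro bianalytic_compl bianalytic_UN)
  moreover have "UNIV - (\<Union>i. D i \<omega>) = H \<omega> \<inter> H' \<omega>" for \<omega>
    unfolding D_def by (auto split: if_splits)
  ultimately show ?thesis by simp
qed

lemma bianalytic_half_line: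
  assumes "A \<in> sets P"
  shows "bianalytic P T (\<lambda>\<omega>. if \<omega> \<in> A then {..r} else {})"
proof -
  have "analytic P T (\<lambda>\<omega>. if \<omega> \<in> A then {0..min r T} else {})"
    using assms by (intro analytic_simple_compact simple_compact_rectangle) auto
  moreover have "analytic P T (\<lambda>\<omega>. \<Union>m. if \<omega> \<in> A then {max 0 (r + 1 / real (Suc m))..T} else {0..T})"
    using assms by (intro analytic_UN analytic_simple_compact simple_compact_rectangle) auto
  moreover have *: "(\<Union>m. {max 0 (r + 1 / real (Suc m))..T}) = {0..T} - {..r}"
  proof (intro equalityI subsetI)
    fix x assume x: "x \<in> {0..T} - {..r}"
    then have "x - r > 0" by simp
    then obtain m where "1 / real (Suc m) < x - r" using nat_approx_posE by metis
    then show "x \<in> (\<Union>m. {max 0 (r + 1 / real (Suc m))..T})" using x by (intro UN_I[of m]) auto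
  next
    fix x assume "x \<in> (\<Union>m. {max 0 (r + 1 / real (Suc m))..T})"
    then obtain m where "0 \<le> x" "x \<le> T" "r + 1 / real (Suc m) \<le> x" by auto
    moreover have "0 < 1 / real (Suc m)" by simp
    ultimately have "r < x" by linarith
    then show "x \<in> {0..T} - {..r}" using \<open>0 \<le> x\<close> \<open>x \<le> T\<close> by simp
  qed
  have "(\<Union>m. if \<omega> \<in> A then {max 0 (r + 1 / real (Suc m))..T} else {0..T})
      = {0..T} - (if \<omega> \<in> A then {..r} else {})" for \<omega>
    using * by (cases "\<omega> \<in> A") simp_all
  ultimately show ?thesis
    by (intro bianalyticI[of P T "\<lambda>\<omega>. if \<omega> \<in> A then {0..min r T} else {}"
          "\<lambda>\<omega>. \<Union>m. if \<omega> \<in> A then {max 0 (r + 1 / real (Suc m))..T} else {0..T}"]) auto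
qed

lemma bianalytic_const_UNIV: "bianalytic P T (\<lambda>\<omega>. if \<omega> \<in> A then UNIV else {})" if "A \<in> sets P"
proof -
  have "bianalytic P T (\<lambda>\<omega>. \<Union>i. if \<omega> \<in> A then {..real i} else {})"
    by (intro bianalytic_UN bianalytic_half_line that)
  moreover have "(\<Union>i. if \<omega> \<in> A then {..real i} else {}) = (if \<omega> \<in> A then UNIV else {})" for \<omega>
    by (auto simp: real_arch_simple)
  ultimately show ?thesis by simp
qed

lemma bianalytic_rectangle:
  assumes A: "A \<in> sets P" and B: "B \<in> sets borel"
  shows "bianalytic P T (\<lambda>\<omega>. if \<omega> \<in> A then B else {})"
proof -
  have "B \<in> sigma_sets UNIV (range (\<lambda>x::real. {..x}))"
    using B by (subst (asm) borel_eq_atMost) (simp add: sets_measure_of)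
  then show ?thesis
  proof induction
    case (Basic a) then show ?case using bianalytic_half_line[OF A] by auto
  next
    case Empty
    then show ?case using bianalytic_half_line[of "{}" P T 0] by simp
  next
    case (Compl a)
    have "bianalytic P T (\<lambda>\<omega>. (UNIV - (if \<omega> \<in> A then a else {})) \<inter> (if \<omega> \<in> A then UNIV else {}))"
      by (intro bianalytic_Int bianalytic_compl bianalytic_const_UNIV Compl.IH A)
    moreover have "(UNIV - (if \<omega> \<in> A then a else {})) \<inter> (if \<omega> \<in> A then UNIV else {}) = (if \<omega> \<in> A then UNIV - a else {})" for \<omega>
      by auto
    ultimately show ?case by simp
  next
    case (Union a)
    then have "bianalytic P T (\<lambda>\<omega>. \<Union>i. if \<omega> \<in> A then a i else {})" by (intro bianalytic_UN)
    moreover have "(\<Union>i. if \<omega> \<in> A then a i else {}) = (if \<omega> \<in> A then \<Union>(range a) else {})" for \<omega> by auto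
    ultimately show ?case by simp
  qed
qed

lemma bianalytic_product_sets:
  assumes "H \<in> sets (borel \<Otimes>\<^sub>M P)"
  shows "bianalytic P T (\<lambda>\<omega>. {t. (t, \<omega>) \<in> H})"
proof -
  have "H \<in> sigma_sets (UNIV \<times> space P) {a \<times> b | a b. a \<in> sets (borel :: real measure) \<and> b \<in> sets P}"
    using assms by (simp add: sets_pair_measure)
  then show ?thesis
  proof induction
    case (Basic H)
    then obtain a b where ab: "H = a \<times> b" "a \<in> sets borel" "b \<in> sets P" by blast
    have "{t. (t, \<omega>) \<in> H} = (if \<omega> \<in> b then a else {})" for \<omega> using ab by auto
    then show ?case using bianalytic_rectangle[OF ab(3,2)] by simp
  next
    case Empty
    then show ?case using bianalytic_half_line[of "{}" P T 0] by simp
  next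
    case (Compl H)
    then have "bianalytic P T (\<lambda>\<omega>. UNIV - {t. (t, \<omega>) \<in> H})" by (intro bianalytic_compl)
    then show ?case by (rule bianalytic_cong) auto
  next
    case (Union H)
    then have "bianalytic P T (\<lambda>\<omega>. \<Union>i. {t. (t, \<omega>) \<in> H i})" by (intro bianalytic_UN)
    moreover have "(\<Union>i. {t. (t, \<omega>) \<in> H i}) = {t. (t, \<omega>) \<in> \<Union>(range H)}" for \<omega> by auto
    ultimately show ?case by simp
  qed
qed

text \<open>Konig's lemma for the finitely branching tree of sequences below \<open>c\<close>, by repeated use of the
  pigeonhole principle.\<close>

lemma bounded_branches_converge:
  fixes F :: "nat \<Rightarrow> nat \<Rightarrow> nat"
  assumes "\<And>k i. F k i \<le> c i"
  obtains f where "\<And>n. \<exists>k\<ge>n. \<forall>i<n. F k i = f i"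
proof -
  define Q where "Q j M \<longleftrightarrow> infinite M \<and> (\<forall>k\<in>M. \<forall>k'\<in>M. \<forall>i<j. F k i = F k' i)" for j M
  have "\<exists>M. \<forall>j. Q j (M j) \<and> M (Suc j) \<subseteq> M j"
  proof (rule dependent_nat_choice)
    show "\<exists>M. Q 0 M" by (auto simp: Q_def intro!: exI[of _ UNIV])
    fix M j assume M: "Q j M"
    have "finite ((\<lambda>k. F k j) ` M)" by (rule finite_subset[of _ "{..c j}"]) (use assms in auto)
    then obtain k0 where k0: "k0 \<in> M" "infinite {k \<in> M. F k j = F k0 j}"
      using pigeonhole_infinite[of M "\<lambda>k. F k j"] M by (auto simp: Q_def)
    have "Q (Suc j) {k \<in> M. F k j = F k0 j}"
      unfolding Q_def
    proof (intro conjI ballI allI impI)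
      fix k k' i assume k: "k \<in> {k \<in> M. F k j = F k0 j}" "k' \<in> {k \<in> M. F k j = F k0 j}" and i: "i < Suc j"
      show "F k i = F k' i"
      proof (cases "i = j")
        case False
        then have "i < j" using i by simp
        then show ?thesis using M k unfolding Q_def by blast
      qed (use k in simp)
    qed (rule k0(2))
    then show "\<exists>M'. Q (Suc j) M' \<and> M' \<subseteq> M" by (intro exI[of _ "{k \<in> M. F k j = F k0 j}"]) auto
  qed
  then obtain M where M: "\<And>j. Q j (M j)" "\<And>j. M (Suc j) \<subseteq> M j" by blast
  have anti: "M j \<subseteq> M i" if "i \<le> j" for i j
    using lift_Suc_antimono_le[of M, OF M(2) that] .
  define pick where "pick i = (SOME k. k \<in> M (Suc i))" for i
  have pick: "pick i \<in> M (Suc i)" for i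
  proof -
    have "M (Suc i) \<noteq> {}" using M(1)[of "Suc i"] by (auto simp: Q_def)
    then show ?thesis unfolding pick_def by (rule some_in_eq[THEN iffD2])
  qed
  show ?thesis
  proof (rule that[of "\<lambda>i. F (pick i) i"])
    fix n
    have "infinite (M n)" using M(1) by (auto simp: Q_def)
    then obtain k where k: "k \<in> M n" "n \<le> k" by (meson infinite_nat_iff_unbounded_le)
    have "F k i = F (pick i) i" if "i < n" for i
    proof -
      have "k \<in> M (Suc i)" using anti[of "Suc i" n] k that by auto
      then show ?thesis using M(1)[of "Suc i"] pick[of i] unfolding Q_def by (meson lessI)
    qed
    then show "\<exists>k\<ge>n. \<forall>i<n. F k i = F (pick i) i" using k by blast
  qed
qed

text \<open>Choquet's capacitability argument. Bounding one entry of the branch after the other costs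
  arbitrarily little outer measure. The branches below the bound form finitely many classes at
  each level, so that their union is again a simple compact set, and a point that belongs to
  all levels lies on a branch by Konig's lemma.\<close>

lemma analytic_inner_approximation:
  assumes "analytic P T H" and r: "r < outer_measure_of P {\<omega> \<in> space P. H \<omega> \<noteq> {}}"
  obtains B :: "nat \<Rightarrow> 'a \<Rightarrow> real set" where
    "\<And>k. simple_compact P (B k)" "\<And>k \<omega>. B (Suc k) \<omega> \<subseteq> B k \<omega>"
    "\<And>\<omega>. \<omega> \<in> space P \<Longrightarrow> (\<Inter>k. B k \<omega>) \<subseteq> H \<omega>"
    "\<And>k. r < emeasure P {\<omega> \<in> space P. B k \<omega> \<noteq> {}}"
proof -
  obtain K where K: "analytic_scheme P K" "\<And>\<omega>. \<omega> \<in> space P \<Longrightarrow> H \<omega> = (\<Union>f. \<Inter>n. K n f \<omega>)"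
    using assms(1) by (auto simp: analytic_def)
  have dep: "K n f = K n g" if "\<And>i. i < n \<Longrightarrow> f i = g i" for n f g
    using K(1) that by (auto simp: analytic_scheme_def)
  \<comment> \<open>the points that are reached by a branch whose first \<open>k\<close> entries are bounded by
    \<open>c\<close>\<close>
  define A where "A c k = {\<omega> \<in> space P. \<exists>f. (\<forall>i<k. f i \<le> c i) \<and> (\<exists>t. \<forall>n. t \<in> K n f \<omega>)}"
    for c :: "nat \<Rightarrow> nat" and k :: nat
  have A0: "A c 0 = {\<omega> \<in> space P. H \<omega> \<noteq> {}}" for c
  proof -
    have "H \<omega> \<noteq> {} \<longleftrightarrow> (\<exists>f t. \<forall>n. t \<in> K n f \<omega>)" if "\<omega> \<in> space P" for \<omega>
      unfolding K(2)[OF that] by blast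
    then show ?thesis unfolding A_def by blast
  qed
  have Acong: "A c k = A c' k" if "\<And>i. i < k \<Longrightarrow> c i = c' i" for c c' k
    using that by (simp add: A_def)
  have step: "\<exists>m. r < outer_measure_of P (A (c(k := m)) (Suc k))" if "r < outer_measure_of P (A c k)" for c k
  proof -
    have "A c k = (\<Union>m. A (c(k := m)) (Suc k))"
    proof (intro equalityI subsetI)
      fix \<omega> assume "\<omega> \<in> A c k"
      then obtain f t where "\<omega> \<in> space P" "\<forall>i<k. f i \<le> c i" "\<forall>n. t \<in> K n f \<omega>" by (auto simp: A_def)
      then have "\<omega> \<in> A (c(k := f k)) (Suc k)"
        unfolding A_def by (auto simp: less_Suc_eq intro!: exI[of _ f])
      then show "\<omega> \<in> (\<Union>m. A (c(k := m)) (Suc k))" by blast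
    next
      fix \<omega> assume "\<omega> \<in> (\<Union>m. A (c(k := m)) (Suc k))"
      then obtain m f t where *: "\<omega> \<in> space P" "\<forall>i<Suc k. f i \<le> (c(k := m)) i" "\<forall>n. t \<in> K n f \<omega>" by (auto simp: A_def)
      have "f i \<le> c i" if "i < k" for i using *(2)[rule_format, of i] that by simp
      then show "\<omega> \<in> A c k" using * unfolding A_def by blast
    qed
    moreover have "incseq (\<lambda>m. A (c(k := m)) (Suc k))"
    proof (rule incseq_SucI, rule subsetI)
      fix m \<omega> assume "\<omega> \<in> A (c(k := m)) (Suc k)"
      then obtain f t where *: "\<omega> \<in> space P" "\<forall>i<Suc k. f i \<le> (c(k := m)) i" "\<forall>n. t \<in> K n f \<omega>" by (auto simp: A_def)
      have "f i \<le> (c(k := Suc m)) i" if "i < Suc k" for i using *(2)[rule_format, of i] that by (cases "i = k") auto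
      then show "\<omega> \<in> A (c(k := Suc m)) (Suc k)" using * unfolding A_def by blast
    qed
    ultimately have "outer_measure_of P (A c k) = (SUP m. outer_measure_of P (A (c(k := m)) (Suc k)))"
      by (subst SUP_outer_measure_of_incseq) (auto simp: A_def)
    then show ?thesis using that by (auto simp: less_SUP_iff)
  qed
  \<comment> \<open>the bounds, chosen successively\<close>
  define C where "C = rec_nat (\<lambda>_. 0) (\<lambda>k c. c(k := SOME m. r < outer_measure_of P (A (c(k := m)) (Suc k))))"
  have C_Suc: "C (Suc k) = (C k)(k := SOME m. r < outer_measure_of P (A ((C k)(k := m)) (Suc k)))" for k
    by (simp add: C_def)
  have C: "r < outer_measure_of P (A (C k) k)" for k
  proof (induction k)
    case 0 then show ?case using r A0 by simp
  next
    case (Suc k)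
    show ?case unfolding C_Suc by (rule someI_ex[OF step[OF Suc]])
  qed
  define c where "c i = C (Suc i) i" for i
  have Cc: "C k i = c i" if "i < k" for i k
    using that
  proof (induction k)
    case (Suc k)
    show ?case
    proof (cases "i = k")
      case False
      then have "C (Suc k) i = C k i" by (simp add: C_Suc)
      then show ?thesis using Suc False by simp
    qed (simp add: c_def)
  qed simp
  have rA: "r < outer_measure_of P (A c k)" for k
    using C[of k] Acong[of k "C k" c] Cc by simp
  \<comment> \<open>representatives of the first \<open>k\<close> entries of the bounded branches, continued by 0\<close>
  define S where "S k = {f. (\<forall>i<k. f i \<le> c i) \<and> (\<forall>i\<ge>k. f i = 0)}" for k
  have S_fin: "finite (S k)" for k
  proof -
    define m where "m = Max (c ` {..k})"
    have "c i \<le> m" if "i < k" for i unfolding m_def using that by (intro Max_ge) auto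
    then have "S k \<subseteq> {f. \<forall>x. (x \<in> {..<k} \<longrightarrow> f x \<in> {..m}) \<and> (x \<notin> {..<k} \<longrightarrow> f x = 0)}"
      by (auto simp: S_def intro: order_trans)
    then show ?thesis by (rule finite_subset) (intro finite_set_of_finite_funs; simp)
  qed
  define B where "B k \<omega> = (\<Union>f\<in>S k. \<Inter>n\<le>k. K n f \<omega>)" for k \<omega>
  have trunc: "(\<lambda>i. if i < k then f i else 0) \<in> S k" if "\<And>i. i < k \<Longrightarrow> f i \<le> c i" for f k
    using that by (auto simp: S_def)
  have trunc_K: "K n (\<lambda>i. if i < k then f i else 0) = K n f" if "n \<le> k" for n k f
    using that by (intro dep) auto
  show ?thesis
  proof (rule that[of B])
    show sc: "simple_compact P (B k)" for k
      unfolding B_def using K(1) S_fin by (intro simple_compact_UN simple_compact_INT_atMost) (auto simp: analytic_scheme_def)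
    show "B (Suc k) \<omega> \<subseteq> B k \<omega>" for k \<omega>
    proof
      fix t assume "t \<in> B (Suc k) \<omega>"
      then obtain f where f: "f \<in> S (Suc k)" "\<And>n. n \<le> Suc k \<Longrightarrow> t \<in> K n f \<omega>" by (auto simp: B_def)
      have "(\<lambda>i. if i < k then f i else 0) \<in> S k" using f(1) by (intro trunc) (auto simp: S_def)
      moreover have "t \<in> K n (\<lambda>i. if i < k then f i else 0) \<omega>" if "n \<le> k" for n
        using f(2)[of n] that trunc_K[OF that] by simp
      ultimately show "t \<in> B k \<omega>" unfolding B_def by blast
    qed
    show "(\<Inter>k. B k \<omega>) \<subseteq> H \<omega>" if \<omega>: "\<omega> \<in> space P" for \<omega>
    proof
      fix t assume "t \<in> (\<Inter>k. B k \<omega>)"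
      then have "\<forall>k. \<exists>f\<in>S k. \<forall>n\<le>k. t \<in> K n f \<omega>" unfolding B_def by blast
      then obtain f where f: "\<And>k. f k \<in> S k" "\<And>k n. n \<le> k \<Longrightarrow> t \<in> K n (f k) \<omega>" by metis
      have "f k i \<le> c i" for k i using f(1)[of k] by (cases "i < k") (auto simp: S_def)
      then obtain g where g: "\<And>n. \<exists>k\<ge>n. \<forall>i<n. f k i = g i" using bounded_branches_converge[of f c] by blast
      have "t \<in> K n g \<omega>" for n
      proof -
        obtain k where k: "k \<ge> n" "\<forall>i<n. f k i = g i" using g by blast
        then have "K n g = K n (f k)" by (intro dep) auto
        then show ?thesis using f(2)[OF k(1)] by simp
      qed
      then show "t \<in> H \<omega>" unfolding K(2)[OF \<omega>] by blast
    qed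
    show "r < emeasure P {\<omega> \<in> space P. B k \<omega> \<noteq> {}}" for k
    proof -
      have "A c k \<subseteq> {\<omega> \<in> space P. B k \<omega> \<noteq> {}}"
      proof
        fix \<omega> assume "\<omega> \<in> A c k"
        then obtain f t where f: "\<omega> \<in> space P" "\<forall>i<k. f i \<le> c i" "\<forall>n. t \<in> K n f \<omega>" by (auto simp: A_def)
        have "(\<lambda>i. if i < k then f i else 0) \<in> S k" using f(2) by (intro trunc) auto
        moreover have "t \<in> K n (\<lambda>i. if i < k then f i else 0) \<omega>" if "n \<le> k" for n
          using f(3) trunc_K[OF that] by simp
        ultimately have "t \<in> B k \<omega>" unfolding B_def by blast
        then show "\<omega> \<in> {\<omega> \<in> space P. B k \<omega> \<noteq> {}}" using f(1) by blast
      qed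
      then have "outer_measure_of P (A c k) \<le> outer_measure_of P {\<omega> \<in> space P. B k \<omega> \<noteq> {}}"
        by (rule outer_measure_of_mono)
      also have "\<dots> = emeasure P {\<omega> \<in> space P. B k \<omega> \<noteq> {}}"
        using simple_compact_hits[OF sc, of k UNIV] by (intro outer_measure_of_eq) simp
      finally show ?thesis using rA[of k] by simp
    qed
  qed
qed

text \<open>The smallest point of a decreasing intersection of simple compact sets is measurable,
  because by compactness it is at most \<open>t\<close> if and only if each of the sets meets \<open>(-\<infinity>,t]\<close>.\<close>

theorem measurable_section:
  fixes P :: "'a measure"
  assumes "finite_measure P" and H: "H \<in> sets (borel \<Otimes>\<^sub>M P)"
    and pos: "0 < outer_measure_of P {\<omega> \<in> space P. \<exists>t\<in>{0..T}. (t, \<omega>) \<in> H}"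
  obtains A and R :: "'a \<Rightarrow> real" where
    "A \<in> sets P" "0 < emeasure P A" "\<And>\<omega>. \<omega> \<in> A \<Longrightarrow> (R \<omega>, \<omega>) \<in> H" "\<And>\<omega>. \<omega> \<in> A \<Longrightarrow> R \<omega> \<in> {0..T}"
    "\<And>t. {\<omega> \<in> A. R \<omega> \<le> t} \<in> sets P"
proof -
  interpret finite_measure P by fact
  let ?H = "\<lambda>\<omega>. {t. (t, \<omega>) \<in> H} \<inter> {0..T}"
  have an: "analytic P T ?H" using bianalytic_product_sets[OF H] by (simp add: bianalytic_def)
  have eq: "{\<omega> \<in> space P. ?H \<omega> \<noteq> {}} = {\<omega> \<in> space P. \<exists>t\<in>{0..T}. (t, \<omega>) \<in> H}" by auto
  obtain r where r: "0 < r" "r < outer_measure_of P {\<omega> \<in> space P. ?H \<omega> \<noteq> {}}"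
    using dense[OF pos] unfolding eq by blast
  obtain B where B: "\<And>k. simple_compact P (B k)" "\<And>k \<omega>. B (Suc k) \<omega> \<subseteq> B k \<omega>"
    "\<And>\<omega>. \<omega> \<in> space P \<Longrightarrow> (\<Inter>k. B k \<omega>) \<subseteq> ?H \<omega>" "\<And>k. r < emeasure P {\<omega> \<in> space P. B k \<omega> \<noteq> {}}"
    using analytic_inner_approximation[OF an r(2)] by blast
  have anti: "B n \<omega> \<subseteq> B m \<omega>" if "m \<le> n" for m n \<omega>
    using lift_Suc_antimono_le[of "\<lambda>k. B k \<omega>", OF B(2) that] .
  define A where "A = (\<Inter>k. {\<omega> \<in> space P. B k \<omega> \<inter> UNIV \<noteq> {}})"
  define R where "R \<omega> = Inf (\<Inter>k. B k \<omega>)" for \<omega>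
  have A: "A \<in> sets P" unfolding A_def by (intro sets.countable_INT' image_subsetI simple_compact_hits B(1)) auto
  have A_sub: "\<omega> \<in> space P" if "\<omega> \<in> A" for \<omega> using that by (auto simp: A_def)
  have nest: "(\<Inter>k. B k \<omega> \<inter> {..t}) \<noteq> {}" if "\<omega> \<in> space P" "\<And>k. B k \<omega> \<inter> {..t} \<noteq> {}" for \<omega> t
  proof (rule compact_nest)
    show "B n \<omega> \<inter> {..t} \<subseteq> B m \<omega> \<inter> {..t}" if "m \<le> n" for m n using anti[OF that] by blast
  qed (use that B(1) in \<open>auto simp: simple_compact_def intro: compact_Int_closed\<close>)
  have nest': "(\<Inter>k. B k \<omega>) \<noteq> {}" if "\<omega> \<in> A" for \<omega>
    using that B(1) anti A_sub[OF that] by (intro compact_nest) (auto simp: simple_compact_def A_def)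
  have compact: "compact (\<Inter>k. B k \<omega>)" if "\<omega> \<in> space P" for \<omega>
    using B(1) that by (intro compact_Inter) (auto simp: simple_compact_def)
  have R_in: "R \<omega> \<in> (\<Inter>k. B k \<omega>)" if "\<omega> \<in> A" for \<omega>
    unfolding R_def using compact[OF A_sub[OF that]] nest'[OF that]
    by (intro closed_contains_Inf) (auto simp: compact_imp_closed intro: bounded_imp_bdd_below compact_imp_bounded)
  have R_le: "R \<omega> \<le> t" if "\<omega> \<in> A" "t \<in> (\<Inter>k. B k \<omega>)" for \<omega> t
    unfolding R_def using compact[OF A_sub[OF that(1)]] that(2)
    by (intro cInf_lower) (auto intro: bounded_imp_bdd_below compact_imp_bounded)
  show ?thesis
  proof (rule that[of A R])
    show "A \<in> sets P" by (rule A)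
    show "0 < emeasure P A"
    proof -
      have "(\<lambda>k. emeasure P {\<omega> \<in> space P. B k \<omega> \<inter> UNIV \<noteq> {}}) \<longlonglongrightarrow> emeasure P A"
        unfolding A_def
      proof (rule Lim_emeasure_decseq)
        show "range (\<lambda>k. {\<omega> \<in> space P. B k \<omega> \<inter> UNIV \<noteq> {}}) \<subseteq> sets P"
          by (intro image_subsetI simple_compact_hits B(1))
        show "decseq (\<lambda>k. {\<omega> \<in> space P. B k \<omega> \<inter> UNIV \<noteq> {}})"
          by (rule decseq_SucI) (use B(2) in blast)
      qed (simp add: emeasure_eq_measure)
      then have "r \<le> emeasure P A"
        by (rule LIMSEQ_le_const) (use B(4) in \<open>auto intro: less_imp_le\<close>)
      then show ?thesis using r by auto
    qed
    show "(R \<omega>, \<omega>) \<in> H" "R \<omega> \<in> {0..T}" if "\<omega> \<in> A" for \<omega>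
      using R_in[OF that] B(3)[OF A_sub[OF that]] by auto
    fix t
    have "{\<omega> \<in> A. R \<omega> \<le> t} = A \<inter> (\<Inter>k. {\<omega> \<in> space P. B k \<omega> \<inter> {..t} \<noteq> {}})"
    proof (intro equalityI subsetI)
      fix \<omega> assume "\<omega> \<in> {\<omega> \<in> A. R \<omega> \<le> t}"
      then show "\<omega> \<in> A \<inter> (\<Inter>k. {\<omega> \<in> space P. B k \<omega> \<inter> {..t} \<noteq> {}})"
        using R_in[of \<omega>] A_sub by blast
    next
      fix \<omega> assume \<omega>: "\<omega> \<in> A \<inter> (\<Inter>k. {\<omega> \<in> space P. B k \<omega> \<inter> {..t} \<noteq> {}})"
      then obtain s where "s \<in> (\<Inter>k. B k \<omega> \<inter> {..t})" using nest[of \<omega> t] by blast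
      then have "R \<omega> \<le> s" "s \<le> t" using R_le[of \<omega> s] \<omega> by auto
      then show "\<omega> \<in> {\<omega> \<in> A. R \<omega> \<le> t}" using \<omega> by auto
    qed
    also have "\<dots> \<in> sets P"
      by (intro sets.Int A sets.countable_INT' image_subsetI simple_compact_hits B(1)) auto
    finally show "{\<omega> \<in> A. R \<omega> \<le> t} \<in> sets P" .
  qed
qed

section \<open>Optional sets of the Poisson filtration\<close>

context poisson_market
begin

text \<open>The information carried by the first \<open>n\<close> jump times.\<close>

definition "past n = sigma \<Omega> ({(\<lambda>\<omega>. min (N s \<omega>) n) -` B \<inter> \<Omega> | s B. 0 \<le> s} \<union> null_sets M)"

lemma gen_past_sub: "{(\<lambda>\<omega>. min (N s \<omega>) n) -` B \<inter> \<Omega> | s B. 0 \<le> s} \<union> null_sets M \<subseteq> events"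
proof -
  have "(\<lambda>\<omega>. min (N s \<omega>) n) -` B \<inter> \<Omega> \<in> events" if "0 \<le> s" for s B
    using measurable_sets[OF N_measurable[OF that], of "(\<lambda>k. min k n) -` B"] by (simp add: vimage_def)
  then show ?thesis by (auto simp: null_sets_def)
qed

lemma sets_past: "sets (past n) = sigma_sets \<Omega> ({(\<lambda>\<omega>. min (N s \<omega>) n) -` B \<inter> \<Omega> | s B. 0 \<le> s} \<union> null_sets M)"
  unfolding past_def using gen_past_sub[of n] sets.space_closed[of M] by (intro sets_measure_of) blast

lemma space_past [simp]: "space (past n) = \<Omega>"
  by (simp add: past_def space_measure_of_conv)

lemma sets_past_subset: "sets (past n) \<subseteq> events"
  unfolding sets_past by (rule sets.sigma_sets_subset[OF gen_past_sub])

lemma N_ge_F: "0 \<le> s \<Longrightarrow> ennreal s \<le> t \<Longrightarrow> {\<omega> \<in> \<Omega>. N s \<omega> \<in> B} \<in> sets (F t)"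
  using measurable_sets[OF N_measurable_F[of s t], of B] by (simp add: vimage_def Int_def conj_commute)

text \<open>If \<open>N t = n\<close>, then up to time \<open>t\<close> the truncation at \<open>n\<close> does not change \<open>N\<close>.\<close>

lemma F_trace_past:
  assumes "A \<in> sets (F (ennreal t))" "0 \<le> t"
  shows "\<exists>A'\<in>sets (past n). \<forall>\<omega>\<in>\<Omega>. N t \<omega> = n \<longrightarrow> (\<omega> \<in> A \<longleftrightarrow> \<omega> \<in> A')"
  using assms(1) unfolding sets_F
proof induction
  case (Basic A)
  then show ?case
  proof
    assume "A \<in> {N s -` B \<inter> \<Omega> | s B. 0 \<le> s \<and> ennreal s \<le> ennreal t}"
    then obtain s B where A: "A = N s -` B \<inter> \<Omega>" "0 \<le> s" "s \<le> t" using assms(2) by auto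
    have m: "(\<lambda>\<omega>. min (N s \<omega>) n) -` B \<inter> \<Omega> \<in> sets (past n)"
      unfolding sets_past using A(2) by (intro sigma_sets.Basic UnI1) blast
    have e: "\<omega> \<in> A \<longleftrightarrow> \<omega> \<in> (\<lambda>\<omega>. min (N s \<omega>) n) -` B \<inter> \<Omega>" if "\<omega> \<in> \<Omega>" "N t \<omega> = n" for \<omega>
      using A that N_mono[OF that(1) A(2,3)] by simp
    show ?thesis by (rule bexI[OF _ m]) (intro ballI impI, rule e)
  next
    assume "A \<in> null_sets M"
    then have "A \<in> sets (past n)" unfolding sets_past by (intro sigma_sets.Basic) auto
    then show ?thesis by blast
  qed
next
  case Empty then show ?case by (intro bexI[of _ "{}"]) auto
next
  case (Compl A)
  then obtain A' where A': "A' \<in> sets (past n)" "\<forall>\<omega>\<in>\<Omega>. N t \<omega> = n \<longrightarrow> (\<omega> \<in> A \<longleftrightarrow> \<omega> \<in> A')" by blast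
  have "\<Omega> - A' \<in> sets (past n)" using sets.compl_sets[OF A'(1)] by simp
  then show ?case using A'(2) by (intro bexI[of _ "\<Omega> - A'"]) auto
next
  case (Union A)
  then obtain A' where A': "\<And>i. A' i \<in> sets (past n)" "\<And>i. \<forall>\<omega>\<in>\<Omega>. N t \<omega> = n \<longrightarrow> (\<omega> \<in> A i \<longleftrightarrow> \<omega> \<in> A' i)" by metis
  have "(\<Union>i. A' i) \<in> sets (past n)" using A'(1) by auto
  then show ?case using A'(2) by (intro bexI[of _ "\<Union>i. A' i"]) auto
qed

text \<open>Once \<open>n\<close> jumps have occurred, the truncated process will not change any more.\<close>

lemma past_trace_F:
  assumes "A \<in> sets (past n)" "0 \<le> t"
  shows "{\<omega> \<in> A. n \<le> N t \<omega>} \<in> sets (F (ennreal t))"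
  using assms(1) unfolding sets_past
proof induction
  case (Basic A)
  have ge: "{\<omega> \<in> \<Omega>. N t \<omega> \<in> {n..}} \<in> sets (F (ennreal t))" using assms(2) by (intro N_ge_F) auto
  from Basic show ?case
  proof
    assume "A \<in> {(\<lambda>\<omega>. min (N s \<omega>) n) -` B \<inter> \<Omega> | s B. 0 \<le> s}"
    then obtain s B where A: "A = (\<lambda>\<omega>. min (N s \<omega>) n) -` B \<inter> \<Omega>" "0 \<le> s" by auto
    show ?thesis
    proof (cases "s \<le> t")
      case True
      have "{\<omega> \<in> \<Omega>. N s \<omega> \<in> (\<lambda>k. min k n) -` B} \<inter> {\<omega> \<in> \<Omega>. N t \<omega> \<in> {n..}} \<in> sets (F (ennreal t))"
        using A True by (intro sets.Int ge N_ge_F) (auto intro: ennreal_leI)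
      moreover have "{\<omega> \<in> A. n \<le> N t \<omega>} = {\<omega> \<in> \<Omega>. N s \<omega> \<in> (\<lambda>k. min k n) -` B} \<inter> {\<omega> \<in> \<Omega>. N t \<omega> \<in> {n..}}"
        using A by auto
      ultimately show ?thesis by simp
    next
      case False
      have "min (N s \<omega>) n = n" if "\<omega> \<in> \<Omega>" "n \<le> N t \<omega>" for \<omega>
        using N_mono[OF that(1) assms(2), of s] False that by simp
      then have "{\<omega> \<in> A. n \<le> N t \<omega>} = (if n \<in> B then {\<omega> \<in> \<Omega>. N t \<omega> \<in> {n..}} else {})"
        using A by auto
      then show ?thesis using ge by simp
    qed
  next
    assume A: "A \<in> null_sets M"
    have "A \<inter> {\<omega> \<in> \<Omega>. N t \<omega> \<in> {n..}} \<in> null_sets M" using A ge sets_F_subset by (intro null_set_Int2) auto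
    moreover have "{\<omega> \<in> A. n \<le> N t \<omega>} = A \<inter> {\<omega> \<in> \<Omega>. N t \<omega> \<in> {n..}}"
      using sets.sets_into_space[OF null_setsD2[OF A]] by auto
    ultimately show ?thesis by (simp add: null_in_F)
  qed
next
  case Empty then show ?case by simp
next
  case (Compl A)
  have "{\<omega> \<in> \<Omega>. N t \<omega> \<in> {n..}} - {\<omega> \<in> A. n \<le> N t \<omega>} \<in> sets (F (ennreal t))"
    using assms(2) Compl by (intro sets.Diff N_ge_F) auto
  moreover have "{\<omega> \<in> \<Omega> - A. n \<le> N t \<omega>} = {\<omega> \<in> \<Omega>. N t \<omega> \<in> {n..}} - {\<omega> \<in> A. n \<le> N t \<omega>}" by auto
  ultimately show ?case by simp
next
  case (Union A)
  have "(\<Union>i. {\<omega> \<in> A i. n \<le> N t \<omega>}) \<in> sets (F (ennreal t))" using Union by auto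
  moreover have "{\<omega> \<in> \<Union>(range A). n \<le> N t \<omega>} = (\<Union>i. {\<omega> \<in> A i. n \<le> N t \<omega>})" by auto
  ultimately show ?case by simp
qed

text \<open>The smallest multiple of \<open>1 / Suc j\<close> above \<open>s\<close>: an approximation of \<open>s\<close> from the right with
  countably many values.\<close>

definition up :: "nat \<Rightarrow> real \<Rightarrow> real" where
  "up j s = real_of_int (\<lfloor>real (Suc j) * s\<rfloor> + 1) / real (Suc j)"

lemma up_bounds: "s < up j s" "up j s \<le> s + 1 / real (Suc j)"
proof -
  have "real (Suc j) * s < real_of_int (\<lfloor>real (Suc j) * s\<rfloor> + 1)" by linarith
  then show "s < up j s" by (simp add: up_def field_simps)
  have "real_of_int (\<lfloor>real (Suc j) * s\<rfloor> + 1) \<le> real (Suc j) * s + 1" by linarith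
  then have "real_of_int (\<lfloor>real (Suc j) * s\<rfloor> + 1) / real (Suc j) \<le> (real (Suc j) * s + 1) / real (Suc j)"
    by (rule divide_right_mono) simp
  then show "up j s \<le> s + 1 / real (Suc j)" by (simp add: up_def add_divide_distrib)
qed

lemma filterlim_up: "filterlim (\<lambda>j. up j s) (at_right s) sequentially"
proof -
  have "(\<lambda>j. up j s) \<longlonglongrightarrow> s"
  proof (rule tendsto_sandwich[of "\<lambda>_. s" _ _ "\<lambda>j. s + 1 / real (Suc j)"])
    have "(\<lambda>j. s + 1 / real (Suc j)) \<longlonglongrightarrow> s + 0"
      by (intro tendsto_intros LIMSEQ_Suc[OF lim_const_over_n])
    then show "(\<lambda>j. s + 1 / real (Suc j)) \<longlonglongrightarrow> s" by simp
    show "(\<lambda>_. s) \<longlonglongrightarrow> s" by simp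
    show "eventually (\<lambda>j. s \<le> up j s) sequentially" using up_bounds(1) by (intro always_eventually allI less_imp_le)
    show "eventually (\<lambda>j. up j s \<le> s + 1 / real (Suc j)) sequentially" using up_bounds(2) by (intro always_eventually allI)
  qed
  moreover have "eventually (\<lambda>j. up j s \<in> {s<..} \<and> up j s \<noteq> s) sequentially"
    using up_bounds(1)[of s] by (intro always_eventually) (auto simp: less_imp_neq[symmetric])
  ultimately show ?thesis unfolding filterlim_at by blast
qed

lemma eventually_N_up:
  assumes "\<omega> \<in> \<Omega>" "0 \<le> t"
  shows "eventually (\<lambda>j. N (up j t) \<omega> = N t \<omega>) sequentially"
proof -
  interpret p: counting_path "\<lambda>t. N t \<omega>" by (rule counting[OF assms(1)])
  obtain e where e: "e > 0" "\<And>s. t \<le> s \<Longrightarrow> s < t + e \<Longrightarrow> N s \<omega> = N t \<omega>"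
    using p.right_constant[OF assms(2)] by blast
  have "eventually (\<lambda>s. N s \<omega> = N t \<omega>) (at_right t)"
    unfolding eventually_at_right_field
  proof (intro exI[of _ "t + e"] conjI allI impI)
    fix y assume "t < y" "y < t + e"
    then show "N y \<omega> = N t \<omega>" by (intro e(2)) auto
  qed (use e in simp)
  then show ?thesis by (rule eventually_compose_filterlim[OF _ filterlim_up])
qed

lemma up_section_sets:
  assumes "\<And>r. A r \<in> sets (past n)"
  shows "{(t, \<omega>). \<omega> \<in> A (up j t)} \<in> sets (borel \<Otimes>\<^sub>M past n)"
proof -
  have "{(t, \<omega>). \<omega> \<in> A (up j t)}
      = (\<Union>k::int. {t. \<lfloor>real (Suc j) * t\<rfloor> = k} \<times> A (real_of_int (k + 1) / real (Suc j)))"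
    by (auto simp: up_def)
  also have "\<dots> \<in> sets (borel \<Otimes>\<^sub>M past n)"
  proof (intro sets.countable_UN' image_subsetI pair_measureI assms)
    show "{t. \<lfloor>real (Suc j) * t\<rfloor> = k} \<in> sets borel" for k by measurable
  qed auto
  finally show ?thesis .
qed

text \<open>At time \<open>t\<close>, a cadlag adapted process is the limit of its values at the times \<open>up j t\<close>,
  which come before the next jump for large \<open>j\<close>. At such a time the process is a function of
  the first \<open>n\<close> jumps, if \<open>N t = n\<close>.\<close>

lemma optional_trace_past:
  assumes "H \<in> sets (optional_sigma \<Omega> F)"
  shows "\<exists>H'\<in>sets (borel \<Otimes>\<^sub>M past n). \<forall>t\<ge>0. \<forall>\<omega>\<in>\<Omega>. N t \<omega> = n \<longrightarrow> ((t, \<omega>) \<in> H \<longleftrightarrow> (t, \<omega>) \<in> H')"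
proof -
  let ?ok = "\<lambda>H H'. \<forall>t\<ge>0. \<forall>\<omega>\<in>\<Omega>. N t \<omega> = n \<longrightarrow> ((t, \<omega>) \<in> H \<longleftrightarrow> (t, \<omega>) \<in> H')"
  let ?G = "{{(t, \<omega>). 0 \<le> t \<and> \<omega> \<in> \<Omega> \<and> X t \<omega> \<in> B} | X B.
        adapted F X \<and> (\<forall>\<omega>\<in>\<Omega>. cadlag (\<lambda>t. X t \<omega>)) \<and> B \<in> sets borel}"
  have sub: "?G \<subseteq> Pow ({0..} \<times> \<Omega>)" by auto
  have sp: "UNIV \<times> \<Omega> \<in> sets (borel \<Otimes>\<^sub>M past n)" using sets.top[of "borel \<Otimes>\<^sub>M past n"] by (simp add: space_pair_measure)
  have compl: "\<exists>H'\<in>sets (borel \<Otimes>\<^sub>M past n). ?ok K H'"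
    if ex: "\<exists>H'\<in>sets (borel \<Otimes>\<^sub>M past n). ?ok H H'" and "\<And>t \<omega>. 0 \<le> t \<Longrightarrow> \<omega> \<in> \<Omega> \<Longrightarrow> (t, \<omega>) \<in> K \<longleftrightarrow> (t, \<omega>) \<notin> H" for H K
  proof -
    obtain H' where "H' \<in> sets (borel \<Otimes>\<^sub>M past n)" "?ok H H'" using ex by blast
    then show ?thesis using that(2) sp by (intro bexI[of _ "UNIV \<times> \<Omega> - H'"]) auto
  qed
  have union: "\<exists>H'\<in>sets (borel \<Otimes>\<^sub>M past n). ?ok K H'"
    if ex: "\<And>i::nat. \<exists>H'\<in>sets (borel \<Otimes>\<^sub>M past n). ?ok (H i) H'" and "\<And>t \<omega>. 0 \<le> t \<Longrightarrow> \<omega> \<in> \<Omega> \<Longrightarrow> (t, \<omega>) \<in> K \<longleftrightarrow> (\<exists>i. (t, \<omega>) \<in> H i)" for H K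
  proof -
    obtain H' where "\<And>i. H' i \<in> sets (borel \<Otimes>\<^sub>M past n)" "\<And>i. ?ok (H i) (H' i)" using ex by metis
    then show ?thesis using that(2) by (intro bexI[of _ "\<Union>i. H' i"]) auto
  qed
  have ray: "\<exists>H'\<in>sets (borel \<Otimes>\<^sub>M past n). ?ok {(t, \<omega>). 0 \<le> t \<and> \<omega> \<in> \<Omega> \<and> X t \<omega> \<in> {u<..}} H'"
    if X: "adapted F X" "\<forall>\<omega>\<in>\<Omega>. cadlag (\<lambda>t. X t \<omega>)" for X :: "real \<Rightarrow> 'a \<Rightarrow> real" and u :: real
  proof -
    let ?c = "\<lambda>i. u + 1 / real (Suc i)"
    define good_set where "good_set r i A' \<longleftrightarrow> A' \<in> sets (past n) \<and>
        (0 \<le> r \<longrightarrow> (\<forall>\<omega>\<in>\<Omega>. N r \<omega> = n \<longrightarrow> (?c i \<le> X r \<omega> \<longleftrightarrow> \<omega> \<in> A')))" for r i A'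
    have ex: "\<exists>A'. good_set r i A'" for r i
    proof (cases "0 \<le> r")
      case True
      then have "X r \<in> borel_measurable (F (ennreal r))" using X(1) by (simp add: adapted_def)
      then have "{\<omega> \<in> space (F (ennreal r)). ?c i \<le> X r \<omega>} \<in> sets (F (ennreal r))" by measurable
      from F_trace_past[OF this True, of n] show ?thesis by (auto simp: good_set_def)
    qed (auto simp: good_set_def)
    define A where "A r i = (SOME A'. good_set r i A')" for r i
    have "good_set r i (A r i)" for r i unfolding A_def by (rule someI_ex[OF ex])
    then have A: "\<And>r i. A r i \<in> sets (past n)"
      "\<And>r i \<omega>. 0 \<le> r \<Longrightarrow> \<omega> \<in> \<Omega> \<Longrightarrow> N r \<omega> = n \<Longrightarrow> ?c i \<le> X r \<omega> \<longleftrightarrow> \<omega> \<in> A r i"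
      unfolding good_set_def by blast+
    \<comment> \<open>\<open>X t > u\<close> if and only if, for some \<open>i\<close>, the approximating values are at
      least \<open>u + 1 / Suc i\<close> from some \<open>j\<close> on\<close>
    let ?H = "\<Union>i. \<Union>m. \<Inter>j\<in>{m..}. {(t, \<omega>). \<omega> \<in> A (up j t) i}"
    have "?H \<in> sets (borel \<Otimes>\<^sub>M past n)"
    proof (intro sets.countable_UN' image_subsetI sets.countable_INT')
      show "{(t, \<omega>). \<omega> \<in> A (up j t) i} \<in> sets (borel \<Otimes>\<^sub>M past n)" for i j
        by (rule up_section_sets[of "\<lambda>r. A r i"]) (rule A(1))
    qed auto
    moreover have "X t \<omega> \<in> {u<..} \<longleftrightarrow> (t, \<omega>) \<in> ?H" if t: "0 \<le> t" and \<omega>: "\<omega> \<in> \<Omega>" and N: "N t \<omega> = n" for t \<omega>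
    proof -
      have pos: "0 \<le> up j t" for j using up_bounds(1)[of t j] t by simp
      have ev: "eventually (\<lambda>j. \<forall>i. ?c i \<le> X (up j t) \<omega> \<longleftrightarrow> \<omega> \<in> A (up j t) i) sequentially"
        using eventually_N_up[OF \<omega> t] by eventually_elim (use A(2) pos \<omega> N in auto)
      have "((\<lambda>s. X s \<omega>) \<longlongrightarrow> X t \<omega>) (at_right t)"
        using X(2) \<omega> t by (auto simp: cadlag_def continuous_within)
      then have lim: "(\<lambda>j. X (up j t) \<omega>) \<longlonglongrightarrow> X t \<omega>" by (rule filterlim_compose[OF _ filterlim_up])
      show ?thesis
      proof
        assume "X t \<omega> \<in> {u<..}"
        then have "0 < X t \<omega> - u" by simp
        then obtain i where i: "1 / real (Suc i) < X t \<omega> - u" using nat_approx_posE by metis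
        then have "eventually (\<lambda>j. ?c i < X (up j t) \<omega>) sequentially"
          by (intro order_tendstoD(1)[OF lim]) simp
        with ev have "eventually (\<lambda>j. \<omega> \<in> A (up j t) i) sequentially"
        proof eventually_elim
          case (elim j)
          then show ?case using less_imp_le[OF elim(2)] by blast
        qed
        then obtain m where "\<And>j. m \<le> j \<Longrightarrow> \<omega> \<in> A (up j t) i" unfolding eventually_sequentially by blast
        then have "(t, \<omega>) \<in> (\<Inter>j\<in>{m..}. {(t, \<omega>). \<omega> \<in> A (up j t) i})" by simp
        then show "(t, \<omega>) \<in> ?H" by blast
      next
        assume "(t, \<omega>) \<in> ?H"
        then obtain i m where "(t, \<omega>) \<in> (\<Inter>j\<in>{m..}. {(t, \<omega>). \<omega> \<in> A (up j t) i})" by blast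
        then have "\<And>j. m \<le> j \<Longrightarrow> \<omega> \<in> A (up j t) i" by simp
        then have "eventually (\<lambda>j. \<omega> \<in> A (up j t) i) sequentially" by (auto simp: eventually_sequentially)
        with ev have "eventually (\<lambda>j. ?c i \<le> X (up j t) \<omega>) sequentially"
          by eventually_elim blast
        then have "?c i \<le> X t \<omega>" by (rule tendsto_lowerbound[OF lim]) simp
        moreover have "0 < 1 / real (Suc i)" by simp
        ultimately have "u < X t \<omega>" by linarith
        then show "X t \<omega> \<in> {u<..}" by simp
      qed
    qed
    ultimately show ?thesis by (intro bexI[of _ ?H]) blast
  qed
  have "H \<in> sigma_sets ({0..} \<times> \<Omega>) ?G"
    using assms unfolding optional_sigma_def sets_measure_of[OF sub] .
  then show ?thesis
  proof induction
    case (Basic H)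
    then obtain X B where X: "adapted F X" "\<forall>\<omega>\<in>\<Omega>. cadlag (\<lambda>t. X t \<omega>)" and B: "B \<in> sets borel"
      and H: "H = {(t, \<omega>). 0 \<le> t \<and> \<omega> \<in> \<Omega> \<and> X t \<omega> \<in> B}" by auto
    have "B \<in> sigma_sets UNIV (range greaterThan)"
      using B by (subst (asm) borel_Ioi) simp
    then show ?case unfolding H
    proof induction
      case (Basic B) then show ?case using ray[OF X] by auto
    next
      case Empty then show ?case by (intro bexI[of _ "{}"]) auto
    next
      case (Compl B) show ?case by (rule compl[OF Compl.IH]) auto
    next
      case (Union B)
      show ?case by (rule union[of "\<lambda>i. {(t, \<omega>). 0 \<le> t \<and> \<omega> \<in> \<Omega> \<and> X t \<omega> \<in> B i}"]) (use Union in auto)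
    qed
  next
    case Empty then show ?case by (intro bexI[of _ "{}"]) auto
  next
    case (Compl H) show ?case by (rule compl[OF Compl.IH]) auto
  next
    case (Union H) show ?case by (rule union[of H]) (use Union in auto)
  qed
qed

text \<open>The time of the \<open>n\<close>-th jump, which is at most \<open>m\<close>, is located in a cell of a grid. From the
  end of the cell, there is no jump for \<open>m\<close> more units of time with probability \<open>exp (- lam
  m)\<close>, independently of the past, and this extends beyond \<open>m\<close>. The only error is due to a
  second jump in the cell, and it vanishes with the mesh.\<close>

lemma next_jump_may_be_late:
  assumes A: "A \<in> sets (past n)" and m: "0 < m" and An: "\<And>\<omega>. \<omega> \<in> A \<Longrightarrow> n \<le> N m \<omega>" and pos: "0 < prob A"
  shows "0 < prob {\<omega> \<in> A. N m \<omega> = n}"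
proof (cases "n = 0")
  case True
  have A\<Omega>: "A \<subseteq> \<Omega>" using A sets_past_subset sets.sets_into_space by blast
  have "{\<omega> \<in> A. n \<le> N 0 \<omega>} = A" using True by simp
  then have "A \<in> sets (F (ennreal 0))" using past_trace_F[OF A, of 0] by simp
  then have "prob (A \<inter> {\<omega> \<in> \<Omega>. N (0 + m) \<omega> = N 0 \<omega>}) = prob A * exp (- (lam * m))"
    using m by (intro indep_F_no_jump) auto
  moreover have "A \<inter> {\<omega> \<in> \<Omega>. N (0 + m) \<omega> = N 0 \<omega>} = {\<omega> \<in> A. N m \<omega> = n}" using True A\<Omega> N_0 by auto
  ultimately show ?thesis using pos by simp
next
  case False
  have A\<Omega>: "A \<subseteq> \<Omega>" and Aev: "A \<in> events" using A sets_past_subset sets.sets_into_space by blast+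
  have Nm: "{\<omega> \<in> A. N m \<omega> = n} \<in> events"
  proof -
    have "{\<omega> \<in> A. N m \<omega> = n} = A \<inter> {\<omega> \<in> \<Omega>. N m \<omega> = n}" using A\<Omega> by auto
    then show ?thesis using Aev count_event_F[of m n] m sets_F_subset by auto
  qed
  have "exp (- (lam * m)) * prob A \<le> prob {\<omega> \<in> A. N m \<omega> = n} + (lam * m)\<^sup>2 / real j" if j: "0 < j" for j :: nat
  proof -
    let ?q = "\<lambda>k. real k * m / real j"
    have q0: "0 \<le> ?q k" for k using m by simp
    have q_le: "?q k \<le> ?q (Suc k)" for k using m by (intro divide_right_mono mult_right_mono) auto
    \<comment> \<open>the \<open>n\<close>-th jump is in the cell \<open>k\<close>\<close>
    define B where "B k = {\<omega> \<in> A. N (?q k) \<omega> < n \<and> n \<le> N (?q (Suc k)) \<omega>}" for k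
    have BF: "B k \<in> sets (F (ennreal (?q (Suc k))))" for k
    proof -
      have "{\<omega> \<in> A. n \<le> N (?q (Suc k)) \<omega>} \<inter> {\<omega> \<in> \<Omega>. N (?q k) \<omega> \<in> {..<n}} \<in> sets (F (ennreal (?q (Suc k))))"
        using q_le q0 by (intro sets.Int past_trace_F[OF A] N_ge_F) (auto intro: ennreal_leI simp del: of_nat_Suc)
      moreover have "B k = {\<omega> \<in> A. n \<le> N (?q (Suc k)) \<omega>} \<inter> {\<omega> \<in> \<Omega>. N (?q k) \<omega> \<in> {..<n}}"
        unfolding B_def using A\<Omega> by auto
      ultimately show ?thesis by simp
    qed
    have B_UN: "A = (\<Union>k<j. B k)"
    proof
      show "(\<Union>k<j. B k) \<subseteq> A" by (auto simp: B_def)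
      show "A \<subseteq> (\<Union>k<j. B k)"
      proof
        fix \<omega> assume \<omega>: "\<omega> \<in> A"
        have 0: "N (?q 0) \<omega> < n" using \<omega> A\<Omega> N_0 False by auto
        have "n \<le> N (?q j) \<omega>" using An[OF \<omega>] j by simp
        then have ex: "\<exists>k. n \<le> N (?q k) \<omega>" by blast
        define k where "k = (LEAST k. n \<le> N (?q k) \<omega>)"
        have k: "n \<le> N (?q k) \<omega>" unfolding k_def using ex by (rule LeastI_ex)
        have kj: "k \<le> j" unfolding k_def using \<open>n \<le> N (?q j) \<omega>\<close> by (rule Least_le)
        have "k \<noteq> 0" using 0 k by (metis not_le)
        then obtain i where i: "k = Suc i" by (cases k) auto
        have "\<not> n \<le> N (?q i) \<omega>" using not_less_Least[of i "\<lambda>k. n \<le> N (?q k) \<omega>"] i by (simp add: k_def[symmetric])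
        then have "\<omega> \<in> B i" "i < j" using k i kj \<omega> by (auto simp: B_def)
        then show "\<omega> \<in> (\<Union>k<j. B k)" by blast
      qed
    qed
    have disj: "disjoint_family_on B {..<j}"
    proof (unfold disjoint_family_on_def, intro ballI impI)
      have "B i \<inter> B k = {}" if "i < k" for i k
      proof -
        have "?q (Suc i) \<le> ?q k" using that m by (intro divide_right_mono mult_right_mono) auto
        then have "N (?q (Suc i)) \<omega> \<le> N (?q k) \<omega>" if "\<omega> \<in> \<Omega>" for \<omega> using q0 that by (intro N_mono)
        then show ?thesis using A\<Omega> unfolding B_def by fastforce
      qed
      then show "B i \<inter> B k = {}" if "i \<noteq> k" for i k using that by (metis Int_commute linorder_neqE_nat)
    qed
    let ?C = "\<lambda>k. B k \<inter> {\<omega> \<in> \<Omega>. N (?q (Suc k) + m) \<omega> = N (?q (Suc k)) \<omega>}"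
    have Bev: "B k \<in> events" for k using BF sets_F_subset by blast
    have Cev: "?C k \<in> events" for k using Bev q0 m by (intro sets.Int events_N_eq) auto
    have "prob A = (\<Sum>k<j. prob (B k))"
      unfolding B_UN using Bev disj by (intro finite_measure_finite_Union) auto
    then have "exp (- (lam * m)) * prob A = (\<Sum>k<j. prob (?C k))"
      using BF q0 m by (simp add: indep_F_no_jump sum_distrib_left mult.commute)
    also have "\<dots> = prob (\<Union>k<j. ?C k)"
    proof (rule finite_measure_finite_Union[symmetric])
      show "disjoint_family_on ?C {..<j}" using disj by (auto simp: disjoint_family_on_def)
    qed (use Cev in auto)
    also have "\<dots> \<le> prob ({\<omega> \<in> A. N m \<omega> = n} \<union> (\<Union>k<j. {\<omega> \<in> \<Omega>. 2 \<le> N (?q (Suc k)) \<omega> - N (?q k) \<omega>}))"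
    proof (rule finite_measure_mono)
      show "{\<omega> \<in> A. N m \<omega> = n} \<union> (\<Union>k<j. {\<omega> \<in> \<Omega>. 2 \<le> N (?q (Suc k)) \<omega> - N (?q k) \<omega>}) \<in> events"
      proof (intro sets.Un Nm sets.finite_UN ballI)
        fix k
        have [measurable]: "N (?q (Suc k)) \<in> measurable M (count_space UNIV)" "N (?q k) \<in> measurable M (count_space UNIV)"
          using q0 by (auto intro!: N_measurable simp del: of_nat_Suc)
        show "{\<omega> \<in> \<Omega>. 2 \<le> N (?q (Suc k)) \<omega> - N (?q k) \<omega>} \<in> events" by measurable
      qed simp
      show "(\<Union>k<j. ?C k) \<subseteq> {\<omega> \<in> A. N m \<omega> = n} \<union> (\<Union>k<j. {\<omega> \<in> \<Omega>. 2 \<le> N (?q (Suc k)) \<omega> - N (?q k) \<omega>})"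
      proof (intro UN_least subsetI)
        fix k \<omega> assume k: "k \<in> {..<j}" and \<omega>: "\<omega> \<in> ?C k"
        show "\<omega> \<in> {\<omega> \<in> A. N m \<omega> = n} \<union> (\<Union>k<j. {\<omega> \<in> \<Omega>. 2 \<le> N (?q (Suc k)) \<omega> - N (?q k) \<omega>})"
        proof (cases "2 \<le> N (?q (Suc k)) \<omega> - N (?q k) \<omega>")
          case True
          then show ?thesis using k \<omega> by blast
        next
          case False
          then have "N (?q (Suc k)) \<omega> = n" using \<omega> by (auto simp: B_def)
          moreover have "N m \<omega> \<le> N (?q (Suc k) + m) \<omega>" using \<omega> m q0[of "Suc k"] by (intro N_mono) auto
          moreover have "n \<le> N m \<omega>" using \<omega> An by (auto simp: B_def)
          ultimately show ?thesis using \<omega> by (auto simp: B_def)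
        qed
      qed
    qed
    also have "\<dots> \<le> prob {\<omega> \<in> A. N m \<omega> = n} + prob (\<Union>k<j. {\<omega> \<in> \<Omega>. 2 \<le> N (?q (Suc k)) \<omega> - N (?q k) \<omega>})"
    proof (intro measure_Un_le Nm sets.finite_UN ballI)
      fix k
      have [measurable]: "N (?q (Suc k)) \<in> measurable M (count_space UNIV)" "N (?q k) \<in> measurable M (count_space UNIV)"
        using q0 by (auto intro!: N_measurable simp del: of_nat_Suc)
      show "{\<omega> \<in> \<Omega>. 2 \<le> N (?q (Suc k)) \<omega> - N (?q k) \<omega>} \<in> events" by measurable
    qed simp
    also have "\<dots> \<le> prob {\<omega> \<in> A. N m \<omega> = n} + (lam * m)\<^sup>2 / real j"
      using prob_double_jump_on_grid_le[OF m j] by simp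
    finally show ?thesis .
  qed
  then have *: "\<And>j. exp (- (lam * m)) * prob A \<le> prob {\<omega> \<in> A. N m \<omega> = n} + (lam * m)\<^sup>2 / real (Suc j)" by blast
  have "(\<lambda>j. prob {\<omega> \<in> A. N m \<omega> = n} + (lam * m)\<^sup>2 / real (Suc j)) \<longlonglongrightarrow> prob {\<omega> \<in> A. N m \<omega> = n} + 0"
    by (intro tendsto_intros LIMSEQ_Suc[OF lim_const_over_n])
  then have "exp (- (lam * m)) * prob A \<le> prob {\<omega> \<in> A. N m \<omega> = n} + 0"
    by (rule LIMSEQ_le_const) (use * in auto)
  moreover have "0 < exp (- (lam * m)) * prob A" using pos by simp
  ultimately show ?thesis by linarith
qed

text \<open>Countably many times up to \<open>t\<close> at which every state of the path up to \<open>t\<close> can be observed: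
  rational times, and \<open>t\<close> itself.\<close>

definition "probes t = {r \<in> insert (enn2real t) (range q). ennreal r \<le> t}"

lemma probes_countable: "countable (probes t)" unfolding probes_def by (rule countable_subset[of _ "insert (enn2real t) (range q)"]) auto

lemma probes_nonneg: "r \<in> probes t \<Longrightarrow> 0 \<le> r" using q_nonneg by (auto simp: probes_def)

lemma probe_exists:
  assumes "\<omega> \<in> \<Omega>" "0 \<le> s" "ennreal s \<le> t"
  shows "\<exists>r\<in>probes t. s \<le> r \<and> N r \<omega> = N s \<omega>"
proof (cases "t = ennreal s")
  case True
  then show ?thesis using assms by (intro bexI[of _ s]) (auto simp: probes_def)
next
  case False
  interpret p: counting_path "\<lambda>t. N t \<omega>" by (rule counting[OF assms(1)])
  obtain e where e: "e > 0" "\<And>r. s \<le> r \<Longrightarrow> r < s + e \<Longrightarrow> N r \<omega> = N s \<omega>"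
    using p.right_constant[OF assms(2)] by blast
  have lt: "ennreal s < t" using False assms(3) by simp
  obtain u where u: "s < u" "u \<le> s + e" "ennreal u \<le> t"
  proof (cases t)
    case (real r)
    then have "s < r" using lt assms(2) by (simp add: ennreal_less_iff)
    then show ?thesis using e(1) real assms(2) by (intro that[of "min r (s + e)"]) (auto intro: ennreal_leI)
  next
    case top
    then show ?thesis using e(1) by (intro that[of "s + e"]) auto
  qed
  obtain i where i: "s < q i" "q i < u" using q_dense[OF assms(2) u(1)] by blast
  have "ennreal (q i) \<le> t" using i u(3) by (meson ennreal_leI less_imp_le order_trans)
  moreover have "N (q i) \<omega> = N s \<omega>" using i u by (intro e(2)) auto
  ultimately show ?thesis using i by (intro bexI[of _ "q i"]) (auto simp: probes_def)
qed

text \<open>If the set were not negligible on \<open>N t = n\<close>, then a section of its trace would be a time \<open>R\<close>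
  that is known from the first \<open>n\<close> jumps, on an event of positive probability. Waiting for
  \<open>R\<close>, with the attempt given up if a jump intervenes, is a stopping time, and with positive
  probability no jump does. At this stopping time the path is in the set.\<close>

theorem optional_evanescent:
  assumes H: "H \<in> sets (optional_sigma \<Omega> F)"
    and T: "\<And>T. stopping_time F T \<Longrightarrow> AE \<omega> in M. T \<omega> < \<infinity> \<longrightarrow> (enn2real (T \<omega>), \<omega>) \<notin> H"
  shows "AE \<omega> in M. \<forall>t\<ge>0. (t, \<omega>) \<notin> H"
proof -
  have "AE \<omega> in M. \<forall>t\<in>{0..real (Suc m)}. N t \<omega> = n \<longrightarrow> (t, \<omega>) \<notin> H" for n m
  proof -
    let ?m = "real (Suc m)"
    obtain H' where H': "H' \<in> sets (borel \<Otimes>\<^sub>M past n)"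
      "\<And>t \<omega>. 0 \<le> t \<Longrightarrow> \<omega> \<in> \<Omega> \<Longrightarrow> N t \<omega> = n \<Longrightarrow> (t, \<omega>) \<in> H \<longleftrightarrow> (t, \<omega>) \<in> H'"
      using optional_trace_past[OF H, of n] by metis
    \<comment> \<open>the times from the \<open>n\<close>-th jump on\<close>
    define L where "L = UNIV \<times> \<Omega> - (\<Union>i. {..<q i} \<times> {\<omega> \<in> \<Omega>. N (q i) \<omega> < n})"
    have L: "L \<in> sets (borel \<Otimes>\<^sub>M past n)"
      unfolding L_def
    proof (intro sets.Diff sets.countable_UN' image_subsetI pair_measureI)
      show "\<Omega> \<in> sets (past n)" using sets.top[of "past n"] by simp
      fix i
      have "(\<lambda>\<omega>. min (N (q i) \<omega>) n) -` {..<n} \<inter> \<Omega> \<in> sets (past n)"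
        unfolding sets_past using q_nonneg by (intro sigma_sets.Basic) blast
      then show "{\<omega> \<in> \<Omega>. N (q i) \<omega> < n} \<in> sets (past n)" by (simp add: vimage_def Int_def conj_commute min_less_iff_disj)
    qed auto
    have L_iff: "(t, \<omega>) \<in> L \<longleftrightarrow> n \<le> N t \<omega>" if t0: "0 \<le> t" and w0: "\<omega> \<in> \<Omega>" for t \<omega>
    proof
      assume l: "(t, \<omega>) \<in> L"
      show "n \<le> N t \<omega>"
      proof (rule ccontr)
        assume "\<not> n \<le> N t \<omega>"
        interpret p: counting_path "\<lambda>t. N t \<omega>" by (rule counting[OF w0])
        obtain e where e: "e > 0" "\<And>r. t \<le> r \<Longrightarrow> r < t + e \<Longrightarrow> N r \<omega> = N t \<omega>"
          using p.right_constant[OF t0] by blast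
        obtain i where i: "t < q i" "q i < t + e" using q_dense[of t "t + e"] t0 e(1) by auto
        then have "N (q i) \<omega> = N t \<omega>" by (intro e(2)) auto
        then show False using l i \<open>\<not> n \<le> N t \<omega>\<close> w0 by (auto simp: L_def)
      qed
    next
      assume "n \<le> N t \<omega>"
      then have "n \<le> N (q i) \<omega>" if "t < q i" for i
        using N_mono[OF w0 t0, of "q i"] that by simp
      then show "(t, \<omega>) \<in> L" using w0 by (auto simp: L_def not_less[symmetric])
    qed
    let ?P = "restr_to_subalg M (past n)"
    have sub: "subalgebra M (past n)" using sets_past_subset by (simp add: subalgebra_def)
    have setsP: "sets ?P = sets (past n)" and spP: "space ?P = \<Omega>"
      using sub by (simp_all add: sets_restr_to_subalg space_restr_to_subalg)
    have em: "emeasure ?P A = emeasure M A" if "A \<in> sets (past n)" for A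
      by (rule emeasure_restr_to_subalg[OF sub that])
    have fin: "finite_measure ?P"
      by (rule finite_measureI) (use em[of \<Omega>] sets.top[of "past n"] spP in \<open>simp add: emeasure_eq_measure\<close>)
    have E: "H' \<inter> L \<in> sets (borel \<Otimes>\<^sub>M ?P)"
      using H'(1) L by (simp add: sets_pair_measure_cong[OF refl setsP])
    let ?E = "{\<omega> \<in> space ?P. \<exists>t\<in>{0..?m}. (t, \<omega>) \<in> H' \<inter> L}"
    have zero: "outer_measure_of ?P ?E = 0"
    proof (rule ccontr)
      assume "outer_measure_of ?P ?E \<noteq> 0"
      then have "0 < outer_measure_of ?P ?E" by (simp add: zero_less_iff_neq_zero)
      then obtain A R where A: "A \<in> sets ?P" "0 < emeasure ?P A" and R: "\<And>\<omega>. \<omega> \<in> A \<Longrightarrow> (R \<omega>, \<omega>) \<in> H' \<inter> L"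
        "\<And>\<omega>. \<omega> \<in> A \<Longrightarrow> R \<omega> \<in> {0..?m}" "\<And>t. {\<omega> \<in> A. R \<omega> \<le> t} \<in> sets ?P"
        using measurable_section[OF fin E, of ?m] by blast
      have Ap: "A \<in> sets (past n)" and Rp: "\<And>t. {\<omega> \<in> A. R \<omega> \<le> t} \<in> sets (past n)" using A R(3) setsP by auto
      have A\<Omega>: "\<omega> \<in> \<Omega>" if "\<omega> \<in> A" for \<omega> using sets.sets_into_space[OF Ap] that by auto
      have RN: "n \<le> N (R \<omega>) \<omega>" if "\<omega> \<in> A" for \<omega>
        using R(1,2)[OF that] L_iff[of "R \<omega>" \<omega>] A\<Omega>[OF that] by auto
      define T where "T \<omega> = (if \<omega> \<in> A \<and> N (R \<omega>) \<omega> = n then ennreal (R \<omega>) else \<infinity>)" for \<omega>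
      have stop: "stopping_time F T"
      proof (rule stopping_timeI)
        fix t :: ennreal
        show "Measurable.pred (F t) (\<lambda>\<omega>. T \<omega> \<le> t)"
        proof (cases "t = \<infinity>")
          case True then show ?thesis by simp
        next
          case False
          have "{\<omega> \<in> \<Omega>. T \<omega> \<le> t} = (\<Union>r\<in>probes t. {\<omega> \<in> {\<omega> \<in> A. R \<omega> \<le> r}. n \<le> N r \<omega>} \<inter> {\<omega> \<in> \<Omega>. N r \<omega> \<in> {n}})"
          proof (intro equalityI subsetI)
            fix \<omega> assume "\<omega> \<in> {\<omega> \<in> \<Omega>. T \<omega> \<le> t}"
            then have \<omega>: "\<omega> \<in> A" "N (R \<omega>) \<omega> = n" "ennreal (R \<omega>) \<le> t"
              using False by (auto simp: T_def top_unique split: if_splits)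
            obtain r where "r \<in> probes t" "R \<omega> \<le> r" "N r \<omega> = N (R \<omega>) \<omega>"
              using probe_exists[OF A\<Omega>[OF \<omega>(1)] _ \<omega>(3)] R(2)[OF \<omega>(1)] by auto
            then show "\<omega> \<in> (\<Union>r\<in>probes t. {\<omega> \<in> {\<omega> \<in> A. R \<omega> \<le> r}. n \<le> N r \<omega>} \<inter> {\<omega> \<in> \<Omega>. N r \<omega> \<in> {n}})"
              using \<omega> A\<Omega>[OF \<omega>(1)] by (intro UN_I[of r]) auto
          next
            fix \<omega> assume "\<omega> \<in> (\<Union>r\<in>probes t. {\<omega> \<in> {\<omega> \<in> A. R \<omega> \<le> r}. n \<le> N r \<omega>} \<inter> {\<omega> \<in> \<Omega>. N r \<omega> \<in> {n}})"
            then obtain r where r: "r \<in> probes t" "\<omega> \<in> A" "R \<omega> \<le> r" "N r \<omega> = n" by auto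
            have "N (R \<omega>) \<omega> \<le> n" using N_mono[OF A\<Omega>[OF r(2)], of "R \<omega>" r] R(2)[OF r(2)] r by simp
            then have "T \<omega> = ennreal (R \<omega>)" using RN[OF r(2)] r(2) by (simp add: T_def)
            moreover have "ennreal (R \<omega>) \<le> ennreal r" using r(3) by (rule ennreal_leI)
            moreover have "ennreal r \<le> t" using r(1) by (simp add: probes_def)
            ultimately show "\<omega> \<in> {\<omega> \<in> \<Omega>. T \<omega> \<le> t}" using A\<Omega>[OF r(2)] by simp
          qed
          also have "\<dots> \<in> sets (F t)"
          proof (intro sets.countable_UN' image_subsetI probes_countable sets.Int N_ge_F)
            fix r assume r: "r \<in> probes t"
            have "{\<omega> \<in> {\<omega> \<in> A. R \<omega> \<le> r}. n \<le> N r \<omega>} \<in> sets (F (ennreal r))"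
              by (rule past_trace_F[OF Rp probes_nonneg[OF r]])
            then show "{\<omega> \<in> {\<omega> \<in> A. R \<omega> \<le> r}. n \<le> N r \<omega>} \<in> sets (F t)"
              using r sets_F_mono[of "ennreal r" t] by (auto simp: probes_def)
            show "0 \<le> r" "ennreal r \<le> t" using r probes_nonneg by (auto simp: probes_def)
          qed
          finally show ?thesis by (simp add: Measurable.pred_def)
        qed
      qed
      have "AE \<omega> in M. \<not> T \<omega> < \<infinity>"
        using T[OF stop] AE_space
      proof eventually_elim
        case (elim \<omega>)
        show ?case
        proof
          assume "T \<omega> < \<infinity>"
          then have \<omega>: "\<omega> \<in> A" "N (R \<omega>) \<omega> = n" "T \<omega> = ennreal (R \<omega>)" by (auto simp: T_def split: if_splits)
          have "0 \<le> R \<omega>" using R(2)[OF \<omega>(1)] by simp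
          then have "(R \<omega>, \<omega>) \<in> H" using H'(2)[of "R \<omega>" \<omega>] R(1)[OF \<omega>(1)] \<omega> A\<Omega>[OF \<omega>(1)] by auto
          then show False using elim \<open>T \<omega> < \<infinity>\<close> \<omega> \<open>0 \<le> R \<omega>\<close> by simp
        qed
      qed
      moreover have "T \<omega> < \<infinity>" if "\<omega> \<in> A" "N ?m \<omega> = n" for \<omega>
      proof -
        have "N (R \<omega>) \<omega> \<le> N ?m \<omega>" using R(2)[OF that(1)] by (intro N_mono A\<Omega>[OF that(1)]) auto
        then show ?thesis using RN[OF that(1)] that by (simp add: T_def)
      qed
      ultimately have "AE \<omega> in M. \<omega> \<notin> {\<omega> \<in> A. N ?m \<omega> = n}"
        by (auto elim!: eventually_mono)
      moreover have "{\<omega> \<in> A. N ?m \<omega> = n} \<in> events"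
      proof -
        have "{\<omega> \<in> A. N ?m \<omega> = n} = A \<inter> {\<omega> \<in> \<Omega>. N ?m \<omega> = n}" using A\<Omega> by auto
        moreover have "{\<omega> \<in> \<Omega>. N ?m \<omega> = n} \<in> events" using count_event_F[of ?m n] sets_F_subset by auto
        ultimately show ?thesis using subsetD[OF sets_past_subset Ap] by (simp only: sets.Int)
      qed
      ultimately have "prob {\<omega> \<in> A. N ?m \<omega> = n} = 0"
        by (intro measure_eq_0_null_sets AE_iff_null_sets[THEN iffD2])
      moreover have "0 < prob {\<omega> \<in> A. N ?m \<omega> = n}"
      proof (rule next_jump_may_be_late[OF Ap])
        show "0 < prob A" using A(2) em[OF Ap] by (simp add: emeasure_eq_measure)
        show "n \<le> N ?m \<omega>" if "\<omega> \<in> A" for \<omega>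
          using N_mono[OF A\<Omega>[OF that], of "R \<omega>" ?m] R(2)[OF that] RN[OF that] by simp
      qed simp
      ultimately show False by simp
    qed
    obtain B where B: "B \<in> sets ?P" "?E \<subseteq> B" "emeasure ?P B = 0"
      using outer_measure_of_attain[of ?E ?P] zero by auto
    then have "B \<in> null_sets M" using em[of B] setsP subsetD[OF sets_past_subset, of B] by (simp add: null_sets_def)
    then have "AE \<omega> in M. \<omega> \<notin> B" by (rule AE_not_in)
    then show ?thesis using AE_space
    proof eventually_elim
      case (elim \<omega>)
      show ?case
      proof (intro ballI impI)
        fix t assume t: "t \<in> {0..?m}" and N: "N t \<omega> = n"
        have "(t, \<omega>) \<notin> H' \<inter> L" using elim B(2) t spP by blast
        then show "(t, \<omega>) \<notin> H" using H'(2)[of t \<omega>] L_iff[of t \<omega>] t N elim by auto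
      qed
    qed
  qed
  then have "AE \<omega> in M. \<forall>n m. \<forall>t\<in>{0..real (Suc m)}. N t \<omega> = n \<longrightarrow> (t, \<omega>) \<notin> H"
    by (intro AE_all_countable[THEN iffD2] allI)
  then show ?thesis
  proof eventually_elim
    case (elim \<omega>)
    show ?case
    proof (intro allI impI)
      fix t :: real assume "0 \<le> t"
      obtain m where "t \<le> real m" using real_arch_simple by blast
      then have "t \<in> {0..real (Suc m)}" using \<open>0 \<le> t\<close> by simp
      then show "(t, \<omega>) \<notin> H" using elim by blast
    qed
  qed
qed

end

section \<open>The Azema supermartingale\<close>

lemma optional_process_cadlag:
  assumes "adapted K X" "\<And>\<omega>. \<omega> \<in> \<Omega> \<Longrightarrow> cadlag (\<lambda>t. X t \<omega>)"
  shows "optional_process \<Omega> K X"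
  unfolding optional_process_def
proof (rule measurableI)
  fix B :: "real set" assume B: "B \<in> sets borel"
  let ?G = "{{(t, \<omega>). 0 \<le> t \<and> \<omega> \<in> \<Omega> \<and> X t \<omega> \<in> B} | X B.
        adapted K X \<and> (\<forall>\<omega>\<in>\<Omega>. cadlag (\<lambda>t. X t \<omega>)) \<and> B \<in> sets borel}"
  have "(\<lambda>(t, \<omega>). X t \<omega>) -` B \<inter> space (optional_sigma \<Omega> K) = {(t, \<omega>). 0 \<le> t \<and> \<omega> \<in> \<Omega> \<and> X t \<omega> \<in> B}"
    by (auto simp: optional_sigma_def space_measure_of_conv)
  also have "\<dots> \<in> ?G" using assms B by blast
  also have "?G \<subseteq> sets (optional_sigma \<Omega> K)"
    unfolding optional_sigma_def by (subst sets_measure_of) auto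
  finally show "(\<lambda>(t, \<omega>). X t \<omega>) -` B \<inter> space (optional_sigma \<Omega> K) \<in> sets (optional_sigma \<Omega> K)" .
qed simp

lemma optional_process_adapted:
  assumes X: "optional_process \<Omega> K X" and sp: "\<And>t. space (K t) = \<Omega>" and t: "0 \<le> t"
  shows "X t \<in> borel_measurable (K (ennreal t))"
proof -
  have "(\<lambda>\<omega>. (t, \<omega>)) \<in> measurable (K (ennreal t)) (optional_sigma \<Omega> K)"
    unfolding optional_sigma_def
  proof (rule measurable_measure_of)
    show "{{(t, \<omega>). 0 \<le> t \<and> \<omega> \<in> \<Omega> \<and> X t \<omega> \<in> B} | X B.
        adapted K X \<and> (\<forall>\<omega>\<in>\<Omega>. cadlag (\<lambda>t. X t \<omega>)) \<and> B \<in> sets borel} \<subseteq> Pow ({0..} \<times> \<Omega>)" by auto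
    show "(\<lambda>\<omega>. (t, \<omega>)) \<in> space (K (ennreal t)) \<rightarrow> {0..} \<times> \<Omega>" using t sp by auto
    fix H assume "H \<in> {{(t, \<omega>). 0 \<le> t \<and> \<omega> \<in> \<Omega> \<and> X t \<omega> \<in> B} | X B.
        adapted K X \<and> (\<forall>\<omega>\<in>\<Omega>. cadlag (\<lambda>t. X t \<omega>)) \<and> B \<in> sets borel}"
    then obtain X' B where *: "adapted K X'" "B \<in> sets borel" "H = {(t, \<omega>). 0 \<le> t \<and> \<omega> \<in> \<Omega> \<and> X' t \<omega> \<in> B}"
      by blast
    have "(\<lambda>\<omega>. (t, \<omega>)) -` H \<inter> space (K (ennreal t)) = X' t -` B \<inter> space (K (ennreal t))"
      using * t sp by auto
    also have "\<dots> \<in> sets (K (ennreal t))" using * t by (intro measurable_sets) (auto simp: adapted_def)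
    finally show "(\<lambda>\<omega>. (t, \<omega>)) -` H \<inter> space (K (ennreal t)) \<in> sets (K (ennreal t))" .
  qed
  from measurable_compose[OF this X[unfolded optional_process_def]] show ?thesis by simp
qed

lemma emeasure_interval_measure_singleton:
  fixes A :: "real \<Rightarrow> real"
  assumes A: "mono A" "\<And>u. continuous (at_right u) A" and l: "(A \<longlongrightarrow> l) (at_left t)"
  shows "emeasure (interval_measure A) {t} = ennreal (A t - l)"
proof -
  let ?I = "\<lambda>n. {t - 1 / real (Suc n)<..t}"
  have e: "emeasure (interval_measure A) (?I n) = ennreal (A t - A (t - 1 / real (Suc n)))" for n
    using A by (intro emeasure_interval_measure_Ioc) (auto dest: monoD)
  have "(\<lambda>n. emeasure (interval_measure A) (?I n)) \<longlonglongrightarrow> emeasure (interval_measure A) (\<Inter>n. ?I n)"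
  proof (rule Lim_emeasure_decseq)
    show "decseq ?I"
      by (rule decseq_SucI) (auto simp: field_simps intro: le_less_trans[rotated])
    show "emeasure (interval_measure A) (?I n) \<noteq> \<infinity>" for n unfolding e by simp
  qed auto
  also have "(\<Inter>n. ?I n) = {t}"
  proof
    show "(\<Inter>n. ?I n) \<subseteq> {t}"
    proof
      fix x assume x: "x \<in> (\<Inter>n. ?I n)"
      have "x = t"
      proof (rule ccontr)
        assume "x \<noteq> t"
        then have "0 < t - x" using x by auto
        then obtain n where "1 / real (Suc n) < t - x" using nat_approx_posE by metis
        moreover have "x \<in> ?I n" using x by blast
        ultimately show False by auto
      qed
      then show "x \<in> {t}" by simp
    qed
  qed auto
  finally have 1: "(\<lambda>n. ennreal (A t - A (t - 1 / real (Suc n)))) \<longlonglongrightarrow> emeasure (interval_measure A) {t}"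
    by (simp only: e)
  have "filterlim (\<lambda>n. t - 1 / real (Suc n)) (at_left t) sequentially"
  proof -
    have "(\<lambda>n. t - 1 / real (Suc n)) \<longlonglongrightarrow> t - 0"
      by (intro tendsto_intros LIMSEQ_Suc[OF lim_const_over_n])
    moreover have "eventually (\<lambda>n. t - 1 / real (Suc n) \<in> {..<t} \<and> t - 1 / real (Suc n) \<noteq> t) sequentially"
      by (intro always_eventually) auto
    ultimately show ?thesis unfolding filterlim_at by simp
  qed
  from filterlim_compose[OF l this]
  have "(\<lambda>n. ennreal (A t - A (t - 1 / real (Suc n)))) \<longlonglongrightarrow> ennreal (A t - l)"
    by (intro tendsto_intros)
  with 1 show ?thesis by (rule LIMSEQ_unique)
qed

lemma increasing_path_null_before:
  assumes "increasing_path A"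
  shows "mono (null_before A)" "continuous (at_right u) (null_before A)"
    "\<exists>l. (null_before A \<longlongrightarrow> l) (at_left t)"
proof -
  have A: "0 \<le> A 0" "mono_on {0..} A" "\<And>t. 0 \<le> t \<Longrightarrow> continuous (at_right t) A"
    using assms by (auto simp: increasing_path_def)
  show m: "mono (null_before A)"
  proof (rule monoI)
    fix x y :: real assume "x \<le> y"
    show "null_before A x \<le> null_before A y"
    proof (cases "x < 0")
      case True
      have "0 \<le> A y" if "0 \<le> y" using A(1) mono_onD[OF A(2), of 0 y] that by auto
      then show ?thesis using True by (simp add: null_before_def)
    next
      case False
      then show ?thesis using mono_onD[OF A(2), of x y] \<open>x \<le> y\<close> by (simp add: null_before_def)
    qed
  qed
  show "continuous (at_right u) (null_before A)"
  proof (cases "u < 0")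
    case True
    have "eventually (\<lambda>v. null_before A v = null_before A u) (at_right u)"
      unfolding eventually_at_right_field using True by (intro exI[of _ 0]) (simp add: null_before_def)
    then show ?thesis unfolding continuous_within by (rule tendsto_eventually)
  next
    case False
    then have "(A \<longlongrightarrow> A u) (at_right u)" using A(3)[of u] by (simp add: continuous_within)
    moreover have "eventually (\<lambda>v. A v = null_before A v) (at_right u)"
      unfolding eventually_at_right_field using False by (intro exI[of _ "u + 1"]) (simp add: null_before_def)
    ultimately have "(null_before A \<longlongrightarrow> A u) (at_right u)" by (rule Lim_transform_eventually)
    then show ?thesis using False by (simp add: continuous_within null_before_def)
  qed
  have "(null_before A \<longlongrightarrow> (SUP s\<in>{..<t}. null_before A s)) (at_left t)"
  proof (rule increasing_tendsto)
    have bdd: "bdd_above (null_before A ` {..<t})"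
      using monoD[OF m, of _ t] by (intro bdd_aboveI[of _ "null_before A t"]) auto
    show "eventually (\<lambda>s. null_before A s \<le> (SUP s\<in>{..<t}. null_before A s)) (at_left t)"
      unfolding eventually_at_left_field using bdd by (intro exI[of _ "t - 1"]) (auto intro!: cSUP_upper)
    fix x assume "x < (SUP s\<in>{..<t}. null_before A s)"
    then obtain s where s: "s < t" "x < null_before A s"
      using less_cSUP_iff[OF _ bdd, of x] by auto
    then show "eventually (\<lambda>s. x < null_before A s) (at_left t)"
      unfolding eventually_at_left_field using monoD[OF m, of s]
      by (intro exI[of _ s]) (auto intro: less_le_trans)
  qed
  then show "\<exists>l. (null_before A \<longlongrightarrow> l) (at_left t)" by blast
qed

lemma increasing_jump_eq:
  assumes A: "increasing_path A" and t: "0 \<le> t"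
  shows "emeasure (interval_measure (null_before A)) {t} = ennreal (increasing_jump A t)" "0 \<le> increasing_jump A t"
proof -
  obtain l where l: "(null_before A \<longlongrightarrow> l) (at_left t)" using increasing_path_null_before(3)[OF A] by blast
  then have L: "Lim (at_left t) (null_before A) = l" by (intro tendsto_Lim) auto
  have j: "increasing_jump A t = null_before A t - l"
    using t by (simp add: increasing_jump_def L null_before_def)
  show "emeasure (interval_measure (null_before A)) {t} = ennreal (increasing_jump A t)"
    unfolding j using increasing_path_null_before[OF A] l by (intro emeasure_interval_measure_singleton)
  have "l \<le> null_before A t"
  proof (rule tendsto_upperbound[OF l])
    show "eventually (\<lambda>s. null_before A s \<le> null_before A t) (at_left t)"
      unfolding eventually_at_left_field using monoD[OF increasing_path_null_before(1)[OF A], of _ t]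
      by (intro exI[of _ "t - 1"]) auto
  qed simp
  then show "0 \<le> increasing_jump A t" using j by simp
qed

context barrier_market
begin

definition "revisit c = {\<omega> \<in> \<Omega>. \<exists>s\<ge>c. Y s \<omega> < a}"

lemma revisit_on_N: "{\<omega> \<in> \<Omega>. N c \<omega> = k} \<inter> revisit c = {\<omega> \<in> \<Omega>. N c \<omega> = k} \<inter> ruin c (\<mu> * c - real k - a)"
  by (auto simp: revisit_def ruin_def Y_eq algebra_simps)

lemma revisit_sets: "0 \<le> c \<Longrightarrow> revisit c \<in> events"
proof -
  assume c: "0 \<le> c"
  have "revisit c = (\<Union>k. {\<omega> \<in> \<Omega>. N c \<omega> = k} \<inter> revisit c)" by (auto simp: revisit_def)
  also have "\<dots> \<in> events"
    unfolding revisit_on_N using c count_event_F[OF c] sets_F_subset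
    by (intro sets.countable_UN' image_subsetI sets.Int ruin_sets) auto
  finally show ?thesis .
qed

text \<open>The Markov property on each of the events \<open>N c = k\<close>, summed over \<open>k\<close>.\<close>

lemma Markov_level:
  assumes A: "A \<in> sets (F (ennreal c))" and c: "0 \<le> c"
  shows "(\<integral>\<omega>. indicator A \<omega> * (indicator (revisit c) \<omega> - h (Y c \<omega>)) \<partial>M) = 0"
proof -
  let ?N = "\<lambda>k. {\<omega> \<in> \<Omega>. N c \<omega> = k}"
  have Aev: "A \<in> events" and NF: "\<And>k. ?N k \<in> sets (F (ennreal c))" and Nev: "\<And>k. ?N k \<in> events"
    using A sets_F_subset count_event_F[OF c] by blast+
  have Ym[measurable]: "Y c \<in> borel_measurable M"
    using Y_measurable_F[OF c order_refl] sets_F_subset measurable_mono[of borel borel "F (ennreal c)" M] by auto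
  have p: "prob (A \<inter> ?N k \<inter> revisit c) = prob (A \<inter> ?N k) * h (\<mu> * c - real k)" for k
  proof -
    have "A \<inter> ?N k \<inter> revisit c = (A \<inter> ?N k) \<inter> ruin c (\<mu> * c - real k - a)" using revisit_on_N by blast
    then show ?thesis using Markov[OF sets.Int[OF A NF] c] by (simp add: h_def)
  qed
  have AR: "A \<inter> revisit c \<in> events" using Aev revisit_sets[OF c] by auto
  have "emeasure M (A \<inter> revisit c) = (\<Sum>k. emeasure M (A \<inter> ?N k \<inter> revisit c))"
  proof -
    have "emeasure M (\<Union>k. A \<inter> ?N k \<inter> revisit c) = (\<Sum>k. emeasure M (A \<inter> ?N k \<inter> revisit c))"
      using Aev Nev revisit_sets[OF c] by (intro suminf_emeasure[symmetric]) (auto simp: disjoint_family_on_def)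
    moreover have "(\<Union>k. A \<inter> ?N k \<inter> revisit c) = A \<inter> revisit c" by (auto simp: revisit_def)
    ultimately show ?thesis by simp
  qed
  also have "\<dots> = (\<Sum>k. \<integral>\<^sup>+\<omega>. ennreal (h (\<mu> * c - real k)) * indicator (A \<inter> ?N k) \<omega> \<partial>M)"
    using Aev Nev by (intro suminf_cong)
      (simp add: emeasure_eq_measure p nn_integral_cmult_indicator ennreal_mult[symmetric] h_bounds mult.commute)
  also have "\<dots> = (\<integral>\<^sup>+\<omega>. (\<Sum>k. ennreal (h (\<mu> * c - real k)) * indicator (A \<inter> ?N k) \<omega>) \<partial>M)"
    using Aev Nev by (intro nn_integral_suminf[symmetric]) auto
  also have "\<dots> = (\<integral>\<^sup>+\<omega>. ennreal (indicator A \<omega> * h (Y c \<omega>)) \<partial>M)"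
  proof (rule nn_integral_cong)
    fix \<omega> assume \<omega>: "\<omega> \<in> \<Omega>"
    have "(\<Sum>k. ennreal (h (\<mu> * c - real k)) * indicator (A \<inter> ?N k) \<omega>)
      = (\<Sum>k\<in>{N c \<omega>}. ennreal (h (\<mu> * c - real k)) * indicator (A \<inter> ?N k) \<omega>)"
      by (rule suminf_finite) auto
    also have "\<dots> = ennreal (indicator A \<omega> * h (Y c \<omega>))"
      using \<omega> by (auto simp: Y_eq indicator_def)
    finally show "(\<Sum>k. ennreal (h (\<mu> * c - real k)) * indicator (A \<inter> ?N k) \<omega>) = ennreal (indicator A \<omega> * h (Y c \<omega>))" .
  qed
  finally have nn: "(\<integral>\<^sup>+\<omega>. ennreal (indicator A \<omega> * h (Y c \<omega>)) \<partial>M) = ennreal (prob (A \<inter> revisit c))"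
    by (simp add: emeasure_eq_measure)
  have i1: "integrable M (\<lambda>\<omega>. indicator A \<omega> * h (Y c \<omega>))"
    using Aev h_bounds by (intro integrable_const_bound[of _ 1]) (auto simp: indicator_def)
  have i2: "integrable M (\<lambda>\<omega>. indicator (A \<inter> revisit c) \<omega> :: real)"
    using AR by (simp add: emeasure_eq_measure)
  have e1: "(\<integral>\<omega>. indicator A \<omega> * h (Y c \<omega>) \<partial>M) = prob (A \<inter> revisit c)"
  proof -
    have "ennreal (\<integral>\<omega>. indicator A \<omega> * h (Y c \<omega>) \<partial>M) = ennreal (prob (A \<inter> revisit c))"
      unfolding nn[symmetric] by (rule nn_integral_eq_integral[symmetric, OF i1]) (auto simp: h_bounds)
    moreover have "0 \<le> (\<integral>\<omega>. indicator A \<omega> * h (Y c \<omega>) \<partial>M)"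
      by (intro integral_nonneg_AE) (auto simp: h_bounds)
    ultimately show ?thesis by simp
  qed
  have "(\<integral>\<omega>. indicator A \<omega> * (indicator (revisit c) \<omega> - h (Y c \<omega>)) \<partial>M)
      = (\<integral>\<omega>. indicator (A \<inter> revisit c) \<omega> - indicator A \<omega> * h (Y c \<omega>) \<partial>M)"
    by (intro Bochner_Integration.integral_cong refl) (auto simp: indicator_def)
  also have "\<dots> = prob (A \<inter> revisit c) - prob (A \<inter> revisit c)"
    using AR by (subst Bochner_Integration.integral_diff[OF i2 i1]) (simp add: e1)
  finally show ?thesis by simp
qed

lemma stopping_set_F:
  assumes T: "stopping_time F T" and A: "A \<in> sets (filtration.pre_sigma \<Omega> F T)" and c: "0 \<le> c"
  shows "{\<omega> \<in> A. T \<omega> < ennreal c} \<in> sets (F (ennreal c))"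
proof -
  interpret fil: filtration \<Omega> F by (rule filtration_F)
  have sub: "{\<omega> \<in> A. T \<omega> \<le> ennreal r} \<in> sets (F (ennreal c))" if "0 \<le> r" "r \<le> c" for r
    using fil.sets_pre_sigmaD[OF T A, of "ennreal r"] sets_F_mono[OF ennreal_leI[OF that(2)]] by auto
  have "{\<omega> \<in> A. T \<omega> < ennreal c} = (\<Union>i\<in>{i. q i < c}. {\<omega> \<in> A. T \<omega> \<le> ennreal (q i)})"
  proof (intro equalityI subsetI)
    fix \<omega> assume \<omega>: "\<omega> \<in> {\<omega> \<in> A. T \<omega> < ennreal c}"
    then obtain s where s: "T \<omega> = ennreal s" "0 \<le> s" by (cases "T \<omega>") auto
    then have "s < c" using \<omega> by (simp add: ennreal_less_iff)
    then obtain i where "s < q i" "q i < c" using q_dense s by blast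
    then show "\<omega> \<in> (\<Union>i\<in>{i. q i < c}. {\<omega> \<in> A. T \<omega> \<le> ennreal (q i)})"
      using \<omega> s by (intro UN_I[of i]) (auto intro: ennreal_leI)
  next
    fix \<omega> assume "\<omega> \<in> (\<Union>i\<in>{i. q i < c}. {\<omega> \<in> A. T \<omega> \<le> ennreal (q i)})"
    then obtain i where i: "q i < c" "\<omega> \<in> A" "T \<omega> \<le> ennreal (q i)" by blast
    have "ennreal (q i) < ennreal c" using i(1) q_nonneg[of i] by (simp add: ennreal_less_iff)
    then show "\<omega> \<in> {\<omega> \<in> A. T \<omega> < ennreal c}" using i by auto
  qed
  also have "\<dots> \<in> sets (F (ennreal c))"
    using sub q_nonneg by (intro sets.countable_UN' image_subsetI) (auto simp: less_imp_le)
  finally show ?thesis .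
qed

lemma revisit_up:
  assumes "\<omega> \<in> \<Omega>" "0 \<le> s"
  shows "eventually (\<lambda>j. \<omega> \<in> revisit (up j s) \<longleftrightarrow> (\<exists>u\<ge>s. Y u \<omega> < a)) sequentially"
proof (cases "\<exists>u\<ge>s. Y u \<omega> < a")
  case False
  then have "\<omega> \<notin> revisit (up j s)" for j
    using up_bounds(1)[of s j] by (auto simp: revisit_def)
  then show ?thesis using False by simp
next
  case True
  then obtain u where u: "s \<le> u" "Y u \<omega> < a" by blast
  interpret p: drift_path "\<lambda>t. N t \<omega>" \<mu> by (rule path[OF assms(1)])
  have "((\<lambda>v. Y v \<omega>) \<longlongrightarrow> Y u \<omega>) (at_right u)"
    unfolding Y_eq using p.right_cont_n[of u] u(1) assms(2) by (auto intro!: tendsto_intros simp: continuous_within)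
  then have "eventually (\<lambda>v. Y v \<omega> < a) (at_right u)" by (rule order_tendstoD(2)[OF _ u(2)])
  then obtain b where b: "b > u" "\<And>v. u < v \<Longrightarrow> v < b \<Longrightarrow> Y v \<omega> < a" unfolding eventually_at_right_field by blast
  define v where "v = (u + b) / 2"
  have v: "u < v" "v < b" using b(1) by (auto simp: v_def)
  have "eventually (\<lambda>r. r < v) (at_right s)"
    unfolding eventually_at_right_field using v u by (intro exI[of _ v]) auto
  then have "eventually (\<lambda>j. up j s < v) sequentially" by (rule eventually_compose_filterlim[OF _ filterlim_up])
  then show ?thesis
  proof eventually_elim
    case (elim j)
    then have "\<omega> \<in> revisit (up j s)" using b(2)[OF v] assms(1) unfolding revisit_def by (auto intro: less_imp_le)
    then show ?case using True by simp
  qed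
qed

lemma tendsto_h_up:
  assumes "\<omega> \<in> \<Omega>" "0 \<le> s"
  shows "(\<lambda>j. h (Y (up j s) \<omega>)) \<longlonglongrightarrow> h (Y s \<omega>)"
proof -
  interpret p: drift_path "\<lambda>t. N t \<omega>" \<mu> by (rule path[OF assms(1)])
  have "filterlim (\<lambda>u. Y u \<omega>) (at_right (Y s \<omega>)) (at_right s)"
    using p.filterlim_y_right[OF assms(2)] by (simp add: p.y_def[abs_def] Y_eq)
  moreover have "(h \<longlongrightarrow> h (Y s \<omega>)) (at_right (Y s \<omega>))" using h_right_continuous by (simp add: continuous_within)
  ultimately have "((\<lambda>u. h (Y u \<omega>)) \<longlongrightarrow> h (Y s \<omega>)) (at_right s)" by (rule filterlim_compose[rotated])
  then show ?thesis by (rule filterlim_compose[OF _ filterlim_up])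
qed

text \<open>\<open>T\<close> is approximated from the right by \<open>up j T\<close>, which has countably many values. On each of
  them the Markov property at a fixed time applies. The limit is taken by right-continuity of
  \<open>h(Y)\<close> and since a path that is below \<open>a\<close> at some time stays so for a while.\<close>

lemma strong_Markov:
  assumes T: "stopping_time F T" and A: "A \<in> sets (filtration.pre_sigma \<Omega> F T)"
  shows "(\<integral>\<omega>. indicator A \<omega> * of_bool (T \<omega> < \<infinity>) * (of_bool (\<exists>u\<ge>enn2real (T \<omega>). Y u \<omega> < a) - h (Y (enn2real (T \<omega>)) \<omega>)) \<partial>M) = 0"
    and "(\<lambda>\<omega>. indicator A \<omega> * of_bool (T \<omega> < \<infinity>) * (of_bool (\<exists>u\<ge>enn2real (T \<omega>). Y u \<omega> < a) - h (Y (enn2real (T \<omega>)) \<omega>))) \<in> borel_measurable M"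
proof -
  let ?f = "\<lambda>\<omega>. indicator A \<omega> * of_bool (T \<omega> < \<infinity>) * (of_bool (\<exists>u\<ge>enn2real (T \<omega>). Y u \<omega> < a) - h (Y (enn2real (T \<omega>)) \<omega>)) :: real"
  define c where "c j k = real (Suc k) / real (Suc j)" for j k :: nat
  define B where "B j k = {\<omega> \<in> A. T \<omega> < ennreal (c j k)} - {\<omega> \<in> A. T \<omega> < ennreal (real k / real (Suc j))}" for j k
  have c: "0 \<le> c j k" "real k / real (Suc j) \<le> c j k" for j k
    by (auto simp: c_def intro!: divide_right_mono)
  have BF: "B j k \<in> sets (F (ennreal (c j k)))" for j k
    unfolding B_def
  proof (rule sets.Diff)
    show "{\<omega> \<in> A. T \<omega> < ennreal (c j k)} \<in> sets (F (ennreal (c j k)))" by (rule stopping_set_F[OF T A c(1)])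
    show "{\<omega> \<in> A. T \<omega> < ennreal (real k / real (Suc j))} \<in> sets (F (ennreal (c j k)))"
      using stopping_set_F[OF T A, of "real k / real (Suc j)"] sets_F_mono[OF ennreal_leI[OF c(2)]] by auto
  qed
  \<comment> \<open>the grid of mesh \<open>1 / Suc j\<close>, up to time \<open>j\<close>\<close>
  define f where "f j \<omega> = (\<Sum>k<j * Suc j. indicator (B j k) \<omega> * (indicator (revisit (c j k)) \<omega> - h (Y (c j k) \<omega>)) :: real)" for j \<omega>
  have meas: "(\<lambda>\<omega>. indicator (B j k) \<omega> * (indicator (revisit (c j k)) \<omega> - h (Y (c j k) \<omega>)) :: real) \<in> borel_measurable M" for j k
  proof -
    have [measurable]: "Y (c j k) \<in> borel_measurable M"
      using Y_measurable_F[OF c(1) order_refl] sets_F_subset measurable_mono[of borel borel "F (ennreal (c j k))" M] by auto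
    have [measurable]: "B j k \<in> events" "revisit (c j k) \<in> events" using BF sets_F_subset revisit_sets[OF c(1)] by auto
    show ?thesis by measurable
  qed
  have int: "integrable M (\<lambda>\<omega>. indicator (B j k) \<omega> * (indicator (revisit (c j k)) \<omega> - h (Y (c j k) \<omega>)) :: real)" for j k
  proof (intro integrable_const_bound[of _ 1] AE_I2 meas)
    fix \<omega>
    show "norm (indicator (B j k) \<omega> * (indicator (revisit (c j k)) \<omega> - h (Y (c j k) \<omega>)) :: real) \<le> 1"
      using h_bounds[of "Y (c j k) \<omega>"] by (auto simp: indicator_def abs_if)
  qed
  have zero: "(\<integral>\<omega>. f j \<omega> \<partial>M) = 0" for j
    unfolding f_def using int Markov_level[OF BF c(1)] by (subst Bochner_Integration.integral_sum) auto
  have fm: "f j \<in> borel_measurable M" for j unfolding f_def using meas by (intro borel_measurable_sum)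
  have f_out: "f j \<omega> = 0" if "\<not> (\<omega> \<in> A \<and> T \<omega> < \<infinity>)" for j \<omega>
  proof -
    have "\<omega> \<notin> B j k" for k
    proof
      assume "\<omega> \<in> B j k"
      then have "\<omega> \<in> A" "T \<omega> < ennreal (c j k)" by (auto simp: B_def)
      then show False using that by (auto simp: less_top intro: less_trans)
    qed
    then show ?thesis by (simp add: f_def)
  qed
  have f_in: "f j \<omega> = (if s < real j then indicator (revisit (up j s)) \<omega> - h (Y (up j s) \<omega>) else 0)"
    if "\<omega> \<in> A" "T \<omega> = ennreal s" "0 \<le> s" for j \<omega> s
  proof -
    define k0 where "k0 = nat \<lfloor>real (Suc j) * s\<rfloor>"
    have fl: "0 \<le> \<lfloor>real (Suc j) * s\<rfloor>" using that(3) by simp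
    have B: "\<omega> \<in> B j k \<longleftrightarrow> k = k0" for k
    proof -
      have "\<omega> \<in> B j k \<longleftrightarrow> s < c j k \<and> real k / real (Suc j) \<le> s"
        using that c(1) by (auto simp: B_def ennreal_less_iff not_less)
      also have "\<dots> \<longleftrightarrow> real k \<le> real (Suc j) * s \<and> real (Suc j) * s < real (Suc k)"
        by (auto simp: c_def field_simps)
      also have "\<dots> \<longleftrightarrow> \<lfloor>real (Suc j) * s\<rfloor> = int k" by (subst floor_eq_iff) auto
      also have "\<dots> \<longleftrightarrow> k = k0" using fl by (auto simp: k0_def)
      finally show ?thesis .
    qed
    have up: "c j k0 = up j s" using fl by (simp add: c_def up_def k0_def add.commute)
    have lt: "k0 < j * Suc j \<longleftrightarrow> s < real j"
    proof -
      have "k0 < j * Suc j \<longleftrightarrow> \<lfloor>real (Suc j) * s\<rfloor> < int (j * Suc j)" using fl unfolding k0_def by linarith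
      also have "\<dots> \<longleftrightarrow> real (Suc j) * s < real (j * Suc j)" by (simp only: floor_less_iff of_int_of_nat_eq)
      also have "\<dots> \<longleftrightarrow> s < real j" by (simp only: of_nat_mult mult.commute[of "real j"] mult_less_cancel_left_pos[of "real (Suc j)"] of_nat_0_less_iff zero_less_Suc)
      finally show ?thesis .
    qed
    have "f j \<omega> = (\<Sum>k<j * Suc j. if k = k0 then indicator (revisit (up j s)) \<omega> - h (Y (up j s) \<omega>) else 0)"
      unfolding f_def by (intro sum.cong refl) (auto simp: B up[symmetric] indicator_def)
    also have "\<dots> = (if s < real j then indicator (revisit (up j s)) \<omega> - h (Y (up j s) \<omega>) else 0)"
      using lt by (simp add: sum.delta)
    finally show ?thesis .
  qed
  have lim: "(\<lambda>j. f j \<omega>) \<longlonglongrightarrow> ?f \<omega>" if \<omega>: "\<omega> \<in> \<Omega>" for \<omega>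
  proof (cases "\<omega> \<in> A \<and> T \<omega> < \<infinity>")
    case False then show ?thesis using f_out[OF False] by auto
  next
    case True
    then obtain s where s: "T \<omega> = ennreal s" "0 \<le> s" by (cases "T \<omega>") auto
    have "eventually (\<lambda>j. f j \<omega> = of_bool (\<exists>u\<ge>s. Y u \<omega> < a) - h (Y (up j s) \<omega>)) sequentially"
      using revisit_up[OF \<omega> s(2)] eventually_gt_at_top[of "nat \<lceil>s\<rceil>"]
    proof eventually_elim
      case (elim j)
      then have "s < real j" by linarith
      then show ?case using f_in[of \<omega> s j] True s elim(1) by (simp add: indicator_def)
    qed
    moreover have "(\<lambda>j. of_bool (\<exists>u\<ge>s. Y u \<omega> < a) - h (Y (up j s) \<omega>)) \<longlonglongrightarrow> of_bool (\<exists>u\<ge>s. Y u \<omega> < a) - h (Y s \<omega>)"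
      by (intro tendsto_intros tendsto_h_up[OF \<omega> s(2)])
    ultimately have "(\<lambda>j. f j \<omega>) \<longlonglongrightarrow> of_bool (\<exists>u\<ge>s. Y u \<omega> < a) - h (Y s \<omega>)"
      by (simp only: tendsto_cong)
    then show ?thesis using True s by simp
  qed
  have bound: "\<bar>f j \<omega>\<bar> \<le> 1" for j \<omega>
  proof (cases "\<omega> \<in> A \<and> T \<omega> < \<infinity>")
    case False then show ?thesis using f_out[OF False] by simp
  next
    case True
    then obtain s where s: "T \<omega> = ennreal s" "0 \<le> s" by (cases "T \<omega>") auto
    then show ?thesis using f_in[of \<omega> s j] True h_bounds[of "Y (up j s) \<omega>"] by (auto simp: indicator_def abs_if)
  qed
  show fmeas: "?f \<in> borel_measurable M"
    by (rule borel_measurable_LIMSEQ_real[OF lim fm])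
  have "(\<lambda>j. \<integral>\<omega>. f j \<omega> \<partial>M) \<longlonglongrightarrow> (\<integral>\<omega>. ?f \<omega> \<partial>M)"
  proof (rule integral_dominated_convergence[where w = "\<lambda>_. 1"])
    show "AE \<omega> in M. (\<lambda>j. f j \<omega>) \<longlonglongrightarrow> ?f \<omega>" using lim by (intro AE_I2)
    show "AE \<omega> in M. norm (f j \<omega>) \<le> 1" for j using bound by simp
  qed (use fmeas fm in auto)
  then show "(\<integral>\<omega>. ?f \<omega> \<partial>M) = 0" unfolding zero using LIMSEQ_unique tendsto_const by blast
qed

text \<open>The conditional probability of \<open>\<tau> \<ge> t\<close> given the past. It is \<open>h(Y)\<close>, except that \<open>Y t = a\<close>
  already implies \<open>\<tau> \<ge> t\<close>.\<close>

definition "V t \<omega> = (if Y t \<omega> = a then 1 else h (Y t \<omega>))"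

text \<open>There is no jump at \<open>\<tau>\<close>, so that the path is below \<open>a\<close> immediately before.\<close>

lemma below_before_tau:
  assumes \<omega>: "\<omega> \<in> \<Omega>" and good: "good \<omega>" and r: "\<tau> \<omega> = ennreal r" "0 < r" and s: "s < r"
  shows "\<exists>u\<ge>s. Y u \<omega> < a"
proof -
  interpret p: drift_path "\<lambda>t. N t \<omega>" \<mu> by (rule path[OF \<omega>])
  have Yr: "Y r \<omega> = a" using tau_eq_a(1)[OF \<omega> r(1)] r(2) by simp
  then have "r = crossing (N r \<omega>)" by (simp add: Y_eq_a_iff)
  then have nj: "p.before r = N r \<omega>" using good by (metis good_def)
  obtain v where v: "0 \<le> v" "v < r" "\<And>u. v \<le> u \<Longrightarrow> u < r \<Longrightarrow> N u \<omega> = p.before r"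
    using p.left_constant[OF r(2)] by blast
  define u where "u = max s ((v + r) / 2)"
  have u: "s \<le> u" "v \<le> u" "u < r" using v s by (auto simp: u_def le_max_iff_disj)
  have "Y u \<omega> < Y r \<omega>" using v(3)[of u] nj u mu_pos by (simp add: Y_eq)
  then show ?thesis using Yr u by auto
qed

lemma le_tau_iff:
  assumes \<omega>: "\<omega> \<in> \<Omega>" and good: "good \<omega>" and s: "0 \<le> s"
  shows "ennreal s \<le> \<tau> \<omega> \<longleftrightarrow> Y s \<omega> = a \<or> (\<exists>u\<ge>s. Y u \<omega> < a)"
proof
  assume "Y s \<omega> = a \<or> (\<exists>u\<ge>s. Y u \<omega> < a)"
  then obtain u where u: "s \<le> u" "Y u \<omega> \<le> a" by force
  then have "ennreal u \<le> \<tau> \<omega>" unfolding tau_eq using s by (intro Sup_upper) auto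
  then show "ennreal s \<le> \<tau> \<omega>" using ennreal_leI[OF u(1)] by (rule order_trans[rotated])
next
  assume le: "ennreal s \<le> \<tau> \<omega>"
  obtain r where r: "\<tau> \<omega> = ennreal r" "0 < r" using good_tau_finite[OF good \<omega>] by blast
  have Yr: "Y r \<omega> = a" using tau_eq_a(1)[OF \<omega> r(1)] r(2) by simp
  show "Y s \<omega> = a \<or> (\<exists>u\<ge>s. Y u \<omega> < a)"
  proof (cases "s = r")
    case False
    then have "s < r" using le r s by (simp add: less_le)
    then show ?thesis using below_before_tau[OF \<omega> good r] by blast
  qed (simp add: Yr)
qed

lemma Y_stopping_measurable:
  assumes T: "stopping_time F T"
  shows "(\<lambda>\<omega>. if T \<omega> < \<infinity> then Y (enn2real (T \<omega>)) \<omega> else 0) \<in> borel_measurable (filtration.pre_sigma \<Omega> F T)"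
proof -
  interpret fil: filtration \<Omega> F by (rule filtration_F)
  let ?P = "fil.pre_sigma T"
  have sp: "space ?P = \<Omega>" by (rule fil.space_pre_sigma)
  have Nm: "{\<omega> \<in> \<Omega>. T \<omega> < \<infinity> \<and> N (enn2real (T \<omega>)) \<omega> \<le> k} \<in> sets ?P" for k
  proof (rule fil.sets_pre_sigmaI[OF T])
    fix t
    have "{\<omega> \<in> {\<omega> \<in> \<Omega>. T \<omega> < \<infinity> \<and> N (enn2real (T \<omega>)) \<omega> \<le> k}. T \<omega> \<le> t}
        = (\<Union>r\<in>probes t. {\<omega> \<in> \<Omega>. T \<omega> \<le> ennreal r} \<inter> {\<omega> \<in> \<Omega>. N r \<omega> \<in> {..k}})"
    proof (intro equalityI subsetI)
      fix \<omega> assume "\<omega> \<in> {\<omega> \<in> {\<omega> \<in> \<Omega>. T \<omega> < \<infinity> \<and> N (enn2real (T \<omega>)) \<omega> \<le> k}. T \<omega> \<le> t}"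
      then have \<omega>: "\<omega> \<in> \<Omega>" "T \<omega> < \<infinity>" "N (enn2real (T \<omega>)) \<omega> \<le> k" "T \<omega> \<le> t" by auto
      have T': "ennreal (enn2real (T \<omega>)) = T \<omega>" using \<omega>(2) by (intro ennreal_enn2real) simp
      obtain r where r: "r \<in> probes t" "enn2real (T \<omega>) \<le> r" "N r \<omega> = N (enn2real (T \<omega>)) \<omega>"
        using probe_exists[OF \<omega>(1), of "enn2real (T \<omega>)" t] \<omega>(4) T' by auto
      have "T \<omega> \<le> ennreal r" using ennreal_leI[OF r(2)] T' by simp
      then show "\<omega> \<in> (\<Union>r\<in>probes t. {\<omega> \<in> \<Omega>. T \<omega> \<le> ennreal r} \<inter> {\<omega> \<in> \<Omega>. N r \<omega> \<in> {..k}})"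
        using r \<omega> by (intro UN_I[of r]) auto
    next
      fix \<omega> assume "\<omega> \<in> (\<Union>r\<in>probes t. {\<omega> \<in> \<Omega>. T \<omega> \<le> ennreal r} \<inter> {\<omega> \<in> \<Omega>. N r \<omega> \<in> {..k}})"
      then obtain r where r: "r \<in> probes t" "\<omega> \<in> \<Omega>" "T \<omega> \<le> ennreal r" "N r \<omega> \<le> k" by auto
      have fin: "T \<omega> < \<infinity>" using r(3) by (rule le_less_trans) simp
      have "enn2real (T \<omega>) \<le> r" using r(3) probes_nonneg[OF r(1)] by (metis enn2real_leI)
      then have "N (enn2real (T \<omega>)) \<omega> \<le> N r \<omega>" by (intro N_mono[OF r(2)]) auto
      moreover have "T \<omega> \<le> t" using r(1,3) by (auto simp: probes_def)
      ultimately show "\<omega> \<in> {\<omega> \<in> {\<omega> \<in> \<Omega>. T \<omega> < \<infinity> \<and> N (enn2real (T \<omega>)) \<omega> \<le> k}. T \<omega> \<le> t}" using r fin by auto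
    qed
    also have "\<dots> \<in> sets (F t)"
    proof (intro sets.countable_UN' image_subsetI probes_countable sets.Int N_ge_F)
      fix r assume r: "r \<in> probes t"
      have "{\<omega> \<in> \<Omega>. T \<omega> \<le> ennreal r} \<in> sets (F (ennreal r))"
        using stopping_timeD[OF T, of "ennreal r"] by (simp add: Measurable.pred_def)
      then show "{\<omega> \<in> \<Omega>. T \<omega> \<le> ennreal r} \<in> sets (F t)"
        using r sets_F_mono[of "ennreal r" t] by (auto simp: probes_def)
      show "0 \<le> r" "ennreal r \<le> t" using r probes_nonneg by (auto simp: probes_def)
    qed
    finally show "{\<omega> \<in> {\<omega> \<in> \<Omega>. T \<omega> < \<infinity> \<and> N (enn2real (T \<omega>)) \<omega> \<le> k}. T \<omega> \<le> t} \<in> sets (F t)" .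
  qed
  have [measurable]: "T \<in> borel_measurable ?P" by (rule fil.measurable_stopping_time_pre_sigma[OF T])
  have inf: "{\<omega> \<in> \<Omega>. \<not> T \<omega> < \<infinity>} \<in> sets ?P"
  proof -
    have "{\<omega> \<in> space ?P. \<not> T \<omega> < \<infinity>} \<in> sets ?P" by measurable
    then show ?thesis by (simp add: sp)
  qed
  have [measurable]: "(\<lambda>\<omega>. if T \<omega> < \<infinity> then real (N (enn2real (T \<omega>)) \<omega>) else 0) \<in> borel_measurable ?P"
  proof (rule borel_measurableI_le)
    fix x :: real
    show "{\<omega> \<in> space ?P. (if T \<omega> < \<infinity> then real (N (enn2real (T \<omega>)) \<omega>) else 0) \<le> x} \<in> sets ?P"
    proof (cases "0 \<le> x")
      case True
      have "{\<omega> \<in> space ?P. (if T \<omega> < \<infinity> then real (N (enn2real (T \<omega>)) \<omega>) else 0) \<le> x}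
          = {\<omega> \<in> \<Omega>. T \<omega> < \<infinity> \<and> N (enn2real (T \<omega>)) \<omega> \<le> nat \<lfloor>x\<rfloor>} \<union> {\<omega> \<in> \<Omega>. \<not> T \<omega> < \<infinity>}"
        proof -
        have "real n \<le> x \<longleftrightarrow> n \<le> nat \<lfloor>x\<rfloor>" for n using True by linarith
        then show ?thesis using True by (auto simp: sp)
      qed
      then show ?thesis using Nm inf by (simp only: sets.Un)
    next
      case False
      then have "{\<omega> \<in> space ?P. (if T \<omega> < \<infinity> then real (N (enn2real (T \<omega>)) \<omega>) else 0) \<le> x} = {}"
        by (auto split: if_splits)
      then show ?thesis by (simp only: sets.empty_sets)
    qed
  qed
  have "(\<lambda>\<omega>. if T \<omega> < \<infinity> then Y (enn2real (T \<omega>)) \<omega> else 0)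
      = (\<lambda>\<omega>. if T \<omega> < \<infinity> then \<mu> * enn2real (T \<omega>) - (if T \<omega> < \<infinity> then real (N (enn2real (T \<omega>)) \<omega>) else 0) else 0)"
    by (auto simp: Y_eq fun_eq_iff)
  also have "\<dots> \<in> borel_measurable ?P" by measurable
  finally show ?thesis .
qed

text \<open>\<open>\<tau> \<ge> T\<close> means that \<open>Y\<close> is at \<open>a\<close> at time \<open>T\<close>, which is known at \<open>T\<close>, or that \<open>Y\<close> is below
  \<open>a\<close> at some later time, to which the strong Markov property applies.\<close>

lemma optional_projection_at_stopping_time:
  assumes T: "stopping_time F T"
  shows "AE \<omega> in M. real_cond_exp M (filtration.pre_sigma \<Omega> F T)
      (\<lambda>\<omega>. of_bool (ennreal (enn2real (T \<omega>)) \<le> \<tau> \<omega>) * of_bool (T \<omega> < \<infinity>)) \<omega>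
    = V (enn2real (T \<omega>)) \<omega> * of_bool (T \<omega> < \<infinity>)"
proof -
  interpret fil: filtration \<Omega> F by (rule filtration_F)
  let ?P = "fil.pre_sigma T"
  have sp: "space ?P = \<Omega>" by (rule fil.space_pre_sigma)
  have Psub: "sets ?P \<subseteq> events"
  proof
    fix A assume A: "A \<in> sets ?P"
    have "{\<omega> \<in> A. T \<omega> \<le> \<infinity>} \<in> events" using fil.sets_pre_sigmaD[OF T A, of \<infinity>] sets_F_subset by blast
    then show "A \<in> events" by simp
  qed
  interpret sub: finite_measure_subalgebra M ?P
    by unfold_locales (use Psub sp in \<open>auto simp: subalgebra_def\<close>)
  have [measurable]: "T \<in> borel_measurable ?P" by (rule fil.measurable_stopping_time_pre_sigma[OF T])
  note [measurable] = Y_stopping_measurable[OF T]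
  let ?YT = "\<lambda>\<omega>. if T \<omega> < \<infinity> then Y (enn2real (T \<omega>)) \<omega> else 0"
  let ?g = "\<lambda>\<omega>. V (enn2real (T \<omega>)) \<omega> * of_bool (T \<omega> < \<infinity>)"
  let ?f = "\<lambda>\<omega>. of_bool (ennreal (enn2real (T \<omega>)) \<le> \<tau> \<omega>) * of_bool (T \<omega> < \<infinity>) :: real"
  have g_eq: "?g = (\<lambda>\<omega>. if T \<omega> < \<infinity> then (if ?YT \<omega> = a then 1 else h (?YT \<omega>)) else 0)"
    by (auto simp: V_def fun_eq_iff)
  have gm: "?g \<in> borel_measurable ?P" unfolding g_eq by measurable
  have gmM: "?g \<in> borel_measurable M" by (rule measurable_from_subalg[OF sub.subalg gm])
  have gb: "\<bar>?g \<omega>\<bar> \<le> 1" for \<omega> using h_bounds by (auto simp: V_def)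
  let ?off = "{\<omega> \<in> space ?P. T \<omega> < \<infinity> \<and> ?YT \<omega> \<noteq> a}"
  have off: "?off \<in> sets ?P" by measurable
  let ?r = "\<lambda>A \<omega>. indicator A \<omega> * of_bool (T \<omega> < \<infinity>) * (of_bool (\<exists>u\<ge>enn2real (T \<omega>). Y u \<omega> < a) - h (Y (enn2real (T \<omega>)) \<omega>)) :: real"
  have diff: "AE \<omega> in M. indicator A \<omega> * (?f \<omega> - ?g \<omega>) = ?r (A \<inter> ?off) \<omega>" for A
    using AE_good AE_space
  proof eventually_elim
    case (elim \<omega>)
    show ?case
    proof (cases "T \<omega> < \<infinity> \<and> \<omega> \<in> A")
      case True
      then show ?thesis using le_tau_iff[OF elim(2,1), of "enn2real (T \<omega>)"] elim(2) sp
        by (cases "Y (enn2real (T \<omega>)) \<omega> = a") (simp_all add: V_def)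
    qed auto
  qed
  have fm: "?f \<in> borel_measurable M"
  proof -
    have 1: "?r (\<Omega> \<inter> ?off) \<in> borel_measurable M"
      using strong_Markov(2)[OF T sets.Int[OF _ off, of \<Omega>]] sets.top[of ?P] sp by simp
    have ae: "AE \<omega> in M. ?r (\<Omega> \<inter> ?off) \<omega> + ?g \<omega> = ?f \<omega>"
      using diff[of \<Omega>] AE_space by eventually_elim (simp add: algebra_simps)
    have "{\<omega> \<in> \<Omega>. ?f \<omega> \<in> B} \<in> events" if B: "B \<in> sets borel" for B
    proof (rule AE_set(1))
      show "{\<omega> \<in> \<Omega>. ?r (\<Omega> \<inter> ?off) \<omega> + ?g \<omega> \<in> B} \<in> events"
        using measurable_sets[OF borel_measurable_add[OF 1 gmM] B] by (simp add: vimage_def Int_def conj_commute)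
      show "AE \<omega> in M. ?f \<omega> \<in> B \<longleftrightarrow> \<omega> \<in> {\<omega> \<in> \<Omega>. ?r (\<Omega> \<inter> ?off) \<omega> + ?g \<omega> \<in> B}"
        using ae AE_space by eventually_elim auto
    qed
    then show ?thesis by (intro measurableI) (auto simp: vimage_def Int_def conj_commute)
  qed
  have fi: "integrable M ?f" using fm by (intro integrable_const_bound[of _ 1]) auto
  have gi: "integrable M ?g" using gmM gb by (intro integrable_const_bound[of _ 1]) auto
  show ?thesis
  proof (rule sub.real_cond_exp_charact[OF _ fi gi gm])
    fix A assume A: "A \<in> sets ?P"
    then have [measurable]: "A \<in> events" using Psub by auto
    have i: "integrable M (\<lambda>\<omega>. indicator A \<omega> * ?f \<omega>)" "integrable M (\<lambda>\<omega>. indicator A \<omega> * ?g \<omega>)"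
      using integrable_mult_indicator[OF _ fi, of A] integrable_mult_indicator[OF _ gi, of A] by simp_all
    have "(\<integral>\<omega>. indicator A \<omega> * ?f \<omega> \<partial>M) - (\<integral>\<omega>. indicator A \<omega> * ?g \<omega> \<partial>M) = (\<integral>\<omega>. indicator A \<omega> * (?f \<omega> - ?g \<omega>) \<partial>M)"
      using i by (simp add: right_diff_distrib)
    also have "\<dots> = (\<integral>\<omega>. ?r (A \<inter> ?off) \<omega> \<partial>M)"
    proof (rule integral_cong_AE)
      show "(\<lambda>\<omega>. indicator A \<omega> * (?f \<omega> - ?g \<omega>)) \<in> borel_measurable M" using fm gmM by measurable
      show "?r (A \<inter> ?off) \<in> borel_measurable M" by (rule strong_Markov(2)[OF T sets.Int[OF A off]])
    qed (rule diff)
    also have "\<dots> = 0" by (rule strong_Markov(1)[OF T sets.Int[OF A off]])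
    finally show "(\<integral>\<omega>\<in>A. ?f \<omega> \<partial>M) = (\<integral>\<omega>\<in>A. ?g \<omega> \<partial>M)"
      by (simp add: set_lebesgue_integral_def)
  qed
qed

text \<open>Both processes are optional and agree at every stopping time.\<close>

lemma optional_projection_unique:
  assumes Z: "is_optional_projection M F (\<lambda>t \<omega>. of_bool (ennreal t \<le> \<tau> \<omega>)) Z"
  shows "AE \<omega> in M. \<forall>t\<ge>0. Z t \<omega> = V t \<omega>"
proof -
  have Zo: "(\<lambda>(t, \<omega>). Z t \<omega>) \<in> borel_measurable (optional_sigma \<Omega> F)"
    using Z by (simp add: is_optional_projection_def optional_process_def)
  have "optional_process \<Omega> F Y"
  proof (rule optional_process_cadlag)
    show "adapted F Y" by (auto simp: adapted_def intro: Y_measurable_F)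
    fix \<omega> assume \<omega>: "\<omega> \<in> \<Omega>"
    interpret p: drift_path "\<lambda>t. N t \<omega>" \<mu> by (rule path[OF \<omega>])
    show "cadlag (\<lambda>t. Y t \<omega>)"
      unfolding cadlag_def
    proof (intro conjI allI impI)
      fix t :: real
      show "continuous (at_right t) (\<lambda>t. Y t \<omega>)" if "0 \<le> t"
        unfolding Y_eq using p.right_cont_n[OF that] by (intro continuous_intros)
      show "\<exists>l. ((\<lambda>t. Y t \<omega>) \<longlongrightarrow> l) (at_left t)" if "0 < t"
        unfolding Y_eq using p.tendsto_before[OF that]
        by (intro exI[of _ "\<mu> * t - real (p.before t)"] tendsto_intros)
    qed
  qed
  then have Yo: "(\<lambda>(t, \<omega>). Y t \<omega>) \<in> borel_measurable (optional_sigma \<Omega> F)" by (simp add: optional_process_def)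
  have "(\<lambda>z. if z = a then 1 else h z) \<in> borel_measurable borel" by measurable
  from measurable_compose[OF Yo this]
  have "(\<lambda>x. (\<lambda>z. if z = a then 1 else h z) ((\<lambda>(t, \<omega>). Y t \<omega>) x)) \<in> borel_measurable (optional_sigma \<Omega> F)" .
  moreover have "(\<lambda>x. (\<lambda>z. if z = a then 1 else h z) ((\<lambda>(t, \<omega>). Y t \<omega>) x)) = (\<lambda>(t, \<omega>). V t \<omega>)"
    by (auto simp: V_def fun_eq_iff)
  ultimately have Vo: "(\<lambda>(t, \<omega>). V t \<omega>) \<in> borel_measurable (optional_sigma \<Omega> F)" by (simp only:)
  have H: "{x \<in> space (optional_sigma \<Omega> F). (\<lambda>(t, \<omega>). Z t \<omega>) x \<noteq> (\<lambda>(t, \<omega>). V t \<omega>) x} \<in> sets (optional_sigma \<Omega> F)"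
    using Zo Vo by measurable
  have "AE \<omega> in M. \<forall>t\<ge>0. (t, \<omega>) \<notin> {x \<in> space (optional_sigma \<Omega> F). (\<lambda>(t, \<omega>). Z t \<omega>) x \<noteq> (\<lambda>(t, \<omega>). V t \<omega>) x}"
  proof (rule optional_evanescent[OF H])
    fix T assume T: "stopping_time F T"
    have "AE \<omega> in M. Z (enn2real (T \<omega>)) \<omega> * of_bool (T \<omega> < \<infinity>) =
           real_cond_exp M (filtration.pre_sigma \<Omega> F T)
             (\<lambda>\<omega>. of_bool (ennreal (enn2real (T \<omega>)) \<le> \<tau> \<omega>) * of_bool (T \<omega> < \<infinity>)) \<omega>"
      using Z T unfolding is_optional_projection_def by blast
    with optional_projection_at_stopping_time[OF T]
    show "AE \<omega> in M. T \<omega> < \<infinity> \<longrightarrow> (enn2real (T \<omega>), \<omega>) \<notin>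
        {x \<in> space (optional_sigma \<Omega> F). (\<lambda>(t, \<omega>). Z t \<omega>) x \<noteq> (\<lambda>(t, \<omega>). V t \<omega>) x}"
      by eventually_elim auto
  qed
  then show ?thesis using AE_space
    by eventually_elim (auto simp: optional_sigma_def space_measure_of_conv)
qed

section \<open>The dual projection and the exit time\<close>

lemma crossing_inj: "crossing j = crossing k \<longleftrightarrow> j = k"
  using mu_pos by (simp add: crossing_def)

lemma tau_eq_crossing_iff:
  assumes \<omega>: "\<omega> \<in> \<Omega>" and good: "good \<omega>"
  shows "\<tau> \<omega> = ennreal (crossing k) \<longleftrightarrow> N (crossing k) \<omega> = k \<and> \<omega> \<notin> revisit (crossing k)"
proof
  assume t: "\<tau> \<omega> = ennreal (crossing k)"
  note after = tau_eq_a[OF \<omega> t less_imp_le[OF crossing_pos]]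
  have "crossing k = crossing (N (crossing k) \<omega>)" using after(1) by (rule Y_eq_a_iff[THEN iffD1])
  then have "N (crossing k) \<omega> = k" using crossing_inj by metis
  moreover have "\<not> Y u \<omega> < a" if "crossing k \<le> u" for u
    using after(1) after(2)[of u] that by (cases "u = crossing k") auto
  ultimately show "N (crossing k) \<omega> = k \<and> \<omega> \<notin> revisit (crossing k)" by (auto simp: revisit_def)
next
  assume *: "N (crossing k) \<omega> = k \<and> \<omega> \<notin> revisit (crossing k)"
  then have "Y (crossing k) \<omega> = a" by (simp add: Y_eq_a_iff)
  then have le: "ennreal (crossing k) \<le> \<tau> \<omega>"
    using le_tau_iff[OF \<omega> good less_imp_le[OF crossing_pos], of k] by simp
  obtain r where r: "\<tau> \<omega> = ennreal r" "0 < r" using good_tau_finite[OF good \<omega>] by blast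
  have "\<not> crossing k < r"
    using below_before_tau[OF \<omega> good r, of "crossing k"] * \<omega> unfolding revisit_def by blast
  moreover have "crossing k \<le> r" using le r by simp
  ultimately show "\<tau> \<omega> = ennreal (crossing k)" using r by simp
qed

lemma increasing_path_after_tau:
  "increasing_path (\<lambda>t. of_bool (\<tau> \<omega> \<le> ennreal t))"
  "0 < c \<Longrightarrow> increasing_jump (\<lambda>t. of_bool (\<tau> \<omega> \<le> ennreal t)) c = of_bool (\<tau> \<omega> = ennreal c)"
proof -
  let ?A = "\<lambda>t. of_bool (\<tau> \<omega> \<le> ennreal t) :: real"
  have right: "continuous (at_right t) ?A" if t: "0 \<le> t" for t
  proof (cases "\<tau> \<omega> \<le> ennreal t")
    case True
    have "eventually (\<lambda>s. ?A s = ?A t) (at_right t)"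
      unfolding eventually_at_right_field using True
      by (intro exI[of _ "t + 1"]) (auto intro: order_trans[OF _ ennreal_leI])
    then show ?thesis unfolding continuous_within by (rule tendsto_eventually)
  next
    case False
    have "eventually (\<lambda>s. ?A s = ?A t) (at_right t)"
    proof (cases "\<tau> \<omega>")
      case (real r)
      then have "t < r" using False t by (simp add: not_le ennreal_less_iff)
      then show ?thesis unfolding eventually_at_right_field using real False t
        by (intro exI[of _ r]) (auto simp: not_le ennreal_less_iff)
    next
      case top
      then show ?thesis by (simp add: top_unique)
    qed
    then show ?thesis unfolding continuous_within by (rule tendsto_eventually)
  qed
  have mono: "mono_on {0..} ?A"
    by (auto intro!: mono_onI intro: order_trans[OF _ ennreal_leI])
  show "increasing_path ?A" unfolding increasing_path_def using right mono by simp
  assume c: "0 < c"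
  have "eventually (\<lambda>s. null_before ?A s = of_bool (\<tau> \<omega> < ennreal c)) (at_left c)"
  proof (cases "\<tau> \<omega> < ennreal c")
    case True
    then obtain r where r: "\<tau> \<omega> = ennreal r" "0 \<le> r" by (cases "\<tau> \<omega>") auto
    then have "r < c" using True by (simp add: ennreal_less_iff)
    then show ?thesis unfolding eventually_at_left_field using r True
      by (intro exI[of _ r]) (auto simp: null_before_def intro: ennreal_leI)
  next
    case False
    have "\<not> \<tau> \<omega> \<le> ennreal s" if "0 \<le> s" "s < c" for s
      using False that by (metis ennreal_lessI le_less_trans order_le_less_trans c)
    then show ?thesis unfolding eventually_at_left_field using c False
      by (intro exI[of _ 0]) (auto simp: null_before_def)
  qed
  then have "(null_before ?A \<longlongrightarrow> of_bool (\<tau> \<omega> < ennreal c)) (at_left c)" by (rule tendsto_eventually)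
  then have "Lim (at_left c) (null_before ?A) = of_bool (\<tau> \<omega> < ennreal c)" by (intro tendsto_Lim) auto
  then show "increasing_jump ?A c = of_bool (\<tau> \<omega> = ennreal c)"
    by (auto simp: increasing_jump_def)
qed

lemma graph_optional:
  assumes B: "B \<in> sets (F (ennreal c))" and c: "0 \<le> c"
  shows "{c} \<times> B \<in> sets (optional_sigma \<Omega> F)"
proof -
  have B\<Omega>: "B \<subseteq> \<Omega>" using sets.sets_into_space[OF B] by simp
  let ?X = "\<lambda>t \<omega>. indicator B \<omega> * of_bool (c \<le> t) :: real"
  have "optional_process \<Omega> F ?X"
  proof (rule optional_process_cadlag)
    show "adapted F ?X"
      unfolding adapted_def
    proof (intro allI impI)
      fix t :: real assume t: "0 \<le> t"
      show "(\<lambda>\<omega>. ?X t \<omega>) \<in> borel_measurable (F (ennreal t))"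
      proof (cases "c \<le> t")
        case True
        then have "B \<in> sets (F (ennreal t))" using B sets_F_mono[OF ennreal_leI[OF True]] by auto
        then show ?thesis using True by simp
      qed simp
    qed
    fix \<omega>
    show "cadlag (\<lambda>t. ?X t \<omega>)"
      unfolding cadlag_def
    proof (intro conjI allI impI)
      fix t :: real
      have "eventually (\<lambda>s. ?X s \<omega> = ?X t \<omega>) (at_right t)"
        unfolding eventually_at_right_field
        by (cases "c \<le> t"; intro exI[of _ "if c \<le> t then t + 1 else c"]) auto
      then show "continuous (at_right t) (\<lambda>t. ?X t \<omega>)"
        unfolding continuous_within by (rule tendsto_eventually)
      have "eventually (\<lambda>s. ?X s \<omega> = indicator B \<omega> * of_bool (c < t)) (at_left t)"
        unfolding eventually_at_left_field
        by (cases "c < t"; intro exI[of _ "if c < t then c else t - 1"]) auto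
      then show "\<exists>l. ((\<lambda>t. ?X t \<omega>) \<longlongrightarrow> l) (at_left t)"
        by (intro exI tendsto_eventually)
    qed
  qed
  moreover have "optional_process \<Omega> F (\<lambda>t \<omega>. t)"
    by (rule optional_process_cadlag) (auto simp: adapted_def cadlag_def intro!: continuous_intros exI tendsto_intros)
  ultimately have [measurable]: "(\<lambda>(t, \<omega>). ?X t \<omega>) \<in> borel_measurable (optional_sigma \<Omega> F)"
     "(\<lambda>(t, \<omega>). t) \<in> borel_measurable (optional_sigma \<Omega> F)" by (simp_all add: optional_process_def)
  have "{x \<in> space (optional_sigma \<Omega> F). (\<lambda>(t, \<omega>). ?X t \<omega>) x = 1 \<and> (\<lambda>(t, \<omega>). t) x = c} \<in> sets (optional_sigma \<Omega> F)"
    by measurable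
  moreover have "{x \<in> space (optional_sigma \<Omega> F). (\<lambda>(t, \<omega>). ?X t \<omega>) x = 1 \<and> (\<lambda>(t, \<omega>). t) x = c} = {c} \<times> B"
    using B\<Omega> c by (auto simp: optional_sigma_def space_measure_of_conv indicator_def split: if_splits)
  ultimately show ?thesis by simp
qed

text \<open>Testing the duality against \<open>{c} \<times> B\<close> with \<open>B\<close> in \<open>F c\<close>, for the deterministic time \<open>c =
  crossing k\<close>, identifies the jump of \<open>Ao\<close> at \<open>c\<close> as the conditional probability of \<open>\<tau> = c\<close>.
  The latter event means that \<open>N c = k\<close>, so that \<open>Y\<close> is at \<open>a\<close>, and that there is no ruin from
  capital 0 afterwards.\<close>

lemma dual_projection_jump:
  assumes Ao: "is_dual_optional_projection M F (\<lambda>t \<omega>. of_bool (\<tau> \<omega> \<le> ennreal t)) Ao"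
  shows "AE \<omega> in M. increasing_jump (\<lambda>t. Ao t \<omega>) (crossing k) = (1 - \<Psi> 0) * of_bool (N (crossing k) \<omega> = k)"
proof -
  let ?c = "crossing k"
  have c: "0 < ?c" "0 \<le> ?c" using crossing_pos[of k] by auto
  let ?A = "\<lambda>t \<omega>. of_bool (\<tau> \<omega> \<le> ennreal t) :: real"
  let ?J = "\<lambda>\<omega>. increasing_jump (\<lambda>t. Ao t \<omega>) ?c"
  have opt: "optional_process \<Omega> F Ao" and inc: "\<And>\<omega>. \<omega> \<in> \<Omega> \<Longrightarrow> increasing_path (\<lambda>t. Ao t \<omega>)"
    and dual: "\<And>U :: real \<times> 'a \<Rightarrow> ennreal. U \<in> borel_measurable (optional_sigma \<Omega> F) \<Longrightarrow>
        (\<integral>\<^sup>+\<omega>. (\<integral>\<^sup>+s\<in>{0..}. U (s, \<omega>) \<partial>interval_measure (null_before (\<lambda>t. ?A t \<omega>))) \<partial>M) =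
        (\<integral>\<^sup>+\<omega>. (\<integral>\<^sup>+s\<in>{0..}. U (s, \<omega>) \<partial>interval_measure (null_before (\<lambda>t. Ao t \<omega>))) \<partial>M)"
    using Ao by (auto simp: is_dual_optional_projection_def)
  interpret sub: finite_measure_subalgebra M "F (ennreal ?c)"
    by unfold_locales (use sets_F_subset in \<open>auto simp: subalgebra_def\<close>)
  have Jm: "?J \<in> borel_measurable (F (ennreal ?c))"
  proof (rule borel_measurable_LIMSEQ_real)
    fix \<omega> assume "\<omega> \<in> space (F (ennreal ?c))"
    then have \<omega>: "\<omega> \<in> \<Omega>" by simp
    obtain l where l: "(null_before (\<lambda>t. Ao t \<omega>) \<longlongrightarrow> l) (at_left ?c)"
      using increasing_path_null_before(3)[OF inc[OF \<omega>]] by blast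
    have seq: "filterlim (\<lambda>n. ?c - ?c / real (Suc (Suc n))) (at_left ?c) sequentially"
    proof -
      have "(\<lambda>n. ?c / real n) \<longlonglongrightarrow> 0" by (rule lim_const_over_n)
      then have "(\<lambda>n. ?c / real (Suc (Suc n))) \<longlonglongrightarrow> 0" by (intro LIMSEQ_Suc[of "\<lambda>n. ?c / real (Suc n)"] LIMSEQ_Suc)
      then have "(\<lambda>n. ?c - ?c / real (Suc (Suc n))) \<longlonglongrightarrow> ?c - 0" by (intro tendsto_intros)
      moreover have "eventually (\<lambda>n. ?c - ?c / real (Suc (Suc n)) \<in> {..<?c} \<and> ?c - ?c / real (Suc (Suc n)) \<noteq> ?c) sequentially"
        using c by (intro always_eventually) auto
      ultimately show ?thesis unfolding filterlim_at by simp
    qed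
    have nn: "0 \<le> ?c - ?c / real (Suc (Suc n))" for n using c by (simp add: field_simps)
    have "(\<lambda>n. null_before (\<lambda>t. Ao t \<omega>) (?c - ?c / real (Suc (Suc n)))) \<longlonglongrightarrow> l"
      by (rule filterlim_compose[OF l seq])
    then have "(\<lambda>n. Ao (?c - ?c / real (Suc (Suc n))) \<omega>) \<longlonglongrightarrow> l"
      using nn by (simp add: null_before_def not_less[symmetric])
    then have "(\<lambda>n. Ao ?c \<omega> - Ao (?c - ?c / real (Suc (Suc n))) \<omega>) \<longlonglongrightarrow> Ao ?c \<omega> - l" by (intro tendsto_intros)
    moreover have "Lim (at_left ?c) (null_before (\<lambda>t. Ao t \<omega>)) = l" using l by (intro tendsto_Lim) auto
    ultimately show "(\<lambda>n. Ao ?c \<omega> - Ao (?c - ?c / real (Suc (Suc n))) \<omega>) \<longlonglongrightarrow> ?J \<omega>"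
      by (simp add: increasing_jump_def)
  next
    fix n
    have nn: "0 \<le> ?c - ?c / real (Suc (Suc n))" "?c - ?c / real (Suc (Suc n)) \<le> ?c" using c by (auto simp: field_simps)
    have "Ao (?c - ?c / real (Suc (Suc n))) \<in> borel_measurable (F (ennreal (?c - ?c / real (Suc (Suc n)))))"
      by (rule optional_process_adapted[OF opt _ nn(1)]) simp
    then have "Ao (?c - ?c / real (Suc (Suc n))) \<in> borel_measurable (F (ennreal ?c))"
      using sets_F_mono[OF ennreal_leI[OF nn(2)]] measurable_mono[of borel borel "F (ennreal (?c - ?c / real (Suc (Suc n))))" "F (ennreal ?c)"] by auto
    moreover have "Ao ?c \<in> borel_measurable (F (ennreal ?c))"
      by (rule optional_process_adapted[OF opt _ c(2)]) simp
    ultimately show "(\<lambda>\<omega>. Ao ?c \<omega> - Ao (?c - ?c / real (Suc (Suc n))) \<omega>) \<in> borel_measurable (F (ennreal ?c))"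
      by (intro borel_measurable_diff) auto
  qed
  have JM: "?J \<in> borel_measurable M" by (rule measurable_from_subalg[OF sub.subalg Jm])
  have J0: "0 \<le> ?J \<omega>" if "\<omega> \<in> \<Omega>" for \<omega> using increasing_jump_eq(2)[OF inc[OF that] c(2)] .
  let ?f = "\<lambda>\<omega>. of_bool (\<tau> \<omega> = ennreal ?c) :: real"
  let ?g = "\<lambda>\<omega>. (1 - \<Psi> 0) * of_bool (N ?c \<omega> = k) :: real"
  have inner: "(\<integral>\<^sup>+s\<in>{0..}. indicator ({?c} \<times> B) (s, \<omega>) \<partial>m) = indicator B \<omega> * emeasure m {?c}"
    if "sets m = sets borel" for B m and \<omega> :: 'a
  proof -
    have "(\<integral>\<^sup>+s\<in>{0..}. indicator ({?c} \<times> B) (s, \<omega>) \<partial>m) = (\<integral>\<^sup>+s. indicator B \<omega> * indicator {?c} s \<partial>m)"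
      using c by (intro nn_integral_cong) (auto simp: indicator_def)
    also have "\<dots> = indicator B \<omega> * emeasure m {?c}"
      using that by (intro nn_integral_cmult_indicator) simp
    finally show ?thesis .
  qed
  have nn: "(\<integral>\<^sup>+\<omega>. ennreal (indicator B \<omega> * ?f \<omega>) \<partial>M) = (\<integral>\<^sup>+\<omega>. ennreal (indicator B \<omega> * ?J \<omega>) \<partial>M)"
    if B: "B \<in> sets (F (ennreal ?c))" for B
  proof -
    have "(indicator ({?c} \<times> B) :: real \<times> 'a \<Rightarrow> ennreal) \<in> borel_measurable (optional_sigma \<Omega> F)"
      using graph_optional[OF B c(2)] by (rule borel_measurable_indicator)
    from dual[OF this]
    have "(\<integral>\<^sup>+\<omega>. indicator B \<omega> * emeasure (interval_measure (null_before (\<lambda>t. ?A t \<omega>))) {?c} \<partial>M)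
        = (\<integral>\<^sup>+\<omega>. indicator B \<omega> * emeasure (interval_measure (null_before (\<lambda>t. Ao t \<omega>))) {?c} \<partial>M)"
      by (simp add: inner)
    moreover have "(\<integral>\<^sup>+\<omega>. indicator B \<omega> * emeasure (interval_measure (null_before (\<lambda>t. ?A t \<omega>))) {?c} \<partial>M)
        = (\<integral>\<^sup>+\<omega>. ennreal (indicator B \<omega> * ?f \<omega>) \<partial>M)"
      by (intro nn_integral_cong)
         (simp add: increasing_jump_eq(1)[OF increasing_path_after_tau(1) c(2)] increasing_path_after_tau(2)[OF c(1)] indicator_def)
    moreover have "(\<integral>\<^sup>+\<omega>. indicator B \<omega> * emeasure (interval_measure (null_before (\<lambda>t. Ao t \<omega>))) {?c} \<partial>M)
        = (\<integral>\<^sup>+\<omega>. ennreal (indicator B \<omega> * ?J \<omega>) \<partial>M)"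
      by (intro nn_integral_cong) (simp add: increasing_jump_eq(1)[OF inc c(2)] indicator_def)
    ultimately show ?thesis by simp
  qed
  let ?Nk = "{\<omega> \<in> \<Omega>. N ?c \<omega> = k}"
  have NkF: "?Nk \<in> sets (F (ennreal ?c))" by (rule count_event_F[OF c(2)])
  have Nk: "?Nk \<in> events" using NkF sets_F_subset by auto
  have R: "revisit ?c \<in> events" by (rule revisit_sets[OF c(2)])
  have ae: "AE \<omega> in M. \<tau> \<omega> = ennreal ?c \<longleftrightarrow> \<omega> \<in> ?Nk - revisit ?c"
    using AE_good AE_space by eventually_elim (simp add: tau_eq_crossing_iff)
  have fset: "{\<omega> \<in> \<Omega>. \<tau> \<omega> = ennreal ?c} \<in> events" by (rule AE_set(1)[OF ae]) (use Nk R in auto)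
  have fM: "?f \<in> borel_measurable M"
  proof -
    have "(\<lambda>\<omega>. indicator {\<omega> \<in> \<Omega>. \<tau> \<omega> = ennreal ?c} \<omega> :: real) \<in> borel_measurable M" using fset by simp
    then show ?thesis by (rule measurable_cong[THEN iffD1, rotated]) (simp add: indicator_def)
  qed
  have fi: "integrable M ?f" using fM by (intro integrable_const_bound[of _ 1]) auto
  have Ji: "integrable M ?J"
  proof (rule integrableI_nonneg[OF JM])
    show "AE \<omega> in M. 0 \<le> ?J \<omega>" using J0 by (intro AE_I2)
    have "(\<integral>\<^sup>+\<omega>. ennreal (?J \<omega>) \<partial>M) = (\<integral>\<^sup>+\<omega>. ennreal (indicator \<Omega> \<omega> * ?J \<omega>) \<partial>M)"
      by (intro nn_integral_cong) simp
    also have "\<dots> = (\<integral>\<^sup>+\<omega>. ennreal (indicator \<Omega> \<omega> * ?f \<omega>) \<partial>M)"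
      using nn[of \<Omega>] sets.top[of "F (ennreal ?c)"] by simp
    also have "\<dots> \<le> (\<integral>\<^sup>+\<omega>. 1 \<partial>M)" by (intro nn_integral_mono) (auto simp: indicator_def)
    also have "\<dots> < \<infinity>" by (simp add: emeasure_eq_measure)
    finally show "(\<integral>\<^sup>+\<omega>. ennreal (?J \<omega>) \<partial>M) < \<infinity>" .
  qed
  have gm: "?g \<in> borel_measurable (F (ennreal ?c))"
  proof -
    have "(\<lambda>\<omega>. (1 - \<Psi> 0) * indicator ?Nk \<omega>) \<in> borel_measurable (F (ennreal ?c))" using NkF by simp
    then show ?thesis by (rule measurable_cong[THEN iffD1, rotated]) (simp add: indicator_def)
  qed
  have gi: "integrable M ?g"
  proof (rule integrable_const_bound[of _ 1])
    show "AE \<omega> in M. norm (?g \<omega>) \<le> 1"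
      using Psi_0_bounds by (intro AE_I2) (simp add: of_bool_def)
    show "?g \<in> borel_measurable M" by (rule measurable_from_subalg[OF sub.subalg gm])
  qed
  have 1: "AE \<omega> in M. real_cond_exp M (F (ennreal ?c)) ?f \<omega> = ?J \<omega>"
  proof (rule sub.real_cond_exp_charact[OF _ fi Ji Jm])
    fix B assume B: "B \<in> sets (F (ennreal ?c))"
    then have Bev: "B \<in> events" using sets_F_subset by auto
    have i: "integrable M (\<lambda>\<omega>. indicator B \<omega> * ?f \<omega>)" "integrable M (\<lambda>\<omega>. indicator B \<omega> * ?J \<omega>)"
      using integrable_mult_indicator[OF Bev fi] integrable_mult_indicator[OF Bev Ji] by simp_all
    have "ennreal (\<integral>\<omega>. indicator B \<omega> * ?f \<omega> \<partial>M) = ennreal (\<integral>\<omega>. indicator B \<omega> * ?J \<omega> \<partial>M)"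
      using nn[OF B] J0
      by (subst (asm) nn_integral_eq_integral[OF i(1)], simp, subst (asm) nn_integral_eq_integral[OF i(2)]) auto
    moreover have "0 \<le> (\<integral>\<omega>. indicator B \<omega> * ?f \<omega> \<partial>M)" "0 \<le> (\<integral>\<omega>. indicator B \<omega> * ?J \<omega> \<partial>M)"
      using J0 by (auto intro!: integral_nonneg_AE)
    ultimately show "(\<integral>\<omega>\<in>B. ?f \<omega> \<partial>M) = (\<integral>\<omega>\<in>B. ?J \<omega> \<partial>M)"
      by (simp add: set_lebesgue_integral_def)
  qed
  have 2: "AE \<omega> in M. real_cond_exp M (F (ennreal ?c)) ?f \<omega> = ?g \<omega>"
  proof (rule sub.real_cond_exp_charact[OF _ fi gi gm])
    fix B assume B: "B \<in> sets (F (ennreal ?c))"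
    then have Bev: "B \<in> events" using sets_F_subset by auto
    have "(\<integral>\<omega>. indicator B \<omega> * ?f \<omega> \<partial>M) = (\<integral>\<omega>. indicator (B \<inter> ?Nk - revisit ?c) \<omega> \<partial>M)"
    proof (rule integral_cong_AE)
      show "(\<lambda>\<omega>. indicator B \<omega> * ?f \<omega>) \<in> borel_measurable M" using Bev fM by measurable
      show "indicator (B \<inter> ?Nk - revisit ?c) \<in> borel_measurable M" using Bev Nk R by simp
      show "AE \<omega> in M. indicator B \<omega> * ?f \<omega> = indicator (B \<inter> ?Nk - revisit ?c) \<omega>"
        using ae by eventually_elim (auto simp: indicator_def)
    qed
    also have "\<dots> = prob (B \<inter> ?Nk - revisit ?c)" using Bev Nk R by simp
    also have "\<dots> = prob (B \<inter> ?Nk) - prob (B \<inter> ?Nk \<inter> revisit ?c)"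
    proof -
      have "B \<inter> ?Nk - revisit ?c = B \<inter> ?Nk - B \<inter> ?Nk \<inter> revisit ?c" by auto
      then show ?thesis using Bev Nk R by (simp only:) (rule finite_measure_Diff, auto)
    qed
    also have "B \<inter> ?Nk \<inter> revisit ?c = (B \<inter> ?Nk) \<inter> ruin ?c 0"
    proof -
      have "\<mu> * ?c - real k - a = 0" using mu_pos by (simp add: crossing_def)
      then show ?thesis using revisit_on_N[of ?c k] by (simp only: Int_assoc)
    qed
    also have "prob ((B \<inter> ?Nk) \<inter> ruin ?c 0) = prob (B \<inter> ?Nk) * \<Psi> 0"
      by (rule Markov[OF sets.Int[OF B NkF] c(2)])
    also have "prob (B \<inter> ?Nk) - prob (B \<inter> ?Nk) * \<Psi> 0 = (1 - \<Psi> 0) * prob (B \<inter> ?Nk)"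
      by (simp add: algebra_simps)
    also have "\<dots> = (\<integral>\<omega>. (1 - \<Psi> 0) * indicator (B \<inter> ?Nk) \<omega> \<partial>M)" using Bev Nk by simp
    also have "\<dots> = (\<integral>\<omega>. indicator B \<omega> * ?g \<omega> \<partial>M)"
      by (intro Bochner_Integration.integral_cong refl) (auto simp: indicator_def)
    finally show "(\<integral>\<omega>\<in>B. ?f \<omega> \<partial>M) = (\<integral>\<omega>\<in>B. ?g \<omega> \<partial>M)"
      unfolding set_lebesgue_integral_def real_scaleR_def .
  qed
  show ?thesis using 1 2 by eventually_elim simp
qed

text \<open>The exit time for the versions \<open>V\<close> of \<open>Z\<close> and \<open>1 - \<Psi> 0\<close> of the jump.\<close>

definition "halving_time \<omega> = Inf (ennreal ` {t. 0 \<le> t \<and> \<tau> \<omega> < ennreal t \<and> h (Y t \<omega>) \<le> \<Psi> 0 / 2})"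

text \<open>\<open>\<tau>\<close> is one of the crossing times, where the jump of \<open>Ao\<close> is \<open>1 - \<Psi> 0\<close>.\<close>

lemma exit_time_eq:
  assumes Z: "is_optional_projection M F (\<lambda>t \<omega>. of_bool (ennreal t \<le> \<tau> \<omega>)) Z"
    and Ao: "is_dual_optional_projection M F (\<lambda>t \<omega>. of_bool (\<tau> \<omega> \<le> ennreal t)) Ao"
  shows "AE \<omega> in M. exit_time \<tau> Z Ao \<omega> = halving_time \<omega>"
proof -
  have "AE \<omega> in M. \<forall>k. increasing_jump (\<lambda>t. Ao t \<omega>) (crossing k) = (1 - \<Psi> 0) * of_bool (N (crossing k) \<omega> = k)"
    unfolding AE_all_countable using dual_projection_jump[OF Ao] by blast
  then show ?thesis using optional_projection_unique[OF Z] AE_good AE_space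
  proof eventually_elim
    case (elim \<omega>)
    obtain r where r: "\<tau> \<omega> = ennreal r" "0 < r" using good_tau_finite[OF elim(3,4)] by blast
    note after = tau_eq_a[OF elim(4) r(1) less_imp_le[OF r(2)]]
    have rc: "r = crossing (N r \<omega>)" using after(1) by (rule Y_eq_a_iff[THEN iffD1])
    have J: "increasing_jump (\<lambda>t. Ao t \<omega>) r = 1 - \<Psi> 0"
      using elim(1)[rule_format, of "N r \<omega>"] rc[symmetric] by simp
    have "Z t \<omega> = h (Y t \<omega>)" if "ennreal r < ennreal t" "0 \<le> t" for t
    proof -
      have "a < Y t \<omega>" using that r by (intro after(2)) (simp add: ennreal_less_iff)
      then show ?thesis using elim(2) that by (simp add: V_def)
    qed
    then have "{t. 0 \<le> t \<and> \<tau> \<omega> < ennreal t \<and> Z t \<omega> \<le> (1 - increasing_jump (\<lambda>s. Ao s \<omega>) (enn2real (\<tau> \<omega>))) / 2}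
        = {t. 0 \<le> t \<and> \<tau> \<omega> < ennreal t \<and> h (Y t \<omega>) \<le> \<Psi> 0 / 2}"
      using r J by auto
    then show ?case by (simp add: exit_time_def halving_time_def)
  qed
qed

lemma tau_le_exit_time: "\<tau> \<omega> \<le> exit_time \<tau> Z Ao \<omega>"
  unfolding exit_time_def by (intro Inf_greatest) (auto intro: less_imp_le)

text \<open>Until the next jump \<open>Y\<close> increases and \<open>h(Y)\<close> decreases, so that the condition remains true
  at a rational time shortly afterwards.\<close>

lemma halving_time_less_iff:
  assumes \<omega>: "\<omega> \<in> \<Omega>" and t: "0 \<le> t"
  shows "halving_time \<omega> < ennreal t \<longleftrightarrow> (\<exists>i. q i < t \<and> \<tau> \<omega> < ennreal (q i) \<and> h (Y (q i) \<omega>) \<le> \<Psi> 0 / 2)"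
proof
  assume "halving_time \<omega> < ennreal t"
  then obtain s where s: "0 \<le> s" "\<tau> \<omega> < ennreal s" "h (Y s \<omega>) \<le> \<Psi> 0 / 2" "ennreal s < ennreal t"
    unfolding halving_time_def Inf_less_iff by auto
  have st: "s < t" using s by (simp add: ennreal_less_iff)
  interpret p: counting_path "\<lambda>t. N t \<omega>" by (rule counting[OF \<omega>])
  obtain e where e: "e > 0" "\<And>r. s \<le> r \<Longrightarrow> r < s + e \<Longrightarrow> N r \<omega> = N s \<omega>"
    using p.right_constant[OF s(1)] by blast
  obtain i where i: "s < q i" "q i < min t (s + e)" using q_dense[OF s(1), of "min t (s + e)"] st e(1) by auto
  have "N (q i) \<omega> = N s \<omega>" using i by (intro e(2)) auto
  then have "Y s \<omega> \<le> Y (q i) \<omega>" using i mu_pos by (simp add: Y_eq)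
  then have "h (Y (q i) \<omega>) \<le> \<Psi> 0 / 2" using h_antimono s(3) by (meson order_trans)
  moreover have "\<tau> \<omega> < ennreal (q i)" using s(2) ennreal_leI[OF less_imp_le[OF i(1)]] by (rule less_le_trans)
  ultimately show "\<exists>i. q i < t \<and> \<tau> \<omega> < ennreal (q i) \<and> h (Y (q i) \<omega>) \<le> \<Psi> 0 / 2" using i by auto
next
  assume "\<exists>i. q i < t \<and> \<tau> \<omega> < ennreal (q i) \<and> h (Y (q i) \<omega>) \<le> \<Psi> 0 / 2"
  then obtain i where i: "q i < t" "\<tau> \<omega> < ennreal (q i)" "h (Y (q i) \<omega>) \<le> \<Psi> 0 / 2" by blast
  have "halving_time \<omega> \<le> ennreal (q i)"
    unfolding halving_time_def using i q_nonneg by (intro Inf_lower) auto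
  also have "\<dots> < ennreal t" using i(1) q_nonneg[of i] by (simp add: ennreal_less_iff)
  finally show "halving_time \<omega> < ennreal t" .
qed

lemma halving_time_window:
  assumes t: "0 \<le> t"
  shows "{\<omega> \<in> \<Omega>. \<tau> \<omega> < ennreal t \<and> ennreal t \<le> halving_time \<omega>} \<in> sets (G (ennreal t))"
proof -
  let ?D = "\<lambda>i. {\<omega> \<in> \<Omega>. \<tau> \<omega> < ennreal (q i)} \<inter> {\<omega> \<in> \<Omega>. h (Y (q i) \<omega>) \<le> \<Psi> 0 / 2}"
  have "{\<omega> \<in> \<Omega>. \<tau> \<omega> < ennreal t \<and> ennreal t \<le> halving_time \<omega>}
      = {\<omega> \<in> \<Omega>. \<tau> \<omega> < ennreal t} - (\<Union>i\<in>{i. q i < t}. ?D i)"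
    using halving_time_less_iff[OF _ t] by (auto simp: not_less[symmetric])
  also have "\<dots> \<in> sets (G (ennreal t))"
  proof (intro sets.Diff sets.countable_UN' image_subsetI sets.Int tau_less_G)
    fix i assume i: "i \<in> {i. q i < t}"
    then show "ennreal (q i) \<le> ennreal t" by (intro ennreal_leI) simp
    then have [measurable]: "Y (q i) \<in> borel_measurable (G (ennreal t))"
      using q_nonneg by (intro measurable_F_G Y_measurable_F)
    have "{\<omega> \<in> space (G (ennreal t)). h (Y (q i) \<omega>) \<le> \<Psi> 0 / 2} \<in> sets (G (ennreal t))" by measurable
    then show "{\<omega> \<in> \<Omega>. h (Y (q i) \<omega>) \<le> \<Psi> 0 / 2} \<in> sets (G (ennreal t))" by simp
  qed auto
  finally show ?thesis .
qed

text \<open>The infimum is attained, since \<open>h(Y)\<close> is right-continuous.\<close>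

lemma h_at_halving_time:
  assumes \<omega>: "\<omega> \<in> \<Omega>" and r: "halving_time \<omega> = ennreal r" "0 \<le> r"
  shows "h (Y r \<omega>) \<le> \<Psi> 0 / 2"
proof (rule ccontr)
  assume "\<not> h (Y r \<omega>) \<le> \<Psi> 0 / 2"
  then have gt: "\<Psi> 0 / 2 < h (Y r \<omega>)" by simp
  interpret p: drift_path "\<lambda>t. N t \<omega>" \<mu> by (rule path[OF \<omega>])
  have "filterlim (\<lambda>u. Y u \<omega>) (at_right (Y r \<omega>)) (at_right r)"
    using p.filterlim_y_right[OF r(2)] by (simp add: p.y_def[abs_def] Y_eq)
  moreover have "(h \<longlongrightarrow> h (Y r \<omega>)) (at_right (Y r \<omega>))" using h_right_continuous by (simp add: continuous_within)
  ultimately have "((\<lambda>u. h (Y u \<omega>)) \<longlongrightarrow> h (Y r \<omega>)) (at_right r)" by (rule filterlim_compose[rotated])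
  then have "eventually (\<lambda>u. \<Psi> 0 / 2 < h (Y u \<omega>)) (at_right r)" using gt by (rule order_tendstoD(1))
  then obtain d where d: "r < d" "\<And>u. r < u \<Longrightarrow> u < d \<Longrightarrow> \<Psi> 0 / 2 < h (Y u \<omega>)"
    unfolding eventually_at_right_field by blast
  have "ennreal d \<le> halving_time \<omega>"
    unfolding halving_time_def
  proof (rule Inf_greatest, clarify)
    fix t assume t: "0 \<le> t" "\<tau> \<omega> < ennreal t" "h (Y t \<omega>) \<le> \<Psi> 0 / 2"
    have "halving_time \<omega> \<le> ennreal t" unfolding halving_time_def using t by (intro Inf_lower) auto
    then have "r \<le> t" using r t by simp
    then have "d \<le> t" using d(2)[of t] t(3) gt by (cases "t = r") (auto simp: not_less[symmetric])
    then show "ennreal d \<le> ennreal t" by (rule ennreal_leI)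
  qed
  then show False using r d(1) by simp
qed

text \<open>\<open>G\<close> contains all null sets, since \<open>F\<close> does.\<close>

lemma AE_set_G:
  assumes ae: "AE \<omega> in M. P \<omega> \<longleftrightarrow> \<omega> \<in> E" and E: "E \<in> sets (G t)"
  shows "{\<omega> \<in> \<Omega>. P \<omega>} \<in> sets (G t)"
proof -
  interpret C: complete_measure M by (rule complete)
  obtain X where X: "{\<omega> \<in> \<Omega>. \<not> (P \<omega> \<longleftrightarrow> \<omega> \<in> E)} \<subseteq> X" "X \<in> null_sets M"
    using ae by (elim AE_E) auto
  have nullG: "D \<in> sets (G t)" if "D \<in> null_sets M" for D by (rule subsetD[OF F_subset_G null_in_F[OF that]])
  have "{\<omega> \<in> \<Omega>. P \<omega>} \<inter> X \<in> null_sets M" by (rule C.complete2[OF Int_lower2 X(2)])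
  moreover have "{\<omega> \<in> \<Omega>. P \<omega>} = (E - X) \<union> ({\<omega> \<in> \<Omega>. P \<omega>} \<inter> X)"
    using X(1) sets.sets_into_space[OF E] by auto
  ultimately show ?thesis
    using sets.Un[OF sets.Diff[OF E nullG[OF X(2)]] nullG, of "{\<omega> \<in> \<Omega>. P \<omega>} \<inter> X"] by simp
qed

theorem arbitrage_after_exit_time:
  assumes Z: "is_optional_projection M F (\<lambda>t \<omega>. of_bool (ennreal t \<le> \<tau> \<omega>)) Z"
    and Ao: "is_dual_optional_projection M F (\<lambda>t \<omega>. of_bool (\<tau> \<omega> \<le> ennreal t)) Ao"
  shows "classical_arbitrage M G (\<lambda>t \<omega>. S t \<omega> - stopped \<tau> S t \<omega>)
    (\<lambda>t \<omega>. - \<phi> t \<omega> * of_bool (\<tau> \<omega> < ennreal t \<and> ennreal t \<le> exit_time \<tau> Z Ao \<omega>))"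
proof (rule arbitrage_after)
  show "AE \<omega> in M. \<tau> \<omega> \<le> exit_time \<tau> Z Ao \<omega>" using tau_le_exit_time by (intro AE_I2)
  show "{\<omega> \<in> \<Omega>. \<tau> \<omega> < ennreal t \<and> ennreal t \<le> exit_time \<tau> Z Ao \<omega>} \<in> sets (G (ennreal t))" if "0 \<le> t" for t
  proof (rule AE_set_G[OF _ halving_time_window[OF that]])
    show "AE \<omega> in M. (\<tau> \<omega> < ennreal t \<and> ennreal t \<le> exit_time \<tau> Z Ao \<omega>)
        \<longleftrightarrow> \<omega> \<in> {\<omega> \<in> \<Omega>. \<tau> \<omega> < ennreal t \<and> ennreal t \<le> halving_time \<omega>}"
      using exit_time_eq[OF Z Ao] AE_space by eventually_elim simp
  qed
  show "AE \<omega> in M. exit_time \<tau> Z Ao \<omega> < \<infinity> \<longrightarrow> h (Y (enn2real (exit_time \<tau> Z Ao \<omega>)) \<omega>) < \<Psi> 0"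
    using exit_time_eq[OF Z Ao] AE_space
  proof eventually_elim
    case (elim \<omega>)
    show ?case
    proof
      assume "exit_time \<tau> Z Ao \<omega> < \<infinity>"
      then obtain r where r: "halving_time \<omega> = ennreal r" "0 \<le> r"
        unfolding elim(1) by (cases "halving_time \<omega>") auto
      then show "h (Y (enn2real (exit_time \<tau> Z Ao \<omega>)) \<omega>) < \<Psi> 0"
        using h_at_halving_time[OF elim(2) r] Psi_0_bounds(1) elim(1) by simp
    qed
  qed
qed

end

theorem proposition4p7:
  fixes M :: "'a measure" and N :: "real \<Rightarrow> 'a \<Rightarrow> nat"
    and lam \<psi> b :: real
    and F G :: "ennreal \<Rightarrow> 'a measure"
    and S \<phi> :: "real \<Rightarrow> 'a \<Rightarrow> real"
    and \<tau> :: "'a \<Rightarrow> ennreal"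
  assumes "prob_space M" and "complete_measure M"
    and "lam > 0" and "poisson_process M lam N"
    and "\<psi> > 0" and "0 < b" and "b < 1"
    and F: "F = natural_filtration M N"
    and S: "S = stock lam \<psi> N"
    and \<tau>: "\<tau> = last_passage S b"
    and G: "G = progressive_enlargement (space M) F \<tau>"
    and \<phi>: "\<phi> = strategy M lam \<psi> N b"
  shows
    "classical_arbitrage M G (stopped \<tau> S) (\<lambda>t \<omega>. \<phi> t \<omega> * of_bool (ennreal t \<le> \<tau> \<omega>)) \<and>
     (\<forall>Z Ao. is_optional_projection M F (\<lambda>t \<omega>. of_bool (ennreal t \<le> \<tau> \<omega>)) Z \<longrightarrow>
        is_dual_optional_projection M F (\<lambda>t \<omega>. of_bool (\<tau> \<omega> \<le> ennreal t)) Ao \<longrightarrow>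
        classical_arbitrage M G (\<lambda>t \<omega>. S t \<omega> - stopped \<tau> S t \<omega>)
          (\<lambda>t \<omega>. - \<phi> t \<omega> * of_bool (\<tau> \<omega> < ennreal t \<and> ennreal t \<le> exit_time \<tau> Z Ao \<omega>)))"
proof -
  interpret prob_space M by fact
  interpret complete_measure M by fact
  interpret m: barrier_market M N lam \<psi> b
    by unfold_locales fact+
  have F': "F = m.F" by (simp add: F m.F_def)
  show ?thesis
    unfolding G \<tau> S \<phi> F'
  proof (intro conjI allI impI)
    fix Z Ao :: "real \<Rightarrow> 'a \<Rightarrow> real"
    assume Z: "is_optional_projection M m.F (\<lambda>t \<omega>. of_bool (ennreal t \<le> m.\<tau> \<omega>)) Z"
      and Ao: "is_dual_optional_projection M m.F (\<lambda>t \<omega>. of_bool (m.\<tau> \<omega> \<le> ennreal t)) Ao"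
    show "classical_arbitrage M m.G (\<lambda>t \<omega>. m.S t \<omega> - stopped m.\<tau> m.S t \<omega>)
        (\<lambda>t \<omega>. - m.\<phi> t \<omega> * of_bool (m.\<tau> \<omega> < ennreal t \<and> ennreal t \<le> exit_time m.\<tau> Z Ao \<omega>))"
      by (rule m.arbitrage_after_exit_time[OF Z Ao])
  qed (rule m.arbitrage_before)
qed

end
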